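(* Let $\psi_4(t)$ be a sedately increasing function. Then for each $\varepsilon>0$ and each $s\in\{13,14\}$ one has $$\widetilde{E}_{s,4}(N;\psi_4)\ll N^{\alpha_s+\varepsilon}\psi_4(N)^4$$ for all sufficiently large $N$, where $\alpha_{13}=\tfrac58$ and $\alpha_{14}=\tfrac12$, and the implied constant may depend on $\varepsilon$.
   Context: For natural numbers $s,k$ and a positive integer $n$, $R_{s,k}(n)$ denotes the number of representations of $n$ as a sum of $s$ $k$th powers of positive integers. Write $e(z)=\exp(2\pi i z)$ and $$\mathfrak{S}_{s,k}(n)=\sum_{q=1}^\infty\sum_{\substack{a=1\\(a,q)=1}}^q\Bigl(q^{-1}\sum_{r=1}^q e(ar^k/q)\Bigr)^s e(-an/q).$$ For a function $\psi$ of a positive variable, $\widetilde{E}_{s,k}(N;\psi)$ denotes the number of integers $n$ with $1\le n\le N$ for which $$\Bigl|R_{s,k}(n)-\frac{\Gamma(1+1/k)^s}{\Gamma(s/k)}\mathfrak{S}_{s,k}(n)n^{s/k-1}\Bigr|>n^{s/k-1}\psi(n)^{-1}.$$ A function $\psi(t)$ of a positive variable $t$ is called sedately increasing if it increases monotonically to infinity and, for large $t$, satisfies $\psi(t)=O(t^\delta)$ for a positive number $\delta$ sufficiently small in the ambient context. *)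

theory Defs
  imports "HOL-Analysis.Analysis" "HOL-Library.Landau_Symbols"
begin

definition rep_count :: "nat \<Rightarrow> nat \<Rightarrow> nat \<Rightarrow> nat" where
  "rep_count s k n =
     card {xs :: nat list. length xs = s \<and> (\<forall>x\<in>set xs. 0 < x) \<and> (\<Sum>x\<leftarrow>xs. x ^ k) = n}"

definition e :: "complex \<Rightarrow> complex" where
  "e z = exp (2 * of_real pi * \<i> * z)"

definition singular_term :: "nat \<Rightarrow> nat \<Rightarrow> nat \<Rightarrow> nat \<Rightarrow> complex" where
  "singular_term s k n q =
     (\<Sum>a | a \<in> {1..q} \<and> coprime a q.
        (inverse (of_nat q) * (\<Sum>r = 1..q. e (of_nat a * of_nat r ^ k / of_nat q))) ^ s
          * e (- (of_nat a * of_nat n / of_nat q)))"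

text \<open>The series runs over \<open>q \<ge> 1\<close>. Its value is a real number whenever it converges, but it
  is kept complex here since the individual factors are complex.\<close>

definition singular_series :: "nat \<Rightarrow> nat \<Rightarrow> nat \<Rightarrow> complex" where
  "singular_series s k n = (\<Sum>q. singular_term s k n (Suc q))"

definition exceptional_count :: "nat \<Rightarrow> nat \<Rightarrow> (real \<Rightarrow> real) \<Rightarrow> real \<Rightarrow> nat" where
  "exceptional_count s k \<psi> N =
     card {n :: nat. 1 \<le> n \<and> real n \<le> N \<and>
       cmod (of_nat (rep_count s k n)
             - of_real (Gamma (1 + 1 / real k) ^ s / Gamma (real s / real k))
               * singular_series s k n * of_real (real n powr (real s / real k - 1)))
         > real n powr (real s / real k - 1) * inverse (\<psi> (real n))}"

text \<open>The exponent \<open>\<delta>\<close>, ``sufficiently small in the ambient context'', is an explicit parameter.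
  A function of a positive variable is rendered as a total function whose values at
  nonpositive arguments are irrelevant.\<close>

definition sedately_increasing :: "real \<Rightarrow> (real \<Rightarrow> real) \<Rightarrow> bool" where
  "sedately_increasing \<delta> \<psi> \<longleftrightarrow>
     mono_on {0<..} \<psi> \<and> filterlim \<psi> at_top at_top \<and> \<psi> \<in> O[at_top](\<lambda>t. t powr \<delta>)"

end

theory Submission
  imports Defs "HOL-Computational_Algebra.Primes" "HOL-Computational_Algebra.Polynomial"
    "HOL-Real_Asymp.Real_Asymp"
begin

text \<open>
  The circle method, with the integral over the circle replaced by an average over \<open>\<alpha> = j / M\<close>, where
  \<open>M\<close> is divisible by all small \<open>q\<close> and exceeds all frequencies. Let \<open>f\<close> be the quartic Weyl sum of length
  \<open>P \<approx> N powr (1/4)\<close>. On the major arcs \<open>|\<alpha> - a / q| = |\<beta>| \<le> R / P\<^sup>4\<close>, \<open>q \<le> R\<close>, with \<open>R\<close> a small power of \<open>P\<close>, the sum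
  \<open>f\<close> is close to the Gauss sum mean times a power series truncation of \<open>\<Gamma>(5/4) (1 - x) powr (- 1/4)\<close>,
  and this produces the main term. On the remaining part of the arcs \<open>q \<le> P\<close>, \<open>|q \<alpha> - a| \<le> P\<^sup>-\<^sup>3\<close>,
  the bound \<open>|f|\<^sup>8 \<lesssim> P powr (8 + \<epsilon>) / (q (1 + P\<^sup>4 |\<beta>|))\<close> is combined with the mean square of \<open>f\<close> over
  residues, which counts solutions of \<open>x\<^sup>4 \<equiv> y\<^sup>4\<close> modulo \<open>q\<close>.

  On the minor arcs, let \<open>Z\<close> be the number of exceptional \<open>n\<close> near \<open>P\<^sup>4\<close>, and \<open>K\<close> an exponential sum with unimodular
  coefficients over them. By Cauchy--Schwarz \<open>(Z P powr (s - 4) / \<psi>)\<^sup>2\<close> is at most the product of the minor arc mean of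
  \<open>|f| ^ (2 s - 4)\<close>, handled by Weyl's inequality and Hua's eighth moment, and of the mean of
  \<open>|f|\<^sup>4 |K|\<^sup>2\<close>. One Weyl differencing and Davenport's use of Cauchy--Schwarz bound the latter by
  \<open>P powr \<epsilon> (P\<^sup>3 Z + P\<^sup>2 Z powr (3/2))\<close>. Solving for \<open>Z\<close> and summing over dyadic blocks gives the theorem.
\<close>

section \<open>Exponential sums over residues\<close>

text \<open>Weyl's inequality saves only about \<open>q powr (1/8)\<close> per factor, and 13/8 < 2,
  so pointwise bounds alone cannot be summed over all fractions \<open>a / q\<close>. On the middle
  arcs and in the singular series two of the thirteen factors are therefore set aside. Their mean
  square over \<open>a\<close> counts solutions of a congruence, which is small on average over
  \<open>q\<close>, and the other eleven factors supply a saving with exponent 11/8. In this way no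
  sharp estimate for complete sums enters.

  The exponents of the theorem come from the minor arcs. There \<open>|f| ^ (2 s - 4)\<close> has
  mean about \<open>P powr (A + 5)\<close> with A = 7(s-6)/4, and solving for Z yields the two terms
  \<open>P powr (A + 8 - 2 (s - 4))\<close> times psi^2 and
  \<open>P powr (2 (A + 7 - 2 (s - 4)))\<close> times psi^4. The exponents are 9/4 and 5/2 for s =
  13, and 2 and 2 for s = 14. Dividing the larger one by 4 gives 5/8 and 1/2, and the second term is
  the origin of psi^4.

  The major arcs save only a tiny power of P, which is what limits the growth of psi.\<close>

definition E :: "real \<Rightarrow> complex" where
  "E x = cis (2 * pi * x)"

lemma E_add: "E (x + y) = E x * E y"
  by (simp add: E_def cis_mult distrib_left)

lemma E_0 [simp]: "E 0 = 1"
  by (simp add: E_def)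

lemma norm_E [simp]: "cmod (E x) = 1"
  by (simp add: E_def)

lemma cnj_E: "cnj (E x) = E (- x)"
  by (simp add: E_def cis_cnj)

lemma E_of_int [simp]: "E (of_int n) = 1"
  by (simp add: E_def cis_multiple_2pi)

lemma E_power: "E x ^ n = E (of_nat n * x)"
  by (simp add: E_def Complex.DeMoivre algebra_simps)

lemma E_diff: "E (x - y) = E x * cnj (E y)"
  by (simp add: cnj_E flip: E_add)

lemma E_add_of_int [simp]: "E (x + of_int n) = E x"
  by (simp add: E_add)

lemma E_eq_1_iff: "E x = 1 \<longleftrightarrow> x \<in> \<int>"
proof
  assume "E x = 1"
  then have "cos (2 * pi * x) = 1"
    by (simp add: E_def cis.ctr complex_eq_iff)
  then obtain n :: int where "2 * pi * x = of_int n * (2 * pi)"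
    using cos_one_2pi_int by (auto simp: mult_ac)
  then show "x \<in> \<int>" by simp
next
  assume "x \<in> \<int>"
  then show "E x = 1" by (auto elim: Ints_cases)
qed

lemma sum_E_complete:
  fixes M k :: int
  assumes "M > 0"
  shows "(\<Sum>j\<in>{0..<M}. E (of_int (j * k) / of_int M)) = (if M dvd k then of_int M else 0)"
proof -
  define z where "z = E (of_int k / of_int M)"
  have zn: "E (of_int (int i * k) / of_int M) = z ^ i" for i
    by (simp add: z_def E_power mult_ac)
  have "(\<Sum>j\<in>{0..<M}. E (of_int (j * k) / of_int M)) = (\<Sum>i<nat M. E (of_int (int i * k) / of_int M))"
    by (rule sum.reindex_bij_witness[where i=int and j=nat]) auto
  also have "\<dots> = (\<Sum>i<nat M. z ^ i)" using zn by simp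
  also have "\<dots> = (if M dvd k then of_int M else 0)"
  proof (cases "M dvd k")
    case True
    then obtain c where "k = M * c" by auto
    then have "z = 1" using assms by (simp add: z_def)
    then show ?thesis using True assms by simp
  next
    case False
    have "z \<noteq> 1"
    proof
      assume "z = 1"
      then obtain c where c: "of_int k / of_int M = (of_int c :: real)"
        unfolding z_def E_eq_1_iff by (auto elim: Ints_cases)
      then have "(of_int k :: real) = of_int (c * M)" using assms by (simp add: field_simps)
      then show False using False by (metis dvd_triv_right of_int_eq_iff)
    qed
    moreover have "z ^ nat M = 1"
      using zn[of "nat M"] assms by simp
    ultimately show ?thesis using False by (simp add: sum_gp_strict)
  qed
  finally show ?thesis .
qed

text \<open>Parseval on the grid. After the square is expanded only pairs with congruent frequencies
  survive, and each contributes at most \<open>M\<close>, whatever the coefficients are. This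
  freedom is used for the phases attached to exceptional numbers and for shifts of the point at
  which a Weyl sum is evaluated.\<close>

lemma mean_square_le_dvd:
  fixes M :: int and w :: "'a \<Rightarrow> int" and a :: "'a \<Rightarrow> complex"
  assumes "M > 0" "finite A" "\<And>i. i \<in> A \<Longrightarrow> cmod (a i) \<le> 1"
  shows "(\<Sum>j\<in>{0..<M}. (cmod (\<Sum>i\<in>A. a i * E (of_int (j * w i) / of_int M)))\<^sup>2)
          \<le> of_int M * real (card {(i, k) \<in> A \<times> A. M dvd w i - w k})"
proof -
  have eq: "complex_of_real ((cmod (\<Sum>i\<in>A. a i * E (of_int (j * w i) / of_int M)))\<^sup>2)
      = (\<Sum>(i,k)\<in>A \<times> A. a i * cnj (a k) * E (of_int (j * (w i - w k)) / of_int M))" for j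
    unfolding complex_norm_square
    by (simp add: sum_product sum.cartesian_product cnj_sum
        left_diff_distrib right_diff_distrib diff_divide_distrib E_diff mult_ac)
  have "complex_of_real (\<Sum>j\<in>{0..<M}. (cmod (\<Sum>i\<in>A. a i * E (of_int (j * w i) / of_int M)))\<^sup>2)
      = (\<Sum>j\<in>{0..<M}. \<Sum>(i,k)\<in>A \<times> A. a i * cnj (a k) * E (of_int (j * (w i - w k)) / of_int M))"
    by (simp only: of_real_sum eq)
  also have "\<dots> = (\<Sum>(i,k)\<in>A \<times> A. a i * cnj (a k) *
       (\<Sum>j\<in>{0..<M}. E (of_int (j * (w i - w k)) / of_int M)))"
    by (subst sum.swap) (simp add: case_prod_unfold sum_distrib_left)
  also have "\<dots> = (\<Sum>(i,k)\<in>A \<times> A. a i * cnj (a k) * (if M dvd w i - w k then of_int M else 0))"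
    by (simp only: sum_E_complete[OF assms(1)] case_prod_unfold)
  finally have eq2: "complex_of_real (\<Sum>j\<in>{0..<M}. (cmod (\<Sum>i\<in>A. a i * E (of_int (j * w i) / of_int M)))\<^sup>2)
      = (\<Sum>(i,k)\<in>A \<times> A. a i * cnj (a k) * (if M dvd w i - w k then of_int M else 0))" .
  have "(\<Sum>j\<in>{0..<M}. (cmod (\<Sum>i\<in>A. a i * E (of_int (j * w i) / of_int M)))\<^sup>2)
      = cmod (complex_of_real (\<Sum>j\<in>{0..<M}. (cmod (\<Sum>i\<in>A. a i * E (of_int (j * w i) / of_int M)))\<^sup>2))"
    by (simp only: norm_of_real) (simp add: sum_nonneg)
  also have "\<dots> \<le> (\<Sum>x\<in>A \<times> A. cmod (case x of (i,k) \<Rightarrow> a i * cnj (a k) * (if M dvd w i - w k then of_int M else 0)))"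
    unfolding eq2 by (rule norm_sum)
  also have "\<dots> \<le> (\<Sum>x\<in>A \<times> A. (case x of (i,k) \<Rightarrow> if M dvd w i - w k then of_int M else 0))"
  proof (rule sum_mono, clarify)
    fix i k assume ik: "i \<in> A" "k \<in> A"
    have "cmod (a i) * cmod (a k) \<le> 1"
      using assms(3)[OF ik(1)] assms(3)[OF ik(2)] by (simp add: mult_le_one)
    then show "cmod (a i * cnj (a k) * (if M dvd w i - w k then of_int M else 0)) \<le> (if M dvd w i - w k then of_int M else 0)"
      using assms(1) by (auto simp: norm_mult mult_left_le_one_le)
  qed
  also have "\<dots> = of_int M * real (card {(i, k) \<in> A \<times> A. M dvd w i - w k})"
  proof -
    have "(\<Sum>x\<in>A \<times> A. (case x of (i,k) \<Rightarrow> if M dvd w i - w k then real_of_int M else 0))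
       = (\<Sum>x\<in>A \<times> A. if (case x of (i,k) \<Rightarrow> M dvd w i - w k) then of_int M else 0)"
      by (rule sum.cong) auto
    also have "\<dots> = (\<Sum>x\<in>{x\<in>A \<times> A. (case x of (i,k) \<Rightarrow> M dvd w i - w k)}. of_int M)"
      using assms(2) by (subst sum.inter_filter) auto
    finally show ?thesis
      by (simp add: mult.commute case_prod_unfold mem_Times_iff conj_assoc)
  qed
  finally show ?thesis .
qed


text \<open>Frequencies below \<open>M / 2\<close> in modulus are equal as soon as they are
  congruent modulo \<open>M\<close>, so the grid average is as good as an integral over the
  circle.\<close>

lemma mean_square_le:
  fixes M :: int and w :: "'a \<Rightarrow> int" and a :: "'a \<Rightarrow> complex"
  assumes "M > 0" "finite A" "\<And>i. i \<in> A \<Longrightarrow> cmod (a i) \<le> 1"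
    and "\<And>i. i \<in> A \<Longrightarrow> 2 * \<bar>w i\<bar> < M"
  shows "(\<Sum>j\<in>{0..<M}. (cmod (\<Sum>i\<in>A. a i * E (of_int (j * w i) / of_int M)))\<^sup>2)
          \<le> of_int M * real (card {(i, k) \<in> A \<times> A. w i = w k})"
proof -
  have "M dvd w i - w k \<longleftrightarrow> w i = w k" if ik: "i \<in> A" "k \<in> A" for i k
  proof
    assume d: "M dvd w i - w k"
    have "\<bar>w i - w k\<bar> < M" using assms(4)[OF ik(1)] assms(4)[OF ik(2)] by linarith
    then show "w i = w k" using dvd_imp_le_int[OF _ d] by fastforce
  qed auto
  then have "{(i, k) \<in> A \<times> A. M dvd w i - w k} = {(i, k) \<in> A \<times> A. w i = w k}" by auto
  with mean_square_le_dvd[OF assms(1-3), where w = w] show ?thesis by simp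
qed

text \<open>The shift \<open>h\<close> runs through the full range for every \<open>A\<close>, with
  empty inner sums where \<open>A\<close> is short. Hence all three differencing steps share one
  index set, and \<open>A\<close> may be the domain left by an earlier step.\<close>

lemma norm_square_differenced:
  fixes \<phi> :: "int \<Rightarrow> complex" and P :: nat
  assumes "A \<subseteq> {1..int P}"
  shows "complex_of_real ((cmod (\<Sum>x\<in>A. \<phi> x))\<^sup>2)
    = (\<Sum>h\<in>{- int P..int P}. \<Sum>x\<in>{x\<in>A. x + h \<in> A}. \<phi> (x + h) * cnj (\<phi> x))"
proof -
  have fin: "finite A" using assms finite_subset by blast
  have b: "1 \<le> x \<and> x \<le> int P" if "x \<in> A" for x using assms that by auto
  have "complex_of_real ((cmod (\<Sum>x\<in>A. \<phi> x))\<^sup>2) = (\<Sum>(y,x)\<in>A \<times> A. \<phi> y * cnj (\<phi> x))"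
    unfolding complex_norm_square by (simp add: sum_product sum.cartesian_product cnj_sum)
  also have "\<dots> = (\<Sum>(h,x)\<in>(SIGMA h:{- int P..int P}. {x\<in>A. x + h \<in> A}). \<phi> (x + h) * cnj (\<phi> x))"
    by (rule sum.reindex_bij_witness[where i="\<lambda>(h,x). (x+h,x)" and j="\<lambda>(y,x). (y-x,x)"])
       (use b in \<open>auto, fastforce+\<close>)
  also have "\<dots> = (\<Sum>h\<in>{- int P..int P}. \<Sum>x\<in>{x\<in>A. x + h \<in> A}. \<phi> (x + h) * cnj (\<phi> x))"
    by (rule sum.Sigma[symmetric]) (use fin in auto)
  finally show ?thesis .
qed

section \<open>The divisor bound\<close>

lemma power_powr: "(x::real) \<ge> 0 \<Longrightarrow> (x ^ n) powr y = (x powr y) ^ n"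
  by (induction n) (simp_all add: powr_mult)

lemma card_divisors_prime_power_mult:
  fixes p m :: nat
  assumes "prime p" "m > 0" "\<not> p dvd m"
  shows "card {d. d dvd p ^ a * m} \<le> (a + 1) * card {d. d dvd m}"
proof -
  have "card {d. d dvd p ^ a * m} \<le> card ((\<lambda>(i, d). p ^ i * d) ` ({..a} \<times> {d. d dvd m}))"
  proof (rule card_mono)
    show "finite ((\<lambda>(i, d). p ^ i * d) ` ({..a} \<times> {d. d dvd m}))"
      using assms by auto
    show "{d. d dvd p ^ a * m} \<subseteq> (\<lambda>(i, d). p ^ i * d) ` ({..a} \<times> {d. d dvd m})"
    proof
      fix d assume "d \<in> {d. d dvd p ^ a * m}"
      then have "d dvd p ^ a * m" by simp
      then obtain x y where "d = x * y" "x dvd p ^ a" "y dvd m"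
        by (rule dvd_productE)
      then show "d \<in> (\<lambda>(i, d). p ^ i * d) ` ({..a} \<times> {d. d dvd m})"
        using assms(1) by (auto simp: divides_primepow_nat)
    qed
  qed
  also have "\<dots> \<le> card ({..a} \<times> {d. d dvd m})"
    by (rule card_image_le) (use assms in auto)
  finally show ?thesis by (simp add: card_cartesian_product)
qed

text \<open>Removing a prime power \<open>p ^ a\<close> costs a factor \<open>(a + 1) / p powr (a * \<epsilon>)\<close>, which is at most
  \<open>1\<close> unless \<open>p\<close> is one of the finitely many primes below \<open>2 powr (1 / \<epsilon>)\<close>.\<close>

lemma card_divisors_le:
  assumes "\<epsilon> > 0"
  shows "\<exists>C>0. \<forall>n::nat. n > 0 \<longrightarrow> real (card {d. d dvd n}) \<le> C * real n powr \<epsilon>"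
proof -
  define S where "S = {p::nat. prime p \<and> real p powr \<epsilon> < 2}"
  have "S \<subseteq> {..nat \<lceil>2 powr (1/\<epsilon>)\<rceil>}"
  proof
    fix p assume "p \<in> S"
    then have "real p powr \<epsilon> < 2" by (simp add: S_def)
    then have "(real p powr \<epsilon>) powr (1/\<epsilon>) \<le> 2 powr (1/\<epsilon>)"
      using assms by (intro powr_mono2) auto
    then have "real p \<le> 2 powr (1/\<epsilon>)" using assms by (simp add: powr_powr)
    then show "p \<in> {..nat \<lceil>2 powr (1/\<epsilon>)\<rceil>}" by (simp add: le_nat_iff) linarith
  qed
  then have finS: "finite S" using finite_subset by blast
  \<comment> \<open>By \<open>exp x \<ge> 1 + x\<close> the ratio of \<open>a + 1\<close> to
    \<open>2 powr (a * \<epsilon>)\<close> is at most \<open>A\<close> for every \<open>a\<close>,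
    so each prime of \<open>S\<close> costs one factor \<open>A\<close>.\<close>
  define A where "A = max 1 (1 / (\<epsilon> * ln 2) + 1)"
  have A1: "A \<ge> 1" by (simp add: A_def)
  have Aa: "real a + 1 \<le> A * 2 powr (a * \<epsilon>)" for a :: nat
  proof -
    have "1 + real a * \<epsilon> * ln 2 \<le> 2 powr (a * \<epsilon>)"
      by (simp add: powr_def add.commute mult.assoc)
    moreover have "real a * 1 = (1 / (\<epsilon> * ln 2)) * (real a * \<epsilon> * ln 2)"
      using assms by (simp add: field_simps)
    moreover have "\<dots> \<le> A * (real a * \<epsilon> * ln 2)"
      by (rule mult_right_mono) (use assms in \<open>auto simp: A_def\<close>)
    ultimately have "real a + 1 \<le> A * (1 + real a * \<epsilon> * ln 2)"
      using A1 by (simp add: algebra_simps)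
    also have "\<dots> \<le> A * 2 powr (a * \<epsilon>)"
      using A1 \<open>1 + real a * \<epsilon> * ln 2 \<le> _\<close> by (intro mult_left_mono) auto
    finally show ?thesis .
  qed
  have main: "real (card {d. d dvd n}) \<le> A ^ card {p\<in>S. p dvd n} * real n powr \<epsilon>" if "n > 0" for n :: nat
    using that
  proof (induction n rule: less_induct)
    case (less n)
    show ?case
    proof (cases "n = 1")
      case True
      then show ?thesis using A1 by (simp add: one_le_power)
    next
      case False
      then obtain p where p: "prime p" "p dvd n" using prime_factor_nat by blast
      define a where "a = multiplicity p n"
      obtain m where m: "n = p ^ a * m" "\<not> p dvd m"
        using less.prems p(1) unfolding a_def
        by (metis multiplicity_decompose' not_prime_unit less_not_refl)
      have a0: "a > 0" using m p(2) by (cases a) auto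
      have m0: "m > 0" using m less.prems by (cases m) auto
      have p2: "p \<ge> 2" using p(1) prime_ge_2_nat by blast
      have "1 < p ^ a" using a0 p2 by (intro one_less_power) auto
      then have "m < n" using m m0 by simp
      have IH: "real (card {d. d dvd m}) \<le> A ^ card {p\<in>S. p dvd m} * real m powr \<epsilon>"
        using less.IH \<open>m < n\<close> m0 by blast
      have n\<epsilon>: "real n powr \<epsilon> = (real p powr \<epsilon>) ^ a * real m powr \<epsilon>"
        using m p2 by (simp add: powr_mult power_powr)
      have "real (card {d. d dvd n}) \<le> real ((a + 1) * card {d. d dvd m})"
        unfolding m(1) of_nat_le_iff by (rule card_divisors_prime_power_mult[OF p(1) m0 m(2)])
      also have "\<dots> = (real a + 1) * real (card {d. d dvd m})" by (simp add: algebra_simps)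
      also have "\<dots> \<le> (real a + 1) * (A ^ card {p\<in>S. p dvd m} * real m powr \<epsilon>)"
        by (rule mult_left_mono[OF IH]) simp
      also have "\<dots> \<le> A ^ card {p\<in>S. p dvd n} * real n powr \<epsilon>"
      proof (cases "p \<in> S")
        case True
        have "insert p {p\<in>S. p dvd m} \<subseteq> {p\<in>S. p dvd n}"
          using m True p by auto
        moreover have "card (insert p {p\<in>S. p dvd m}) = Suc (card {p\<in>S. p dvd m})"
          using finS m(2) by simp
        moreover have "finite {p\<in>S. p dvd n}" using finS by simp
        ultimately have "Suc (card {p\<in>S. p dvd m}) \<le> card {p\<in>S. p dvd n}"
          by (metis card_mono)
        then have 1: "A * A ^ card {p\<in>S. p dvd m} \<le> A ^ card {p\<in>S. p dvd n}"
          using A1 by (metis power_Suc power_increasing)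
        have "2 powr (a * \<epsilon>) \<le> real p powr (a * \<epsilon>)"
          using p2 assms by (intro powr_mono2) auto
        also have "\<dots> = (real p powr \<epsilon>) ^ a"
          using p2 by (simp add: powr_power mult.commute)
        finally have "A * 2 powr (a * \<epsilon>) \<le> A * (real p powr \<epsilon>) ^ a"
          using A1 by (intro mult_left_mono) auto
        then have "real a + 1 \<le> A * (real p powr \<epsilon>) ^ a"
          using Aa[of a] by linarith
        then have "(real a + 1) * (A ^ card {p\<in>S. p dvd m} * real m powr \<epsilon>)
           \<le> A * (real p powr \<epsilon>) ^ a * (A ^ card {p\<in>S. p dvd m} * real m powr \<epsilon>)"
          using A1 by (intro mult_right_mono) auto
        also have "\<dots> = (A * A ^ card {p\<in>S. p dvd m}) * ((real p powr \<epsilon>) ^ a * real m powr \<epsilon>)"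
          by simp
        also have "\<dots> \<le> A ^ card {p\<in>S. p dvd n} * ((real p powr \<epsilon>) ^ a * real m powr \<epsilon>)"
          using 1 by (intro mult_right_mono) auto
        finally show ?thesis using n\<epsilon> by simp
      next
        case False
        then have "real p powr \<epsilon> \<ge> 2" using p(1) by (simp add: S_def)
        then have "(2::real) ^ a \<le> (real p powr \<epsilon>) ^ a"
          by (intro power_mono) auto
        moreover have "1 + real a * 1 \<le> (1 + 1) ^ a"
          by (rule Bernoulli_inequality) simp
        ultimately have 2: "real a + 1 \<le> (real p powr \<epsilon>) ^ a"
          by simp
        have "A ^ card {p\<in>S. p dvd m} \<le> A ^ card {p\<in>S. p dvd n}"
          using A1 m finS by (intro power_increasing card_mono) auto
        then have "(real a + 1) * (A ^ card {p\<in>S. p dvd m} * real m powr \<epsilon>)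
          \<le> (real p powr \<epsilon>) ^ a * (A ^ card {p\<in>S. p dvd n} * real m powr \<epsilon>)"
          using 2 A1 by (intro mult_mono mult_right_mono) auto
        then show ?thesis using n\<epsilon> by (simp add: mult_ac)
      qed
      finally show ?thesis .
    qed
  qed
  have "real (card {d. d dvd n}) \<le> A ^ card S * real n powr \<epsilon>" if "n > 0" for n :: nat
  proof -
    have "A ^ card {p\<in>S. p dvd n} \<le> A ^ card S"
      using A1 finS by (intro power_increasing card_mono) auto
    then have "A ^ card {p\<in>S. p dvd n} * real n powr \<epsilon> \<le> A ^ card S * real n powr \<epsilon>"
      by (rule mult_right_mono) simp
    then show ?thesis using main[OF that] by linarith
  qed
  moreover have "A ^ card S > 0" using A1 by simp
  ultimately show ?thesis by blast
qed

text \<open>Divisors of both signs are counted, since factors such as \<open>h\<close> and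
  \<open>x - y\<close> can be negative. At \<open>n = 0\<close> the set is infinite and
  \<open>card\<close> returns 0, so the bounds built on this count assume
  \<open>n \<noteq> 0\<close>.\<close>

definition int_divisor_count :: "int \<Rightarrow> nat" where
  "int_divisor_count n = card {d. d dvd n}"

lemma finite_int_divisors: "n \<noteq> 0 \<Longrightarrow> finite {d::int. d dvd n}"
  by (rule finite_subset[of _ "{- \<bar>n\<bar>..\<bar>n\<bar>}"]) (auto dest!: dvd_imp_le_int)

lemma int_divisor_count_le:
  assumes "\<epsilon> > 0" "B > 0"
  shows "\<exists>C>0. \<forall>P::nat. P > 0 \<longrightarrow> (\<forall>n. n \<noteq> 0 \<longrightarrow> \<bar>n\<bar> \<le> B * int P ^ 4 \<longrightarrow> real (int_divisor_count n) \<le> C * real P powr \<epsilon>)"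
proof -
  obtain C where C: "C > 0" "\<And>n::nat. n > 0 \<Longrightarrow> real (card {d. d dvd n}) \<le> C * real n powr (\<epsilon>/4)"
    using card_divisors_le[of "\<epsilon>/4"] assms by auto
  have "real (int_divisor_count n) \<le> (2 * C * real_of_int B powr (\<epsilon>/4)) * real P powr \<epsilon>"
    if "P > 0" "n \<noteq> 0" "\<bar>n\<bar> \<le> B * int P ^ 4" for n and P :: nat
  proof -
    have sub: "{d. d dvd n} \<subseteq> int ` {d. d dvd nat \<bar>n\<bar>} \<union> (\<lambda>d. - int d) ` {d. d dvd nat \<bar>n\<bar>}"
    proof
      fix d assume "d \<in> {d. d dvd n}"
      then have "nat \<bar>d\<bar> dvd nat \<bar>n\<bar>" by (simp add: nat_abs_dvd_iff)
      moreover have "d = int (nat \<bar>d\<bar>) \<or> d = - int (nat \<bar>d\<bar>)" by auto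
      ultimately show "d \<in> int ` {d. d dvd nat \<bar>n\<bar>} \<union> (\<lambda>d. - int d) ` {d. d dvd nat \<bar>n\<bar>}" by blast
    qed
    have fin: "finite {d. d dvd nat \<bar>n\<bar>}" using that by (intro finite_divisors_nat) auto
    have "int_divisor_count n \<le> card (int ` {d. d dvd nat \<bar>n\<bar>} \<union> (\<lambda>d. - int d) ` {d. d dvd nat \<bar>n\<bar>})"
      unfolding int_divisor_count_def by (rule card_mono[OF _ sub]) (use fin in auto)
    also have "\<dots> \<le> card {d. d dvd nat \<bar>n\<bar>} + card {d. d dvd nat \<bar>n\<bar>}"
      by (rule order.trans[OF card_Un_le]) (intro add_mono card_image_le fin)
    finally have "real (int_divisor_count n) \<le> 2 * real (card {d. d dvd nat \<bar>n\<bar>})" by linarith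
    also have "\<dots> \<le> 2 * (C * real (nat \<bar>n\<bar>) powr (\<epsilon>/4))"
      using C(2)[of "nat \<bar>n\<bar>"] that by auto
    also have "real (nat \<bar>n\<bar>) powr (\<epsilon>/4) \<le> (real_of_int B * real P ^ 4) powr (\<epsilon>/4)"
    proof (rule powr_mono2)
      have "real_of_int \<bar>n\<bar> \<le> real_of_int (B * int P ^ 4)" using that(3) of_int_le_iff by blast
      then show "real (nat \<bar>n\<bar>) \<le> real_of_int B * real P ^ 4" by simp
    qed (use assms in auto)
    also have "(real_of_int B * real P ^ 4) powr (\<epsilon>/4) = real_of_int B powr (\<epsilon>/4) * real P powr \<epsilon>"
      using assms that by (simp add: powr_mult power_powr powr_power)
    finally show ?thesis using C by (simp add: mult_ac)
  qed
  moreover have "2 * C * real_of_int B powr (\<epsilon>/4) > 0" using C assms by simp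
  ultimately show ?thesis by blast
qed

text \<open>To be used when an equation with right-hand side \<open>n\<close> factors: the factors
  divide \<open>n\<close>, and two of them already determine the solution.\<close>

lemma card_le_divs2:
  assumes "n \<noteq> 0" "\<And>s. s \<in> S \<Longrightarrow> f s dvd n \<and> g s dvd n" "inj_on (\<lambda>s. (f s, g s)) S"
  shows "finite S" "card S \<le> int_divisor_count n ^ 2"
proof -
  have sub: "(\<lambda>s. (f s, g s)) ` S \<subseteq> {d. d dvd n} \<times> {d. d dvd n}" using assms(2) by auto
  have fin: "finite ({d. d dvd n} \<times> {d. d dvd n})" using finite_int_divisors[OF assms(1)] by simp
  show "finite S" using finite_subset[OF sub fin] assms(3) by (rule finite_imageD)
  have "card S = card ((\<lambda>s. (f s, g s)) ` S)" by (rule card_image[symmetric, OF assms(3)])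
  also have "\<dots> \<le> card ({d. d dvd n} \<times> {d. d dvd n})" by (rule card_mono[OF fin sub])
  finally show "card S \<le> int_divisor_count n ^ 2" by (simp add: card_cartesian_product int_divisor_count_def power2_eq_square)
qed

lemma card_le_divs4:
  assumes "n \<noteq> 0" "\<And>s. s \<in> S \<Longrightarrow> f s dvd n \<and> g s dvd n \<and> h s dvd n \<and> k s dvd n"
    "inj_on (\<lambda>s. (f s, g s, h s, k s)) S"
  shows "finite S" "card S \<le> int_divisor_count n ^ 4"
proof -
  let ?D = "{d. d dvd n}"
  have sub: "(\<lambda>s. (f s, g s, h s, k s)) ` S \<subseteq> ?D \<times> ?D \<times> ?D \<times> ?D" using assms(2) by auto
  have fin: "finite (?D \<times> ?D \<times> ?D \<times> ?D)" using finite_int_divisors[OF assms(1)] by simp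
  show "finite S" using finite_subset[OF sub fin] assms(3) by (rule finite_imageD)
  have "card S = card ((\<lambda>s. (f s, g s, h s, k s)) ` S)" by (rule card_image[symmetric, OF assms(3)])
  also have "\<dots> \<le> card (?D \<times> ?D \<times> ?D \<times> ?D)" by (rule card_mono[OF fin sub])
  finally show "card S \<le> int_divisor_count n ^ 4" by (simp add: card_cartesian_product int_divisor_count_def power4_eq_xxxx)
qed

section \<open>Differenced quartic Weyl sums and their mean values\<close>

lemma card_fibres:
  assumes "finite S" "finite T" "f ` S \<subseteq> T"
  shows "card S = (\<Sum>t\<in>T. card {s\<in>S. f s = t})"
  using sum.group[OF assms, of "\<lambda>_. 1::nat"] by simp

lemma card_le_fibres:
  assumes "finite S" "finite T" "f ` S \<subseteq> T" "\<And>t. t \<in> T \<Longrightarrow> real (card {s\<in>S. f s = t}) \<le> B"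
  shows "real (card S) \<le> real (card T) * B"
proof -
  have "real (card S) = (\<Sum>t\<in>T. real (card {s\<in>S. f s = t}))"
    using card_fibres[OF assms(1-3)] by simp
  also have "\<dots> \<le> (\<Sum>t\<in>T. B)" by (rule sum_mono) (rule assms(4))
  finally show ?thesis by simp
qed

lemma sum_square_le_card:
  fixes a :: "'a \<Rightarrow> real"
  shows "(\<Sum>i\<in>I. a i)\<^sup>2 \<le> real (card I) * (\<Sum>i\<in>I. (a i)\<^sup>2)"
  using Cauchy_Schwarz_ineq_sum[of "\<lambda>_. 1" a I] by simp

text \<open>Cauchy--Schwarz over the fibres of \<open>f\<close>: the sum of the squares of the fibre
  sizes counts the pairs that lie in a common fibre.\<close>

lemma card_square_le_pairs:
  assumes "finite S" "finite T" "f ` S \<subseteq> T"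
  shows "(card S)\<^sup>2 \<le> card T * card {(s, s') \<in> S \<times> S. f s = f s'}"
proof -
  have "(real (card S))\<^sup>2 = (\<Sum>t\<in>T. real (card {s\<in>S. f s = t}))\<^sup>2"
    using card_fibres[OF assms] by simp
  also have "\<dots> \<le> real (card T) * (\<Sum>t\<in>T. (real (card {s\<in>S. f s = t}))\<^sup>2)"
    by (rule sum_square_le_card)
  also have "(\<Sum>t\<in>T. (real (card {s\<in>S. f s = t}))\<^sup>2)
     = real (\<Sum>t\<in>T. card {x \<in> {(s, s') \<in> S \<times> S. f s = f s'}. f (fst x) = t})"
    unfolding of_nat_sum
  proof (rule sum.cong[OF refl])
    fix t
    have "{x \<in> {(s, s') \<in> S \<times> S. f s = f s'}. f (fst x) = t} = {s\<in>S. f s = t} \<times> {s\<in>S. f s = t}"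
      by auto
    then show "(real (card {s \<in> S. f s = t}))\<^sup>2 = real (card {x \<in> {(s, s') \<in> S \<times> S. f s = f s'}. f (fst x) = t})"
      by (simp add: card_cartesian_product power2_eq_square)
  qed
  also have "(\<Sum>t\<in>T. card {x \<in> {(s, s') \<in> S \<times> S. f s = f s'}. f (fst x) = t})
      = card {(s, s') \<in> S \<times> S. f s = f s'}"
    by (rule card_fibres[symmetric]) (use assms in \<open>auto intro: finite_subset[of _ "S \<times> S"]\<close>)
  finally show ?thesis
    by (metis (mono_tags, lifting) of_nat_le_iff of_nat_mult of_nat_power)
qed

definition diff4 :: "int \<Rightarrow> int \<Rightarrow> int" where
  "diff4 h x = (x + h) ^ 4 - x ^ 4"

definition dom4 :: "nat \<Rightarrow> int \<Rightarrow> int set" where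
  "dom4 P h = {x \<in> {1..int P}. x + h \<in> {1..int P}}"

lemma finite_dom4 [simp]: "finite (dom4 P h)"
  by (rule finite_subset[of _ "{1..int P}"]) (auto simp: dom4_def)

lemma pow4_le: "x \<in> {1..int P} \<Longrightarrow> 1 \<le> x ^ 4 \<and> x ^ 4 \<le> int P ^ 4"
  by (auto intro: power_mono one_le_power)

lemma abs_diff4_le: "x \<in> dom4 P h \<Longrightarrow> \<bar>diff4 h x\<bar> \<le> int P ^ 4"
  using pow4_le[of x P] pow4_le[of "x + h" P] unfolding dom4_def diff4_def mem_Collect_eq by linarith

lemma diff4_0 [simp]: "diff4 0 x = 0"
  by (simp add: diff4_def)

text \<open>The cofactor is written as a sum of squares so that its positivity for
  \<open>h \<noteq> 0\<close> is visible. This makes \<open>diff4 h\<close> injective, and the two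
  linear factors \<open>h\<close> and \<open>x - y\<close> are available as divisors.\<close>

lemma diff4_diff:
  "diff4 h x - diff4 h y = h * (x - y) * (3 * (2 * y + h + (x - y))\<^sup>2 + h\<^sup>2 + (x - y)\<^sup>2)"
  unfolding diff4_def by algebra

lemma diff4_inj:
  assumes "h \<noteq> 0" "diff4 h x = diff4 h y"
  shows "x = y"
proof (rule ccontr)
  assume ne: "x \<noteq> y"
  have "3 * (2 * y + h + (x - y))\<^sup>2 + h\<^sup>2 + (x - y)\<^sup>2 > 0"
    using assms(1) by (simp add: add_nonneg_pos add_pos_nonneg)
  then show False using diff4_diff[of h x y] assms ne by auto
qed

text \<open>A further difference splits completely into linear factors, and these determine
  \<open>h\<close>, \<open>d\<close>, \<open>y\<close> and \<open>y'\<close>. This is what a second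
  Cauchy--Schwarz step can exploit: equations of this shape have few solutions by the divisor
  bound.\<close>

lemma diff4_diff_diff:
  "(diff4 h (y + d) - diff4 h y) - (diff4 h (y' + d) - diff4 h y')
     = 12 * h * d * (y - y') * (y + y' + h + d)"
  unfolding diff4_def by algebra

lemma diff4_diff_inj:
  assumes "h \<noteq> 0" "x \<noteq> y" "x \<in> dom4 P h" "y \<in> dom4 P h" "x' \<in> dom4 P h" "y' \<in> dom4 P h"
    "x - y = x' - y'" "diff4 h x - diff4 h y = diff4 h x' - diff4 h y'"
  shows "y = y'"
proof -
  define d where "d = x - y"
  have x: "x = y + d" "x' = y' + d" "d \<noteq> 0" using assms d_def by auto
  have "12 * h * d * (y - y') * (y + y' + h + d) = 0"
    using diff4_diff_diff[of h y d y'] assms(8) x by simp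
  \<comment> \<open>The sum is \<open>x + (y' + h)\<close>, and both summands lie in
    \<open>{1..int P}\<close>.\<close>
  moreover have "y + y' + h + d > 0" using assms(3-6) x by (auto simp: dom4_def)
  ultimately show "y = y'" using assms(1) x by auto
qed

lemma card_pow4_diff_le:
  assumes "n \<noteq> 0"
  shows "card {(x, y) \<in> {1..int P} \<times> {1..int P}. x ^ 4 - y ^ 4 = n} \<le> int_divisor_count n ^ 2"
proof (rule card_le_divs2(2)[OF assms, where f = "\<lambda>(x,y). x - y" and g = "\<lambda>(x,y). x + y"])
  fix s assume "s \<in> {(x, y) \<in> {1..int P} \<times> {1..int P}. x ^ 4 - y ^ 4 = n}"
  then obtain x y where s: "s = (x, y)" "x ^ 4 - y ^ 4 = n" by auto
  have "n = (x - y) * ((x + y) * (x\<^sup>2 + y\<^sup>2))" unfolding s(2)[symmetric] by algebra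
  moreover have "n = (x + y) * ((x - y) * (x\<^sup>2 + y\<^sup>2))" unfolding s(2)[symmetric] by algebra
  ultimately show "(case s of (x, y) \<Rightarrow> x - y) dvd n \<and> (case s of (x, y) \<Rightarrow> x + y) dvd n"
    using s(1) by (metis case_prod_conv dvd_triv_left)
next
  show "inj_on (\<lambda>s. (case s of (x, y) \<Rightarrow> x - y, case s of (x, y) \<Rightarrow> x + y))
     {(x, y) \<in> {1..int P} \<times> {1..int P}. x ^ 4 - y ^ 4 = n}"
    by (rule inj_onI) auto
qed

text \<open>By \<open>diff4_diff\<close> both \<open>h\<close> and \<open>x - y\<close> divide
  \<open>n\<close>; once these two are fixed, \<open>diff4_diff_inj\<close> leaves a single
  \<open>y\<close>.\<close>

lemma card_diff4_diff_le:
  assumes "n \<noteq> 0"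
  shows "card {(h, x, y). h \<noteq> 0 \<and> x \<in> dom4 P h \<and> y \<in> dom4 P h \<and> diff4 h x - diff4 h y = n} \<le> int_divisor_count n ^ 2"
    (is "card ?S \<le> _")
proof (rule card_le_divs2(2)[OF assms, where f = "\<lambda>(h,x,y). h" and g = "\<lambda>(h,x,y). x - y"])
  fix s assume "s \<in> ?S"
  then obtain h x y where s: "s = (h, x, y)" "diff4 h x - diff4 h y = n" by auto
  then show "(case s of (h,x,y) \<Rightarrow> h) dvd n \<and> (case s of (h,x,y) \<Rightarrow> x - y) dvd n"
    using diff4_diff[of h x y] by (simp add: mult.assoc) (metis dvd_triv_left mult.left_commute)
next
  show "inj_on (\<lambda>s. (case s of (h,x,y) \<Rightarrow> h, case s of (h,x,y) \<Rightarrow> x - y)) ?S"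
  proof (rule inj_onI)
    fix s t assume s: "s \<in> ?S" and t: "t \<in> ?S"
      and eq: "(case s of (h,x,y) \<Rightarrow> h, case s of (h,x,y) \<Rightarrow> x - y) = (case t of (h,x,y) \<Rightarrow> h, case t of (h,x,y) \<Rightarrow> x - y)"
    obtain h x y where s': "s = (h, x, y)" by (cases s)
    obtain x' y' where t': "t = (h, x', y')" using eq s' by (cases t) auto
    have xy: "x - y = x' - y'" using eq s' t' by simp
    have h0: "h \<noteq> 0" and n: "diff4 h x - diff4 h y = n" "diff4 h x' - diff4 h y' = n"
      and dm: "x \<in> dom4 P h" "y \<in> dom4 P h" "x' \<in> dom4 P h" "y' \<in> dom4 P h"
      using s t s' t' by auto
    have "x \<noteq> y" using n assms by auto
    have "y = y'"
      by (rule diff4_diff_inj[OF h0 \<open>x \<noteq> y\<close> dm xy]) (simp add: n)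
    then show "s = t" using s' t' xy by simp
  qed
qed

lemma card_diff4_diff_diff_le:
  assumes "n \<noteq> 0"
  shows "finite {(h, d, y, y'). y \<in> dom4 P h \<and> y' \<in> dom4 P h \<and> y + d \<in> dom4 P h \<and> y' + d \<in> dom4 P h
     \<and> (diff4 h (y + d) - diff4 h y) - (diff4 h (y' + d) - diff4 h y') = n}" (is "finite ?S")
   and "card {(h, d, y, y'). y \<in> dom4 P h \<and> y' \<in> dom4 P h \<and> y + d \<in> dom4 P h \<and> y' + d \<in> dom4 P h
     \<and> (diff4 h (y + d) - diff4 h y) - (diff4 h (y' + d) - diff4 h y') = n} \<le> int_divisor_count n ^ 4"
proof -
  have A: "h dvd n \<and> d dvd n \<and> y - y' dvd n \<and> y + y' + h + d dvd n"
    if "(diff4 h (y + d) - diff4 h y) - (diff4 h (y' + d) - diff4 h y') = n" for h d y y'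
    using that[symmetric] unfolding diff4_diff_diff by (simp add: dvd_mult dvd_mult2)
  have inj: "inj_on (\<lambda>s. (case s of (h,d,y,y') \<Rightarrow> h, case s of (h,d,y,y') \<Rightarrow> d,
      case s of (h,d,y,y') \<Rightarrow> y - y', case s of (h,d,y,y') \<Rightarrow> y + y' + h + d)) ?S"
    by (rule inj_onI) auto
  show "finite ?S"
    by (rule card_le_divs4(1)[OF assms _ inj]) (use A in auto)
  show "card ?S \<le> int_divisor_count n ^ 4"
    by (rule card_le_divs4(2)[OF assms _ inj]) (use A in auto)
qed


section \<open>Weyl sums and their mean values over the grid\<close>

definition weyl4 :: "nat \<Rightarrow> real \<Rightarrow> complex" where
  "weyl4 P \<alpha> = (\<Sum>x\<in>{1..int P}. E (\<alpha> * of_int (x ^ 4)))"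

definition weyl4_diff :: "nat \<Rightarrow> int \<Rightarrow> real \<Rightarrow> complex" where
  "weyl4_diff P h \<alpha> = (\<Sum>x\<in>dom4 P h. E (\<alpha> * of_int (diff4 h x)))"

lemma norm_weyl4_le: "cmod (weyl4 P \<alpha>) \<le> real P"
  unfolding weyl4_def by (rule order.trans[OF norm_sum]) simp

lemma weyl4_differenced:
  "complex_of_real ((cmod (weyl4 P \<alpha>))\<^sup>2) = (\<Sum>h\<in>{- int P..int P}. weyl4_diff P h \<alpha>)"
  unfolding weyl4_def weyl4_diff_def norm_square_differenced[OF order.refl] dom4_def[symmetric]
  by (intro sum.cong refl) (simp add: E_diff diff4_def right_diff_distrib)

lemma norm_square_sum_le:
  fixes z :: "int \<Rightarrow> complex"
  assumes "complex_of_real r = (\<Sum>h\<in>{- int P..int P}. z h)"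
  shows "r\<^sup>2 \<le> (2 * real P + 1) * (\<Sum>h\<in>{- int P..int P}. (cmod (z h))\<^sup>2)"
proof -
  have "\<bar>r\<bar> \<le> (\<Sum>h\<in>{- int P..int P}. cmod (z h))"
    using norm_sum[of z "{- int P..int P}"] unfolding assms[symmetric] by simp
  then have "r\<^sup>2 \<le> (\<Sum>h\<in>{- int P..int P}. cmod (z h))\<^sup>2"
    by (metis abs_ge_zero power2_abs power_mono)
  also have "\<dots> \<le> real (card {- int P..int P}) * (\<Sum>h\<in>{- int P..int P}. (cmod (z h))\<^sup>2)"
    by (rule sum_square_le_card)
  finally show ?thesis by simp
qed

lemma weyl4_pow4_le:
  "(cmod (weyl4 P \<alpha>)) ^ 4 \<le> (2 * real P + 1) * (\<Sum>h\<in>{- int P..int P}. (cmod (weyl4_diff P h \<alpha>))\<^sup>2)"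
  using norm_square_sum_le[OF weyl4_differenced] by (simp flip: power_mult)

text \<open>Off-diagonal solutions of the equation that counts the mean value of \<open>|f|\<^sup>4 |K|\<^sup>2\<close>, where \<open>f\<close> is the Weyl sum
  and \<open>K\<close> has frequencies \<open>w\<close>.\<close>

definition coll4 :: "nat \<Rightarrow> 'a set \<Rightarrow> ('a \<Rightarrow> int) \<Rightarrow> (int \<times> int \<times> int \<times> 'a \<times> 'a) set" where
  "coll4 P I w = {(h, x, y, i, k). h \<in> {- int P..int P} \<and> h \<noteq> 0 \<and> x \<in> dom4 P h \<and> y \<in> dom4 P h \<and> x \<noteq> y
      \<and> i \<in> I \<and> k \<in> I \<and> diff4 h x + w i = diff4 h y + w k}"

lemma finite_coll4: "finite I \<Longrightarrow> finite (coll4 P I w)"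
  by (rule finite_subset[of _ "{- int P..int P} \<times> {1..int P} \<times> {1..int P} \<times> I \<times> I"])
     (auto simp: coll4_def dom4_def)

lemma card_symmetric_interval: "card {- int P..int P} = 2 * P + 1"
  by simp

lemma card_one_interval: "card {1..int P} = P"
  by simp

text \<open>The source of the condition \<open>8 * int P ^ 4 < M\<close>: a frequency
  \<open>diff4 h x + w i\<close> has modulus at most \<open>4 * int P ^ 4\<close>, and
  \<open>mean_square_le\<close> asks for less than \<open>M / 2\<close>.\<close>

lemma twice_abs_add_less:
  fixes a b B M :: int
  assumes "\<bar>a\<bar> \<le> B" "\<bar>b\<bar> \<le> 3 * B" "8 * B < M"
  shows "2 * \<bar>a + b\<bar> < M"
proof -
  have "\<bar>a + b\<bar> \<le> B + 3 * B"
    by (rule order.trans[OF abs_triangle_ineq add_mono[OF assms(1,2)]])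
  then show ?thesis using assms(3) by simp
qed

text \<open>The solutions of \<open>diff4 h x + w i = diff4 h y + w k\<close> with \<open>h = 0\<close> or \<open>x = y\<close> are diagonal.\<close>

lemma mean_weyl4_pow4:
  fixes M :: int and w :: "'a \<Rightarrow> int" and \<eta> :: "'a \<Rightarrow> complex"
  assumes "finite I" "\<And>i. i \<in> I \<Longrightarrow> cmod (\<eta> i) \<le> 1"
    and w: "\<And>i. i \<in> I \<Longrightarrow> \<bar>w i\<bar> \<le> 3 * int P ^ 4" and M: "8 * int P ^ 4 < M"
  shows "(\<Sum>j\<in>{0..<M}. (cmod (weyl4 P (of_int j / of_int M))) ^ 4 *
            (cmod (\<Sum>i\<in>I. \<eta> i * E (of_int (j * w i) / of_int M)))\<^sup>2)
     \<le> of_int M * ((2 * real P + 1) * (4 * real P ^ 2 * real (card {(i, k) \<in> I \<times> I. w i = w k}) + real (card (coll4 P I w))))"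
proof -
  define K where "K = (\<lambda>j::int. (\<Sum>i\<in>I. \<eta> i * E (of_int (j * w i) / of_int M)))"
  define G where "G = {(i, k) \<in> I \<times> I. w i = w k}"
  have M0: "M > 0" using M by (smt (verit) zero_le_power of_nat_0_le_iff)
  have finG: "finite G" unfolding G_def using assms(1) by (auto intro: finite_subset[of _ "I \<times> I"])
  have eq: "weyl4_diff P h (of_int j / of_int M) * K j
      = (\<Sum>(x,i)\<in>dom4 P h \<times> I. \<eta> i * E (of_int (j * (diff4 h x + w i)) / of_int M))" for j h
    unfolding weyl4_diff_def K_def sum_product sum.cartesian_product
    by (rule sum.cong) (auto simp: E_add distrib_left add_divide_distrib mult_ac)
  define S where "S = (\<lambda>h. {(p, q) \<in> (dom4 P h \<times> I) \<times> (dom4 P h \<times> I). diff4 h (fst p) + w (snd p) = diff4 h (fst q) + w (snd q)})"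
  have 1: "(\<Sum>j\<in>{0..<M}. (cmod (weyl4_diff P h (of_int j / of_int M)))\<^sup>2 * (cmod (K j))\<^sup>2) \<le> of_int M * real (card (S h))" for h
  proof -
    have "(\<Sum>j\<in>{0..<M}. (cmod (weyl4_diff P h (of_int j / of_int M)))\<^sup>2 * (cmod (K j))\<^sup>2)
       = (\<Sum>j\<in>{0..<M}. (cmod (\<Sum>p\<in>dom4 P h \<times> I. \<eta> (snd p) * E (of_int (j * (diff4 h (fst p) + w (snd p))) / of_int M)))\<^sup>2)"
      by (simp only: power_mult_distrib[symmetric] norm_mult[symmetric] eq case_prod_unfold)
    also have "\<dots> \<le> of_int M * real (card (S h))"
      unfolding S_def
    proof (rule mean_square_le[OF M0])
      fix p assume "p \<in> dom4 P h \<times> I"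
      then have p: "fst p \<in> dom4 P h" "snd p \<in> I" by auto
      show "cmod (\<eta> (snd p)) \<le> 1" using p assms(2) by simp
      show "2 * \<bar>diff4 h (fst p) + w (snd p)\<bar> < M" by (rule twice_abs_add_less[OF abs_diff4_le[OF p(1)] w[OF p(2)] M])
    qed (use assms(1) in simp)
    finally show ?thesis .
  qed
  have fS: "finite (S h)" for h
    unfolding S_def using assms(1) by (auto intro: finite_subset[of _ "(dom4 P h \<times> I) \<times> (dom4 P h \<times> I)"])
  define g where "g = (\<lambda>(h::int, (x::int, i::'a), (y::int, k::'a)). (h, x, y, i, k))"
  define A where "A = (\<lambda>(x,y,i,k). (0::int,x,y,i,k)) ` ({1..int P} \<times> {1..int P} \<times> G)"
  define B where "B = (\<lambda>(h,x,i,k). (h,x,x,i,k)) ` ({- int P..int P} \<times> {1..int P} \<times> G)"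
  have sub: "g ` (SIGMA h:{- int P..int P}. S h) \<subseteq> A \<union> (B \<union> coll4 P I w)"
  proof (rule image_subsetI)
    fix s assume s: "s \<in> (SIGMA h:{- int P..int P}. S h)"
    obtain h x i y k where s': "s = (h, (x, i), (y, k))" by (metis surj_pair)
    have *: "h \<in> {- int P..int P}" "((x, i), (y, k)) \<in> S h" using s unfolding s' by auto
    from *(2) have m: "x \<in> dom4 P h" "y \<in> dom4 P h" "i \<in> I" "k \<in> I" "diff4 h x + w i = diff4 h y + w k"
      by (auto simp: S_def)
    have P: "x \<in> {1..int P}" "y \<in> {1..int P}" using m by (auto simp: dom4_def)
    have "(h, x, y, i, k) \<in> coll4 P I w" if "h \<noteq> 0" "x \<noteq> y"
      using m *(1) that by (simp add: coll4_def)
    moreover have "(h, x, y, i, k) \<in> B" if "x = y"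
      using m P that *(1) unfolding G_def B_def by (intro image_eqI[of _ _ "(h,x,i,k)"]) auto
    moreover have "(h, x, y, i, k) \<in> A" if "h = 0"
      using m P that *(1) unfolding G_def A_def by (intro image_eqI[of _ _ "(x,y,i,k)"]) auto
    ultimately show "g s \<in> A \<union> (B \<union> coll4 P I w)"
      unfolding s' g_def prod.case by blast
  qed
  have inj: "inj_on g (SIGMA h:{- int P..int P}. S h)"
    by (auto simp: inj_on_def g_def)
  have fin: "finite (A \<union> (B \<union> coll4 P I w))"
    unfolding A_def B_def using finG finite_coll4[OF assms(1)] by simp
  have "(\<Sum>h\<in>{- int P..int P}. card (S h)) = card (SIGMA h:{- int P..int P}. S h)"
    using fS by simp
  also have "\<dots> \<le> card (A \<union> (B \<union> coll4 P I w))"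
    by (rule card_inj_on_le[OF inj sub fin])
  also have "\<dots> \<le> card A + (card B + card (coll4 P I w))"
    by (rule order.trans[OF card_Un_le add_left_mono[OF card_Un_le]])
  also have "\<dots> \<le> card ({1..int P} \<times> {1..int P} \<times> G) + (card ({- int P..int P} \<times> {1..int P} \<times> G) + card (coll4 P I w))"
    unfolding A_def B_def by (intro add_mono card_image_le order.refl) (use finG in auto)
  also have "\<dots> = (P * P + (2 * P + 1) * P) * card G + card (coll4 P I w)"
    by (simp only: card_cartesian_product card_symmetric_interval card_one_interval) (simp add: algebra_simps)
  also have "\<dots> \<le> 4 * P ^ 2 * card G + card (coll4 P I w)"
    by (intro add_mono mult_right_mono order.refl) (cases P, auto simp: power2_eq_square)
  finally have c: "(\<Sum>h\<in>{- int P..int P}. card (S h)) \<le> 4 * P ^ 2 * card G + card (coll4 P I w)" .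
  have 2: "real (\<Sum>h\<in>{- int P..int P}. card (S h)) \<le> 4 * real P ^ 2 * real (card G) + real (card (coll4 P I w))"
    using of_nat_mono[OF c, where 'a = real]
    by (simp only: of_nat_add of_nat_mult of_nat_numeral of_nat_power)
  have "(\<Sum>j\<in>{0..<M}. (cmod (weyl4 P (of_int j / of_int M))) ^ 4 * (cmod (K j))\<^sup>2)
     \<le> (\<Sum>j\<in>{0..<M}. ((2 * real P + 1) * (\<Sum>h\<in>{- int P..int P}. (cmod (weyl4_diff P h (of_int j / of_int M)))\<^sup>2)) * (cmod (K j))\<^sup>2)"
    by (intro sum_mono mult_right_mono weyl4_pow4_le) simp
  also have "\<dots> = (2 * real P + 1) * (\<Sum>h\<in>{- int P..int P}. \<Sum>j\<in>{0..<M}. (cmod (weyl4_diff P h (of_int j / of_int M)))\<^sup>2 * (cmod (K j))\<^sup>2)"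
    unfolding sum.swap[where A = "{- int P..int P}" and B = "{0..<M}"]
    by (simp add: sum_distrib_left sum_distrib_right mult_ac)
  also have "\<dots> \<le> (2 * real P + 1) * (\<Sum>h\<in>{- int P..int P}. of_int M * real (card (S h)))"
    by (intro mult_left_mono sum_mono 1) simp
  also have "\<dots> = of_int M * ((2 * real P + 1) * real (\<Sum>h\<in>{- int P..int P}. card (S h)))"
    by (simp add: sum_distrib_left mult_ac)
  also have "\<dots> \<le> of_int M * ((2 * real P + 1) * (4 * real P ^ 2 * real (card G) + real (card (coll4 P I w))))"
    using 2 M0 by (intro mult_left_mono) auto
  finally show ?thesis unfolding K_def G_def .
qed

lemma abs_w_diff_le:
  fixes w :: "'a \<Rightarrow> int"
  assumes "\<bar>w i\<bar> \<le> 3 * B" "\<bar>w k\<bar> \<le> 3 * B"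
  shows "\<bar>w k - w i\<bar> \<le> 8 * B"
  using assms by linarith

text \<open>Fix \<open>(i, k)\<close> and count \<open>(h, x, y)\<close> by divisors of
  \<open>w k - w i\<close>. If this difference vanishes, injectivity of \<open>diff4 h\<close>
  leaves only \<open>x = y\<close>, which \<open>coll4\<close> excludes. Here \<open>w\<close> need
  not be injective, so the lemma applies to sums of two fourth powers, as the eighth moment
  requires.\<close>

lemma card_coll4_le:
  assumes "finite I" "\<And>i. i \<in> I \<Longrightarrow> \<bar>w i\<bar> \<le> 3 * int P ^ 4"
    and L: "\<And>n. n \<noteq> 0 \<Longrightarrow> \<bar>n\<bar> \<le> 8 * int P ^ 4 \<Longrightarrow> real (int_divisor_count n) \<le> L"
  shows "real (card (coll4 P I w)) \<le> real (card I) ^ 2 * L ^ 2"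
proof -
  have "real (card (coll4 P I w)) \<le> real (card (I \<times> I)) * L ^ 2"
  proof (rule card_le_fibres[where f = "\<lambda>(h,x,y,i,k). (i,k)"])
    show "finite (coll4 P I w)" using finite_coll4 assms(1) .
    show "finite (I \<times> I)" using assms(1) by simp
    show "(\<lambda>(h,x,y,i,k). (i,k)) ` coll4 P I w \<subseteq> I \<times> I" by (auto simp: coll4_def)
    fix t assume "t \<in> I \<times> I"
    then obtain i k where t: "t = (i, k)" "i \<in> I" "k \<in> I" by auto
    let ?F = "{s \<in> coll4 P I w. (case s of (h,x,y,i,k) \<Rightarrow> (i,k)) = t}"
    show "real (card ?F) \<le> L ^ 2"
    proof (cases "w k - w i = 0")
      case True
      have "(h, x, y, i, k) \<notin> coll4 P I w" for h x y
        using True diff4_inj[of h x y] by (auto simp: coll4_def)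
      then have "?F = {}" using t(1) by fastforce
      then have c: "card ?F = 0" by (simp only: card.empty)
      show ?thesis unfolding c by simp
    next
      case False
      let ?T = "{(h, x, y). h \<noteq> 0 \<and> x \<in> dom4 P h \<and> y \<in> dom4 P h \<and> diff4 h x - diff4 h y = w k - w i}"
      have finT: "finite ?T"
        by (rule finite_subset[of _ "{- int P..int P} \<times> {1..int P} \<times> {1..int P}"]) (auto simp: dom4_def)
      have "card ?F \<le> card ?T"
      proof (rule card_inj_on_le[where f = "\<lambda>(h,x,y,i,k). (h,x,y)"])
        show "inj_on (\<lambda>(h,x,y,i,k). (h,x,y)) ?F"
          by (rule inj_onI) (use t(1) in auto)
        show "(\<lambda>(h,x,y,i,k). (h,x,y)) ` ?F \<subseteq> ?T"
          by (rule image_subsetI) (clarsimp simp: coll4_def t(1))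
      qed (rule finT)
      also have "\<dots> \<le> int_divisor_count (w k - w i) ^ 2" by (rule card_diff4_diff_le[OF False])
      finally have c: "card ?F \<le> int_divisor_count (w k - w i) ^ 2" .
      have "real (card ?F) \<le> real (int_divisor_count (w k - w i)) ^ 2"
        using of_nat_mono[OF c, where 'a = real] by (simp only: of_nat_power)
      also have "\<dots> \<le> L ^ 2"
        using L[OF False] abs_w_diff_le[of w _ "int P ^ 4", OF assms(2)[OF t(2)] assms(2)[OF t(3)]]
        by (intro power_mono) auto
      finally show ?thesis .
    qed
  qed
  then show ?thesis by (simp add: card_cartesian_product power2_eq_square)
qed

text \<open>Davenport's trick: Cauchy--Schwarz over \<open>(h, x - y, k)\<close> creates a further difference.\<close>

lemma card_coll4_square_le:
  fixes I :: "'a set" and w :: "'a \<Rightarrow> int"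
  assumes "finite I" "\<And>i. i \<in> I \<Longrightarrow> \<bar>w i\<bar> \<le> 3 * int P ^ 4" "inj_on w I"
    and L: "\<And>n. n \<noteq> 0 \<Longrightarrow> \<bar>n\<bar> \<le> 8 * int P ^ 4 \<Longrightarrow> real (int_divisor_count n) \<le> L"
  shows "(real (card (coll4 P I w)))\<^sup>2
     \<le> (2 * real P + 1)\<^sup>2 * real (card I) * (real (card (coll4 P I w)) + real (card I) ^ 2 * L ^ 4)"
proof -
  let ?C = "coll4 P I w"
  define f :: "int \<times> int \<times> int \<times> 'a \<times> 'a \<Rightarrow> int \<times> int \<times> 'a"
    where "f = (\<lambda>(h,x,y,i,k). (h, x - y, k))"
  define T where "T = {- int P..int P} \<times> {- int P..int P} \<times> I"
  have fC: "finite ?C" using finite_coll4 assms(1) .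
  have fT: "finite T" unfolding T_def using assms(1) by simp
  have cT: "real (card T) = (2 * real P + 1)\<^sup>2 * real (card I)"
    by (simp only: T_def card_cartesian_product card_symmetric_interval) (simp add: power2_eq_square algebra_simps)
  have "f ` ?C \<subseteq> T" by (auto simp: f_def T_def coll4_def dom4_def)
  then have "(card ?C)\<^sup>2 \<le> card T * card {(s, s') \<in> ?C \<times> ?C. f s = f s'}"
    by (rule card_square_le_pairs[OF fC fT])
  then have 1: "(real (card ?C))\<^sup>2 \<le> real (card T) * real (card {(s, s') \<in> ?C \<times> ?C. f s = f s'})"
    by (metis (mono_tags, lifting) of_nat_le_iff of_nat_mult of_nat_power)
  define U where "U = {(h, d, y, y', i, i'). y \<in> dom4 P h \<and> y' \<in> dom4 P h \<and> y + d \<in> dom4 P h \<and> y' + d \<in> dom4 P h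
     \<and> i \<in> I \<and> i' \<in> I \<and> i \<noteq> i' \<and> (diff4 h (y + d) - diff4 h y) - (diff4 h (y' + d) - diff4 h y') = w i' - w i}"
  have fU: "finite U"
    by (rule finite_subset[of _ "{- int P..int P} \<times> {- int P..int P} \<times> {1..int P} \<times> {1..int P} \<times> I \<times> I"])
       (use assms(1) in \<open>auto simp: U_def dom4_def\<close>)
  have cU: "real (card U) \<le> real (card (I \<times> I)) * L ^ 4"
  proof (rule card_le_fibres[where f = "\<lambda>(h,d,y,y',i,i'). (i,i')"])
    show "finite (I \<times> I)" using assms(1) by simp
    show "(\<lambda>(h,d,y,y',i,i'). (i,i')) ` U \<subseteq> I \<times> I" by (auto simp: U_def)
    fix t assume "t \<in> I \<times> I"
    then obtain i i' where t: "t = (i, i')" "i \<in> I" "i' \<in> I" by auto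
    let ?F = "{s \<in> U. (case s of (h,d,y,y',i,i') \<Rightarrow> (i,i')) = t}"
    show "real (card ?F) \<le> L ^ 4"
    proof (cases "i = i'")
      case True
      then have "(h, d, y, y', i, i') \<notin> U" for h d y y'
        by (simp add: U_def)
      then have "?F = {}" using t(1) by fastforce
      then have c: "card ?F = 0" by (simp only: card.empty)
      show ?thesis unfolding c by simp
    next
      case False
      then have n0: "w i' - w i \<noteq> 0" using assms(3) t by (auto dest: inj_onD)
      let ?T = "{(h, d, y, y'). y \<in> dom4 P h \<and> y' \<in> dom4 P h \<and> y + d \<in> dom4 P h \<and> y' + d \<in> dom4 P h
         \<and> (diff4 h (y + d) - diff4 h y) - (diff4 h (y' + d) - diff4 h y') = w i' - w i}"
      have "card ?F \<le> card ?T"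
      proof (rule card_inj_on_le[where f = "\<lambda>(h,d,y,y',i,i'). (h,d,y,y')"])
        show "inj_on (\<lambda>(h,d,y,y',i,i'). (h,d,y,y')) ?F"
          by (rule inj_onI) (use t(1) in auto)
        show "(\<lambda>(h,d,y,y',i,i'). (h,d,y,y')) ` ?F \<subseteq> ?T"
          by (rule image_subsetI) (clarsimp simp: U_def t(1))
      qed (rule card_diff4_diff_diff_le(1)[OF n0])
      also have "\<dots> \<le> int_divisor_count (w i' - w i) ^ 4" by (rule card_diff4_diff_diff_le(2)[OF n0])
      finally have c: "card ?F \<le> int_divisor_count (w i' - w i) ^ 4" .
      have "real (card ?F) \<le> real (int_divisor_count (w i' - w i)) ^ 4"
        using of_nat_mono[OF c, where 'a = real] by (simp only: of_nat_power)
      also have "\<dots> \<le> L ^ 4"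
        using L[OF n0] abs_w_diff_le[of w _ "int P ^ 4", OF assms(2)[OF t(2)] assms(2)[OF t(3)]]
        by (intro power_mono) auto
      finally show ?thesis .
    qed
  qed (rule fU)
  define V where "V = {(s, s') \<in> ?C \<times> ?C. f s = f s'}"
  define ix where "ix = (\<lambda>(h::int,x::int,y::int,i::'a,k::'a). i)"
  have fV: "finite V" unfolding V_def using fC by (auto intro: finite_subset[of _ "?C \<times> ?C"])
  have V: "\<exists>h x y i k x' y' i'. p = ((h,x,y,i,k),(h,x',y',i',k)) \<and> (h,x,y,i,k) \<in> ?C \<and> (h,x',y',i',k) \<in> ?C \<and> x - y = x' - y'"
    if "p \<in> V" for p
    using that by (auto simp: V_def f_def)
  \<comment> \<open>Pairs with equal \<open>i\<close> coincide by \<open>diff4_diff_inj\<close>,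
    which returns \<open>card ?C\<close> itself on the right. For pairs with distinct
    \<open>i\<close> the common \<open>k\<close> cancels on subtraction, and a second difference
    equals \<open>w i' - w i\<close>, which is nonzero because \<open>w\<close> is
    injective.\<close>
  have "card V = card ({p\<in>V. ix (fst p) = ix (snd p)} \<union> {p\<in>V. ix (fst p) \<noteq> ix (snd p)})"
    by (rule arg_cong[where f = card]) auto
  also have "\<dots> \<le> card {p\<in>V. ix (fst p) = ix (snd p)} + card {p\<in>V. ix (fst p) \<noteq> ix (snd p)}"
    by (rule card_Un_le)
  also have "\<dots> \<le> card ?C + card U"
  proof (rule add_mono)
    show "card {p\<in>V. ix (fst p) = ix (snd p)} \<le> card ?C"
    proof (rule card_inj_on_le[where f = fst])
      show "fst ` {p\<in>V. ix (fst p) = ix (snd p)} \<subseteq> ?C" by (auto simp: V_def)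
      show "inj_on fst {p\<in>V. ix (fst p) = ix (snd p)}"
      proof (rule inj_onI)
        have *: "snd p = fst p" if pV: "p \<in> {p\<in>V. ix (fst p) = ix (snd p)}" for p
        proof -
          obtain h x y i k x' y' i' where p: "p = ((h,x,y,i,k),(h,x',y',i',k))"
            "(h,x,y,i,k) \<in> ?C" "(h,x',y',i',k) \<in> ?C" "x - y = x' - y'" using V[of p] pV by blast
          have i: "i = i'" using pV p(1) by (simp add: ix_def)
          have "y = y'"
            by (rule diff4_diff_inj[of h x y P x' y']) (use p(2-4) i in \<open>auto simp: coll4_def\<close>)
          then show ?thesis using p i by simp
        qed
        fix p q assume pq: "p \<in> {p\<in>V. ix (fst p) = ix (snd p)}" "q \<in> {p\<in>V. ix (fst p) = ix (snd p)}" "fst p = fst q"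
        have "snd p = snd q" unfolding *[OF pq(1)] *[OF pq(2)] by (rule pq(3))
        show "p = q" by (rule prod_eqI[OF pq(3) \<open>snd p = snd q\<close>])
      qed
    qed (rule fC)
    \<comment> \<open>The map \<open>g\<close> forgets \<open>k\<close> and \<open>x'\<close>. The
      equation and the injectivity of \<open>w\<close> restore \<open>k\<close>, and
      \<open>x - y = x' - y'\<close> restores \<open>x'\<close>.\<close>
    define g where "g = (\<lambda>((h::int,x::int,y::int,i::'a,k::'a),(h'::int,x'::int,y'::int,i'::'a,k'::'a)). (h, x - y, y, y', i, i'))"
    show "card {p\<in>V. ix (fst p) \<noteq> ix (snd p)} \<le> card U"
    proof (rule card_inj_on_le[where f = g])
      show "g ` {p\<in>V. ix (fst p) \<noteq> ix (snd p)} \<subseteq> U"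
      proof (rule image_subsetI)
        fix p assume pV: "p \<in> {p\<in>V. ix (fst p) \<noteq> ix (snd p)}"
        then obtain h x y i k x' y' i' where p: "p = ((h,x,y,i,k),(h,x',y',i',k))"
            "(h,x,y,i,k) \<in> ?C" "(h,x',y',i',k) \<in> ?C" "x - y = x' - y'" using V[of p] by blast
        have "i \<noteq> i'" using pV p(1) by (simp add: ix_def)
        moreover have "y' + (x - y) = x'" using p(4) by simp
        ultimately show "g p \<in> U"
          using p(2,3) unfolding p(1) by (simp add: U_def coll4_def g_def)
      qed
      show "inj_on g {p\<in>V. ix (fst p) \<noteq> ix (snd p)}"
      proof (rule inj_onI)
        fix p q
        assume pV: "p \<in> {p\<in>V. ix (fst p) \<noteq> ix (snd p)}" and qV: "q \<in> {p\<in>V. ix (fst p) \<noteq> ix (snd p)}"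
          and eq: "g p = g q"
        obtain h x y i k x' y' i' where p: "p = ((h,x,y,i,k),(h,x',y',i',k))"
            "(h,x,y,i,k) \<in> ?C" "(h,x',y',i',k) \<in> ?C" "x - y = x' - y'" using V[of p] pV by blast
        obtain h2 x2 y2 i2 k2 x2' y2' i2' where q: "q = ((h2,x2,y2,i2,k2),(h2,x2',y2',i2',k2))"
            "(h2,x2,y2,i2,k2) \<in> ?C" "(h2,x2',y2',i2',k2) \<in> ?C" "x2 - y2 = x2' - y2'" using V[of q] qV by blast
        have e1: "h2 = h" "y2 = y" "x2 - y2 = x - y" "y2' = y'" "i2 = i" "i2' = i'"
          using eq unfolding p(1) q(1) g_def by simp_all
        then have e2: "x2 = x" "x2' = x'" using p(4) q(4) by simp_all
        have "w k = w k2" "k \<in> I" "k2 \<in> I" using p(2) q(2) e1 e2 by (auto simp: coll4_def)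
        then have "k2 = k" using assms(3) by (auto dest: inj_onD)
        then show "p = q" using p(1) q(1) e1 e2 by simp
      qed
    qed (rule fU)
  qed
  finally have "real (card {(s, s') \<in> ?C \<times> ?C. f s = f s'}) \<le> real (card ?C) + real (card U)"
    unfolding V_def by linarith
  also have "\<dots> \<le> real (card ?C) + real (card I) ^ 2 * L ^ 4"
    using cU by (simp add: card_cartesian_product power2_eq_square)
  finally have "real (card T) * real (card {(s, s') \<in> ?C \<times> ?C. f s = f s'})
      \<le> real (card T) * (real (card ?C) + real (card I) ^ 2 * L ^ 4)"
    by (rule mult_left_mono) simp
  from order.trans[OF 1 this] show ?thesis unfolding cT .
qed

text \<open>Moving one fourth power across turns the equation into an equality of differences of
  fourth powers. With the right-hand pair fixed, a zero difference allows at most \<open>P\<close>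
  solutions and occurs for \<open>P\<close> pairs; a nonzero one is controlled by divisors.\<close>

lemma card_pow4_sums_le:
  assumes L: "\<And>n. n \<noteq> 0 \<Longrightarrow> \<bar>n\<bar> \<le> 8 * int P ^ 4 \<Longrightarrow> real (int_divisor_count n) \<le> L"
  shows "real (card {(s, t) \<in> ({1..int P} \<times> {1..int P}) \<times> ({1..int P} \<times> {1..int P}).
           fst s ^ 4 + snd s ^ 4 = fst t ^ 4 + snd t ^ 4}) \<le> real P ^ 2 * (1 + L ^ 2)"
proof -
  define S where "S = {(s, t) \<in> ({1..int P} \<times> {1..int P}) \<times> ({1..int P} \<times> {1..int P}).
           fst s ^ 4 + snd s ^ 4 = fst t ^ 4 + snd t ^ 4}"
  define f where "f = (\<lambda>p::(int \<times> int) \<times> (int \<times> int). (snd (snd p), snd (fst p)))"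
  define g where "g = (\<lambda>p::(int \<times> int) \<times> (int \<times> int). (fst (fst p), fst (snd p)))"
  let ?T = "{1..int P} \<times> {1..int P}"
  have fS: "finite S" unfolding S_def by (rule finite_subset[of _ "?T \<times> ?T"]) auto
  have memS: "fst (fst p) \<in> {1..int P} \<and> snd (fst p) \<in> {1..int P} \<and> fst (snd p) \<in> {1..int P} \<and> snd (snd p) \<in> {1..int P}
      \<and> fst (fst p) ^ 4 - fst (snd p) ^ 4 = snd (snd p) ^ 4 - snd (fst p) ^ 4" if "p \<in> S" for p
    using that by (auto simp: S_def)
  have fib: "real (card {p\<in>S. f p = t}) \<le> (if fst t = snd t then real P else L ^ 2)" if t: "t \<in> ?T" for t
  proof -
    define T where "T = {(x, y) \<in> {1..int P} \<times> {1..int P}. x ^ 4 - y ^ 4 = fst t ^ 4 - snd t ^ 4}"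
    have fT: "finite T" unfolding T_def by (rule finite_subset[of _ ?T]) auto
    have c1: "card {p\<in>S. f p = t} \<le> card T"
    proof (rule card_inj_on_le[where f = g])
      show "g ` {p\<in>S. f p = t} \<subseteq> T"
      proof (rule image_subsetI)
        fix p assume p: "p \<in> {p\<in>S. f p = t}"
        then show "g p \<in> T" using memS[of p] by (auto simp: T_def g_def f_def)
      qed
      show "inj_on g {p\<in>S. f p = t}"
        by (rule inj_onI) (auto simp: g_def f_def prod_eq_iff)
    qed (rule fT)
    show ?thesis
    proof (cases "fst t = snd t")
      case True
      have "T \<subseteq> (\<lambda>x. (x, x)) ` {1..int P}"
      proof
        fix z assume z: "z \<in> T"
        then have "fst z ^ 4 = snd z ^ 4" "fst z > 0" "snd z > 0" using True by (auto simp: T_def)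
        then have "fst z = snd z" by (meson order.order_iff_strict power_eq_imp_eq_base zero_less_numeral)
        then show "z \<in> (\<lambda>x. (x, x)) ` {1..int P}" using z by (auto simp: T_def image_iff prod_eq_iff)
      qed
      then have "card T \<le> card ((\<lambda>x. (x, x)) ` {1..int P})" by (intro card_mono) auto
      also have "\<dots> \<le> P" using card_image_le[of "{1..int P}"] by fastforce
      finally show ?thesis using c1 True by simp
    next
      case False
      have pos: "fst t \<in> {1..int P}" "snd t \<in> {1..int P}" using t by auto
      have n0: "fst t ^ 4 - snd t ^ 4 \<noteq> 0"
      proof
        assume "fst t ^ 4 - snd t ^ 4 = 0"
        then have "fst t ^ 4 = snd t ^ 4" "fst t \<ge> 0" "snd t \<ge> 0" using pos by auto
        then have "fst t = snd t" using power_eq_imp_eq_base[of "fst t" 4 "snd t"] by simp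
        with False show False ..
      qed
      have c: "card T \<le> int_divisor_count (fst t ^ 4 - snd t ^ 4) ^ 2"
        unfolding T_def by (rule card_pow4_diff_le[OF n0])
      have "\<bar>fst t ^ 4 - snd t ^ 4\<bar> \<le> 8 * int P ^ 4" using pow4_le[OF pos(1)] pow4_le[OF pos(2)] by linarith
      then have "real (int_divisor_count (fst t ^ 4 - snd t ^ 4)) ^ 2 \<le> L ^ 2" by (intro power_mono L n0) auto
      moreover have "real (card T) \<le> real (int_divisor_count (fst t ^ 4 - snd t ^ 4)) ^ 2"
        using of_nat_mono[OF c, where 'a = real] by (simp only: of_nat_power)
      ultimately have "real (card {p\<in>S. f p = t}) \<le> L ^ 2" using of_nat_mono[OF c1, where 'a = real] by linarith
      then show ?thesis using False by simp
    qed
  qed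
  have "f ` S \<subseteq> ?T" using memS by (auto simp: f_def)
  then have "real (card S) = (\<Sum>t\<in>?T. real (card {p\<in>S. f p = t}))"
    using card_fibres[OF fS, of ?T f] by simp
  also have "\<dots> \<le> (\<Sum>t\<in>?T. if fst t = snd t then real P else L ^ 2)"
    by (rule sum_mono) (rule fib)
  also have "\<dots> = (\<Sum>x\<in>{1..int P}. \<Sum>y\<in>{1..int P}. if x = y then real P else L ^ 2)"
    by (simp add: sum.cartesian_product case_prod_unfold)
  also have "\<dots> \<le> (\<Sum>x\<in>{1..int P}. \<Sum>y\<in>{1..int P}. (if x = y then real P else 0) + L ^ 2)"
    by (intro sum_mono) auto
  also have "\<dots> = real P ^ 2 * (1 + L ^ 2)"
    by (simp add: sum.distrib algebra_simps power2_eq_square)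
  finally show ?thesis unfolding S_def .
qed

text \<open>Hua's eighth moment: in \<open>mean_weyl4_pow4\<close> the square of the Weyl sum itself
  plays the role of the second sum, with pairs \<open>(x, y)\<close> as indices and frequencies
  \<open>x ^ 4 + y ^ 4\<close>.\<close>

lemma mean_weyl4_pow8:
  fixes M :: int
  assumes L: "\<And>n. n \<noteq> 0 \<Longrightarrow> \<bar>n\<bar> \<le> 8 * int P ^ 4 \<Longrightarrow> real (int_divisor_count n) \<le> L" and "L \<ge> 1"
    and "P > 0" and M: "8 * int P ^ 4 < M"
  shows "(\<Sum>j\<in>{0..<M}. (cmod (weyl4 P (of_int j / of_int M))) ^ 8) \<le> of_int M * (27 * real P ^ 5 * L ^ 2)"
proof -
  let ?I = "{1..int P} \<times> {1..int P}"
  define w where "w = (\<lambda>s::int \<times> int. fst s ^ 4 + snd s ^ 4)"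
  have M0: "M \<ge> 0" using M by (smt (verit) zero_le_power of_nat_0_le_iff)
  have w: "\<bar>w i\<bar> \<le> 3 * int P ^ 4" if "i \<in> ?I" for i
  proof -
    have "fst i \<in> {1..int P}" "snd i \<in> {1..int P}" using that by auto
    from this[THEN pow4_le] show ?thesis unfolding w_def by linarith
  qed
  have K: "(weyl4 P (of_int j / of_int M))\<^sup>2 = (\<Sum>i\<in>?I. 1 * E (of_int (j * w i) / of_int M))" for j
    unfolding weyl4_def power2_eq_square sum_product sum.cartesian_product
    by (rule sum.cong) (auto simp: w_def E_add distrib_left add_divide_distrib mult_ac)
  have G: "real (card {(i, k) \<in> ?I \<times> ?I. w i = w k}) \<le> real P ^ 2 * (1 + L ^ 2)"
    unfolding w_def by (rule card_pow4_sums_le[OF L])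
  have R: "real (card (coll4 P ?I w)) \<le> real (card ?I) ^ 2 * L ^ 2"
    by (rule card_coll4_le[OF _ w L]) auto
  have "(\<Sum>j\<in>{0..<M}. (cmod (weyl4 P (of_int j / of_int M))) ^ 8)
     = (\<Sum>j\<in>{0..<M}. (cmod (weyl4 P (of_int j / of_int M))) ^ 4 *
            (cmod (\<Sum>i\<in>?I. 1 * E (of_int (j * w i) / of_int M)))\<^sup>2)"
    unfolding K[symmetric] norm_power power_mult[symmetric] power_add[symmetric] by simp
  also have "\<dots> \<le> of_int M * ((2 * real P + 1) * (4 * real P ^ 2 * real (card {(i, k) \<in> ?I \<times> ?I. w i = w k}) + real (card (coll4 P ?I w))))"
    by (rule mean_weyl4_pow4[OF _ _ w M]) auto
  also have "\<dots> \<le> of_int M * ((3 * real P) * (4 * real P ^ 2 * (real P ^ 2 * (2 * L ^ 2)) + real P ^ 4 * L ^ 2))"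
  proof -
    have L2: "1 + L ^ 2 \<le> 2 * L ^ 2" using \<open>L \<ge> 1\<close> by (simp add: one_le_power)
    have "real P ^ 2 * (1 + L ^ 2) \<le> real P ^ 2 * (2 * L ^ 2)" by (rule mult_left_mono[OF L2]) simp
    then have 1: "4 * real P ^ 2 * real (card {(i, k) \<in> ?I \<times> ?I. w i = w k}) \<le> 4 * real P ^ 2 * (real P ^ 2 * (2 * L ^ 2))"
      using G by (intro mult_left_mono) auto
    have 2: "real (card (coll4 P ?I w)) \<le> real P ^ 4 * L ^ 2"
      using R by (simp add: card_cartesian_product power2_eq_square power4_eq_xxxx)
    show ?thesis
      using \<open>P > 0\<close> M0 by (intro mult_left_mono[OF mult_mono[OF _ add_mono[OF 1 2]]]) auto
  qed
  also have "\<dots> = of_int M * (27 * real P ^ 5 * L ^ 2)"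
    by (simp add: algebra_simps power_numeral_reduce)
  finally show ?thesis .
qed

lemma mean_weyl4_pow4_set:
  fixes M :: int and Z :: "nat set" and \<eta> :: "nat \<Rightarrow> complex"
  assumes L: "\<And>n. n \<noteq> 0 \<Longrightarrow> \<bar>n\<bar> \<le> 8 * int P ^ 4 \<Longrightarrow> real (int_divisor_count n) \<le> L"
    and "P > 0" and M: "8 * int P ^ 4 < M" and Z: "Z \<subseteq> {1..P ^ 4}" and \<eta>: "\<And>n. n \<in> Z \<Longrightarrow> cmod (\<eta> n) \<le> 1"
  shows "(\<Sum>j\<in>{0..<M}. (cmod (weyl4 P (of_int j / of_int M))) ^ 4 *
            (cmod (\<Sum>n\<in>Z. \<eta> n * E (- (of_int j * real n / of_int M))))\<^sup>2)
     \<le> of_int M * (66 * real P ^ 3 * real (card Z) + 15 * real P ^ 2 * L ^ 2 * (real (card Z) * sqrt (real (card Z))))"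
proof -
  define w where "w = (\<lambda>n::nat. - int n)"
  define z where "z = real (card Z)"
  define R where "R = real (card (coll4 P Z w))"
  have M0: "M \<ge> 0" using M by (smt (verit) zero_le_power of_nat_0_le_iff)
  have fin: "finite Z" using Z finite_subset by blast
  have w: "\<bar>w n\<bar> \<le> 3 * int P ^ 4" if "n \<in> Z" for n
  proof -
    have "n \<le> P ^ 4" using Z that by auto
    then have "int n \<le> int P ^ 4" by (metis of_nat_le_iff of_nat_power)
    then show ?thesis using of_nat_0_le_iff[of n] unfolding w_def abs_minus_cancel abs_of_nat by linarith
  qed
  have inj: "inj_on w Z" by (simp add: inj_on_def w_def)
  have z0: "z \<ge> 0" by (simp add: z_def)
  have "{(i, k) \<in> Z \<times> Z. w i = w k} = (\<lambda>i. (i, i)) ` Z" by (auto simp: w_def)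
  then have G: "real (card {(i, k) \<in> Z \<times> Z. w i = w k}) = z"
    by (simp add: card_image inj_on_def z_def)
  have "R\<^sup>2 \<le> (2 * real P + 1)\<^sup>2 * z * (R + z ^ 2 * L ^ 4)"
    unfolding R_def z_def by (rule card_coll4_square_le[OF fin w inj L])
  also have "\<dots> \<le> (3 * real P)\<^sup>2 * z * (R + z ^ 2 * L ^ 4)"
    using \<open>P > 0\<close> z0 by (intro mult_right_mono power_mono) (auto simp: R_def)
  finally have R2: "R\<^sup>2 \<le> (9 * real P ^ 2 * z) * R + (9 * real P ^ 2 * z) * (z ^ 2 * L ^ 4)"
    by (simp add: power_mult_distrib distrib_left)
  have R0: "R \<ge> 0" by (simp add: R_def)
  \<comment> \<open>With a = 9 P^2 z and b = z^2 L^4 the fact \<open>R2\<close> is R^2 <= a R + a b,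
    so R <= 2 a or R^2 <= 2 a b. The second case gives the other term, as 5 exceeds the square root
    of 18.\<close>
  have "R \<le> 18 * real P ^ 2 * z + 5 * real P * L ^ 2 * (z * sqrt z)"
  proof (rule ccontr)
    assume "\<not> ?thesis"
    then have n: "R > 18 * real P ^ 2 * z + 5 * real P * L ^ 2 * (z * sqrt z)" by simp
    have nn: "0 \<le> 18 * real P ^ 2 * z" "0 \<le> 5 * real P * L ^ 2 * (z * sqrt z)" using z0 by auto
    have "18 * real P ^ 2 * z \<le> R" using n nn by linarith
    then have "18 * real P ^ 2 * z * R \<le> R * R" using R0 by (rule mult_right_mono)
    moreover have "(5 * real P * L ^ 2 * (z * sqrt z)) ^ 2 < R ^ 2"
    proof (rule power_strict_mono)
      show "5 * real P * L ^ 2 * (z * sqrt z) < R" using n nn by linarith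
    qed (use nn in auto)
    moreover have "(5 * real P * L ^ 2 * (z * sqrt z)) ^ 2 = 25 * real P ^ 2 * z * (z ^ 2 * L ^ 4)"
    proof -
      have "(5 * real P * L ^ 2 * (z * sqrt z)) ^ 2 = 25 * real P ^ 2 * L ^ 4 * (z ^ 2 * (sqrt z) ^ 2)"
        by (simp add: power_mult_distrib flip: power_mult)
      then show ?thesis using z0 by simp
    qed
    moreover have "0 \<le> real P ^ 2 * z * (z ^ 2 * L ^ 4)" using z0 by simp
    ultimately show False using R2 unfolding power2_eq_square by linarith
  qed
  then have RR: "4 * real P ^ 2 * z + R \<le> 22 * real P ^ 2 * z + 5 * real P * L ^ 2 * (z * sqrt z)" by linarith
  have "(\<Sum>j\<in>{0..<M}. (cmod (weyl4 P (of_int j / of_int M))) ^ 4 *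
            (cmod (\<Sum>n\<in>Z. \<eta> n * E (- (of_int j * real n / of_int M))))\<^sup>2)
     = (\<Sum>j\<in>{0..<M}. (cmod (weyl4 P (of_int j / of_int M))) ^ 4 *
            (cmod (\<Sum>n\<in>Z. \<eta> n * E (of_int (j * w n) / of_int M)))\<^sup>2)"
    by (simp add: w_def)
  also have "\<dots> \<le> of_int M * ((2 * real P + 1) * (4 * real P ^ 2 * real (card {(i, k) \<in> Z \<times> Z. w i = w k}) + real (card (coll4 P Z w))))"
    by (rule mean_weyl4_pow4[OF fin \<eta> w M])
  also have "\<dots> \<le> of_int M * ((3 * real P) * (22 * real P ^ 2 * z + 5 * real P * L ^ 2 * (z * sqrt z)))"
    unfolding G R_def[symmetric]
    using \<open>P > 0\<close> M0 R0 z0 by (intro mult_left_mono[OF mult_mono[OF _ RR]]) auto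
  also have "\<dots> = of_int M * (66 * real P ^ 3 * z + 15 * real P ^ 2 * L ^ 2 * (z * sqrt z))"
    by (simp add: algebra_simps power_numeral_reduce)
  finally show ?thesis unfolding z_def .
qed

section \<open>Weyl's inequality\<close>

definition int_dist :: "real \<Rightarrow> real" where
  "int_dist \<theta> = \<bar>\<theta> - of_int (round \<theta>)\<bar>"

lemma int_dist_nonneg: "int_dist \<theta> \<ge> 0"
  by (simp add: int_dist_def)

lemma int_dist_le: "int_dist \<theta> \<le> \<bar>\<theta> - of_int m\<bar>"
  unfolding int_dist_def by (rule round_diff_minimal)

lemma int_dist_minus: "int_dist (- \<theta>) = int_dist \<theta>"
proof -
  have "int_dist (- \<theta>) \<le> int_dist \<theta>" for \<theta>
    using int_dist_le[of "- \<theta>" "- round \<theta>"] by (simp add: int_dist_def)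
  from this[of \<theta>] this[of "- \<theta>"] show ?thesis by simp
qed

lemma norm_one_minus_E: "cmod (1 - E t) = 2 * \<bar>sin (pi * t)\<bar>"
proof -
  define s where "s = pi * t"
  have "(cmod (1 - E t))\<^sup>2 = (1 - cos (2 * s))\<^sup>2 + (sin (2 * s))\<^sup>2"
    by (simp add: E_def s_def cmod_power2 mult_ac)
  also have "\<dots> = (2 * \<bar>sin s\<bar>)\<^sup>2"
  proof -
    have "(1 - (1 - 2 * (sin s)\<^sup>2))\<^sup>2 + (2 * sin s * cos s)\<^sup>2 = 4 * (sin s)\<^sup>2 * ((sin s)\<^sup>2 + (cos s)\<^sup>2)"
      by algebra
    then show ?thesis unfolding cos_double_sin sin_double by (simp add: power_mult_distrib)
  qed
  finally have sq: "(cmod (1 - E t))\<^sup>2 = (2 * \<bar>sin s\<bar>)\<^sup>2" .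
  have "cmod (1 - E t) = 2 * \<bar>sin s\<bar>"
    by (rule power2_eq_imp_eq[OF sq norm_ge_zero]) simp
  then show ?thesis by (simp add: s_def)
qed

lemma int_dist_le_norm: "2 * int_dist \<theta> \<le> cmod (1 - E \<theta>)"
proof -
  define t where "t = \<theta> - of_int (round \<theta>)"
  have t: "\<bar>t\<bar> \<le> 1/2" using of_int_round_abs_le[of \<theta>] by (simp add: t_def abs_minus_commute)
  have "E \<theta> = E (t + of_int (round \<theta>))" by (simp add: t_def)
  then have E: "E \<theta> = E t" by simp
  define s where "s = pi * t"
  \<comment> \<open>Here 1.6 exceeds pi / 2, and 1.6^2 / 6 < 1/2, so the cubic remainder of the sine
    takes away less than half of \<open>\<bar>s\<bar>\<close>.\<close>
  have s: "\<bar>s\<bar> \<le> 1.6"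
  proof -
    have "pi \<le> 3.2" using pi_approx(2) by simp
    then have "pi * \<bar>t\<bar> \<le> 3.2 * (1/2)" using t by (intro mult_mono) auto
    then show ?thesis by (simp add: s_def abs_mult)
  qed
  have n: "cmod (1 - E t) = 2 * \<bar>sin s\<bar>"
    by (simp add: norm_one_minus_E s_def)
  have "\<bar>sin s - (\<Sum>m<3. sin_coeff m * s ^ m)\<bar> \<le> inverse (fact 3) * \<bar>s\<bar> ^ 3"
    by (rule Maclaurin_sin_bound)
  moreover have "(\<Sum>m<3. sin_coeff m * s ^ m) = s"
    by (simp add: lessThan_nat_numeral sin_coeff_def)
  moreover have "inverse (fact 3) = (1 / 6 :: real)"
    by (simp add: fact_numeral)
  ultimately have "\<bar>sin s - s\<bar> \<le> \<bar>s\<bar> ^ 3 / 6" by simp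
  also have "\<dots> = \<bar>s\<bar> * (\<bar>s\<bar>\<^sup>2 / 6)" by (simp add: power3_eq_cube power2_eq_square)
  also have "\<dots> \<le> \<bar>s\<bar> * (1.6\<^sup>2 / 6)"
    using s by (intro mult_left_mono divide_right_mono power_mono) auto
  also have "\<dots> \<le> \<bar>s\<bar> / 2" by (simp add: power2_eq_square)
  finally have "\<bar>sin s\<bar> \<ge> \<bar>s\<bar> / 2" by linarith
  moreover have "\<bar>s\<bar> \<ge> 2 * \<bar>t\<bar>" using pi_ge_two by (simp add: s_def abs_mult mult_right_mono)
  ultimately have "2 * \<bar>t\<bar> \<le> cmod (1 - E t)" using n by linarith
  then show ?thesis unfolding E by (simp add: int_dist_def t_def)
qed

text \<open>The usual minimum of \<open>P\<close> and \<open>1 / int_dist \<theta>\<close>. The case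
  distinction gives \<open>P\<close> at integers, where \<open>1 / 0 = 0\<close> would turn a
  literal minimum into 0.\<close>

definition geom_bound :: "nat \<Rightarrow> real \<Rightarrow> real" where
  "geom_bound P \<theta> = (if real P * int_dist \<theta> \<le> 1 then real P else 1 / int_dist \<theta>)"

lemma geom_bound_le: "geom_bound P \<theta> \<le> real P"
  using int_dist_nonneg[of \<theta>]
  by (cases "int_dist \<theta> = 0") (auto simp: geom_bound_def field_simps)

lemma geom_bound_nonneg: "geom_bound P \<theta> \<ge> 0"
  using int_dist_nonneg[of \<theta>] by (simp add: geom_bound_def)

lemma geom_bound_minus: "geom_bound P (- \<theta>) = geom_bound P \<theta>"
  by (simp add: geom_bound_def int_dist_minus)

lemma geom_bound_le_inverse:
  assumes "0 < u" "u \<le> int_dist \<theta>"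
  shows "geom_bound P \<theta> \<le> 1 / u"
proof -
  have "1 / int_dist \<theta> \<le> 1 / u" using assms by (intro divide_left_mono) auto
  moreover have "real P \<le> 1 / int_dist \<theta>" if "real P * int_dist \<theta> \<le> 1"
    using that assms by (simp add: pos_le_divide_eq)
  ultimately show ?thesis by (auto simp: geom_bound_def)
qed

lemma norm_sum_E_interval_le:
  assumes "{l..u} \<subseteq> {1..int P}"
  shows "cmod (\<Sum>x\<in>{l..u}. E (\<theta> * of_int x + d)) \<le> geom_bound P \<theta>"
proof -
  have "cmod (\<Sum>x\<in>{l..u}. E (\<theta> * of_int x + d)) \<le> real (card {l..u})"
    by (rule order.trans[OF norm_sum]) simp
  also have "\<dots> \<le> real P" using card_mono[OF _ assms] by simp
  finally have 1: "cmod (\<Sum>x\<in>{l..u}. E (\<theta> * of_int x + d)) \<le> real P" .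
  define n where "n = nat (u - l + 1)"
  have "(\<Sum>x\<in>{l..u}. E (\<theta> * of_int x + d)) = (\<Sum>i<n. E (\<theta> * of_int l + d) * E \<theta> ^ i)"
    by (rule sum.reindex_bij_witness[where i = "\<lambda>i. l + int i" and j = "\<lambda>x. nat (x - l)"])
       (auto simp: n_def E_power algebra_simps simp flip: E_add)
  then have "(1 - E \<theta>) * (\<Sum>x\<in>{l..u}. E (\<theta> * of_int x + d)) = E (\<theta> * of_int l + d) * (1 - E \<theta> ^ n)"
    by (simp add: one_diff_power_eq sum_distrib_left mult_ac)
  then have "cmod (1 - E \<theta>) * cmod (\<Sum>x\<in>{l..u}. E (\<theta> * of_int x + d)) = cmod (1 - E \<theta> ^ n)"
    by (metis norm_E norm_mult mult_1)
  also have "\<dots> \<le> 2" by (rule order.trans[OF norm_triangle_ineq4]) (simp add: norm_power)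
  finally have "cmod (1 - E \<theta>) * cmod (\<Sum>x\<in>{l..u}. E (\<theta> * of_int x + d)) \<le> 2" .
  then have "(2 * int_dist \<theta>) * cmod (\<Sum>x\<in>{l..u}. E (\<theta> * of_int x + d)) \<le> 2"
    using mult_right_mono[OF int_dist_le_norm[of \<theta>], of "cmod (\<Sum>x\<in>{l..u}. E (\<theta> * of_int x + d))"] by simp
  then have 2: "int_dist \<theta> * cmod (\<Sum>x\<in>{l..u}. E (\<theta> * of_int x + d)) \<le> 1" by simp
  show ?thesis
  proof (cases "real P * int_dist \<theta> \<le> 1")
    case True
    then show ?thesis using 1 by (simp add: geom_bound_def)
  next
    case False
    then have "int_dist \<theta> > 0" using int_dist_nonneg[of \<theta>] by (cases "int_dist \<theta> = 0") auto
    then show ?thesis using 2 False by (simp add: geom_bound_def field_simps)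
  qed
qed

text \<open>The unit interval is cut into \<open>q\<close> cells of length \<open>1 / q\<close>. A
  point of cell \<open>t\<close> has distance at least \<open>t / q\<close> from the integer on its
  left and at least \<open>(q - 1 - t) / q\<close> from the one on its right; the nearest integer is
  one of the two.\<close>

lemma int_dist_cell:
  assumes "q > 0" "t = \<lfloor>real q * frac \<theta>\<rfloor>"
  shows "0 \<le> t" "t < int q"
    and "real_of_int t / real q \<le> int_dist \<theta> \<or> real_of_int (int q - 1 - t) / real q \<le> int_dist \<theta>"
proof -
  have q: "real q > 0" using assms by simp
  have t: "real_of_int t \<le> real q * frac \<theta>" "real q * frac \<theta> < real_of_int t + 1"
    unfolding assms(2) by linarith+
  have "0 \<le> real q * frac \<theta>" by simp
  then show "0 \<le> t" unfolding assms(2) by simp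
  have "real q * frac \<theta> < real q * 1" using q frac_lt_1 by (intro mult_strict_left_mono) auto
  then show "t < int q" using t(1) by linarith
  show "real_of_int t / real q \<le> int_dist \<theta> \<or> real_of_int (int q - 1 - t) / real q \<le> int_dist \<theta>"
  proof (cases "round \<theta> \<le> \<lfloor>\<theta>\<rfloor>")
    case True
    then have "of_int (round \<theta>) \<le> (of_int \<lfloor>\<theta>\<rfloor> :: real)" by simp
    then have "frac \<theta> \<le> int_dist \<theta>" unfolding int_dist_def frac_def by linarith
    then have "real q * frac \<theta> \<le> real q * int_dist \<theta>" using q by simp
    then have "real_of_int t \<le> real q * int_dist \<theta>" using t(1) by linarith
    then show ?thesis using q by (simp add: pos_divide_le_eq mult.commute)
  next
    case False
    then have "round \<theta> \<ge> \<lfloor>\<theta>\<rfloor> + 1" by simp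
    then have "of_int (round \<theta>) \<ge> (of_int (\<lfloor>\<theta>\<rfloor> + 1) :: real)" by (simp only: of_int_le_iff)
    then have "1 - frac \<theta> \<le> int_dist \<theta>" unfolding int_dist_def frac_def by simp
    then have "real q * (1 - frac \<theta>) \<le> real q * int_dist \<theta>" using q by simp
    then have "real_of_int (int q - 1 - t) \<le> real q * int_dist \<theta>" using t by (simp add: right_diff_distrib)
    then show ?thesis using q by (simp add: pos_divide_le_eq mult.commute)
  qed
qed

text \<open>Two multiples of \<open>\<alpha>\<close> in the same cell differ, as multiples of \<open>a / q\<close>, by less than \<open>2 / q\<close>.\<close>

lemma card_cell_le:
  fixes a m0 :: int
  assumes "q > 0" "coprime a (int q)" "\<bar>\<alpha> - of_int a / real q\<bar> \<le> 1 / (real q)\<^sup>2"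
  shows "card {m \<in> {m0..<m0 + int q}. \<lfloor>real q * frac (of_int m * \<alpha>)\<rfloor> = t} \<le> 3"
proof (cases "{m \<in> {m0..<m0 + int q}. \<lfloor>real q * frac (of_int m * \<alpha>)\<rfloor> = t} = {}")
  case True
  then have "card {m \<in> {m0..<m0 + int q}. \<lfloor>real q * frac (of_int m * \<alpha>)\<rfloor> = t} = 0" by (simp only: card.empty)
  then show ?thesis by linarith
next
  case False
  define C where "C = {m \<in> {m0..<m0 + int q}. \<lfloor>real q * frac (of_int m * \<alpha>)\<rfloor> = t}"
  obtain m1 where m1: "m1 \<in> C" using False by (auto simp: C_def)
  have q: "real q > 0" using assms by simp
  define K where "K = (\<lambda>m. \<lfloor>of_int m * \<alpha>\<rfloor> - \<lfloor>of_int m1 * \<alpha>\<rfloor>)"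
  have *: "a * (m - m1) - int q * K m \<in> {-1, 0, 1}" if m: "m \<in> C" for m
  proof -
    have f: "\<bar>real q * frac (of_int m * \<alpha>) - real q * frac (of_int m1 * \<alpha>)\<bar> < 1"
      using m m1 unfolding C_def mem_Collect_eq by linarith
    have "\<bar>m - m1\<bar> \<le> int q" using m m1 by (auto simp: C_def)
    then have "\<bar>of_int (m - m1)\<bar> \<le> real q" by linarith
    moreover have "\<bar>real q * (\<alpha> - of_int a / real q)\<bar> \<le> 1 / real q"
      using mult_left_mono[OF assms(3), of "real q"] q by (simp add: abs_mult power2_eq_square)
    ultimately have f1: "\<bar>of_int (m - m1)\<bar> * \<bar>real q * (\<alpha> - of_int a / real q)\<bar> \<le> real q * (1 / real q)"
      by (intro mult_mono) auto
    have f2: "real q * (\<alpha> - of_int a / real q) = real q * \<alpha> - of_int a" and f3: "real q * (1 / real q) = 1"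
      using q by (simp_all add: right_diff_distrib)
    have g: "\<bar>of_int (m - m1) * (real q * \<alpha> - of_int a)\<bar> \<le> 1"
      using f1[unfolded f2 f3] by (simp only: abs_mult)
    have "real_of_int (a * (m - m1) - int q * K m) =
       (real q * frac (of_int m * \<alpha>) - real q * frac (of_int m1 * \<alpha>)) - of_int (m - m1) * (real q * \<alpha> - of_int a)"
      by (simp add: K_def frac_def algebra_simps)
    then have "\<bar>real_of_int (a * (m - m1) - int q * K m)\<bar> < 2" using f g by linarith
    then have "\<bar>a * (m - m1) - int q * K m\<bar> < 2" by linarith
    then show ?thesis by auto
  qed
  \<comment> \<open>Equal values give \<open>int q dvd a * (m - m')\<close>, and coprimality
    together with \<open>\<bar>m - m'\<bar> < int q\<close> forces \<open>m = m'\<close>. So the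
    cell has no more elements than the three values allowed by \<open>*\<close>.\<close>
  have "inj_on (\<lambda>m. a * (m - m1) - int q * K m) C"
  proof (rule inj_onI)
    fix m m' assume mm: "m \<in> C" "m' \<in> C" and eq: "a * (m - m1) - int q * K m = a * (m' - m1) - int q * K m'"
    have "a * (m - m') = int q * (K m - K m')" using eq by (simp add: algebra_simps)
    then have "int q dvd a * (m - m')" by simp
    then have "int q dvd m - m'" using assms(2) by (metis coprime_commute coprime_dvd_mult_right_iff)
    moreover have "\<bar>m - m'\<bar> < int q" using mm by (auto simp: C_def)
    ultimately show "m = m'" using dvd_imp_le_int[of "m - m'" "int q"] by fastforce
  qed
  moreover have "(\<lambda>m. a * (m - m1) - int q * K m) ` C \<subseteq> {-1, 0, 1}"
    by (rule image_subsetI) (rule *)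
  ultimately have "card C \<le> card {-1, 0, 1::int}"
    by (rule card_inj_on_le) simp
  then show ?thesis by (simp add: C_def)
qed

lemma sum_inverse_le_ln: "n > 0 \<Longrightarrow> (\<Sum>i = 1..n. 1 / real i) \<le> 1 + ln (real n)"
proof (induction n)
  case (Suc n)
  show ?case
  proof (cases "n = 0")
    case False
    have "ln (real n / real (Suc n)) \<le> real n / real (Suc n) - 1"
      using False by (intro ln_le_minus_one) simp
    then have "ln (real n) + 1 / real (Suc n) \<le> ln (real (Suc n))"
      using False by (simp add: ln_div field_simps)
    then show ?thesis using Suc False by simp
  qed simp
qed simp

text \<open>By \<open>card_cell_le\<close> each cell receives at most three multiples. The first and
  the last cell are bounded trivially by \<open>P\<close>, and the remaining ones give harmonic sums
  from both ends; three times two is the factor 6.\<close>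

lemma sum_geom_bound_block:
  fixes a m0 :: int
  assumes "q > 0" "coprime a (int q)" "\<bar>\<alpha> - of_int a / real q\<bar> \<le> 1 / (real q)\<^sup>2"
  shows "(\<Sum>m\<in>{m0..<m0 + int q}. geom_bound P (of_int m * \<alpha>)) \<le> 6 * (real P + real q * (1 + ln (real q)))"
proof -
  define c where "c = (\<lambda>m::int. \<lfloor>real q * frac (of_int m * \<alpha>)\<rfloor>)"
  define g where "g = (\<lambda>t::int. if t = 0 \<or> t = int q - 1 then real P else real q / of_int t + real q / of_int (int q - 1 - t))"
  have q: "real q > 0" using assms by simp
  have cell: "0 \<le> c m \<and> c m < int q" for m using int_dist_cell(1,2)[OF assms(1), of "c m"] by (simp add: c_def)
  have g0: "g t \<ge> 0" if "t \<in> {0..<int q}" for t using that by (auto simp: g_def)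
  have le: "geom_bound P (of_int m * \<alpha>) \<le> g (c m)" for m
  proof (cases "c m = 0 \<or> c m = int q - 1")
    case True
    then show ?thesis using geom_bound_le by (simp add: g_def)
  next
    case False
    then have p: "0 < c m" "0 < int q - 1 - c m" using cell[of m] by auto
    then have p': "0 < real_of_int (c m)" "0 < real_of_int (int q - 1 - c m)" by linarith+
    have "geom_bound P (of_int m * \<alpha>) \<le> real q / of_int (c m) \<or> geom_bound P (of_int m * \<alpha>) \<le> real q / of_int (int q - 1 - c m)"
      using int_dist_cell(3)[OF assms(1) c_def[THEN fun_cong, of m, simplified]]
    proof
      assume "of_int (c m) / real q \<le> int_dist (of_int m * \<alpha>)"
      from geom_bound_le_inverse[OF divide_pos_pos[OF p'(1) q] this, of P] show ?thesis by simp
    next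
      assume "of_int (int q - 1 - c m) / real q \<le> int_dist (of_int m * \<alpha>)"
      from geom_bound_le_inverse[OF divide_pos_pos[OF p'(2) q] this, of P] show ?thesis by simp
    qed
    moreover have "0 \<le> real q / of_int (c m)" "0 \<le> real q / of_int (int q - 1 - c m)"
      using p' q by (auto intro!: divide_nonneg_pos)
    ultimately show ?thesis using False unfolding g_def by auto
  qed
  have "(\<Sum>m\<in>{m0..<m0 + int q}. geom_bound P (of_int m * \<alpha>)) \<le> (\<Sum>m\<in>{m0..<m0 + int q}. g (c m))"
    by (rule sum_mono) (rule le)
  also have "\<dots> = (\<Sum>t\<in>{0..<int q}. \<Sum>m\<in>{m\<in>{m0..<m0 + int q}. c m = t}. g (c m))"
    by (rule sum.group[symmetric]) (use cell in auto)
  also have "\<dots> = (\<Sum>t\<in>{0..<int q}. real (card {m\<in>{m0..<m0 + int q}. c m = t}) * g t)"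
    by (intro sum.cong refl) (simp add: sum.cong[of _ _ "\<lambda>m. g (c m)" "\<lambda>_. g _"])
  also have "\<dots> \<le> (\<Sum>t\<in>{0..<int q}. 3 * g t)"
  proof (intro sum_mono mult_right_mono g0)
    fix t show "real (card {m\<in>{m0..<m0 + int q}. c m = t}) \<le> 3"
      using card_cell_le[OF assms, of m0 t] unfolding c_def by linarith
  qed auto
  also have "\<dots> = 3 * (\<Sum>t\<in>{0..<int q}. g t)" by (simp add: sum_distrib_left)
  also have "(\<Sum>t\<in>{0..<int q}. g t) \<le> (\<Sum>t\<in>{0..<int q}. (if t = 0 then real P else real q / of_int t)
       + (if t = int q - 1 then real P else real q / of_int (int q - 1 - t)))"
    by (intro sum_mono) (auto simp: g_def)
  also have "\<dots> = (\<Sum>t\<in>{0..<int q}. if t = 0 then real P else real q / of_int t)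
       + (\<Sum>t\<in>{0..<int q}. if t = int q - 1 then real P else real q / of_int (int q - 1 - t))"
    by (rule sum.distrib)
  also have "(\<Sum>t\<in>{0..<int q}. if t = int q - 1 then real P else real q / of_int (int q - 1 - t))
      = (\<Sum>t\<in>{0..<int q}. if t = 0 then real P else real q / of_int t)"
    by (rule sum.reindex_bij_witness[where i = "\<lambda>t. int q - 1 - t" and j = "\<lambda>t. int q - 1 - t"]) auto
  also have "(\<Sum>t\<in>{0..<int q}. if t = 0 then real P else real q / of_int t)
      = (\<Sum>i<q. if i = 0 then real P else real q / real i)"
    by (rule sum.reindex_bij_witness[where i = int and j = nat]) auto
  also have "\<dots> = real P + (\<Sum>i\<in>{1..<q}. real q / real i)"
  proof -
    have "{..<q} = insert 0 {1..<q}" using assms(1) by auto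
    then show ?thesis by simp
  qed
  also have "(\<Sum>i\<in>{1..<q}. real q / real i) \<le> (\<Sum>i = 1..q. real q / real i)"
    by (rule sum_mono2) auto
  also have "\<dots> = real q * (\<Sum>i = 1..q. 1 / real i)"
    by (simp add: sum_distrib_left)
  also have "\<dots> \<le> real q * (1 + ln (real q))"
    by (rule mult_left_mono[OF sum_inverse_le_ln[OF assms(1)]]) simp
  finally show ?thesis by simp
qed

lemma sum_geom_bound_le:
  fixes a :: int
  assumes "q > 0" "coprime a (int q)" "\<bar>\<alpha> - of_int a / real q\<bar> \<le> 1 / (real q)\<^sup>2"
  shows "(\<Sum>m\<in>{1..int H}. geom_bound P (of_int m * \<alpha>))
      \<le> (real H / real q + 1) * (6 * (real P + real q * (1 + ln (real q))))"
proof -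
  define B where "B = 6 * (real P + real q * (1 + ln (real q)))"
  have B0: "B \<ge> 0" using assms(1) by (simp add: B_def)
  have blocks: "(\<Sum>m\<in>{1..<1 + int q * int n}. geom_bound P (of_int m * \<alpha>)) \<le> real n * B" for n
  proof (induction n)
    case (Suc n)
    have nn: "0 \<le> int q * int n" by simp
    have "{1..<1 + int q * int (Suc n)} = {1..<1 + int q * int n} \<union> {1 + int q * int n..<1 + int q * int n + int q}"
      by (auto simp: distrib_left) (use nn in linarith)
    then have "(\<Sum>m\<in>{1..<1 + int q * int (Suc n)}. geom_bound P (of_int m * \<alpha>))
      = (\<Sum>m\<in>{1..<1 + int q * int n}. geom_bound P (of_int m * \<alpha>))
        + (\<Sum>m\<in>{1 + int q * int n..<1 + int q * int n + int q}. geom_bound P (of_int m * \<alpha>))"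
      by (simp only:) (rule sum.union_disjoint, auto)
    also have "\<dots> \<le> real n * B + B"
      unfolding B_def by (intro add_mono Suc[unfolded B_def] sum_geom_bound_block[OF assms])
    finally show ?case by (simp add: algebra_simps)
  qed simp
  define n where "n = H div q + 1"
  have "H < q * n" using assms(1) by (simp add: n_def dividend_less_times_div)
  then have "int H < int q * int n" by (metis of_nat_less_iff of_nat_mult)
  then have "(\<Sum>m\<in>{1..int H}. geom_bound P (of_int m * \<alpha>)) \<le> (\<Sum>m\<in>{1..<1 + int q * int n}. geom_bound P (of_int m * \<alpha>))"
    by (intro sum_mono2) (auto simp: geom_bound_nonneg)
  also have "\<dots> \<le> real n * B" by (rule blocks)
  also have "\<dots> \<le> (real H / real q + 1) * B"
  proof (rule mult_right_mono[OF _ B0])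
    show "real n \<le> real H / real q + 1"
      using of_nat_div_le_of_nat[of H q, where 'a = real] by (simp add: n_def)
  qed
  finally show ?thesis by (simp add: B_def)
qed

section \<open>Weyl differencing down to linear phases\<close>

lemma shift_interval: "{x \<in> {l..u}. x + h \<in> {l..u}} = {max l (l - h)..min u (u - (h::int))}"
  by auto

definition weyl4_diff2 :: "nat \<Rightarrow> int \<Rightarrow> int \<Rightarrow> real \<Rightarrow> complex" where
  "weyl4_diff2 P h k \<alpha> = (\<Sum>x\<in>{x \<in> dom4 P h. x + k \<in> dom4 P h}. E (\<alpha> * of_int (diff4 h (x + k) - diff4 h x)))"

lemma weyl4_diff_differenced:
  "complex_of_real ((cmod (weyl4_diff P h \<alpha>))\<^sup>2) = (\<Sum>k\<in>{- int P..int P}. weyl4_diff2 P h k \<alpha>)"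
proof -
  have "dom4 P h \<subseteq> {1..int P}" by (auto simp: dom4_def)
  from norm_square_differenced[OF this, of "\<lambda>x. E (\<alpha> * of_int (diff4 h x))"] show ?thesis
    by (simp add: weyl4_diff_def weyl4_diff2_def E_diff right_diff_distrib)
qed

text \<open>One more difference makes the phase linear in \<open>x\<close>, with slope
  \<open>24 * h * k * l\<close> times \<open>\<alpha>\<close>. The domain is still an interval after
  all the shifts, so the inner sum is geometric.\<close>

lemma weyl4_diff2_le:
  "(cmod (weyl4_diff2 P h k \<alpha>))\<^sup>2 \<le> (\<Sum>l\<in>{- int P..int P}. geom_bound P (of_int (24 * h * k * l) * \<alpha>))"
proof -
  define A where "A = {x \<in> dom4 P h. x + k \<in> dom4 P h}"
  obtain l0 u0 where dom: "dom4 P h = {l0..u0}" unfolding dom4_def shift_interval by blast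
  obtain l u where A: "A = {l..u}" unfolding A_def dom shift_interval by blast
  have sub: "A \<subseteq> {1..int P}" by (auto simp: A_def dom4_def)
  define \<phi> where "\<phi> = (\<lambda>x. E (\<alpha> * of_int (diff4 h (x + k) - diff4 h x)))"
  have third: "\<phi> (x + l) * cnj (\<phi> x) = E ((of_int (24 * h * k * l) * \<alpha>) * of_int x + \<alpha> * of_int (12 * h * k * l * (h + k + l)))" for x l
  proof -
    have "\<phi> (x + l) * cnj (\<phi> x) = E (\<alpha> * of_int ((diff4 h (x + l + k) - diff4 h (x + l)) - (diff4 h (x + k) - diff4 h x)))"
      unfolding \<phi>_def of_int_diff right_diff_distrib by (simp add: E_diff)
    also have "(diff4 h (x + l + k) - diff4 h (x + l)) - (diff4 h (x + k) - diff4 h x)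
        = 24 * h * k * l * x + 12 * h * k * l * (h + k + l)"
      unfolding diff4_diff_diff by algebra
    finally show ?thesis by (simp only: of_int_add of_int_mult distrib_left mult_ac)
  qed
  have inner: "cmod (\<Sum>x\<in>{x \<in> A. x + l \<in> A}. \<phi> (x + l) * cnj (\<phi> x)) \<le> geom_bound P (of_int (24 * h * k * l) * \<alpha>)" for l
    unfolding third A shift_interval
    by (rule norm_sum_E_interval_le) (use sub A in auto)
  have "(cmod (weyl4_diff2 P h k \<alpha>))\<^sup>2 = cmod (complex_of_real ((cmod (\<Sum>x\<in>A. \<phi> x))\<^sup>2))"
    unfolding norm_of_real weyl4_diff2_def A_def \<phi>_def by simp
  also have "\<dots> \<le> (\<Sum>l\<in>{- int P..int P}. cmod (\<Sum>x\<in>{x \<in> A. x + l \<in> A}. \<phi> (x + l) * cnj (\<phi> x)))"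
    unfolding norm_square_differenced[OF sub] by (rule norm_sum)
  also have "\<dots> \<le> (\<Sum>l\<in>{- int P..int P}. geom_bound P (of_int (24 * h * k * l) * \<alpha>))"
    by (intro sum_mono inner)
  finally show ?thesis .
qed

text \<open>Of the four factors \<open>2 * P + 1\<close>, two come from squaring the first
  Cauchy--Schwarz step, one from the sum over \<open>h\<close> and one from the sum over
  \<open>k\<close>. The last differencing over \<open>l\<close> loses nothing.\<close>

lemma weyl4_pow8_le:
  "(cmod (weyl4 P \<alpha>)) ^ 8 \<le> (2 * real P + 1) ^ 4 *
     (\<Sum>h\<in>{- int P..int P}. \<Sum>k\<in>{- int P..int P}. \<Sum>l\<in>{- int P..int P}. geom_bound P (of_int (24 * h * k * l) * \<alpha>))"
proof -
  let ?H = "{- int P..int P}"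
  let ?c = "2 * real P + 1"
  have "(cmod (weyl4 P \<alpha>)) ^ 8 = ((cmod (weyl4 P \<alpha>)) ^ 4)\<^sup>2" by (simp flip: power_mult)
  also have "\<dots> \<le> (?c * (\<Sum>h\<in>?H. (cmod (weyl4_diff P h \<alpha>))\<^sup>2))\<^sup>2"
    by (intro power_mono weyl4_pow4_le) simp
  also have "\<dots> = ?c\<^sup>2 * (\<Sum>h\<in>?H. (cmod (weyl4_diff P h \<alpha>))\<^sup>2)\<^sup>2" by (simp add: power_mult_distrib)
  also have "(\<Sum>h\<in>?H. (cmod (weyl4_diff P h \<alpha>))\<^sup>2)\<^sup>2 \<le> real (card ?H) * (\<Sum>h\<in>?H. ((cmod (weyl4_diff P h \<alpha>))\<^sup>2)\<^sup>2)"
    by (rule sum_square_le_card)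
  also have "real (card ?H) = ?c" by simp
  also have "(\<Sum>h\<in>?H. ((cmod (weyl4_diff P h \<alpha>))\<^sup>2)\<^sup>2) \<le> (\<Sum>h\<in>?H. ?c * (\<Sum>k\<in>?H. (cmod (weyl4_diff2 P h k \<alpha>))\<^sup>2))"
    by (intro sum_mono norm_square_sum_le weyl4_diff_differenced)
  also have "\<dots> \<le> (\<Sum>h\<in>?H. ?c * (\<Sum>k\<in>?H. \<Sum>l\<in>?H. geom_bound P (of_int (24 * h * k * l) * \<alpha>)))"
    by (intro sum_mono mult_left_mono weyl4_diff2_le) simp
  also have "?c\<^sup>2 * (?c * \<dots>) = ?c ^ 4 * (\<Sum>h\<in>?H. \<Sum>k\<in>?H. \<Sum>l\<in>?H. geom_bound P (of_int (24 * h * k * l) * \<alpha>))"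
    by (simp add: sum_distrib_left[symmetric] power2_eq_square power4_eq_xxxx mult.assoc)
  finally show ?thesis by (simp add: mult_left_mono)
qed

lemma card_product_eq_le:
  assumes "m \<noteq> 0"
  shows "card {(h, k, l) \<in> {- int P..int P} \<times> {- int P..int P} \<times> {- int P..int P}. 24 * h * k * l = m} \<le> int_divisor_count m ^ 2"
proof (rule card_le_divs2(2)[OF assms, where f = "\<lambda>(h,k,l). h" and g = "\<lambda>(h,k,l). k"])
  let ?S = "{(h, k, l) \<in> {- int P..int P} \<times> {- int P..int P} \<times> {- int P..int P}. 24 * h * k * l = m}"
  have *: "h dvd m \<and> k dvd m" if "24 * h * k * l = m" for h k l
    using that by (metis dvd_triv_left dvd_triv_right dvd_mult2)
  fix s assume "s \<in> ?S"
  then show "(case s of (h,k,l) \<Rightarrow> h) dvd m \<and> (case s of (h,k,l) \<Rightarrow> k) dvd m"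
    using * by (cases s) auto
next
  let ?S = "{(h, k, l) \<in> {- int P..int P} \<times> {- int P..int P} \<times> {- int P..int P}. 24 * h * k * l = m}"
  show "inj_on (\<lambda>s. (case s of (h,k,l) \<Rightarrow> h, case s of (h,k,l) \<Rightarrow> k)) ?S"
  proof (rule inj_onI)
    fix s t assume s: "s \<in> ?S" and t: "t \<in> ?S"
      and eq: "(case s of (h,k,l) \<Rightarrow> h, case s of (h,k,l) \<Rightarrow> k) = (case t of (h,k,l) \<Rightarrow> h, case t of (h,k,l) \<Rightarrow> k)"
    obtain h k l where s': "s = (h, k, l)" by (cases s)
    obtain l' where t': "t = (h, k, l')" using eq s' by (cases t) auto
    have "24 * h * k * l = m" "24 * h * k * l' = m" using s t s' t' by auto
    then have "l = l'" using assms by (metis mult_cancel_left mult_zero_left)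
    then show "s = t" using s' t' by simp
  qed
qed

text \<open>Triples are grouped by the value of \<open>24 * h * k * l\<close>. Value 0 is taken by
  at most 27 P^2 triples, each bounded by \<open>P\<close>; a nonzero value has few representations
  by the divisor bound. The factor 2 pairs \<open>m\<close> with \<open>- m\<close>.\<close>

lemma triple_product_sum_le:
  assumes L: "\<And>n. n \<noteq> 0 \<Longrightarrow> \<bar>n\<bar> \<le> 24 * int P ^ 4 \<Longrightarrow> real (int_divisor_count n) \<le> L" and "P > 0"
  shows "(\<Sum>h\<in>{- int P..int P}. \<Sum>k\<in>{- int P..int P}. \<Sum>l\<in>{- int P..int P}. geom_bound P (of_int (24 * h * k * l) * \<alpha>))
     \<le> 27 * real P ^ 3 + 2 * L ^ 2 * (\<Sum>m\<in>{1..int (24 * P ^ 3)}. geom_bound P (of_int m * \<alpha>))"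
proof -
  let ?H = "{- int P..int P}"
  define T where "T = ?H \<times> ?H \<times> ?H"
  define f where "f = (\<lambda>t::int \<times> int \<times> int. 24 * fst t * fst (snd t) * snd (snd t))"
  define G where "G = (\<lambda>m::int. geom_bound P (of_int m * \<alpha>))"
  have fT: "finite T" by (simp add: T_def)
  have "(\<Sum>h\<in>?H. \<Sum>k\<in>?H. \<Sum>l\<in>?H. geom_bound P (of_int (24 * h * k * l) * \<alpha>)) = (\<Sum>t\<in>T. G (f t))"
    by (simp add: T_def f_def G_def sum.cartesian_product case_prod_unfold)
  also have "\<dots> = (\<Sum>t\<in>{t\<in>T. f t = 0}. G (f t)) + (\<Sum>t\<in>{t\<in>T. f t \<noteq> 0}. G (f t))"
    by (rule sum.Int_Diff[OF fT, of _ "{t. f t = 0}", unfolded Int_def Diff_eq, simplified, THEN trans])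
       (simp add: Int_def)
  also have "(\<Sum>t\<in>{t\<in>T. f t = 0}. G (f t)) \<le> 27 * real P ^ 3"
  proof -
    have sub: "{t\<in>T. f t = 0} \<subseteq> ({0} \<times> ?H \<times> ?H) \<union> ((?H \<times> {0} \<times> ?H) \<union> (?H \<times> ?H \<times> {0}))"
      by (auto simp: T_def f_def)
    have "card {t\<in>T. f t = 0} \<le> card (({0} \<times> ?H \<times> ?H) \<union> ((?H \<times> {0} \<times> ?H) \<union> (?H \<times> ?H \<times> {0})))"
      by (rule card_mono[OF _ sub]) simp
    also have "\<dots> \<le> card ({0::int} \<times> ?H \<times> ?H) + (card (?H \<times> {0::int} \<times> ?H) + card (?H \<times> ?H \<times> {0::int}))"
      by (rule order.trans[OF card_Un_le add_left_mono[OF card_Un_le]])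
    also have "\<dots> = 3 * (2 * P + 1)\<^sup>2"
      by (simp only: card_cartesian_product card_symmetric_interval) (simp add: power2_eq_square)
    also have "\<dots> \<le> 3 * (3 * P)\<^sup>2" using \<open>P > 0\<close> by (intro mult_left_mono power_mono) auto
    finally have c: "card {t\<in>T. f t = 0} \<le> 27 * P\<^sup>2" by (simp add: power_mult_distrib)
    have "(\<Sum>t\<in>{t\<in>T. f t = 0}. G (f t)) \<le> (\<Sum>t\<in>{t\<in>T. f t = 0}. real P)"
      by (rule sum_mono) (simp add: G_def geom_bound_le)
    also have "\<dots> = real (card {t\<in>T. f t = 0}) * real P" by simp
    also have "\<dots> \<le> real (27 * P\<^sup>2) * real P" by (rule mult_right_mono[OF of_nat_mono[OF c]]) simp
    finally show ?thesis by (simp add: power2_eq_square power3_eq_cube)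
  qed
  also have "(\<Sum>t\<in>{t\<in>T. f t \<noteq> 0}. G (f t)) \<le> L ^ 2 * (\<Sum>m\<in>{- int (24 * P ^ 3)..int (24 * P ^ 3)} - {0}. G m)"
  proof -
    let ?R = "{- int (24 * P ^ 3)..int (24 * P ^ 3)} - {0}"
    have P34: "int (24 * P ^ 3) \<le> 24 * int P ^ 4"
    proof -
      have "P ^ 3 \<le> P ^ 4" using \<open>P > 0\<close> by (intro power_increasing) auto
      from of_nat_mono[OF this, where 'a = int] show ?thesis by simp
    qed
    have im: "f ` {t\<in>T. f t \<noteq> 0} \<subseteq> ?R"
    proof (rule image_subsetI)
      fix t assume t: "t \<in> {t\<in>T. f t \<noteq> 0}"
      then have b: "\<bar>fst t\<bar> \<le> int P" "\<bar>fst (snd t)\<bar> \<le> int P" "\<bar>snd (snd t)\<bar> \<le> int P" by (auto simp: T_def)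
      have "\<bar>f t\<bar> = 24 * (\<bar>fst t\<bar> * \<bar>fst (snd t)\<bar> * \<bar>snd (snd t)\<bar>)" by (simp add: f_def abs_mult)
      also have "\<dots> \<le> 24 * (int P * int P * int P)"
        using b by (intro mult_left_mono mult_mono) auto
      also have "\<dots> = int (24 * P ^ 3)" by (simp add: power3_eq_cube)
      finally show "f t \<in> ?R" using t by auto
    qed
    have "(\<Sum>t\<in>{t\<in>T. f t \<noteq> 0}. G (f t)) = (\<Sum>m\<in>?R. \<Sum>t\<in>{t \<in> {t\<in>T. f t \<noteq> 0}. f t = m}. G (f t))"
      by (rule sum.group[OF _ _ im, symmetric]) (use fT in auto)
    also have "\<dots> \<le> (\<Sum>m\<in>?R. L ^ 2 * G m)"
    proof (rule sum_mono)
      fix m assume m: "m \<in> ?R"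
      then have m0: "m \<noteq> 0" and mb: "\<bar>m\<bar> \<le> 24 * int P ^ 4" using P34 by auto
      have eq: "{t \<in> {t\<in>T. f t \<noteq> 0}. f t = m} = {(h, k, l) \<in> ?H \<times> ?H \<times> ?H. 24 * h * k * l = m}"
        using m0 by (auto simp: T_def f_def)
      have "real (card {(h, k, l) \<in> ?H \<times> ?H \<times> ?H. 24 * h * k * l = m}) \<le> real (int_divisor_count m) ^ 2"
        using of_nat_mono[OF card_product_eq_le[OF m0, of P], where 'a = real] by (simp only: of_nat_power)
      also have "\<dots> \<le> L ^ 2" using L[OF m0 mb] by (intro power_mono) auto
      finally have c: "real (card {t \<in> {t\<in>T. f t \<noteq> 0}. f t = m}) \<le> L ^ 2" unfolding eq .
      have "(\<Sum>t\<in>{t \<in> {t\<in>T. f t \<noteq> 0}. f t = m}. G (f t)) = (\<Sum>t\<in>{t \<in> {t\<in>T. f t \<noteq> 0}. f t = m}. G m)"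
        by (rule sum.cong) auto
      also have "\<dots> = real (card {t \<in> {t\<in>T. f t \<noteq> 0}. f t = m}) * G m" by simp
      also have "\<dots> \<le> L ^ 2 * G m" by (rule mult_right_mono[OF c]) (simp add: G_def geom_bound_nonneg)
      finally show "(\<Sum>t\<in>{t \<in> {t\<in>T. f t \<noteq> 0}. f t = m}. G (f t)) \<le> L ^ 2 * G m" .
    qed
    finally show ?thesis by (simp add: sum_distrib_left)
  qed
  also have "(\<Sum>m\<in>{- int (24 * P ^ 3)..int (24 * P ^ 3)} - {0}. G m) = 2 * (\<Sum>m\<in>{1..int (24 * P ^ 3)}. G m)"
  proof -
    have "{- int (24 * P ^ 3)..int (24 * P ^ 3)} - {0} = {1..int (24 * P ^ 3)} \<union> uminus ` {1..int (24 * P ^ 3)}"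
      by (auto simp: image_iff)
    moreover have "(\<Sum>m\<in>uminus ` {1..int (24 * P ^ 3)}. G m) = (\<Sum>m\<in>{1..int (24 * P ^ 3)}. G m)"
      by (subst sum.reindex) (auto simp: G_def geom_bound_minus)
    ultimately show ?thesis
      by (simp only:) (subst sum.union_disjoint, auto)
  qed
  finally show ?thesis by (simp add: G_def mult_ac)
qed

lemma int_divisor_count_le_ge1:
  assumes "\<epsilon> > 0" "B > 0"
  shows "\<exists>C\<ge>1. \<forall>P::nat. P > 0 \<longrightarrow> (\<forall>n. n \<noteq> 0 \<longrightarrow> \<bar>n\<bar> \<le> B * int P ^ 4 \<longrightarrow> real (int_divisor_count n) \<le> C * real P powr \<epsilon>)"
proof -
  obtain C where C: "C > 0" "\<And>P n. P > 0 \<Longrightarrow> n \<noteq> 0 \<Longrightarrow> \<bar>n\<bar> \<le> B * int P ^ 4 \<Longrightarrow> real (int_divisor_count n) \<le> C * real P powr \<epsilon>"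
    using int_divisor_count_le[OF assms] by blast
  show ?thesis
  proof (intro exI[of _ "max 1 C"] conjI allI impI)
    fix P :: nat and n :: int assume "P > 0" "n \<noteq> 0" "\<bar>n\<bar> \<le> B * int P ^ 4"
    then have "real (int_divisor_count n) \<le> C * real P powr \<epsilon>" by (rule C(2))
    also have "\<dots> \<le> max 1 C * real P powr \<epsilon>" by (intro mult_right_mono) auto
    finally show "real (int_divisor_count n) \<le> max 1 C * real P powr \<epsilon>" .
  qed simp
qed

lemma one_le_powr: "P > 0 \<Longrightarrow> \<epsilon> \<ge> 0 \<Longrightarrow> 1 \<le> real P powr \<epsilon>"
  by (rule ge_one_powr_ge_zero) auto

lemma ln_le_powr:
  assumes "\<epsilon> > 0" "P > 0" "q > 0" "q \<le> 3 * P ^ 4"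
  shows "1 + ln (real q) \<le> (3 + 4 / \<epsilon>) * real P powr \<epsilon>"
proof -
  have "real q \<le> 3 * real P ^ 4" using of_nat_mono[OF assms(4), where 'a = real] by simp
  then have "ln (real q) \<le> ln (3 * real P ^ 4)" using assms by (intro ln_mono) auto
  also have "\<dots> = ln 3 + 4 * ln (real P)" using assms by (simp add: ln_mult ln_realpow)
  also have "ln 3 \<le> (3 - 1 :: real)" by (rule ln_le_minus_one) simp
  also have "ln (real P) \<le> real P powr \<epsilon> / \<epsilon>" using assms by (intro ln_powr_bound) auto
  finally have "1 + ln (real q) \<le> 3 + 4 / \<epsilon> * real P powr \<epsilon>" by simp
  also have "\<dots> \<le> 3 * real P powr \<epsilon> + 4 / \<epsilon> * real P powr \<epsilon>"
    using one_le_powr[of P \<epsilon>] assms by simp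
  finally show ?thesis by (simp add: distrib_right)
qed

text \<open>The condition \<open>q \<le> 3 * P ^ 4\<close> makes \<open>ln q\<close> as small as a
  power \<open>P powr \<epsilon>\<close>. The slack factor 3 accommodates the denominators of the
  second approximation in \<open>weyl_major\<close>.\<close>

lemma weyl_inequality:
  assumes "\<epsilon> > 0"
  shows "\<exists>C>0. \<forall>P q :: nat. \<forall>a :: int. \<forall>\<alpha>. P > 0 \<longrightarrow> q > 0 \<longrightarrow> q \<le> 3 * P ^ 4 \<longrightarrow> coprime a (int q) \<longrightarrow>
      \<bar>\<alpha> - of_int a / real q\<bar> \<le> 1 / (real q)\<^sup>2 \<longrightarrow>
      (cmod (weyl4 P \<alpha>)) ^ 8 \<le> C * real P powr (8 + \<epsilon>) * (1 / real q + 1 / real P + real q / real P ^ 4)"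
proof -
  obtain D where D: "D \<ge> 1" "\<And>P n. P > 0 \<Longrightarrow> n \<noteq> 0 \<Longrightarrow> \<bar>n\<bar> \<le> 24 * int P ^ 4 \<Longrightarrow> real (int_divisor_count n) \<le> D * real P powr (\<epsilon>/4)"
    using int_divisor_count_le_ge1[of "\<epsilon>/4" 24] assms by auto
  define C where "C = 81 * 327 * D\<^sup>2 * (3 + 8 / \<epsilon>)"
  have "(cmod (weyl4 P \<alpha>)) ^ 8 \<le> C * real P powr (8 + \<epsilon>) * (1 / real q + 1 / real P + real q / real P ^ 4)"
    if P: "P > 0" and q: "q > 0" "q \<le> 3 * P ^ 4" and a: "coprime a (int q)" "\<bar>\<alpha> - of_int a / real q\<bar> \<le> 1 / (real q)\<^sup>2"
    for P q :: nat and a \<alpha>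
  proof -
    define L where "L = D * real P powr (\<epsilon>/4)"
    define l where "l = 1 + ln (real q)"
    define p where "p = real P"
    define r where "r = real q"
    define X where "X = 1 / r + 1 / p + r / p ^ 4"
    have p1: "p \<ge> 1" using P by (simp add: p_def)
    have r1: "r \<ge> 1" using q by (simp add: r_def)
    have L1: "L \<ge> 1"
      using mult_mono[OF D(1) one_le_powr[of P "\<epsilon>/4"]] D(1) P assms by (simp add: L_def)
    then have L2: "L\<^sup>2 \<ge> 1" by (rule one_le_power)
    have l1: "l \<ge> 1" using q by (simp add: l_def)
    have X: "p ^ 4 * X = p ^ 4 / r + p ^ 3 + r"
      using p1 by (simp add: X_def field_simps power_numeral_reduce)
    have X0: "X \<ge> 0" using p1 r1 by (simp add: X_def)
    have pX: "p ^ 3 \<le> p ^ 4 * X" unfolding X using p1 r1 by simp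
    have "(24 * p ^ 3 / r + 1) * (p + r * l) \<le> (24 * p ^ 3 / r + 1) * ((p + r) * l)"
      using p1 r1 l1 by (intro mult_left_mono) (auto simp: distrib_right)
    also have "\<dots> = l * (24 * p ^ 4 / r + 24 * p ^ 3 + p + r)"
      using r1 by (simp add: field_simps power_numeral_reduce)
    also have "\<dots> \<le> l * (25 * (p ^ 4 * X))"
    proof (rule mult_left_mono)
      have "p ^ 1 \<le> p ^ 3" using p1 by (intro power_increasing) auto
      moreover have "0 \<le> p ^ 4 / r" using p1 r1 by simp
      moreover define A where "A = p ^ 4 / r"
      moreover have e1: "24 * p ^ 4 / r = 24 * A" by (simp add: A_def)
      ultimately show "24 * p ^ 4 / r + 24 * p ^ 3 + p + r \<le> 25 * (p ^ 4 * X)"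
        unfolding X e1 power_one_right A_def[symmetric] using r1 by simp
    qed (use l1 in simp)
    finally have 1: "(24 * p ^ 3 / r + 1) * (p + r * l) \<le> l * (25 * (p ^ 4 * X))" .
    have "(cmod (weyl4 P \<alpha>)) ^ 8 \<le> (2 * real P + 1) ^ 4 *
      (\<Sum>h\<in>{- int P..int P}. \<Sum>k\<in>{- int P..int P}. \<Sum>l\<in>{- int P..int P}. geom_bound P (of_int (24 * h * k * l) * \<alpha>))"
      by (rule weyl4_pow8_le)
    also have "\<dots> \<le> (3 * p) ^ 4 * (27 * p ^ 3 + 2 * L\<^sup>2 * ((24 * p ^ 3 / r + 1) * (6 * (p + r * l))))"
    proof (rule mult_mono)
      show "(2 * real P + 1) ^ 4 \<le> (3 * p) ^ 4" using p1 by (intro power_mono) (auto simp: p_def)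
      have "(\<Sum>h\<in>{- int P..int P}. \<Sum>k\<in>{- int P..int P}. \<Sum>l\<in>{- int P..int P}. geom_bound P (of_int (24 * h * k * l) * \<alpha>))
         \<le> 27 * real P ^ 3 + 2 * L ^ 2 * (\<Sum>m\<in>{1..int (24 * P ^ 3)}. geom_bound P (of_int m * \<alpha>))"
        by (rule triple_product_sum_le) (use D(2)[OF P] P in \<open>auto simp: L_def\<close>)
      also have "(\<Sum>m\<in>{1..int (24 * P ^ 3)}. geom_bound P (of_int m * \<alpha>))
         \<le> (real (24 * P ^ 3) / real q + 1) * (6 * (real P + real q * (1 + ln (real q))))"
        by (rule sum_geom_bound_le[OF q(1) a])
      finally show "(\<Sum>h\<in>{- int P..int P}. \<Sum>k\<in>{- int P..int P}. \<Sum>l\<in>{- int P..int P}. geom_bound P (of_int (24 * h * k * l) * \<alpha>))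
         \<le> 27 * p ^ 3 + 2 * L\<^sup>2 * ((24 * p ^ 3 / r + 1) * (6 * (p + r * l)))"
        by (simp add: p_def r_def l_def mult_left_mono)
    qed (auto intro!: sum_nonneg geom_bound_nonneg simp: p_def)
    also have "\<dots> = 81 * p ^ 4 * (27 * p ^ 3 + 12 * L\<^sup>2 * ((24 * p ^ 3 / r + 1) * (p + r * l)))"
      by (simp add: power_mult_distrib)
    also have "\<dots> \<le> 81 * p ^ 4 * (27 * (L\<^sup>2 * l * (p ^ 4 * X)) + 12 * L\<^sup>2 * (l * (25 * (p ^ 4 * X))))"
    proof (intro mult_left_mono add_mono 1)
      have "1 * 1 * p ^ 3 \<le> L\<^sup>2 * l * (p ^ 4 * X)"
        using L2 l1 pX p1 by (intro mult_mono) auto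
      then show "p ^ 3 \<le> L\<^sup>2 * l * (p ^ 4 * X)" by simp
    qed (use p1 in auto)
    also have "\<dots> = 81 * 327 * (L\<^sup>2 * l) * (p ^ 8 * X)"
      by (simp add: algebra_simps power_numeral_reduce)
    also have "\<dots> \<le> 81 * 327 * (D\<^sup>2 * p powr (\<epsilon>/2) * ((3 + 8 / \<epsilon>) * p powr (\<epsilon>/2))) * (p ^ 8 * X)"
    proof (intro mult_right_mono mult_left_mono mult_mono)
      show "L\<^sup>2 \<le> D\<^sup>2 * p powr (\<epsilon>/2)"
        using P by (simp add: L_def p_def power_mult_distrib powr_power)
      show "l \<le> (3 + 8 / \<epsilon>) * p powr (\<epsilon>/2)"
        using ln_le_powr[of "\<epsilon>/2" P q] P q assms by (simp add: l_def p_def)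
    qed (use X0 p1 l1 in auto)
    also have "\<dots> = C * (p powr (\<epsilon>/2) * p powr (\<epsilon>/2) * p ^ 8) * X"
      by (simp add: C_def)
    also have "p powr (\<epsilon>/2) * p powr (\<epsilon>/2) * p ^ 8 = p powr (8 + \<epsilon>)"
    proof -
      have "p ^ 8 = p powr 8" using p1 by simp
      then show ?thesis by (simp add: add.commute flip: powr_add)
    qed
    finally show ?thesis by (simp add: X_def p_def r_def)
  qed
  moreover have "C > 0" using D(1) assms by (simp add: C_def add_pos_pos)
  ultimately show ?thesis by blast
qed

section \<open>Dirichlet arcs, minor arcs and complete sums\<close>

definition dirichlet_arc :: "nat \<Rightarrow> real \<Rightarrow> nat \<Rightarrow> int \<Rightarrow> bool" where
  "dirichlet_arc P \<alpha> q a \<longleftrightarrow> 0 < q \<and> q \<le> P \<and> coprime a (int q) \<and> \<bar>real q * \<alpha> - of_int a\<bar> \<le> 1 / real P ^ 3"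

text \<open>Dirichlet's theorem with denominators up to \<open>P ^ 3\<close> always gives an
  approximation of the quality required in \<open>dirichlet_arc\<close>. If no arc contains
  \<open>\<alpha>\<close>, its denominator exceeds \<open>P\<close>, and then each of the three
  terms in Weyl's inequality is at most \<open>1 / P\<close>.\<close>

lemma weyl_minor:
  assumes "\<epsilon> > 0"
  shows "\<exists>C>0. \<forall>P \<alpha>. P > 0 \<longrightarrow> (\<nexists>q a. dirichlet_arc P \<alpha> q a) \<longrightarrow> (cmod (weyl4 P \<alpha>)) ^ 8 \<le> C * real P powr (7 + \<epsilon>)"
proof -
  obtain C where C: "C > 0" and W: "\<And>P q a \<alpha>. P > 0 \<Longrightarrow> q > 0 \<Longrightarrow> q \<le> 3 * P ^ 4 \<Longrightarrow> coprime a (int q) \<Longrightarrow>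
      \<bar>\<alpha> - of_int a / real q\<bar> \<le> 1 / (real q)\<^sup>2 \<Longrightarrow>
      (cmod (weyl4 P \<alpha>)) ^ 8 \<le> C * real P powr (8 + \<epsilon>) * (1 / real q + 1 / real P + real q / real P ^ 4)"
    using weyl_inequality[OF assms] by blast
  have "(cmod (weyl4 P \<alpha>)) ^ 8 \<le> 3 * C * real P powr (7 + \<epsilon>)" if P: "P > 0" and no: "\<nexists>q a. dirichlet_arc P \<alpha> q a" for P \<alpha>
  proof -
    obtain h k where hk: "coprime h k" "0 < k" "k \<le> int (P ^ 3)" "\<bar>of_int k * \<alpha> - of_int h\<bar> < 1 / real (P ^ 3)"
      by (rule Dirichlet_approx_coprime[of "P ^ 3" \<alpha>]) (use P in auto)
    define q where "q = nat k"
    have q: "q > 0" "int q = k" "q \<le> P ^ 3" using hk by (auto simp: q_def nat_le_iff)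
    have rq: "real q = of_int k" using q(2) by (metis of_int_of_nat_eq)
    have "\<not> dirichlet_arc P \<alpha> q h" using no by blast
    then have qP: "q > P" using q hk unfolding dirichlet_arc_def rq by (auto simp: not_le)
    have P1: "real P \<ge> 1" using P by simp
    have q3: "real q \<le> real P ^ 3" using of_nat_mono[OF q(3), where 'a = real] by simp
    have P34: "P ^ 3 \<le> P ^ 4" using P by (intro power_increasing) auto
    have d: "\<bar>\<alpha> - of_int h / real q\<bar> \<le> 1 / (real q)\<^sup>2"
    proof -
      have "\<alpha> - of_int h / real q = (of_int k * \<alpha> - of_int h) / real q"
        using q(1) unfolding rq[symmetric] by (simp add: diff_divide_distrib)
      then have "\<bar>\<alpha> - of_int h / real q\<bar> = \<bar>of_int k * \<alpha> - of_int h\<bar> / real q"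
        by (simp only: abs_divide abs_of_nat)
      also have "\<dots> \<le> (1 / real (P ^ 3)) / real q"
        using hk(4) by (intro divide_right_mono) auto
      also have "\<dots> \<le> (1 / real q) / real q"
        using q3 q(1) P by (intro divide_right_mono divide_left_mono) auto
      finally show ?thesis by (simp add: power2_eq_square)
    qed
    have "(cmod (weyl4 P \<alpha>)) ^ 8 \<le> C * real P powr (8 + \<epsilon>) * (1 / real q + 1 / real P + real q / real P ^ 4)"
      by (rule W[OF P q(1) _ _ d]) (use q(3) P34 hk q(2) in auto)
    also have "\<dots> \<le> C * real P powr (8 + \<epsilon>) * (3 / real P)"
    proof (rule mult_left_mono)
      have "1 / real q \<le> 1 / real P" using qP P by (intro divide_left_mono) auto
      moreover have "real q / real P ^ 4 \<le> real P ^ 3 / real P ^ 4" by (rule divide_right_mono[OF q3]) simp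
      moreover have "real P ^ 3 / real P ^ 4 = 1 / real P" using P by (simp add: power_numeral_reduce)
      ultimately show "1 / real q + 1 / real P + real q / real P ^ 4 \<le> 3 / real P" by simp
    qed (use C in auto)
    also have "\<dots> = 3 * C * real P powr (7 + \<epsilon>)"
    proof -
      have "8 + \<epsilon> = (7 + \<epsilon>) + 1" by simp
      then have "real P powr (8 + \<epsilon>) = real P powr (7 + \<epsilon>) * real P powr 1" by (simp only: powr_add)
      then show ?thesis using P by simp
    qed
    finally show ?thesis .
  qed
  then show ?thesis using C by (intro exI[of _ "3 * C"]) auto
qed

text \<open>Length equal to modulus turns Weyl's inequality into a bound with exponent 7/8 for
  complete sums. The true exponent is 3/4, but \<open>unit_weight_le\<close> makes do with this one
  by keeping back a mean square.\<close>

lemma weyl_complete: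
  assumes "\<epsilon> > 0"
  shows "\<exists>C>0. \<forall>q a. q > 0 \<longrightarrow> coprime a (int q) \<longrightarrow> (cmod (weyl4 q (of_int a / real q))) ^ 8 \<le> C * real q powr (7 + \<epsilon>)"
proof -
  obtain C where C: "C > 0" and W: "\<And>P q a \<alpha>. P > 0 \<Longrightarrow> q > 0 \<Longrightarrow> q \<le> 3 * P ^ 4 \<Longrightarrow> coprime a (int q) \<Longrightarrow>
      \<bar>\<alpha> - of_int a / real q\<bar> \<le> 1 / (real q)\<^sup>2 \<Longrightarrow>
      (cmod (weyl4 P \<alpha>)) ^ 8 \<le> C * real P powr (8 + \<epsilon>) * (1 / real q + 1 / real P + real q / real P ^ 4)"
    using weyl_inequality[OF assms] by blast
  have "(cmod (weyl4 q (of_int a / real q))) ^ 8 \<le> 3 * C * real q powr (7 + \<epsilon>)" if q: "q > 0" "coprime a (int q)" for q a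
  proof -
    have "q ^ 1 \<le> q ^ 4" using q(1) by (intro power_increasing) auto
    then have "(cmod (weyl4 q (of_int a / real q))) ^ 8 \<le> C * real q powr (8 + \<epsilon>) * (1 / real q + 1 / real q + real q / real q ^ 4)"
      by (intro W[OF q(1) q(1) _ q(2)]) auto
    also have "\<dots> \<le> C * real q powr (8 + \<epsilon>) * (3 / real q)"
    proof (rule mult_left_mono)
      have "real q ^ 1 \<le> real q ^ 3" using q(1) by (intro power_increasing) auto
      then have "1 / real q ^ 3 \<le> 1 / real q" using q(1) by (intro divide_left_mono) auto
      moreover have "real q / real q ^ 4 = 1 / real q ^ 3" using q(1) by (simp add: power_numeral_reduce)
      ultimately show "1 / real q + 1 / real q + real q / real q ^ 4 \<le> 3 / real q" by simp
    qed (use C in auto)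
    also have "\<dots> = 3 * C * real q powr (7 + \<epsilon>)"
    proof -
      have "8 + \<epsilon> = (7 + \<epsilon>) + 1" by simp
      then have "real q powr (8 + \<epsilon>) = real q powr (7 + \<epsilon>) * real q powr 1" by (simp only: powr_add)
      then show ?thesis using q(1) by simp
    qed
    finally show ?thesis .
  qed
  then show ?thesis using C by (intro exI[of _ "3 * C"]) auto
qed


text \<open>For \<open>p ^ 4 * b \<le> 1\<close> Weyl's inequality with \<open>a / q\<close>
  suffices. Otherwise it is applied to a second fraction \<open>h / k\<close> near
  \<open>\<alpha>\<close>, whose denominator is forced to have the order of
  \<open>1 / (q * b)\<close>; the terms \<open>1 / k\<close> and \<open>k / P ^ 4\<close> then carry
  the decay in \<open>b\<close>.\<close>

lemma weyl_major:
  assumes "\<epsilon> > 0"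
  shows "\<exists>C>0. \<forall>P \<alpha> q a. P > 0 \<longrightarrow> dirichlet_arc P \<alpha> q a \<longrightarrow>
     (cmod (weyl4 P \<alpha>)) ^ 8 \<le> C * real P powr (8 + \<epsilon>) / (real q * (1 + real P ^ 4 * \<bar>\<alpha> - of_int a / real q\<bar>))"
proof -
  obtain C where C: "C > 0" and W: "\<And>P q a \<alpha>. P > 0 \<Longrightarrow> q > 0 \<Longrightarrow> q \<le> 3 * P ^ 4 \<Longrightarrow> coprime a (int q) \<Longrightarrow>
      \<bar>\<alpha> - of_int a / real q\<bar> \<le> 1 / (real q)\<^sup>2 \<Longrightarrow>
      (cmod (weyl4 P \<alpha>)) ^ 8 \<le> C * real P powr (8 + \<epsilon>) * (1 / real q + 1 / real P + real q / real P ^ 4)"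
    using weyl_inequality[OF assms] by blast
  have "(cmod (weyl4 P \<alpha>)) ^ 8 \<le> 12 * C * real P powr (8 + \<epsilon>) / (real q * (1 + real P ^ 4 * \<bar>\<alpha> - of_int a / real q\<bar>))"
    if P: "P > 0" and Q: "dirichlet_arc P \<alpha> q a" for P \<alpha> q a
  proof -
    define p where "p = real P"
    define r where "r = real q"
    define b where "b = \<bar>\<alpha> - of_int a / real q\<bar>"
    have q: "q > 0" "q \<le> P" "coprime a (int q)" and Qa: "\<bar>real q * \<alpha> - of_int a\<bar> \<le> 1 / real P ^ 3"
      using Q by (auto simp: dirichlet_arc_def)
    have p1: "p \<ge> 1" and r1: "r \<ge> 1" and rp: "r \<le> p" using P q by (auto simp: p_def r_def)
    have "real q * \<alpha> - of_int a = real q * (\<alpha> - of_int a / real q)" using q(1) by (simp add: right_diff_distrib)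
    then have rb0: "\<bar>real q * \<alpha> - of_int a\<bar> = r * b" by (simp only: abs_mult r_def b_def abs_of_nat)
    then have rb: "r * b \<le> 1 / p ^ 3" using Qa by (simp add: p_def)
    have b0: "b \<ge> 0" by (simp add: b_def)
    have p3: "p ^ 1 \<le> p ^ 3" "p ^ 1 \<le> p ^ 4" "p ^ 2 \<le> p ^ 4" "1 \<le> p ^ 3"
      by (rule power_increasing one_le_power; use p1 in simp)+
    have main: "1 / real k + 1 / p + real k / p ^ 4 \<le> 12 / (r * (1 + p ^ 4 * b)) \<Longrightarrow>
        k > 0 \<Longrightarrow> k \<le> 3 * P ^ 4 \<Longrightarrow> coprime h (int k) \<Longrightarrow> \<bar>\<alpha> - of_int h / real k\<bar> \<le> 1 / (real k)\<^sup>2 \<Longrightarrow> ?thesis" for k h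
    proof -
      assume le: "1 / real k + 1 / p + real k / p ^ 4 \<le> 12 / (r * (1 + p ^ 4 * b))"
        and k: "k > 0" "k \<le> 3 * P ^ 4" "coprime h (int k)" "\<bar>\<alpha> - of_int h / real k\<bar> \<le> 1 / (real k)\<^sup>2"
      have "(cmod (weyl4 P \<alpha>)) ^ 8 \<le> C * real P powr (8 + \<epsilon>) * (1 / real k + 1 / real P + real k / real P ^ 4)"
        by (rule W[OF P k])
      also have "\<dots> \<le> C * real P powr (8 + \<epsilon>) * (12 / (r * (1 + p ^ 4 * b)))"
        using le C by (intro mult_left_mono) (auto simp: p_def)
      finally show ?thesis by (simp add: p_def r_def b_def mult_ac)
    qed
    show ?thesis
    proof (cases "p ^ 4 * b \<le> 1")
      case True
      show ?thesis
      proof (rule main[of q a])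
        have f1: "r * (1 + p ^ 4 * b) \<le> r * 2" using True r1 by (intro mult_left_mono) auto
        have f2: "0 < r * (1 + p ^ 4 * b)" using r1 p1 b0 by (intro mult_pos_pos add_pos_nonneg) auto
        have "12 / (r * 2) \<le> 12 / (r * (1 + p ^ 4 * b))" by (rule frac_le[OF _ order.refl f2 f1]) simp
        moreover have "1 / p \<le> 1 / r" using rp r1 by (intro divide_left_mono) auto
        moreover have "r / p ^ 4 \<le> 1 / r"
        proof -
          have "r * r \<le> p * p" using rp r1 by (intro mult_mono) auto
          then have "r * r \<le> p ^ 4" using p3(3) by (simp add: power2_eq_square)
          then show ?thesis using r1 p1 by (simp add: field_simps)
        qed
        moreover have "12 / (r * 2) = 6 * (1 / r)" "0 \<le> 1 / r" using r1 by simp_all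
        ultimately show "1 / real q + 1 / p + real q / p ^ 4 \<le> 12 / (r * (1 + p ^ 4 * b))"
          unfolding r_def[symmetric] by linarith
        show "q \<le> 3 * P ^ 4"
        proof -
          have "P ^ 1 \<le> P ^ 4" using P by (intro power_increasing) auto
          then show ?thesis using q(2) by simp
        qed
        have "r * r * b \<le> p * (1 / p ^ 3)" using rb rp r1 b0 unfolding mult.assoc by (intro mult_mono) auto
        also have "\<dots> \<le> 1" using p3(1) p1 by (simp add: field_simps)
        finally have "b \<le> 1 / r\<^sup>2" using r1 by (simp add: power2_eq_square field_simps)
        then show "\<bar>\<alpha> - of_int a / real q\<bar> \<le> 1 / (real q)\<^sup>2" by (simp only: b_def r_def)
      qed (use q in auto)
    next
      case False
      define s where "s = r * b"
      have bpos: "b > 0" using False p1 b0 by (cases "b = 0") auto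
      have s0: "s > 0" using bpos r1 by (simp add: s_def)
      have s1: "s \<le> 1 / p ^ 3" using rb by (simp add: s_def)
      have s1': "s \<le> 1" using s1 p3(4) by (smt (verit) divide_le_eq_1)
      \<comment> \<open>Then \<open>1 / N \<le> s / 2\<close>, while \<open>s\<close> is the modulus
        of \<open>q * \<alpha> - a\<close>. The new approximation is therefore strictly better than
        the old one, so \<open>h / k\<close> differs from \<open>a / q\<close>.\<close>
      define N where "N = nat \<lceil>2 / s\<rceil>"
      have N1: "2 / s \<le> real N" by (simp add: N_def real_nat_ceiling_ge)
      have "real N < 2 / s + 1" using s0 by (simp add: N_def) linarith
      also have "\<dots> \<le> 3 / s" using s0 s1' by (simp add: field_simps)
      finally have N2: "real N \<le> 3 / s" by simp
      have "2 / s > 0" using s0 by simp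
      then have N0: "N > 0" using N1 by (cases N) auto
      obtain h k where hk: "coprime h k" "0 < k" "k \<le> int N" "\<bar>of_int k * \<alpha> - of_int h\<bar> < 1 / real N"
        by (rule Dirichlet_approx_coprime[OF N0])
      define m where "m = nat k"
      have m: "m > 0" "int m = k" "m \<le> N" using hk by (auto simp: m_def nat_le_iff)
      have rm: "real m = of_int k" using m(2) by (metis of_int_of_nat_eq)
      have invN: "1 / real N \<le> s / 2" using N1 s0 N0 by (simp add: field_simps)
      have ne: "a * k - h * int q \<noteq> 0"
      proof
        assume z: "a * k - h * int q = 0"
        then have ak: "a * k = h * int q" by simp
        then have "k dvd h * int q" by (metis dvd_triv_right)
        then have "k dvd int q" using hk(1) by (metis coprime_commute coprime_dvd_mult_right_iff)
        moreover have "int q dvd a * k" using ak by simp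
        then have "int q dvd k" using q(3) by (metis coprime_commute coprime_dvd_mult_right_iff)
        ultimately have kq: "k = int q" using hk(2) by (simp add: zdvd_antisym_nonneg)
        then have "h = a" using ak hk(2) by simp
        then have "s < s / 2" using hk(4) invN rb0 kq by (simp add: s_def)
        then show False using s0 by simp
      qed
      \<comment> \<open>A nonzero integer determinant has modulus at least 1. The part with the
        error of \<open>h / k\<close> contributes at most 1/2, because \<open>r \<le> p\<close> and
        \<open>s \<le> 1 / p ^ 3\<close>; this leaves \<open>k * s \<ge> 1 / 2\<close>.\<close>
      have "1 \<le> \<bar>real_of_int (a * k - h * int q)\<bar>" using ne by linarith
      also have "real_of_int (a * k - h * int q) = r * (of_int k * \<alpha> - of_int h) - of_int k * (real q * \<alpha> - of_int a)"
        by (simp add: r_def algebra_simps)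
      also have "\<bar>\<dots>\<bar> \<le> \<bar>r * (of_int k * \<alpha> - of_int h)\<bar> + \<bar>of_int k * (real q * \<alpha> - of_int a)\<bar>"
        by (rule abs_triangle_ineq4)
      also have "\<dots> = r * \<bar>of_int k * \<alpha> - of_int h\<bar> + of_int k * s"
        using r1 hk(2) by (simp add: abs_mult rb0 s_def)
      also have "r * \<bar>of_int k * \<alpha> - of_int h\<bar> \<le> p * ((1 / p ^ 3) / 2)"
        using rp hk(4) invN s1 r1 p1 by (intro mult_mono) auto
      also have "\<dots> \<le> 1 / 2" using p3(1) p1 by (simp add: field_simps)
      finally have ks: "1 / 2 \<le> real m * s" using rm by simp
      have kN: "real m \<le> 3 / s" using m(3) N2 by linarith
      have u: "1 < p ^ 4 * b" using False by simp
      have rs: "s * p ^ 4 = r * (p ^ 4 * b)" by (simp add: s_def)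
      have "1 * 1 \<le> r * (p ^ 4 * b)" by (rule mult_mono[OF r1 less_imp_le[OF u]]) (use r1 in auto)
      then have sp: "1 \<le> s * p ^ 4" by (simp only: rs mult_1)
      have sp0: "0 < s * p ^ 4" using sp by simp
      show ?thesis
      proof (rule main[of m h])
        have "r * (1 + p ^ 4 * b) \<le> r * (2 * (p ^ 4 * b))"
          by (rule mult_left_mono) (use u r1 in linarith)+
        also have "\<dots> = 2 * (s * p ^ 4)" unfolding rs by (rule mult.left_commute)
        finally have f1: "r * (1 + p ^ 4 * b) \<le> 2 * (s * p ^ 4)" .
        have f2: "0 < r * (1 + p ^ 4 * b)" by (rule mult_pos_pos) (use r1 u in linarith)+
        have "12 / (2 * (s * p ^ 4)) \<le> 12 / (r * (1 + p ^ 4 * b))"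
          by (rule frac_le[OF _ order.refl f2 f1]) simp
        moreover have "1 / real m \<le> 2 / (s * p ^ 4)"
        proof -
          have "1 / real m \<le> 2 * s" using ks m(1) by (simp add: field_simps)
          moreover have "s * (s * p ^ 4) \<le> 1"
          proof -
            have "s * (s * p ^ 4) \<le> (1 / p ^ 3) * ((1 / p ^ 3) * p ^ 4)"
              using s1 s0 p1 by (intro mult_mono) auto
            also have "(1 / p ^ 3) * p ^ 4 = p" using p1 by (simp add: power_numeral_reduce)
            also have "(1 / p ^ 3) * p \<le> 1" using p3(1) p1 by simp
            finally show ?thesis .
          qed
          then have "2 * s \<le> 2 / (s * p ^ 4)" using sp0 by (simp add: pos_le_divide_eq)
          ultimately show ?thesis by linarith
        qed
        moreover have "1 / p \<le> 1 / (s * p ^ 4)"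
        proof (rule divide_left_mono)
          have "s * p ^ 4 \<le> (1 / p ^ 3) * p ^ 4" using s1 p1 by (intro mult_right_mono) auto
          then show "s * p ^ 4 \<le> p" using p1 by (simp add: power_numeral_reduce)
        qed (use sp0 p1 in auto)
        moreover have "real m / p ^ 4 \<le> 3 / (s * p ^ 4)"
          using divide_right_mono[OF kN, of "p ^ 4"] p1 by (simp add: mult.commute)
        moreover define A where "A = 1 / (s * p ^ 4)"
        moreover have "12 / (2 * (s * p ^ 4)) = 6 * A" "2 / (s * p ^ 4) = 2 * A" "3 / (s * p ^ 4) = 3 * A"
          by (simp_all add: A_def)
        ultimately show "1 / real m + 1 / p + real m / p ^ 4 \<le> 12 / (r * (1 + p ^ 4 * b))"
          by linarith
        have "3 / s \<le> 3 * p ^ 4" using sp s0 by (simp add: field_simps)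
        then have "real m \<le> real (3 * P ^ 4)" using kN by (simp add: p_def)
        then show "m \<le> 3 * P ^ 4" by (simp only: of_nat_le_iff)
        show "coprime h (int m)" using hk(1) m(2) by simp
        have "\<alpha> - of_int h / real m = (of_int k * \<alpha> - of_int h) / real m"
          using m(1) unfolding rm[symmetric] by (simp add: diff_divide_distrib)
        then have "\<bar>\<alpha> - of_int h / real m\<bar> = \<bar>of_int k * \<alpha> - of_int h\<bar> / real m"
          by (simp only: abs_divide abs_of_nat)
        also have "\<dots> \<le> (1 / real N) / real m" using hk(4) by (intro divide_right_mono) auto
        also have "\<dots> \<le> (1 / real m) / real m" using m by (intro divide_right_mono divide_left_mono) auto
        finally show "\<bar>\<alpha> - of_int h / real m\<bar> \<le> 1 / (real m)\<^sup>2" by (simp add: power2_eq_square)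
      qed (rule m(1))
    qed
  qed
  then show ?thesis using C by (intro exI[of _ "12 * C"]) auto
qed

section \<open>The middle arcs\<close>

text \<open>Comparison with an integral, one mean value theorem per term. The subtracted power on
  the right is the value of the antiderivative at the end, and keeping it makes the induction
  telescope.\<close>

lemma sum_powr_le:
  fixes c \<gamma> :: real
  assumes "c > 0" "\<gamma> > 1"
  shows "(\<Sum>b = 1..n. c * (1 + c * real b) powr (- \<gamma>)) \<le> (1 - (1 + c * real n) powr (1 - \<gamma>)) / (\<gamma> - 1)"
proof (induction n)
  case (Suc n)
  define x y where "x = 1 + c * real n" and "y = 1 + c * real (Suc n)"
  have x: "x > 0" and xy: "x < y" using assms by (auto simp: x_def y_def add_pos_nonneg)
  have "\<exists>z. z > x \<and> z < y \<and> y powr (1 - \<gamma>) - x powr (1 - \<gamma>) = (y - x) * ((1 - \<gamma>) * z powr (1 - \<gamma> - 1))"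
  proof (rule MVT2[OF xy])
    fix t assume "x \<le> t" "t \<le> y"
    then show "((\<lambda>t. t powr (1 - \<gamma>)) has_real_derivative (1 - \<gamma>) * t powr (1 - \<gamma> - 1)) (at t)"
      using x by (intro has_real_derivative_powr) linarith
  qed
  then obtain z where z: "z > x" "z < y" "y powr (1 - \<gamma>) - x powr (1 - \<gamma>) = (y - x) * ((1 - \<gamma>) * z powr (1 - \<gamma> - 1))"
    by blast
  have "y powr (- \<gamma>) \<le> z powr (- \<gamma>)" using z x assms by (intro powr_mono2') auto
  then have "c * y powr (- \<gamma>) \<le> c * z powr (- \<gamma>)" using assms by (intro mult_left_mono) auto
  also have "\<dots> = (x powr (1 - \<gamma>) - y powr (1 - \<gamma>)) / (\<gamma> - 1)"
  proof -
    have "y - x = c" by (simp add: x_def y_def algebra_simps)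
    then have "x powr (1 - \<gamma>) - y powr (1 - \<gamma>) = (\<gamma> - 1) * (c * z powr (- \<gamma>))"
      using z(3) by (simp add: algebra_simps)
    then show ?thesis using assms by simp
  qed
  finally have "c * y powr (- \<gamma>) \<le> (x powr (1 - \<gamma>) - y powr (1 - \<gamma>)) / (\<gamma> - 1)" .
  then show ?case using Suc unfolding x_def y_def by (simp add: diff_divide_distrib)
qed simp

lemma sum_powr_symmetric_le:
  fixes c \<gamma> :: real
  assumes "c > 0" "\<gamma> > 1"
  shows "(\<Sum>b\<in>{- int n..int n}. (1 + c * \<bar>of_int b\<bar>) powr (- \<gamma>)) \<le> 1 + 2 / (c * (\<gamma> - 1))"
proof -
  have "{- int n..int n} = insert 0 ({1..int n} \<union> uminus ` {1..int n})"
    by (auto simp: image_iff)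
  then have "(\<Sum>b\<in>{- int n..int n}. (1 + c * \<bar>of_int b\<bar>) powr (- \<gamma>))
     = 1 + (\<Sum>b\<in>{1..int n} \<union> uminus ` {1..int n}. (1 + c * \<bar>of_int b\<bar>) powr (- \<gamma>))"
    by (simp only:) (subst sum.insert, auto)
  also have "(\<Sum>b\<in>{1..int n} \<union> uminus ` {1..int n}. (1 + c * \<bar>of_int b\<bar>) powr (- \<gamma>))
     = 2 * (\<Sum>b\<in>{1..int n}. (1 + c * \<bar>of_int b\<bar>) powr (- \<gamma>))"
  proof -
    have "(\<Sum>b\<in>uminus ` {1..int n}. (1 + c * \<bar>of_int b\<bar>) powr (- \<gamma>)) = (\<Sum>b\<in>{1..int n}. (1 + c * \<bar>of_int b\<bar>) powr (- \<gamma>))"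
      by (subst sum.reindex) auto
    then show ?thesis by (subst sum.union_disjoint) auto
  qed
  also have "(\<Sum>b\<in>{1..int n}. (1 + c * \<bar>of_int b\<bar>) powr (- \<gamma>)) = (\<Sum>b = 1..n. (1 + c * real b) powr (- \<gamma>))"
    by (rule sum.reindex_bij_witness[where i = int and j = nat]) auto
  also have "\<dots> = (\<Sum>b = 1..n. c * (1 + c * real b) powr (- \<gamma>)) / c"
    using assms by (simp add: sum_distrib_left[symmetric])
  also have "\<dots> \<le> (1 / (\<gamma> - 1)) / c"
  proof (rule divide_right_mono)
    have "(1 - (1 + c * real n) powr (1 - \<gamma>)) / (\<gamma> - 1) \<le> 1 / (\<gamma> - 1)"
      using assms by (intro divide_right_mono) auto
    then show "(\<Sum>b = 1..n. c * (1 + c * real b) powr (- \<gamma>)) \<le> 1 / (\<gamma> - 1)"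
      using sum_powr_le[OF assms, of n] by linarith
  qed (use assms in auto)
  finally show ?thesis by (simp add: mult.commute)
qed

section \<open>Mean squares over residue classes\<close>

definition congr_count :: "nat \<Rightarrow> nat \<Rightarrow> nat" where
  "congr_count P q = card {(x, y) \<in> {1..int P} \<times> {1..int P}. int q dvd x ^ 4 - y ^ 4}"

lemma weyl4_periodic: "weyl4 P (\<alpha> + of_int n) = weyl4 P \<alpha>"
proof -
  have "E ((\<alpha> + of_int n) * of_int (x ^ 4)) = E (\<alpha> * of_int (x ^ 4))" for x
  proof -
    have "(\<alpha> + of_int n) * of_int (x ^ 4) = \<alpha> * of_int (x ^ 4) + of_int (n * x ^ 4)"
      by (simp add: distrib_right)
    then show ?thesis by (simp only: E_add_of_int)
  qed
  then show ?thesis by (simp only: weyl4_def)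
qed

text \<open>The shift \<open>\<beta>\<close> only alters coefficients of modulus 1, so Parseval
  modulo \<open>q\<close> gives a bound uniform in \<open>\<beta>\<close>.\<close>

lemma sum_weyl4_residues_le:
  assumes "q > 0"
  shows "(\<Sum>a\<in>{0..<int q}. (cmod (weyl4 P (of_int a / real q + \<beta>)))\<^sup>2) \<le> real q * real (congr_count P q)"
proof -
  have "weyl4 P (of_int a / real q + \<beta>) = (\<Sum>x\<in>{1..int P}. E (\<beta> * of_int (x ^ 4)) * E (of_int (a * x ^ 4) / of_int (int q)))" for a
    unfolding weyl4_def by (intro sum.cong refl) (simp add: distrib_right mult.commute add.commute flip: E_add)
  then show ?thesis
    using mean_square_le_dvd[of "int q" "{1..int P}" "\<lambda>x. E (\<beta> * of_int (x ^ 4))" "\<lambda>x. x ^ 4"] assms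
    by (simp add: congr_count_def)
qed

lemma sum_UNION_le:
  fixes g :: "'a \<Rightarrow> real"
  assumes "finite K" "\<And>k. k \<in> K \<Longrightarrow> finite (A k)" "\<And>x. g x \<ge> 0"
  shows "sum g (\<Union>k\<in>K. A k) \<le> (\<Sum>k\<in>K. sum g (A k))"
  using assms
proof (induction K)
  case (insert k K)
  have "sum g (A k \<union> (\<Union>k\<in>K. A k)) + sum g (A k \<inter> (\<Union>k\<in>K. A k)) = sum g (A k) + sum g (\<Union>k\<in>K. A k)"
    by (rule sum.union_inter) (use insert in auto)
  moreover have "sum g (A k \<inter> (\<Union>k\<in>K. A k)) \<ge> 0" by (rule sum_nonneg) (rule insert.prems(2))
  ultimately show ?case using insert by simp
qed simp

text \<open>The range consists of \<open>q + 3\<close> consecutive numerators, those which points of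
  \<open>[0, 1)\<close> can have by \<open>dirichlet_arc_range\<close>. Four periods always cover
  it, and for \<open>q = 1\<close> it has exactly four elements.\<close>

lemma sum_weyl4_window_le:
  assumes "q > 0"
  shows "(\<Sum>a\<in>{-1..int q + 1}. (cmod (weyl4 P (of_int a / real q + \<beta>)))\<^sup>2) \<le> 4 * (real q * real (congr_count P q))"
proof -
  define G where "G = (\<lambda>a::int. (cmod (weyl4 P (of_int a / real q + \<beta>)))\<^sup>2)"
  have shift: "(\<Sum>a\<in>{int q * k - 1..<int q * k - 1 + int q}. G a) \<le> real q * real (congr_count P q)" for k
  proof -
    have "(\<Sum>a\<in>{int q * k - 1..<int q * k - 1 + int q}. G a)
      = (\<Sum>a\<in>{0..<int q}. (cmod (weyl4 P (of_int a / real q + (\<beta> - 1 / real q))))\<^sup>2)"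
    proof (rule sum.reindex_bij_witness[where i = "\<lambda>a. a + (int q * k - 1)" and j = "\<lambda>a. a - (int q * k - 1)"])
      fix a assume "a \<in> {int q * k - 1..<int q * k - 1 + int q}"
      have "of_int a / real q + \<beta> = (of_int (a - (int q * k - 1)) / real q + (\<beta> - 1 / real q)) + of_int k"
        using assms by (simp add: field_simps)
      then show "(cmod (weyl4 P (of_int (a - (int q * k - 1)) / real q + (\<beta> - 1 / real q))))\<^sup>2 = G a"
        unfolding G_def by (simp only: weyl4_periodic)
    qed auto
    also have "\<dots> \<le> real q * real (congr_count P q)" by (rule sum_weyl4_residues_le[OF assms])
    finally show ?thesis .
  qed
  have "(\<Sum>a\<in>{-1..int q + 1}. G a) \<le> (\<Sum>a\<in>(\<Union>k\<in>{0..3::int}. {int q * k - 1..<int q * k - 1 + int q}). G a)"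
  proof (rule sum_mono2)
    show "{-1..int q + 1} \<subseteq> (\<Union>k\<in>{0..3::int}. {int q * k - 1..<int q * k - 1 + int q})"
    proof
      fix a assume a: "a \<in> {-1..int q + 1}"
      define k where "k = (a + 1) div int q"
      have k0: "k \<ge> 0" using a assms by (simp add: k_def pos_imp_zdiv_nonneg_iff)
      have m: "a + 1 = int q * k + (a + 1) mod int q" by (simp add: k_def)
      have mm: "0 \<le> (a + 1) mod int q" "(a + 1) mod int q < int q" using assms by auto
      have "k \<le> 3"
      proof (rule ccontr)
        assume "\<not> k \<le> 3"
        then have "int q * 4 \<le> int q * k" using assms by (intro mult_left_mono) auto
        then show False using m mm a assms unfolding atLeastAtMost_iff by linarith
      qed
      then show "a \<in> (\<Union>k\<in>{0..3::int}. {int q * k - 1..<int q * k - 1 + int q})"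
        using k0 m mm by (intro UN_I[of k]) auto
    qed
  qed (auto simp: G_def)
  also have "\<dots> \<le> (\<Sum>k\<in>{0..3::int}. \<Sum>a\<in>{int q * k - 1..<int q * k - 1 + int q}. G a)"
    by (rule sum_UNION_le) (auto simp: G_def)
  also have "\<dots> \<le> (\<Sum>k\<in>{0..3::int}. real q * real (congr_count P q))"
    by (intro sum_mono shift)
  finally show ?thesis by (simp add: G_def)
qed

text \<open>After interchanging the sums, a pair \<open>x \<noteq> y\<close> is counted once for
  every \<open>q\<close> dividing \<open>x ^ 4 - y ^ 4\<close>, hence at most \<open>L\<close>
  times. The diagonal pairs contribute \<open>P\<close> each.\<close>

lemma sum_congr_count_le:
  assumes L: "\<And>n. n \<noteq> 0 \<Longrightarrow> \<bar>n\<bar> \<le> 8 * int P ^ 4 \<Longrightarrow> real (int_divisor_count n) \<le> L" and "L \<ge> 1"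
  shows "(\<Sum>q = 1..P. real (congr_count P q)) \<le> 2 * real P ^ 2 * L"
proof -
  let ?T = "{1..int P} \<times> {1..int P}"
  have "(\<Sum>q = 1..P. real (congr_count P q)) = (\<Sum>q = 1..P. \<Sum>s\<in>?T. if int q dvd fst s ^ 4 - snd s ^ 4 then 1 else 0)"
  proof (rule sum.cong[OF refl])
    fix q
    have "{(x, y) \<in> ?T. int q dvd x ^ 4 - y ^ 4} = {s \<in> ?T. int q dvd fst s ^ 4 - snd s ^ 4}" by auto
    then show "real (congr_count P q) = (\<Sum>s\<in>?T. if int q dvd fst s ^ 4 - snd s ^ 4 then 1 else 0)"
      by (simp add: congr_count_def sum.If_cases Int_def)
  qed
  also have "\<dots> = (\<Sum>s\<in>?T. \<Sum>q = 1..P. if int q dvd fst s ^ 4 - snd s ^ 4 then 1 else 0)"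
    by (rule sum.swap)
  also have "\<dots> \<le> (\<Sum>s\<in>?T. (if fst s = snd s then real P else 0) + L)"
  proof (rule sum_mono)
    fix s assume s: "s \<in> ?T"
    have "(\<Sum>q = 1..P. if int q dvd fst s ^ 4 - snd s ^ 4 then 1 else (0::real)) = real (card {q\<in>{1..P}. int q dvd fst s ^ 4 - snd s ^ 4})"
      by (simp add: sum.If_cases Int_def)
    also have "\<dots> \<le> (if fst s = snd s then real P else 0) + L"
    proof (cases "fst s = snd s")
      case True
      have "card {q\<in>{1..P}. int q dvd fst s ^ 4 - snd s ^ 4} \<le> card {1..P}" by (rule card_mono) auto
      then show ?thesis using True \<open>L \<ge> 1\<close> by simp
    next
      case False
      have pos: "fst s \<in> {1..int P}" "snd s \<in> {1..int P}" using s by auto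
      have n0: "fst s ^ 4 - snd s ^ 4 \<noteq> 0"
      proof
        assume "fst s ^ 4 - snd s ^ 4 = 0"
        then have "fst s ^ 4 = snd s ^ 4" "fst s \<ge> 0" "snd s \<ge> 0" using pos by auto
        then have "fst s = snd s" using power_eq_imp_eq_base[of "fst s" 4 "snd s"] by simp
        with False show False ..
      qed
      have "card {q\<in>{1..P}. int q dvd fst s ^ 4 - snd s ^ 4} = card (int ` {q\<in>{1..P}. int q dvd fst s ^ 4 - snd s ^ 4})"
        by (simp add: card_image)
      also have "\<dots> \<le> int_divisor_count (fst s ^ 4 - snd s ^ 4)"
        unfolding int_divisor_count_def by (rule card_mono[OF finite_int_divisors[OF n0]]) auto
      finally have c: "card {q\<in>{1..P}. int q dvd fst s ^ 4 - snd s ^ 4} \<le> int_divisor_count (fst s ^ 4 - snd s ^ 4)" .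
      have "\<bar>fst s ^ 4 - snd s ^ 4\<bar> \<le> 8 * int P ^ 4" using pow4_le[OF pos(1)] pow4_le[OF pos(2)] by linarith
      from L[OF n0 this] of_nat_mono[OF c, where 'a = real] show ?thesis using False by simp
    qed
    finally show "(\<Sum>q = 1..P. if int q dvd fst s ^ 4 - snd s ^ 4 then 1 else (0::real)) \<le> (if fst s = snd s then real P else 0) + L" .
  qed
  also have "\<dots> = (\<Sum>x\<in>{1..int P}. \<Sum>y\<in>{1..int P}. (if x = y then real P else 0) + L)"
    by (simp add: sum.cartesian_product case_prod_unfold)
  also have "\<dots> = real P ^ 2 * (1 + L)"
    by (simp add: sum.distrib algebra_simps power2_eq_square)
  also have "\<dots> \<le> real P ^ 2 * (2 * L)" using \<open>L \<ge> 1\<close> by (intro mult_left_mono) auto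
  finally show ?thesis by simp
qed

text \<open>Unlike in \<open>dirichlet_arc\<close> the width does not depend on \<open>q\<close>.
  Therefore one and the same sum of the model over the window can be factored out of the
  contributions of all fractions.\<close>

definition major_arc :: "nat \<Rightarrow> real \<Rightarrow> real \<Rightarrow> bool" where
  "major_arc P R \<alpha> \<longleftrightarrow> (\<exists>q a. 0 < q \<and> real q \<le> R \<and> coprime a (int q) \<and> \<bar>\<alpha> - of_int a / real q\<bar> \<le> R / real P ^ 4)"

text \<open>What remains of the power -11/8 of \<open>q * (1 + P ^ 4 * \<bar>\<beta>\<bar>)\<close>
  once the gain from being off the major arcs is split off. The exponent 5/4 exceeds 1, so the
  weights are summable over \<open>\<beta>\<close>, and \<open>1 / q\<close> cancels the modulus in
  \<open>sum_weyl4_residues_le\<close>.\<close>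

definition arc_weight :: "nat \<Rightarrow> nat \<Rightarrow> real \<Rightarrow> real" where
  "arc_weight P q \<beta> = (1 + real P ^ 4 * \<bar>\<beta>\<bar>) powr (- (5/4)) / real q"

lemma dirichlet_arc_close:
  assumes "P > 0" "dirichlet_arc P \<alpha> q a"
  shows "\<bar>\<alpha> - of_int a / real q\<bar> \<le> 1"
proof -
  have q: "q > 0" and Qa: "\<bar>real q * \<alpha> - of_int a\<bar> \<le> 1 / real P ^ 3" using assms(2) by (auto simp: dirichlet_arc_def)
  have "\<alpha> - of_int a / real q = (real q * \<alpha> - of_int a) / real q" using q by (simp add: diff_divide_distrib)
  then have "\<bar>\<alpha> - of_int a / real q\<bar> = \<bar>real q * \<alpha> - of_int a\<bar> / real q" by (simp only: abs_divide abs_of_nat)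
  also have "\<dots> \<le> \<bar>real q * \<alpha> - of_int a\<bar> / 1" by (rule divide_left_mono) (use q in auto)
  also have "\<dots> \<le> 1 / real P ^ 3" using Qa by simp
  also have "\<dots> \<le> 1" using assms(1) by (simp add: one_le_power)
  finally show ?thesis .
qed

lemma dirichlet_arc_range:
  assumes "P > 0" "dirichlet_arc P \<alpha> q a" "0 \<le> \<alpha>" "\<alpha> < 1"
  shows "a \<in> {-1..int q + 1}"
proof -
  have q: "q > 0" and Qa: "\<bar>real q * \<alpha> - of_int a\<bar> \<le> 1 / real P ^ 3" using assms(2) by (auto simp: dirichlet_arc_def)
  have "1 / real P ^ 3 \<le> 1" using assms(1) by (simp add: one_le_power)
  then have d: "\<bar>real q * \<alpha> - of_int a\<bar> \<le> 1" using Qa by linarith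
  have "0 \<le> real q * \<alpha>" "real q * \<alpha> \<le> real q * 1" using q assms(3,4) by (auto intro: mult_left_mono)
  then have "- 1 \<le> (of_int a :: real)" "of_int a \<le> real q + 1" using d by linarith+
  then show ?thesis by auto
qed

text \<open>Because \<open>q\<close> divides \<open>M\<close>, each centre lies on the grid and the
  distance to it is \<open>b / M\<close> with \<open>b\<close> an integer. For fixed
  \<open>b\<close> the weight does not involve \<open>a\<close>, so the sum over \<open>a\<close>
  becomes a mean square over residues; the sum over \<open>b\<close> then costs a multiple of
  \<open>M / P ^ 4\<close>.\<close>

lemma middle_sum_le:
  fixes M :: int
  assumes P: "P > 0" and M: "int P ^ 4 \<le> M" and dvd: "\<And>q. q \<in> {1..P} \<Longrightarrow> int q dvd M"
  shows "(\<Sum>q = 1..P. \<Sum>a\<in>{-1..int q + 1}. \<Sum>j\<in>{j\<in>{0..<M}. dirichlet_arc P (of_int j / of_int M) q a}.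
           arc_weight P q (of_int j / of_int M - of_int a / real q) * (cmod (weyl4 P (of_int j / of_int M)))\<^sup>2)
     \<le> 36 * of_int M / real P ^ 4 * (\<Sum>q = 1..P. real (congr_count P q))"
proof -
  define c where "c = real P ^ 4 / of_int M"
  have "int P ^ 4 > 0" using P by simp
  then have M0: "M > 0" using M by linarith
  have M0': "(of_int M :: real) > 0" using M0 by simp
  have c0: "c > 0" using M0' P by (simp add: c_def)
  have PM: "real P ^ 4 \<le> of_int M"
  proof -
    have "real_of_int (int P ^ 4) \<le> of_int M" using M by (simp only: of_int_le_iff)
    then show ?thesis by simp
  qed
  define B where "B = {- int (nat M)..int (nat M)}"
  define h where "h = (\<lambda>b::int. (1 + c * \<bar>of_int b\<bar>) powr (- (5/4)))"
  have h0: "h b \<ge> 0" for b by (simp add: h_def)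
  have sumh: "(\<Sum>b\<in>B. h b) \<le> 9 * of_int M / real P ^ 4"
  proof -
    have "(\<Sum>b\<in>B. h b) \<le> 1 + 2 / (c * (5/4 - 1))"
      unfolding B_def h_def by (rule sum_powr_symmetric_le[OF c0]) simp
    also have "\<dots> = 1 + 8 * of_int M / real P ^ 4" using P M0' by (simp add: c_def field_simps)
    also have "1 \<le> of_int M / real P ^ 4" using PM P by simp
    finally show ?thesis by simp
  qed
  have one: "(\<Sum>a\<in>{-1..int q + 1}. \<Sum>j\<in>{j\<in>{0..<M}. dirichlet_arc P (of_int j / of_int M) q a}.
           arc_weight P q (of_int j / of_int M - of_int a / real q) * (cmod (weyl4 P (of_int j / of_int M)))\<^sup>2)
     \<le> 36 * of_int M / real P ^ 4 * real (congr_count P q)" if q: "q \<in> {1..P}" for q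
  proof -
    have q0: "q > 0" using q by simp
    obtain k where k: "M = int q * k" using dvd[OF q] by auto
    define H where "H = (\<lambda>a b::int. h b / real q * (cmod (weyl4 P (of_int a / real q + of_int b / of_int M)))\<^sup>2)"
    have "(\<Sum>j\<in>{j\<in>{0..<M}. dirichlet_arc P (of_int j / of_int M) q a}.
           arc_weight P q (of_int j / of_int M - of_int a / real q) * (cmod (weyl4 P (of_int j / of_int M)))\<^sup>2)
       \<le> (\<Sum>b\<in>B. H a b)" for a
    proof -
      let ?J = "{j\<in>{0..<M}. dirichlet_arc P (of_int j / of_int M) q a}"
      have eq: "of_int j / of_int M - of_int a / real q = real_of_int (j - a * k) / of_int M" for j
      proof -
        have "k \<noteq> 0" "q \<noteq> 0" using k M0 q0 by auto
        then show ?thesis by (simp add: k field_simps)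
      qed
      have "(\<Sum>j\<in>?J. arc_weight P q (of_int j / of_int M - of_int a / real q) * (cmod (weyl4 P (of_int j / of_int M)))\<^sup>2)
         = (\<Sum>j\<in>?J. H a (j - a * k))"
      proof (rule sum.cong[OF refl])
        fix j
        have 1: "of_int a / real q + real_of_int (j - a * k) / of_int M = of_int j / of_int M"
          using eq[of j] by linarith
        have 2: "arc_weight P q (of_int j / of_int M - of_int a / real q) = h (j - a * k) / real q"
          unfolding eq arc_weight_def h_def c_def using M0' by (simp add: abs_divide)
        show "arc_weight P q (of_int j / of_int M - of_int a / real q) * (cmod (weyl4 P (of_int j / of_int M)))\<^sup>2 = H a (j - a * k)"
          unfolding H_def 1 2 by (rule refl)
      qed
      also have "\<dots> = (\<Sum>b\<in>(\<lambda>j. j - a * k) ` ?J. H a b)"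
        by (subst sum.reindex) (auto simp: inj_on_def)
      also have "\<dots> \<le> (\<Sum>b\<in>B. H a b)"
      proof (rule sum_mono2)
        show "(\<lambda>j. j - a * k) ` ?J \<subseteq> B"
        proof (rule image_subsetI)
          fix j assume "j \<in> ?J"
          then have "\<bar>of_int j / of_int M - of_int a / real q\<bar> \<le> 1" using dirichlet_arc_close[OF P] by auto
          then have "\<bar>real_of_int (j - a * k)\<bar> \<le> of_int M" unfolding eq using M0' by (simp add: abs_divide)
          then have "\<bar>j - a * k\<bar> \<le> M" by linarith
          then show "j - a * k \<in> B" using M0 by (auto simp: B_def)
        qed
      qed (auto simp: B_def H_def h0)
      finally show ?thesis .
    qed
    then have "(\<Sum>a\<in>{-1..int q + 1}. \<Sum>j\<in>{j\<in>{0..<M}. dirichlet_arc P (of_int j / of_int M) q a}.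
           arc_weight P q (of_int j / of_int M - of_int a / real q) * (cmod (weyl4 P (of_int j / of_int M)))\<^sup>2)
      \<le> (\<Sum>a\<in>{-1..int q + 1}. \<Sum>b\<in>B. H a b)" by (rule sum_mono)
    also have "\<dots> = (\<Sum>b\<in>B. h b / real q * (\<Sum>a\<in>{-1..int q + 1}. (cmod (weyl4 P (of_int a / real q + of_int b / of_int M)))\<^sup>2))"
      by (subst sum.swap) (simp add: H_def sum_distrib_left)
    also have "\<dots> \<le> (\<Sum>b\<in>B. h b / real q * (4 * (real q * real (congr_count P q))))"
      by (intro sum_mono mult_left_mono sum_weyl4_window_le[OF q0]) (simp add: h0)
    also have "\<dots> = (\<Sum>b\<in>B. h b) * (4 * real (congr_count P q))"
      using q0 by (simp add: sum_distrib_right)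
    also have "\<dots> \<le> (9 * of_int M / real P ^ 4) * (4 * real (congr_count P q))"
      by (rule mult_right_mono[OF sumh]) simp
    finally show ?thesis by simp
  qed
  have "(\<Sum>q = 1..P. \<Sum>a\<in>{-1..int q + 1}. \<Sum>j\<in>{j\<in>{0..<M}. dirichlet_arc P (of_int j / of_int M) q a}.
           arc_weight P q (of_int j / of_int M - of_int a / real q) * (cmod (weyl4 P (of_int j / of_int M)))\<^sup>2)
     \<le> (\<Sum>q = 1..P. 36 * of_int M / real P ^ 4 * real (congr_count P q))"
    by (rule sum_mono) (rule one)
  then show ?thesis by (simp add: sum_distrib_left)
qed

lemma powr_mult_mult_divide:
  fixes C Y D g :: real
  assumes "C > 0" "Y \<ge> 0" "D > 0"
  shows "(C * Y / D) powr g = C powr g * Y powr g * D powr (- g)"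
  using assms by (simp add: powr_mult powr_divide powr_minus_divide)

text \<open>Two factors are kept, eleven are bounded by \<open>weyl_major\<close> and the rest by
  \<open>P\<close>. The eleven give the power -11/8 of
  \<open>D = q * (1 + P ^ 4 * \<bar>\<beta>\<bar>)\<close>, split as 5/4 + 1/8: the first part goes
  into the arc weight, the second yields \<open>R powr (- (1/8))\<close>, since
  \<open>D \<ge> R\<close> off the major arcs.\<close>

lemma weyl4_middle_pointwise:
  assumes "\<epsilon> > 0"
  shows "\<exists>C>0. \<forall>P \<alpha> R q a s. P > 0 \<longrightarrow> R \<ge> 1 \<longrightarrow> 13 \<le> s \<longrightarrow> dirichlet_arc P \<alpha> q a \<longrightarrow> \<not> major_arc P R \<alpha> \<longrightarrow>
     (cmod (weyl4 P \<alpha>)) ^ s \<le> C * real P powr (real s - 2 + \<epsilon>) * R powr (- (1/8)) *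
        (arc_weight P q (\<alpha> - of_int a / real q) * (cmod (weyl4 P \<alpha>))\<^sup>2)"
proof -
  \<comment> \<open>Raising to the power 11/8 turns this into \<open>\<epsilon>\<close>.\<close>
  define e1 where "e1 = 8 / 11 * \<epsilon>"
  have e1: "e1 > 0" using assms by (simp add: e1_def)
  obtain C where C: "C > 0" and W: "\<And>P q a \<alpha>. P > 0 \<Longrightarrow> dirichlet_arc P \<alpha> q a \<Longrightarrow>
      (cmod (weyl4 P \<alpha>)) ^ 8 \<le> C * real P powr (8 + e1) / (real q * (1 + real P ^ 4 * \<bar>\<alpha> - of_int a / real q\<bar>))"
    using weyl_major[OF e1] by blast
  have "(cmod (weyl4 P \<alpha>)) ^ s \<le> C powr (11/8) * real P powr (real s - 2 + \<epsilon>) * R powr (- (1/8)) *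
        (arc_weight P q (\<alpha> - of_int a / real q) * (cmod (weyl4 P \<alpha>))\<^sup>2)"
    if P: "P > 0" and R: "R \<ge> 1" and s: "13 \<le> s" and Q: "dirichlet_arc P \<alpha> q a" and nM: "\<not> major_arc P R \<alpha>" for P \<alpha> R q a s
  proof -
    define w where "w = cmod (weyl4 P \<alpha>)"
    define b where "b = \<bar>\<alpha> - of_int a / real q\<bar>"
    define u where "u = 1 + real P ^ 4 * b"
    define D where "D = real q * u"
    have q: "q > 0" "coprime a (int q)" using Q by (auto simp: dirichlet_arc_def)
    have w0: "w \<ge> 0" "w \<le> real P" using norm_weyl4_le by (auto simp: w_def)
    have b0: "b \<ge> 0" by (simp add: b_def)
    have u1: "u \<ge> 1" using b0 by (simp add: u_def)
    have q1: "real q \<ge> 1" using q by simp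
    have DR: "D \<ge> R"
    proof (rule ccontr)
      assume "\<not> D \<ge> R"
      then have DR: "D < R" by simp
      have "real q * 1 \<le> D" unfolding D_def using u1 by (intro mult_left_mono) auto
      then have "real q \<le> R" using DR by simp
      have "1 * u \<le> D" unfolding D_def using q1 u1 by (intro mult_right_mono) auto
      then have "real P ^ 4 * b \<le> R" using DR by (simp add: u_def)
      then have "b \<le> R / real P ^ 4" using P by (simp add: pos_le_divide_eq mult.commute)
      then have "major_arc P R \<alpha>" unfolding major_arc_def using q \<open>real q \<le> R\<close> unfolding b_def by blast
      with nM show False ..
    qed
    have D1: "D \<ge> 1" using DR R by linarith
    have w8: "w ^ 8 \<le> C * real P powr (8 + e1) / D"
      using W[OF P Q] unfolding w_def D_def u_def b_def .
    have "w ^ 11 = (w ^ 8) powr (11/8)"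
    proof (cases "w = 0")
      case False
      then have "w > 0" using w0 by simp
      have "w ^ 8 = w powr 8" "w ^ 11 = w powr 11" using \<open>w > 0\<close> by simp_all
      moreover have "(w powr 8) powr (11/8) = w powr (8 * (11/8))" by (rule powr_powr)
      moreover have "8 * (11/8) = (11::real)" by simp
      ultimately show ?thesis by (simp only:)
    qed simp
    also have "\<dots> \<le> (C * real P powr (8 + e1) / D) powr (11/8)"
      using w8 w0 by (intro powr_mono2) auto
    also have "\<dots> = C powr (11/8) * real P powr (11 + \<epsilon>) * D powr (- (11/8))"
    proof -
      have "(8 + e1) * (11/8) = 11 + \<epsilon>" by (simp add: e1_def algebra_simps)
      then have "(real P powr (8 + e1)) powr (11/8) = real P powr (11 + \<epsilon>)"
        by (simp only: powr_powr)
      moreover have "(C * real P powr (8 + e1) / D) powr (11/8)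
          = C powr (11/8) * (real P powr (8 + e1)) powr (11/8) * D powr (- (11/8))"
        by (rule powr_mult_mult_divide) (use C D1 in auto)
      ultimately show ?thesis by (simp only:)
    qed
    also have "D powr (- (11/8)) \<le> R powr (- (1/8)) * (u powr (- (5/4)) / real q)"
    proof -
      have "D powr (- (11/8)) = D powr (- (1/8)) * D powr (- (5/4))" by (simp flip: powr_add)
      also have "\<dots> \<le> R powr (- (1/8)) * (u powr (- (5/4)) / real q)"
      proof (rule mult_mono)
        show "D powr (- (1/8)) \<le> R powr (- (1/8))" using DR R by (intro powr_mono2') auto
        have "real q powr (- (5/4)) \<le> real q powr (- 1)" using q1 by (intro powr_mono) auto
        also have "\<dots> = 1 / real q" using q1 by (simp add: powr_minus_divide)
        finally have qq: "real q powr (- (5/4)) \<le> 1 / real q" .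
        have "D powr (- (5/4)) = u powr (- (5/4)) * real q powr (- (5/4))"
          using u1 q1 by (simp add: D_def powr_mult mult.commute)
        also have "\<dots> \<le> u powr (- (5/4)) * (1 / real q)" by (rule mult_left_mono[OF qq]) simp
        finally show "D powr (- (5/4)) \<le> u powr (- (5/4)) / real q" by simp
      qed auto
      finally show ?thesis .
    qed
    also have "u powr (- (5/4)) / real q = arc_weight P q (\<alpha> - of_int a / real q)"
      by (simp add: arc_weight_def u_def b_def)
    finally have w11: "w ^ 11 \<le> C powr (11/8) * real P powr (11 + \<epsilon>) * (R powr (- (1/8)) * arc_weight P q (\<alpha> - of_int a / real q))"
      using C by (simp add: mult_left_mono)
    obtain d where d: "s = 13 + d" using s le_Suc_ex by blast
    have "w ^ s = w ^ d * w ^ 11 * w\<^sup>2" by (simp add: d power_add)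
    also have "\<dots> \<le> real P ^ d * (C powr (11/8) * real P powr (11 + \<epsilon>) * (R powr (- (1/8)) * arc_weight P q (\<alpha> - of_int a / real q))) * w\<^sup>2"
      using w0 by (intro mult_right_mono mult_mono power_mono w11) auto
    also have "\<dots> = C powr (11/8) * (real P ^ d * real P powr (11 + \<epsilon>)) * R powr (- (1/8)) *
        (arc_weight P q (\<alpha> - of_int a / real q) * w\<^sup>2)" by (simp add: mult_ac)
    also have "real P ^ d * real P powr (11 + \<epsilon>) = real P powr (real s - 2 + \<epsilon>)"
    proof -
      have "real P ^ d = real P powr real d" using P by (simp add: powr_realpow)
      moreover have "real d + (11 + \<epsilon>) = real s - 2 + \<epsilon>" by (simp add: d)
      ultimately show ?thesis by (simp only: powr_add[symmetric])
    qed
    finally show ?thesis by (simp add: w_def)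
  qed
  moreover have "C powr (11/8) > 0" using C by simp
  ultimately show ?thesis by blast
qed

text \<open>Power count: \<open>P powr (s - 2)\<close> from the pointwise bound,
  \<open>P powr (- 4)\<close> from summing the weights, and \<open>P ^ 2\<close> from the average of
  \<open>congr_count\<close>. Arcs may overlap, but all terms are nonnegative, so summing over every
  arc that contains a point is only generous.\<close>

lemma weyl4_middle:
  assumes "\<epsilon> > 0"
  shows "\<exists>C>0. \<forall>P R s. \<forall>M::int. P > 0 \<longrightarrow> R \<ge> 1 \<longrightarrow> 13 \<le> s \<longrightarrow> int P ^ 4 \<le> M \<longrightarrow> (\<forall>q\<in>{1..P}. int q dvd M) \<longrightarrow>
     (\<Sum>j\<in>{j\<in>{0..<M}. (\<exists>q a. dirichlet_arc P (of_int j / of_int M) q a) \<and> \<not> major_arc P R (of_int j / of_int M)}.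
        (cmod (weyl4 P (of_int j / of_int M))) ^ s)
      \<le> C * of_int M * real P powr (real s - 4 + \<epsilon>) * R powr (- (1/8))"
proof -
  obtain C where C: "C > 0" and W: "\<And>P \<alpha> R q a s. P > 0 \<Longrightarrow> R \<ge> 1 \<Longrightarrow> 13 \<le> s \<Longrightarrow> dirichlet_arc P \<alpha> q a \<Longrightarrow> \<not> major_arc P R \<alpha> \<Longrightarrow>
     (cmod (weyl4 P \<alpha>)) ^ s \<le> C * real P powr (real s - 2 + \<epsilon>/2) * R powr (- (1/8)) *
        (arc_weight P q (\<alpha> - of_int a / real q) * (cmod (weyl4 P \<alpha>))\<^sup>2)"
    using weyl4_middle_pointwise[of "\<epsilon>/2"] assms by auto
  obtain D where D: "D \<ge> 1" "\<And>P n. P > 0 \<Longrightarrow> n \<noteq> 0 \<Longrightarrow> \<bar>n\<bar> \<le> 8 * int P ^ 4 \<Longrightarrow> real (int_divisor_count n) \<le> D * real P powr (\<epsilon>/2)"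
    using int_divisor_count_le_ge1[of "\<epsilon>/2" 8] assms by auto
  have "(\<Sum>j\<in>{j\<in>{0..<M}. (\<exists>q a. dirichlet_arc P (of_int j / of_int M) q a) \<and> \<not> major_arc P R (of_int j / of_int M)}.
        (cmod (weyl4 P (of_int j / of_int M))) ^ s)
      \<le> (72 * C * D) * of_int M * real P powr (real s - 4 + \<epsilon>) * R powr (- (1/8))"
    if P: "P > 0" and R: "R \<ge> 1" and s: "13 \<le> s" and M: "int P ^ 4 \<le> M" and dvd: "\<And>q. q \<in> {1..P} \<Longrightarrow> int q dvd M"
    for P R s and M :: int
  proof -
    define J where "J = {j\<in>{0..<M}. (\<exists>q a. dirichlet_arc P (of_int j / of_int M) q a) \<and> \<not> major_arc P R (of_int j / of_int M)}"
    define K where "K = C * real P powr (real s - 2 + \<epsilon>/2) * R powr (- (1/8))"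
    define g where "g = (\<lambda>q a (j::int). if dirichlet_arc P (of_int j / of_int M) q a then
        arc_weight P q (of_int j / of_int M - of_int a / real q) * (cmod (weyl4 P (of_int j / of_int M)))\<^sup>2 else 0)"
    have K0: "K \<ge> 0" using C by (simp add: K_def)
    have g0: "g q a j \<ge> 0" for q a j by (simp add: g_def arc_weight_def)
    have M0: "M > 0" using M P by (smt (verit) of_nat_0_less_iff zero_less_power)
    have "(\<Sum>j\<in>J. (cmod (weyl4 P (of_int j / of_int M))) ^ s) \<le> (\<Sum>j\<in>J. K * (\<Sum>q = 1..P. \<Sum>a\<in>{-1..int q + 1}. g q a j))"
    proof (rule sum_mono)
      fix j assume j: "j \<in> J"
      then obtain q a where Q: "dirichlet_arc P (of_int j / of_int M) q a" by (auto simp: J_def)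
      have qP: "q \<in> {1..P}" using Q by (auto simp: dirichlet_arc_def)
      have nm: "\<not> major_arc P R (of_int j / of_int M)" using j by (simp add: J_def)
      have ar: "a \<in> {-1..int q + 1}" by (rule dirichlet_arc_range[OF P Q]) (use j M0 in \<open>auto simp: J_def\<close>)
      have "(cmod (weyl4 P (of_int j / of_int M))) ^ s \<le> K * g q a j"
        using W[OF P R s Q nm] Q by (simp add: K_def g_def)
      also have "g q a j \<le> (\<Sum>a\<in>{-1..int q + 1}. g q a j)"
        by (rule member_le_sum[OF ar]) (auto simp: g0)
      also have "\<dots> \<le> (\<Sum>q = 1..P. \<Sum>a\<in>{-1..int q + 1}. g q a j)"
        by (rule member_le_sum[OF qP]) (auto intro!: sum_nonneg simp: g0)
      finally show "(cmod (weyl4 P (of_int j / of_int M))) ^ s \<le> K * (\<Sum>q = 1..P. \<Sum>a\<in>{-1..int q + 1}. g q a j)"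
        using K0 by (simp add: mult_left_mono)
    qed
    also have "\<dots> = K * (\<Sum>j\<in>J. \<Sum>q = 1..P. \<Sum>a\<in>{-1..int q + 1}. g q a j)" by (simp add: sum_distrib_left)
    also have "(\<Sum>j\<in>J. \<Sum>q = 1..P. \<Sum>a\<in>{-1..int q + 1}. g q a j) \<le> (\<Sum>j\<in>{0..<M}. \<Sum>q = 1..P. \<Sum>a\<in>{-1..int q + 1}. g q a j)"
      by (rule sum_mono2) (auto intro!: sum_nonneg simp: g0 J_def)
    also have "\<dots> = (\<Sum>q = 1..P. \<Sum>j\<in>{0..<M}. \<Sum>a\<in>{-1..int q + 1}. g q a j)" by (rule sum.swap)
    also have "\<dots> = (\<Sum>q = 1..P. \<Sum>a\<in>{-1..int q + 1}. \<Sum>j\<in>{0..<M}. g q a j)" by (intro sum.cong refl sum.swap)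
    also have "\<dots> = (\<Sum>q = 1..P. \<Sum>a\<in>{-1..int q + 1}. \<Sum>j\<in>{j\<in>{0..<M}. dirichlet_arc P (of_int j / of_int M) q a}.
           arc_weight P q (of_int j / of_int M - of_int a / real q) * (cmod (weyl4 P (of_int j / of_int M)))\<^sup>2)"
      unfolding g_def by (intro sum.cong[OF refl] sum.inter_filter[symmetric]) simp
    also have "\<dots> \<le> 36 * of_int M / real P ^ 4 * (\<Sum>q = 1..P. real (congr_count P q))"
      by (rule middle_sum_le[OF P M dvd])
    also have "(\<Sum>q = 1..P. real (congr_count P q)) \<le> 2 * real P ^ 2 * (D * real P powr (\<epsilon>/2))"
    proof (rule sum_congr_count_le)
      show "real (int_divisor_count n) \<le> D * real P powr (\<epsilon>/2)" if "n \<noteq> 0" "\<bar>n\<bar> \<le> 8 * int P ^ 4" for n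
        by (rule D(2)[OF P that])
      have "1 * 1 \<le> D * real P powr (\<epsilon>/2)" by (rule mult_mono[OF D(1) one_le_powr[OF P]]) (use assms D(1) in auto)
      then show "1 \<le> D * real P powr (\<epsilon>/2)" by simp
    qed
    finally have "(\<Sum>j\<in>J. (cmod (weyl4 P (of_int j / of_int M))) ^ s)
       \<le> K * (36 * of_int M / real P ^ 4 * (2 * real P ^ 2 * (D * real P powr (\<epsilon>/2))))"
      using K0 M0 by (simp add: mult_left_mono divide_right_mono)
    also have "\<dots> = (72 * C * D) * of_int M * (real P powr (real s - 2 + \<epsilon>/2) * real P powr (\<epsilon>/2) * (real P ^ 2 / real P ^ 4)) * R powr (- (1/8))"
      by (simp add: K_def)
    also have "real P ^ 2 / real P ^ 4 = real P powr (- 2)"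
      using P by (simp add: powr_minus_divide power_numeral_reduce flip: powr_realpow)
    also have "real P powr (real s - 2 + \<epsilon>/2) * real P powr (\<epsilon>/2) * real P powr (- 2) = real P powr (real s - 4 + \<epsilon>)"
    proof -
      have "(real s - 2 + \<epsilon>/2) + \<epsilon>/2 + (- 2) = real s - 4 + \<epsilon>" by simp
      then show ?thesis by (simp only: powr_add[symmetric])
    qed
    finally show ?thesis by (simp add: J_def)
  qed
  moreover have "72 * C * D > 0" using C D(1) by simp
  ultimately show ?thesis by blast
qed

section \<open>Coefficients of powers of 1 - z\<close>

text \<open>The finitely many ratios at which the eventual bound may fail are added to the
  constant.\<close>

lemma bigo_nat_imp_bound:
  fixes f g :: "nat \<Rightarrow> real"
  assumes "f \<in> O(g)" "\<And>n. n \<ge> 1 \<Longrightarrow> g n > 0"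
  shows "\<exists>C>0. \<forall>n\<ge>1. \<bar>f n\<bar> \<le> C * g n"
proof -
  obtain c where c: "c > 0" "eventually (\<lambda>n. \<bar>f n\<bar> \<le> c * \<bar>g n\<bar>) sequentially"
    using assms(1) by (auto elim!: landau_o.bigE)
  then obtain N where N: "\<And>n. n \<ge> N \<Longrightarrow> \<bar>f n\<bar> \<le> c * \<bar>g n\<bar>" by (auto simp: eventually_sequentially)
  define C where "C = c + (\<Sum>n\<in>{1..N}. \<bar>f n\<bar> / g n)"
  have nn: "0 \<le> \<bar>f n\<bar> / g n" if "n \<ge> 1" for n using assms(2)[OF that] by simp
  have s0: "(\<Sum>n\<in>{1..N}. \<bar>f n\<bar> / g n) \<ge> 0" by (rule sum_nonneg) (use nn in auto)
  have "\<bar>f n\<bar> \<le> C * g n" if n: "n \<ge> 1" for n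
  proof (cases "n \<ge> N")
    case True
    have "c * g n \<le> C * g n" using s0 assms(2)[OF n] by (intro mult_right_mono) (auto simp: C_def)
    then show ?thesis using N[OF True] assms(2)[OF n] by (simp only: abs_of_pos)
  next
    case False
    have "\<bar>f n\<bar> / g n \<le> (\<Sum>n\<in>{1..N}. \<bar>f n\<bar> / g n)"
      by (rule member_le_sum) (use False n nn in auto)
    then have "\<bar>f n\<bar> / g n \<le> C" using c(1) by (simp add: C_def)
    then show ?thesis using assms(2)[OF n] by (simp add: pos_divide_le_eq)
  qed
  moreover have "C > 0" using c(1) s0 by (simp add: C_def)
  ultimately show ?thesis by blast
qed

text \<open>The coefficients of \<open>(1 - x) powr (- z)\<close>. As these multiply like powers, a model of the Weyl sum
  with the coefficients for \<open>z = 1/4\<close> has powers with explicit coefficients, and no singular integral is needed.\<close>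

definition poch_coeff :: "real \<Rightarrow> nat \<Rightarrow> real" where
  "poch_coeff z n = pochhammer z n / fact n"

lemma poch_coeff_pos: "z > 0 \<Longrightarrow> poch_coeff z n > 0"
  by (simp add: poch_coeff_def pochhammer_pos)

lemma poch_coeff_0 [simp]: "poch_coeff z 0 = 1"
  by (simp add: poch_coeff_def)

lemma poch_coeff_Suc: "poch_coeff z (Suc n) = poch_coeff z n * ((z + real n) / real (Suc n))"
  by (simp add: poch_coeff_def pochhammer_Suc)

text \<open>Taking partial sums of coefficients is multiplication of the generating function by
  \<open>1 / (1 - x)\<close>, which raises the exponent from \<open>z\<close> to
  \<open>z + 1\<close>.\<close>

lemma sum_poch_coeff: "(\<Sum>m\<le>t. poch_coeff z m) = poch_coeff (z + 1) t"
proof (induction t)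
  case (Suc t)
  have "poch_coeff z (Suc t) = poch_coeff (z + 1) t * (z / real (Suc t))"
    by (simp add: poch_coeff_def pochhammer_rec mult.commute)
  then have "poch_coeff (z + 1) t + poch_coeff z (Suc t) = poch_coeff (z + 1) t * (1 + z / real (Suc t))"
    by (simp add: distrib_left)
  also have "1 + z / real (Suc t) = (z + 1 + real t) / real (Suc t)" by (simp add: field_simps)
  finally show ?case using Suc poch_coeff_Suc[of "z + 1" t] by simp
qed simp

lemma poch_coeff_convolution: "(\<Sum>i\<le>n. poch_coeff z i * poch_coeff w (n - i)) = poch_coeff (z + w) n"
proof -
  have "poch_coeff (z + w) n = (\<Sum>k\<le>n. of_nat (n choose k) * pochhammer z k * pochhammer w (n - k)) / fact n"
    unfolding poch_coeff_def by (subst pochhammer_binomial_sum) simp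
  also have "\<dots> = (\<Sum>i\<le>n. poch_coeff z i * poch_coeff w (n - i))"
    unfolding sum_divide_distrib
    by (intro sum.cong refl) (simp add: poch_coeff_def binomial_fact)
  finally show ?thesis by simp
qed

lemma poch_coeff_antimono:
  assumes "0 < z" "z \<le> 1" "m \<le> n"
  shows "poch_coeff z n \<le> poch_coeff z m"
  using assms(3)
proof (induction n rule: dec_induct)
  case (step n)
  have "poch_coeff z (Suc n) \<le> poch_coeff z n * 1"
    unfolding poch_coeff_Suc using assms poch_coeff_pos[of z n] by (intro mult_left_mono) auto
  then show ?case using step by simp
qed simp

lemma poch_coeff_normalised_tendsto:
  assumes "z > 0"
  shows "(\<lambda>n. poch_coeff z n * real n powr (1 - z)) \<longlonglongrightarrow> 1 / Gamma z"
proof -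
  have "(\<lambda>n. real n / (real n + z) * (1 / Gamma_series z n)) \<longlonglongrightarrow> 1 * (1 / Gamma z)"
  proof (intro tendsto_mult tendsto_divide tendsto_const)
    show "(\<lambda>n. real n / (real n + z)) \<longlonglongrightarrow> 1" by real_asymp
    show "Gamma_series z \<longlonglongrightarrow> Gamma z" by (rule Gamma_series_LIMSEQ)
    show "Gamma z \<noteq> 0" using Gamma_real_pos[OF assms] by simp
  qed
  moreover have "eventually (\<lambda>n. real n / (real n + z) * (1 / Gamma_series z n) = poch_coeff z n * real n powr (1 - z)) sequentially"
    using eventually_gt_at_top[of "0::nat"]
  proof eventually_elim
    case (elim n)
    define X where "X = real n powr z"
    define p where "p = pochhammer z n"
    have p: "p > 0" using assms by (simp add: pochhammer_pos p_def)
    have X: "X > 0" using elim by (simp add: X_def)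
    have e: "exp (z * ln (real n)) = X" using elim by (simp add: powr_def X_def)
    have 1: "real n powr (1 - z) = real n / X" using elim by (simp add: powr_diff X_def)
    have 2: "Gamma_series z n = fact n * X / (p * (z + real n))"
      by (simp add: Gamma_series_def pochhammer_Suc e p_def)
    have 3: "z + real n > 0" using assms by simp
    have "real n / (real n + z) * (1 / Gamma_series z n) = real n / (z + real n) * (p * (z + real n) / (fact n * X))"
      unfolding 2 by (simp add: add.commute)
    also have "\<dots> = p / fact n * (real n / X)" using 3 X by simp
    finally show ?case unfolding 1 poch_coeff_def p_def .
  qed
  ultimately have "(\<lambda>n. poch_coeff z n * real n powr (1 - z)) \<longlonglongrightarrow> 1 * (1 / Gamma z)"
    by (rule Lim_transform_eventually)
  then show ?thesis by simp
qed

text \<open>The normalised sequence \<open>r\<close> has consecutive ratios 1 + O(1/n^2) and is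
  bounded. Its increments are therefore O(1/n^2), and by telescoping it approaches its limit
  \<open>1 / Gamma z\<close> at the rate 1/n.\<close>

lemma poch_coeff_asymp:
  assumes "z > 0"
  shows "\<exists>C>0. \<forall>n\<ge>1. \<bar>poch_coeff z n - real n powr (z - 1) / Gamma z\<bar> \<le> C * real n powr (z - 2)"
proof -
  define r where "r = (\<lambda>n. poch_coeff z n * real n powr (1 - z))"
  have lim: "r \<longlonglongrightarrow> 1 / Gamma z" unfolding r_def by (rule poch_coeff_normalised_tendsto[OF assms])
  then have "Bseq r" by (intro convergent_imp_Bseq convergentI)
  then obtain B where B: "B > 0" "\<And>n. \<bar>r n\<bar> \<le> B" by (auto simp: Bseq_def)
  have "(\<lambda>n::nat. (z + real n) / (real n + 1) * ((real n + 1) / real n) powr (1 - z) - 1) \<in> O(\<lambda>n. 1 / real n ^ 2)"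
    by real_asymp
  then obtain K where K: "K > 0" "\<And>n. n \<ge> 1 \<Longrightarrow> \<bar>(z + real n) / (real n + 1) * ((real n + 1) / real n) powr (1 - z) - 1\<bar> \<le> K * (1 / real n ^ 2)"
    using bigo_nat_imp_bound[of "\<lambda>n::nat. (z + real n) / (real n + 1) * ((real n + 1) / real n) powr (1 - z) - 1" "\<lambda>n. 1 / real n ^ 2"] by auto
  have step: "\<bar>r (Suc n) - r n\<bar> \<le> B * K / real n ^ 2" if n: "n \<ge> 1" for n
  proof -
    have "r (Suc n) = r n * ((z + real n) / (real n + 1) * ((real n + 1) / real n) powr (1 - z))"
      using n by (simp add: r_def poch_coeff_Suc powr_divide add.commute)
    then have "r (Suc n) - r n = r n * ((z + real n) / (real n + 1) * ((real n + 1) / real n) powr (1 - z) - 1)"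
      by (simp add: right_diff_distrib)
    then have "\<bar>r (Suc n) - r n\<bar> = \<bar>r n\<bar> * \<bar>(z + real n) / (real n + 1) * ((real n + 1) / real n) powr (1 - z) - 1\<bar>"
      by (simp add: abs_mult)
    also have "\<dots> \<le> B * (K * (1 / real n ^ 2))"
      using B K(2)[OF n] by (intro mult_mono) auto
    finally show ?thesis by simp
  qed
  define C where "C = 2 * (B * K)"
  have C0: "C > 0" using B K by (simp add: C_def)
  have tele: "\<bar>r m - r n\<bar> \<le> C * (1 / real n - 1 / real m)" if n: "n \<ge> 1" and mn: "n \<le> m" for n m
    using mn
  proof (induction m rule: dec_induct)
    case (step m)
    have m1: "m \<ge> 1" using n step by simp
    have "1 / real m ^ 2 \<le> 2 * (1 / real m - 1 / real (Suc m))"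
    proof -
      have "1 / real m - 1 / real (Suc m) = 1 / (real m * (real m + 1))" using m1 by (simp add: field_simps)
      moreover have a: "0 < real m * (real m + 1)" using m1 by simp
      have b: "real m * (real m + 1) \<le> 2 * real m ^ 2" using m1 by (simp add: power2_eq_square distrib_left)
      have "2 / (2 * real m ^ 2) \<le> 2 / (real m * (real m + 1))"
        by (rule frac_le[OF _ order.refl a b]) simp
      ultimately show ?thesis by simp
    qed
    then have "B * K * (1 / real m ^ 2) \<le> B * K * (2 * (1 / real m - 1 / real (Suc m)))"
      using B K by (intro mult_left_mono) auto
    also have "\<dots> = C * (1 / real m - 1 / real (Suc m))" by (simp add: C_def)
    finally have "\<bar>r (Suc m) - r m\<bar> \<le> C * (1 / real m - 1 / real (Suc m))"
      using \<open>\<And>n. n \<ge> 1 \<Longrightarrow> \<bar>r (Suc n) - r n\<bar> \<le> B * K / real n ^ 2\<close>[OF m1] by simp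
    moreover have "\<bar>r (Suc m) - r n\<bar> \<le> \<bar>r (Suc m) - r m\<bar> + \<bar>r m - r n\<bar>" by linarith
    ultimately have "\<bar>r (Suc m) - r n\<bar> \<le> C * (1 / real m - 1 / real (Suc m)) + C * (1 / real n - 1 / real m)"
      using step.IH by linarith
    then show ?case by (simp add: right_diff_distrib)
  qed simp
  have rate: "\<bar>1 / Gamma z - r n\<bar> \<le> C / real n" if n: "n \<ge> 1" for n
  proof (rule tendsto_upperbound)
    show "(\<lambda>m. \<bar>r m - r n\<bar>) \<longlonglongrightarrow> \<bar>1 / Gamma z - r n\<bar>" by (intro tendsto_intros lim)
    have "\<bar>r m - r n\<bar> \<le> C / real n" if m: "m \<ge> n" for m
    proof -
      have "C * (1 / real n - 1 / real m) \<le> C * (1 / real n)" using C0 by (intro mult_left_mono) auto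
      then show ?thesis using tele[OF n m] by simp
    qed
    then show "eventually (\<lambda>m. \<bar>r m - r n\<bar> \<le> C / real n) sequentially"
      by (auto simp: eventually_sequentially)
  qed simp
  have "\<bar>poch_coeff z n - real n powr (z - 1) / Gamma z\<bar> \<le> C * real n powr (z - 2)" if n: "n \<ge> 1" for n
  proof -
    have "real n powr (1 - z) * real n powr (z - 1) = 1" using n by (simp flip: powr_add)
    then have "poch_coeff z n = r n * real n powr (z - 1)" by (simp add: r_def mult.assoc)
    then have "poch_coeff z n - real n powr (z - 1) / Gamma z = - (1 / Gamma z - r n) * real n powr (z - 1)"
      by (simp add: algebra_simps)
    then have "\<bar>poch_coeff z n - real n powr (z - 1) / Gamma z\<bar> = \<bar>1 / Gamma z - r n\<bar> * real n powr (z - 1)"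
      by (simp only: abs_mult abs_minus_cancel) simp
    also have "\<dots> \<le> C / real n * real n powr (z - 1)" by (rule mult_right_mono[OF rate[OF n]]) simp
    also have "\<dots> = C * real n powr (z - 2)"
    proof -
      have "real n powr (z - 1) = real n powr ((z - 2) + 1)" by simp
      also have "\<dots> = real n powr (z - 2) * real n" unfolding powr_add using n by simp
      finally show ?thesis using n by simp
    qed
    finally show ?thesis .
  qed
  then show ?thesis using C0 by blast
qed

lemma norm_one_minus_E_le: "cmod (1 - E t) \<le> 7 * \<bar>t\<bar>"
proof -
  have "\<bar>sin (pi * t)\<bar> \<le> \<bar>pi * t\<bar>" by (rule abs_sin_x_le_abs_x)
  also have "\<dots> = pi * \<bar>t\<bar>" by (simp add: abs_mult)
  also have "\<dots> \<le> 3.5 * \<bar>t\<bar>" using pi_approx by (intro mult_right_mono) auto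
  finally show ?thesis by (simp add: norm_one_minus_E)
qed

lemma norm_one_minus_E_ge:
  assumes "\<bar>t\<bar> \<le> 1/2"
  shows "2 * \<bar>t\<bar> \<le> cmod (1 - E t)"
proof -
  have "\<bar>t\<bar> \<le> \<bar>t - of_int m\<bar>" for m :: int
  proof (cases "m = 0")
    case False
    then have "\<bar>of_int m\<bar> \<ge> (1::real)" by linarith
    then show ?thesis using assms by linarith
  qed simp
  then have "\<bar>t\<bar> \<le> int_dist t" by (simp add: int_dist_def)
  then show ?thesis using int_dist_le_norm[of t] by linarith
qed

text \<open>Summation by parts. At \<open>z = E \<beta>\<close> and \<open>X = P ^ 4\<close> the
  loss over the partial sums is of the order \<open>1 + P ^ 4 * \<bar>\<beta>\<bar>\<close>.\<close>

lemma abel_bound: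
  fixes g :: "nat \<Rightarrow> complex" and z :: complex
  assumes "\<And>t. t \<le> X \<Longrightarrow> cmod (\<Sum>m\<le>t. g m) \<le> G" "cmod z = 1"
  shows "cmod (\<Sum>m\<le>X. g m * z ^ m) \<le> G * (1 + real X * cmod (1 - z))"
proof -
  define S where "S = (\<lambda>t. \<Sum>m\<le>t. g m)"
  have parts: "(\<Sum>m\<le>n. g m * z ^ m) = S n * z ^ n + (\<Sum>m<n. S m * (z ^ m * (1 - z)))" for n
    by (induction n) (simp_all add: S_def algebra_simps)
  have z: "cmod (z ^ m) = 1" for m using assms(2) by (simp add: norm_power)
  have "cmod (\<Sum>m\<le>X. g m * z ^ m) \<le> cmod (S X * z ^ X) + (\<Sum>m<X. cmod (S m * (z ^ m * (1 - z))))"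
    unfolding parts by (rule order.trans[OF norm_triangle_ineq add_left_mono[OF norm_sum]])
  also have "\<dots> \<le> G + (\<Sum>m<X. G * cmod (1 - z))"
    by (intro add_mono sum_mono) (auto simp: norm_mult z S_def intro!: assms(1) mult_right_mono)
  finally show ?thesis by (simp add: algebra_simps)
qed

lemma norm_le_norm_add: "cmod a \<le> cmod (a + b) + cmod b"
  using norm_triangle_ineq4[of "a + b" b] by simp

text \<open>Multiplication by \<open>1 - z\<close> makes the sum telescope and keeps the bound
  meaningful at \<open>z = 1\<close>. In the induction the boundary term
  \<open>c X * z ^ Suc X\<close> is carried along, because then one step changes the expression by
  exactly \<open>c n - c (Suc n)\<close> times a power of \<open>z\<close>.\<close>

lemma monotone_tail_bound:
  fixes c :: "nat \<Rightarrow> real" and z :: complex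
  assumes "\<And>m n. m \<le> n \<Longrightarrow> c n \<le> c m" "\<And>m. c m \<ge> 0" "cmod z = 1" "p \<le> X"
  shows "cmod (1 - z) * cmod (\<Sum>m = p..X. of_real (c m) * z ^ m) \<le> 2 * c p"
proof -
  have z: "cmod (z ^ m) = 1" for m using assms(3) by (simp add: norm_power)
  have parts: "cmod ((1 - z) * (\<Sum>m = p..X. of_real (c m) * z ^ m) + of_real (c X) * z ^ Suc X) \<le> 2 * c p - c X"
    using assms(4)
  proof (induction X rule: dec_induct)
    case base
    have "(1 - z) * (\<Sum>m = p..p. of_real (c m) * z ^ m) + of_real (c p) * z ^ Suc p = of_real (c p) * z ^ p"
      by (simp add: algebra_simps)
    then show ?case using assms(2)[of p] by (simp add: norm_mult z)
  next
    case (step n)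
    have "(1 - z) * (\<Sum>m = p..Suc n. of_real (c m) * z ^ m) + of_real (c (Suc n)) * z ^ Suc (Suc n)
      = ((1 - z) * (\<Sum>m = p..n. of_real (c m) * z ^ m) + of_real (c n) * z ^ Suc n) - of_real (c n - c (Suc n)) * z ^ Suc n"
      using step by (simp add: algebra_simps)
    also have "cmod \<dots> \<le> (2 * c p - c n) + (c n - c (Suc n))"
      by (rule order.trans[OF norm_triangle_ineq4 add_mono[OF step.IH]])
         (use assms(1)[of n "Suc n"] in \<open>simp add: norm_mult z del: of_real_diff power_Suc\<close>)
    finally show ?case by simp
  qed
  have "cmod (1 - z) * cmod (\<Sum>m = p..X. of_real (c m) * z ^ m) = cmod ((1 - z) * (\<Sum>m = p..X. of_real (c m) * z ^ m))"
    by (simp add: norm_mult)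
  also have "\<dots> \<le> cmod ((1 - z) * (\<Sum>m = p..X. of_real (c m) * z ^ m) + of_real (c X) * z ^ Suc X) + cmod (of_real (c X) * z ^ Suc X)"
    by (rule norm_le_norm_add)
  also have "\<dots> \<le> (2 * c p - c X) + c X"
    by (intro add_mono parts) (use assms(2)[of X] in \<open>simp add: norm_mult z del: power_Suc\<close>)
  finally show ?thesis by simp
qed

section \<open>Approximation of the Weyl sum on the major arcs\<close>

definition weyl4_model :: "nat \<Rightarrow> real \<Rightarrow> complex" where
  "weyl4_model P \<beta> = (\<Sum>m\<le>P ^ 4. of_real (Gamma (5/4) * poch_coeff (1/4) m) * E \<beta> ^ m)"

lemma Gamma_5_4_pos: "Gamma (5/4 :: real) > 0"
  by (rule Gamma_real_pos) simp

text \<open>This explains the normalisation by \<open>Gamma (5/4)\<close>: up to a bounded error,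
  the coefficients up to \<open>t\<close> sum to the number of positive fourth powers up to
  \<open>t\<close>. By \<open>sum_poch_coeff\<close> the sum is a single coefficient for the
  exponent 5/4, whose asymptotics are known.\<close>

lemma partial_sum_weyl4_model:
  "\<exists>K>0. \<forall>t::nat. \<bar>(\<Sum>m\<le>t. Gamma (5/4) * poch_coeff (1/4) m) - real t powr (1/4)\<bar> \<le> K"
proof -
  obtain C where C: "C > 0" "\<And>n. n \<ge> 1 \<Longrightarrow> \<bar>poch_coeff (5/4) n - real n powr (5/4 - 1) / Gamma (5/4)\<bar> \<le> C * real n powr (5/4 - 2)"
    using poch_coeff_asymp[of "5/4"] by auto
  define K where "K = Gamma (5/4) * (1 + C)"
  have "\<bar>(\<Sum>m\<le>t. Gamma (5/4) * poch_coeff (1/4) m) - real t powr (1/4)\<bar> \<le> K" for t :: nat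
  proof -
    have S: "(\<Sum>m\<le>t. Gamma (5/4) * poch_coeff (1/4) m) = Gamma (5/4) * poch_coeff (5/4) t"
      unfolding sum_distrib_left[symmetric] sum_poch_coeff by simp
    show ?thesis
    proof (cases "t = 0")
      case True
      have "Gamma (5/4) * 1 \<le> K" unfolding K_def using Gamma_5_4_pos C(1) by (intro mult_left_mono) auto
      then show ?thesis unfolding S using True Gamma_5_4_pos by simp
    next
      case False
      have "Gamma (5/4) * poch_coeff (5/4) t - real t powr (1/4) = Gamma (5/4) * (poch_coeff (5/4) t - real t powr (5/4 - 1) / Gamma (5/4))"
        using less_imp_neq[OF Gamma_5_4_pos] by (simp add: right_diff_distrib)
      then have "\<bar>Gamma (5/4) * poch_coeff (5/4) t - real t powr (1/4)\<bar> = Gamma (5/4) * \<bar>poch_coeff (5/4) t - real t powr (5/4 - 1) / Gamma (5/4)\<bar>"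
        using Gamma_5_4_pos by (simp only: abs_mult abs_of_pos)
      also have "\<dots> \<le> Gamma (5/4) * (C * real t powr (5/4 - 2))"
        using C(2)[of t] False Gamma_5_4_pos by (intro mult_left_mono) auto
      also have "\<dots> \<le> Gamma (5/4) * (C * 1)"
      proof (intro mult_left_mono)
        have "real t powr (5/4 - 2) \<le> real t powr 0" using False by (intro powr_mono) auto
        then show "real t powr (5/4 - 2) \<le> 1" using False by simp
      qed (use C Gamma_5_4_pos in auto)
      also have "\<dots> \<le> K" unfolding K_def using Gamma_5_4_pos by (intro mult_left_mono) auto
      finally show ?thesis unfolding S .
    qed
  qed
  moreover have "K > 0" using C(1) Gamma_5_4_pos by (simp add: K_def)
  ultimately show ?thesis by blast
qed

lemma poch_coeff_quarter_le:
  "\<exists>K>0. \<forall>n\<ge>1. poch_coeff (1/4) n \<le> K * real n powr (- (3/4))"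
proof -
  obtain C where C: "C > 0" "\<And>n. n \<ge> 1 \<Longrightarrow> \<bar>poch_coeff (1/4) n - real n powr (1/4 - 1) / Gamma (1/4)\<bar> \<le> C * real n powr (1/4 - 2)"
    using poch_coeff_asymp[of "1/4"] by auto
  have G: "Gamma (1/4 :: real) > 0" by (rule Gamma_real_pos) simp
  have "poch_coeff (1/4) n \<le> (1 / Gamma (1/4) + C) * real n powr (- (3/4))" if n: "n \<ge> 1" for n
  proof -
    have "poch_coeff (1/4) n \<le> real n powr (1/4 - 1) / Gamma (1/4) + C * real n powr (1/4 - 2)"
      using C(2)[OF n] by linarith
    also have "real n powr (1/4 - 2) \<le> real n powr (- (3/4))" using n by (intro powr_mono) auto
    finally show ?thesis using C(1) by (simp add: distrib_right)
  qed
  moreover have "1 / Gamma (1/4) + C > 0" using G C(1) by (simp add: add_pos_pos)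
  ultimately show ?thesis by blast
qed

text \<open>The sum is cut near \<open>1 / \<bar>\<beta>\<bar>\<close>. Below the cut there is
  little oscillation, and the sum of the coefficients, of size
  \<open>\<bar>\<beta>\<bar> powr (- (1/4))\<close>, is used; above it
  \<open>monotone_tail_bound\<close> gives the coefficient at the cut divided by
  \<open>\<bar>\<beta>\<bar>\<close>, which has the same size.\<close>

lemma weyl4_model_bounds:
  "\<exists>K>0. (\<forall>P \<beta>. P > 0 \<longrightarrow> cmod (weyl4_model P \<beta>) \<le> K * real P) \<and>
      (\<forall>P \<beta>. P > 0 \<longrightarrow> 0 < \<bar>\<beta>\<bar> \<longrightarrow> \<bar>\<beta>\<bar> \<le> 1/2 \<longrightarrow> cmod (weyl4_model P \<beta>) \<le> K * \<bar>\<beta>\<bar> powr (- (1/4)))"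
proof -
  obtain A where A: "A > 0" "\<And>t::nat. \<bar>(\<Sum>m\<le>t. Gamma (5/4) * poch_coeff (1/4) m) - real t powr (1/4)\<bar> \<le> A"
    using partial_sum_weyl4_model by blast
  obtain B where B: "B > 0" "\<And>n. n \<ge> 1 \<Longrightarrow> poch_coeff (1/4) n \<le> B * real n powr (- (3/4))"
    using poch_coeff_quarter_le by blast
  define c where "c = (\<lambda>m. Gamma (5/4) * poch_coeff (1/4) m)"
  define K where "K = A + 1 + Gamma (5/4) * B"
  have GB: "Gamma (5/4) * B \<ge> 0" using Gamma_5_4_pos B(1) by simp
  have c0: "c m \<ge> 0" for m using Gamma_5_4_pos poch_coeff_pos[of "1/4" m] by (simp add: c_def)
  have cmono: "c n \<le> c m" if "m \<le> n" for m n
    unfolding c_def using Gamma_5_4_pos poch_coeff_antimono[of "1/4" m n] that by (intro mult_left_mono) auto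
  have sumc: "(\<Sum>m\<le>t. c m) \<le> A + real t powr (1/4)" for t
    using A(2)[of t] unfolding c_def by linarith
  have triv: "cmod (\<Sum>m\<le>t. of_real (c m) * E \<beta> ^ m) \<le> (\<Sum>m\<le>t. c m)" for t \<beta>
    by (rule order.trans[OF norm_sum]) (simp add: norm_mult norm_power c0)
  have 1: "cmod (weyl4_model P \<beta>) \<le> K * real P" if P: "P > 0" for P \<beta>
  proof -
    have "cmod (weyl4_model P \<beta>) \<le> (\<Sum>m\<le>P ^ 4. c m)" unfolding weyl4_model_def using triv[of \<beta> "P ^ 4"] by (simp add: c_def)
    also have "\<dots> \<le> A + real (P ^ 4) powr (1/4)" by (rule sumc)
    also have "real (P ^ 4) powr (1/4) = real P" using P by (simp add: power_powr powr_power)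
    also have "A + real P \<le> (A + 1) * real P"
      using A(1) P mult_left_mono[of 1 "real P" A] by (simp add: distrib_right)
    also have "\<dots> \<le> K * real P" unfolding K_def using GB by (intro mult_right_mono) auto
    finally show ?thesis .
  qed
  have 2: "cmod (weyl4_model P \<beta>) \<le> K * \<bar>\<beta>\<bar> powr (- (1/4))" if P: "P > 0" and b: "0 < \<bar>\<beta>\<bar>" "\<bar>\<beta>\<bar> \<le> 1/2" for P \<beta>
  proof -
    define b where "b = \<bar>\<beta>\<bar>"
    define Y where "Y = nat \<lfloor>1 / b\<rfloor>"
    have b0: "b > 0" "b \<le> 1/2" using b by (auto simp: b_def)
    have ib: "1 / b \<ge> 1" using b0 by (simp add: pos_le_divide_eq)
    have Yle: "real Y \<le> 1 / b" using b0 by (simp add: Y_def)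
    have Ygt: "1 / b < real (Suc Y)" using ib by (simp add: Y_def) linarith
    have bp: "1 \<le> b powr (- (1/4))"
    proof -
      have "1 powr (- (1/4)) \<le> b powr (- (1/4))" using b0 by (intro powr_mono2') auto
      then show ?thesis by simp
    qed
    have Yp: "real t powr (1/4) \<le> b powr (- (1/4))" if "t \<le> Y" for t
    proof -
      have "real t powr (1/4) \<le> (1 / b) powr (1/4)" using that Yle by (intro powr_mono2) auto
      also have "\<dots> = b powr (- (1/4))" using b0 by (simp add: powr_divide powr_minus_divide)
      finally show ?thesis .
    qed
    have low: "cmod (\<Sum>m\<le>t. of_real (c m) * E \<beta> ^ m) \<le> (A + 1) * b powr (- (1/4))" if "t \<le> Y" for t
    proof -
      have "cmod (\<Sum>m\<le>t. of_real (c m) * E \<beta> ^ m) \<le> A + real t powr (1/4)"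
        by (rule order.trans[OF triv sumc])
      also have "\<dots> \<le> A * b powr (- (1/4)) + b powr (- (1/4))"
        using Yp[OF that] A(1) bp by (intro add_mono) auto
      finally show ?thesis by (simp add: distrib_right)
    qed
    show ?thesis
    proof (cases "P ^ 4 \<le> Y")
      case True
      have "cmod (weyl4_model P \<beta>) \<le> (A + 1) * b powr (- (1/4))"
        using low[OF True] by (simp add: weyl4_model_def c_def)
      also have "\<dots> \<le> K * b powr (- (1/4))" unfolding K_def using GB by (intro mult_right_mono) auto
      finally show ?thesis by (simp add: b_def)
    next
      case False
      then have YP: "Suc Y \<le> P ^ 4" by simp
      have split: "{..P ^ 4} = {..Y} \<union> {Suc Y..P ^ 4}" using YP by auto
      have V: "weyl4_model P \<beta> = (\<Sum>m\<le>Y. of_real (c m) * E \<beta> ^ m) + (\<Sum>m = Suc Y..P ^ 4. of_real (c m) * E \<beta> ^ m)"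
        unfolding weyl4_model_def split c_def by (rule sum.union_disjoint) auto
      have "cmod (1 - E \<beta>) * cmod (\<Sum>m = Suc Y..P ^ 4. of_real (c m) * E \<beta> ^ m) \<le> 2 * c (Suc Y)"
        by (rule monotone_tail_bound[OF cmono c0 norm_E YP])
      moreover have "2 * b * cmod (\<Sum>m = Suc Y..P ^ 4. of_real (c m) * E \<beta> ^ m)
           \<le> cmod (1 - E \<beta>) * cmod (\<Sum>m = Suc Y..P ^ 4. of_real (c m) * E \<beta> ^ m)"
        using norm_one_minus_E_ge[OF b(2)] unfolding b_def by (intro mult_right_mono) auto
      ultimately have tail: "b * cmod (\<Sum>m = Suc Y..P ^ 4. of_real (c m) * E \<beta> ^ m) \<le> c (Suc Y)" by simp
      have "c (Suc Y) \<le> Gamma (5/4) * (B * real (Suc Y) powr (- (3/4)))"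
        unfolding c_def using B(2)[of "Suc Y"] Gamma_5_4_pos by (intro mult_left_mono) auto
      also have "real (Suc Y) powr (- (3/4)) \<le> (1 / b) powr (- (3/4))"
        using Ygt ib b0 by (intro powr_mono2') auto
      also have "(1 / b) powr (- (3/4)) = b powr (3/4)" using b0 by (simp add: powr_divide powr_minus_divide)
      finally have cY: "c (Suc Y) \<le> Gamma (5/4) * B * b powr (3/4)"
        using Gamma_5_4_pos B(1) by (simp add: mult_left_mono)
      have "cmod (\<Sum>m = Suc Y..P ^ 4. of_real (c m) * E \<beta> ^ m) \<le> Gamma (5/4) * B * b powr (3/4) / b"
        using order.trans[OF tail cY] b0 by (simp add: pos_le_divide_eq mult.commute)
      also have "\<dots> = Gamma (5/4) * B * b powr (- (1/4))"
      proof -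
        have "b powr (3/4) = b powr (- (1/4) + 1)" by simp
        also have "\<dots> = b powr (- (1/4)) * b" unfolding powr_add using b0 by simp
        finally show ?thesis using b0 by simp
      qed
      finally have hi: "cmod (\<Sum>m = Suc Y..P ^ 4. of_real (c m) * E \<beta> ^ m) \<le> Gamma (5/4) * B * b powr (- (1/4))" .
      have "cmod (weyl4_model P \<beta>) \<le> (A + 1) * b powr (- (1/4)) + Gamma (5/4) * B * b powr (- (1/4))"
        unfolding V by (rule order.trans[OF norm_triangle_ineq add_mono[OF low[OF order.refl] hi]])
      then show ?thesis by (simp add: K_def b_def distrib_right)
    qed
  qed
  have "K > 0" using A(1) GB by (simp add: K_def)
  then show ?thesis using 1 2 by blast
qed

lemma weyl4_Suc: "weyl4 (Suc P) \<alpha> = weyl4 P \<alpha> + E (\<alpha> * of_int ((int P + 1) ^ 4))"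
proof -
  have "{1..int (Suc P)} = insert (int P + 1) {1..int P}" by auto
  then show ?thesis by (simp add: weyl4_def)
qed

lemma weyl4_add_period:
  assumes "q > 0"
  shows "weyl4 (P + q) (of_int a / real q) = weyl4 P (of_int a / real q) + weyl4 q (of_int a / real q)"
proof (induction P)
  case 0
  show ?case by (simp add: weyl4_def)
next
  case (Suc P)
  define n where "n = a * ((int P + 1) ^ 3 * 4 + (int P + 1) ^ 2 * 6 * int q + (int P + 1) * 4 * int q ^ 2 + int q ^ 3)"
  have "(int P + int q + 1) ^ 4 = (int P + 1) ^ 4 + int q * ((int P + 1) ^ 3 * 4 + (int P + 1) ^ 2 * 6 * int q + (int P + 1) * 4 * int q ^ 2 + int q ^ 3)"
    by algebra
  then have "of_int a / real q * of_int ((int (P + q) + 1) ^ 4) = of_int a / real q * of_int ((int P + 1) ^ 4) + of_int n"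
    using assms by (simp add: n_def distrib_left add_ac)
  then have eq: "E (of_int a / real q * of_int ((int (P + q) + 1) ^ 4)) = E (of_int a / real q * of_int ((int P + 1) ^ 4))"
    by (simp only: E_add_of_int)
  show ?case unfolding add_Suc weyl4_Suc Suc eq by (simp only: add_ac)
qed

lemma weyl4_complete_approx:
  assumes "q > 0"
  shows "cmod (weyl4 y (of_int a / real q) - weyl4 q (of_int a / real q) / of_nat q * of_nat y) \<le> 2 * real q"
proof -
  define S where "S = weyl4 q (of_int a / real q)"
  have blocks: "weyl4 (r + q * k) (of_int a / real q) = weyl4 r (of_int a / real q) + of_nat k * S" for r k
  proof (induction k)
    case (Suc k)
    have "r + q * Suc k = (r + q * k) + q" by simp
    then show ?case using Suc weyl4_add_period[OF assms, of "r + q * k" a] by (simp add: S_def algebra_simps)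
  qed simp
  define r where "r = y mod q"
  define k where "k = y div q"
  have y: "y = r + q * k" by (simp add: r_def k_def)
  have rq: "r < q" using assms by (simp add: r_def)
  have "S / of_nat q * of_nat y = of_nat k * S + S / of_nat q * of_nat r"
    using assms unfolding y by (simp add: field_simps)
  then have "weyl4 y (of_int a / real q) - S / of_nat q * of_nat y = weyl4 r (of_int a / real q) - S / of_nat q * of_nat r"
    unfolding y blocks by simp
  also have "cmod \<dots> \<le> real r + real r"
  proof (rule order.trans[OF norm_triangle_ineq4 add_mono[OF norm_weyl4_le]])
    have "cmod S \<le> real q" unfolding S_def by (rule norm_weyl4_le)
    then have "cmod S / real q \<le> 1" using assms by simp
    then have "cmod S / real q * real r \<le> 1 * real r" by (rule mult_right_mono) simp
    then show "cmod (S / of_nat q * of_nat r) \<le> real r" by (simp add: norm_mult norm_divide)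
  qed
  finally show ?thesis using rq by (simp add: S_def)
qed

text \<open>The difference is a power series in \<open>E \<beta>\<close> whose coefficients have
  partial sums O(q): up to \<open>t\<close>, the Weyl sum is an incomplete sum over residues,
  replaced by its mean times the number of terms, and the model matches that number. Abel summation
  then loses the factor \<open>1 + P ^ 4 * \<bar>\<beta>\<bar>\<close>. The error is crude, but
  \<open>R\<close> is a tiny power of \<open>P\<close>.\<close>

lemma weyl4_approx:
  "\<exists>K>0. \<forall>P q a \<beta>. q > 0 \<longrightarrow>
     cmod (weyl4 P (of_int a / real q + \<beta>) - weyl4 q (of_int a / real q) / of_nat q * weyl4_model P \<beta>)
       \<le> K * real q * (1 + real P ^ 4 * \<bar>\<beta>\<bar>)"
proof -
  obtain A where A: "A > 0" "\<And>t::nat. \<bar>(\<Sum>m\<le>t. Gamma (5/4) * poch_coeff (1/4) m) - real t powr (1/4)\<bar> \<le> A"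
    using partial_sum_weyl4_model by blast
  have "cmod (weyl4 P (of_int a / real q + \<beta>) - weyl4 q (of_int a / real q) / of_nat q * weyl4_model P \<beta>)
       \<le> (7 * (A + 3)) * real q * (1 + real P ^ 4 * \<bar>\<beta>\<bar>)" if q: "q > 0" for P q a \<beta>
  proof -
    define \<sigma> where "\<sigma> = weyl4 q (of_int a / real q) / of_nat q"
    define h where "h = (\<lambda>x::int. E (of_int a / real q * of_int (x ^ 4)))"
    define f where "f = (\<lambda>x::int. nat (x ^ 4))"
    define g where "g = (\<lambda>m::nat. (\<Sum>x\<in>{x\<in>{1..int P}. f x = m}. h x) - \<sigma> * of_real (Gamma (5/4) * poch_coeff (1/4) m))"
    have \<sigma>: "cmod \<sigma> \<le> 1"
      using norm_weyl4_le[of q "of_int a / real q"] q by (simp add: \<sigma>_def norm_divide)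
    have fP: "f ` {1..int P} \<subseteq> {..P ^ 4}"
    proof (rule image_subsetI)
      fix x assume "x \<in> {1..int P}"
      then have "x ^ 4 \<le> int P ^ 4" using pow4_le by blast
      then show "f x \<in> {..P ^ 4}" by (simp add: f_def nat_le_iff)
    qed
    have Ex: "E (\<beta> * of_int (x ^ 4)) = E \<beta> ^ f x" if "x \<in> {1..int P}" for x
    proof -
      have "real (f x) = of_int (x ^ 4)" using that by (simp add: f_def)
      then show ?thesis by (simp add: E_power mult.commute)
    qed
    have "weyl4 P (of_int a / real q + \<beta>) = (\<Sum>x\<in>{1..int P}. h x * E \<beta> ^ f x)"
      unfolding weyl4_def h_def by (intro sum.cong refl) (simp only: Ex[symmetric] distrib_right E_add)
    also have "\<dots> = (\<Sum>m\<le>P ^ 4. \<Sum>x\<in>{x\<in>{1..int P}. f x = m}. h x * E \<beta> ^ f x)"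
      by (rule sum.group[OF _ _ fP, symmetric]) auto
    also have "\<dots> = (\<Sum>m\<le>P ^ 4. (\<Sum>x\<in>{x\<in>{1..int P}. f x = m}. h x) * E \<beta> ^ m)"
      by (intro sum.cong refl) (simp add: sum_distrib_right)
    finally have W: "weyl4 P (of_int a / real q + \<beta>) = (\<Sum>m\<le>P ^ 4. (\<Sum>x\<in>{x\<in>{1..int P}. f x = m}. h x) * E \<beta> ^ m)" .
    have diff: "weyl4 P (of_int a / real q + \<beta>) - \<sigma> * weyl4_model P \<beta> = (\<Sum>m\<le>P ^ 4. g m * E \<beta> ^ m)"
      unfolding W weyl4_model_def g_def by (simp add: sum_distrib_left sum_subtractf left_diff_distrib mult.assoc)
    have partial: "cmod (\<Sum>m\<le>t. g m) \<le> (A + 3) * real q" if t: "t \<le> P ^ 4" for t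
    proof -
      \<comment> \<open>The number of positive fourth powers up to \<open>t\<close>.\<close>
      define y where "y = nat \<lfloor>real t powr (1/4)\<rfloor>"
      have y1: "real y \<le> real t powr (1/4)" by (simp add: y_def)
      have y2: "real t powr (1/4) < real y + 1" by (simp add: y_def)
      have root: "(real t powr (1/4)) ^ 4 = real t" by (cases "t = 0") (simp_all add: powr_power)
      have mem: "x \<le> int y \<longleftrightarrow> f x \<le> t" if x: "x \<ge> 1" for x
      proof -
        have rx: "real (f x) = real_of_int x ^ 4" using x by (simp add: f_def)
        have "x \<le> int y \<longleftrightarrow> real_of_int x \<le> real t powr (1/4)"
          using y1 y2 by linarith
        also have "\<dots> \<longleftrightarrow> real_of_int x ^ 4 \<le> (real t powr (1/4)) ^ 4"
          using x by (intro power_mono_iff[symmetric]) auto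
        also have "\<dots> \<longleftrightarrow> f x \<le> t" unfolding root rx[symmetric] by simp
        finally show ?thesis .
      qed
      have yP: "y \<le> P"
      proof -
        have "real t powr (1/4) \<le> (real P ^ 4) powr (1/4)"
          using of_nat_mono[OF t, where 'a = real] by (intro powr_mono2) auto
        also have "\<dots> = real P" by (cases "P = 0") (simp_all add: power_powr powr_power)
        finally show ?thesis using y1 by linarith
      qed
      have yPi: "int y \<le> int P" using yP by simp
      have "x \<in> {x\<in>{1..int P}. f x = m} \<longleftrightarrow> x \<in> {x\<in>{1..int y}. f x = m}" if "m \<le> t" for x m
        by (cases "1 \<le> x \<and> f x = m") (use mem[of x] that yPi in auto)
      then have "(\<Sum>m\<le>t. \<Sum>x\<in>{x\<in>{1..int P}. f x = m}. h x) = (\<Sum>m\<le>t. \<Sum>x\<in>{x\<in>{1..int y}. f x = m}. h x)"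
        by (intro sum.cong refl set_eqI) auto
      also have "\<dots> = (\<Sum>x\<in>{1..int y}. h x)"
        by (rule sum.group) (use mem in auto)
      also have "\<dots> = weyl4 y (of_int a / real q)" by (simp add: weyl4_def h_def)
      finally have "(\<Sum>m\<le>t. g m) = weyl4 y (of_int a / real q) - \<sigma> * of_real (\<Sum>m\<le>t. Gamma (5/4) * poch_coeff (1/4) m)"
        unfolding g_def sum_subtractf by (simp add: sum_distrib_left)
      also have "\<dots> = (weyl4 y (of_int a / real q) - \<sigma> * of_nat y) - \<sigma> * of_real ((\<Sum>m\<le>t. Gamma (5/4) * poch_coeff (1/4) m) - real y)"
        by (simp add: algebra_simps)
      also have "cmod \<dots> \<le> 2 * real q + 1 * (A + 1)"
      proof (rule order.trans[OF norm_triangle_ineq4 add_mono])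
        show "cmod (weyl4 y (of_int a / real q) - \<sigma> * of_nat y) \<le> 2 * real q"
          unfolding \<sigma>_def by (rule weyl4_complete_approx[OF q])
        have "\<bar>(\<Sum>m\<le>t. Gamma (5/4) * poch_coeff (1/4) m) - real y\<bar> \<le> A + 1"
          using A(2)[of t] y1 y2 by linarith
        then show "cmod (\<sigma> * of_real ((\<Sum>m\<le>t. Gamma (5/4) * poch_coeff (1/4) m) - real y)) \<le> 1 * (A + 1)"
          unfolding norm_mult norm_of_real using \<sigma> by (intro mult_mono) auto
      qed
      also have "\<dots> \<le> 2 * real q + (A + 1) * real q"
        using A(1) q mult_left_mono[of 1 "real q" "A + 1"] by simp
      finally show ?thesis by (simp add: algebra_simps)
    qed
    have "cmod (\<Sum>m\<le>P ^ 4. g m * E \<beta> ^ m) \<le> (A + 3) * real q * (1 + real (P ^ 4) * cmod (1 - E \<beta>))"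
      by (rule abel_bound[OF partial norm_E])
    also have "\<dots> \<le> (A + 3) * real q * (7 * (1 + real P ^ 4 * \<bar>\<beta>\<bar>))"
    proof (rule mult_left_mono)
      have "real (P ^ 4) * cmod (1 - E \<beta>) \<le> real (P ^ 4) * (7 * \<bar>\<beta>\<bar>)"
        by (rule mult_left_mono[OF norm_one_minus_E_le]) simp
      then show "1 + real (P ^ 4) * cmod (1 - E \<beta>) \<le> 7 * (1 + real P ^ 4 * \<bar>\<beta>\<bar>)" by simp
    qed (use A(1) in simp)
    also have "\<dots> = (7 * (A + 3)) * real q * (1 + real P ^ 4 * \<bar>\<beta>\<bar>)" by (simp only: mult_ac)
    finally show ?thesis unfolding diff[symmetric] \<sigma>_def .
  qed
  then show ?thesis using A(1) by (intro exI[of _ "7 * (A + 3)"]) auto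
qed

section \<open>Absolute convergence of the singular series\<close>

lemma sum_powr_bounded:
  fixes \<gamma> :: real
  assumes "\<gamma> > 1"
  shows "(\<Sum>n = 1..X. real n powr (- \<gamma>)) \<le> 1 + 1 / (\<gamma> - 1)"
proof (cases X)
  case (Suc Y)
  have "(\<Sum>n = 1..Suc Y. real n powr (- \<gamma>)) = 1 + (\<Sum>n = 2..Suc Y. real n powr (- \<gamma>))"
    by (subst sum.atLeast_Suc_atMost) (auto simp: numeral_2_eq_2)
  also have "(\<Sum>n = 2..Suc Y. real n powr (- \<gamma>)) = (\<Sum>b = 1..Y. 1 * (1 + 1 * real b) powr (- \<gamma>))"
    by (rule sum.reindex_bij_witness[where i = Suc and j = "\<lambda>n. n - 1"]) auto
  also have "\<dots> \<le> (1 - (1 + 1 * real Y) powr (1 - \<gamma>)) / (\<gamma> - 1)" by (rule sum_powr_le) (use assms in auto)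
  also have "\<dots> \<le> 1 / (\<gamma> - 1)" using assms by (intro divide_right_mono) auto
  finally show ?thesis using Suc by simp
qed (use assms in simp)

text \<open>Diagonal solutions contribute \<open>q powr (- (5/4))\<close>. For an off-diagonal pair
  with maximum \<open>m\<close>, only divisors \<open>q \<ge> m\<close> of
  \<open>x ^ 4 - y ^ 4\<close> matter, so the divisor bound gives at most
  \<open>D * m powr (1/8 - 9/4)\<close>. At most \<open>2 * m\<close> pairs have maximum
  \<open>m\<close>, and the exponent -9/8 is summable.\<close>

lemma sum_congr_count_weighted:
  "\<exists>C>0. \<forall>X. (\<Sum>q = 1..X. real q powr (- (9/4)) * real (congr_count q q)) \<le> C"
proof -
  obtain D where D: "D \<ge> 1" "\<And>P n. P > 0 \<Longrightarrow> n \<noteq> 0 \<Longrightarrow> \<bar>n\<bar> \<le> 8 * int P ^ 4 \<Longrightarrow> real (int_divisor_count n) \<le> D * real P powr (1/8)"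
    using int_divisor_count_le_ge1[of "1/8" 8] by auto
  have "(\<Sum>q = 1..X. real q powr (- (9/4)) * real (congr_count q q)) \<le> 5 + 2 * D * 9" for X
  proof -
    let ?T = "{1..int X} \<times> {1..int X}"
    define \<phi> where "\<phi> = (\<lambda>x::int. D * of_int x powr (- (17/8)))"
    define k where "k = (\<lambda>q::nat. \<lambda>s::int \<times> int. if fst s \<noteq> snd s \<and> fst s \<le> int q \<and> snd s \<le> int q \<and> int q dvd fst s ^ 4 - snd s ^ 4
        then real q powr (- (9/4)) else 0)"
    have cc: "real q powr (- (9/4)) * real (congr_count q q) \<le> real q powr (- (5/4)) + (\<Sum>s\<in>?T. k q s)" if q: "q \<in> {1..X}" for q
    proof -
      define U where "U = {s \<in> ?T. fst s \<noteq> snd s \<and> fst s \<le> int q \<and> snd s \<le> int q \<and> int q dvd fst s ^ 4 - snd s ^ 4}"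
      have fU: "finite U" unfolding U_def by simp
      have "{(x, y) \<in> {1..int q} \<times> {1..int q}. int q dvd x ^ 4 - y ^ 4} \<subseteq> (\<lambda>x. (x, x)) ` {1..int q} \<union> U"
        using q by (auto simp: U_def)
      then have "congr_count q q \<le> card ((\<lambda>x. (x, x)) ` {1..int q} \<union> U)"
        unfolding congr_count_def using fU by (intro card_mono) auto
      also have "\<dots> \<le> card ((\<lambda>x. (x, x)) ` {1..int q}) + card U" by (rule card_Un_le)
      also have "card ((\<lambda>x. (x, x)) ` {1..int q}) = q" by (simp add: card_image inj_on_def)
      finally have c: "real (congr_count q q) \<le> real q + real (card U)" by linarith
      have "real q powr (- (9/4)) * real (congr_count q q) \<le> real q powr (- (9/4)) * (real q + real (card U))"
        by (rule mult_left_mono[OF c]) simp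
      also have "\<dots> = real q powr (- (9/4)) * real q + (\<Sum>s\<in>U. real q powr (- (9/4)))"
        by (simp add: distrib_left)
      also have "real q powr (- (9/4)) * real q = real q powr (- (9/4) + 1)"
        unfolding powr_add using q by simp
      also have "- (9/4) + 1 = (- (5/4) :: real)" by simp
      also have "(\<Sum>s\<in>U. real q powr (- (9/4))) = (\<Sum>s\<in>?T. k q s)"
        unfolding U_def k_def by (rule sum.inter_filter) simp
      finally show ?thesis .
    qed
    have ks: "(\<Sum>q = 1..X. k q s) \<le> (if snd s \<le> fst s then \<phi> (fst s) else 0) + (if fst s \<le> snd s then \<phi> (snd s) else 0)" if s: "s \<in> ?T" for s
    proof -
      define m where "m = max (fst s) (snd s)"
      have m1: "m \<ge> 1" using s by (auto simp: m_def)
      have \<phi>0: "\<phi> x \<ge> 0" for x using D(1) by (simp add: \<phi>_def)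
      have "(\<Sum>q = 1..X. k q s) \<le> \<phi> m"
      proof (cases "fst s = snd s")
        case True
        then have "(\<Sum>q = 1..X. k q s) = 0" by (simp add: k_def)
        then show ?thesis using \<phi>0 by simp
      next
        case False
        define n where "n = fst s ^ 4 - snd s ^ 4"
        have pos: "fst s \<in> {1..int X}" "snd s \<in> {1..int X}" using s by auto
        have n0: "n \<noteq> 0"
        proof
          assume "n = 0"
          then have "fst s ^ 4 = snd s ^ 4" "fst s \<ge> 0" "snd s \<ge> 0" using pos by (auto simp: n_def)
          then have "fst s = snd s" using power_eq_imp_eq_base[of "fst s" 4 "snd s"] by simp
          with False show False ..
        qed
        have fm: "fst s \<in> {1..int (nat m)}" "snd s \<in> {1..int (nat m)}" using pos by (auto simp: m_def)
        have nb: "\<bar>n\<bar> \<le> 8 * int (nat m) ^ 4" using pow4_le[OF fm(1)] pow4_le[OF fm(2)] unfolding n_def by linarith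
        define Q where "Q = {q\<in>{1..X}. int q dvd n}"
        have "card Q = card (int ` Q)" by (simp add: card_image)
        also have "\<dots> \<le> int_divisor_count n" unfolding int_divisor_count_def Q_def by (rule card_mono[OF finite_int_divisors[OF n0]]) auto
        finally have cQ: "card Q \<le> int_divisor_count n" .
        have "(\<Sum>q = 1..X. k q s) \<le> (\<Sum>q = 1..X. if int q dvd n then of_int m powr (- (9/4)) else 0)"
        proof (rule sum_mono)
          fix q assume q: "q \<in> {1..X}"
          have "real q powr (- (9/4)) \<le> of_int m powr (- (9/4))" if "m \<le> int q"
          proof (rule powr_mono2')
            show "of_int m \<le> real q" using that by linarith
          qed (use m1 in auto)
          then show "k q s \<le> (if int q dvd n then of_int m powr (- (9/4)) else 0)"
            by (auto simp: k_def n_def m_def)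
        qed
        also have "\<dots> = real (card Q) * of_int m powr (- (9/4))"
          unfolding Q_def by (simp add: sum.If_cases Int_def)
        also have "\<dots> \<le> (D * real (nat m) powr (1/8)) * of_int m powr (- (9/4))"
        proof (rule mult_right_mono)
          show "real (card Q) \<le> D * real (nat m) powr (1/8)"
            using of_nat_mono[OF cQ, where 'a = real] D(2)[OF _ n0 nb] m1 by simp
        qed simp
        also have "\<dots> = \<phi> m"
        proof -
          have "of_int m powr (1/8) * of_int m powr (- (9/4)) = (of_int m :: real) powr (1/8 + - (9/4))"
            by (rule powr_add[symmetric])
          moreover have "1/8 + - (9/4) = (- (17/8) :: real)" by simp
          ultimately show ?thesis using m1 by (simp add: \<phi>_def)
        qed
        finally show ?thesis .
      qed
      then show ?thesis using \<phi>0[of "fst s"] \<phi>0[of "snd s"] by (auto simp: m_def max_def split: if_splits)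
    qed
    have half: "(\<Sum>x\<in>{1..int X}. \<Sum>y\<in>{1..int X}. if y \<le> x then \<phi> x else 0) \<le> D * 9"
    proof -
      have "(\<Sum>x\<in>{1..int X}. \<Sum>y\<in>{1..int X}. if y \<le> x then \<phi> x else 0) \<le> (\<Sum>x\<in>{1..int X}. D * of_int x powr (- (9/8)))"
      proof (rule sum_mono)
        fix x assume x: "x \<in> {1..int X}"
        have "(\<Sum>y\<in>{1..int X}. if y \<le> x then \<phi> x else 0) = real (card {y\<in>{1..int X}. y \<le> x}) * \<phi> x"
          by (simp add: sum.If_cases Int_def)
        also have "{y\<in>{1..int X}. y \<le> x} = {1..x}" using x by auto
        also have "real (card {1..x}) * \<phi> x = D * (of_int x * of_int x powr (- (17/8)))"
          using x by (simp add: \<phi>_def)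
        also have "of_int x * of_int x powr (- (17/8)) = (of_int x :: real) powr (1 + - (17/8))"
          unfolding powr_add using x by simp
        finally show "(\<Sum>y\<in>{1..int X}. if y \<le> x then \<phi> x else 0) \<le> D * of_int x powr (- (9/8))" by simp
      qed
      also have "\<dots> = D * (\<Sum>x\<in>{1..int X}. of_int x powr (- (9/8)))" by (simp add: sum_distrib_left)
      also have "(\<Sum>x\<in>{1..int X}. of_int x powr (- (9/8))) = (\<Sum>n = 1..X. real n powr (- (9/8)))"
        by (rule sum.reindex_bij_witness[where i = int and j = nat]) auto
      also have "\<dots> \<le> 1 + 1 / (9/8 - 1)" by (rule sum_powr_bounded) simp
      finally show ?thesis using D(1) by simp
    qed
    have "(\<Sum>q = 1..X. real q powr (- (9/4)) * real (congr_count q q)) \<le> (\<Sum>q = 1..X. real q powr (- (5/4)) + (\<Sum>s\<in>?T. k q s))"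
      by (rule sum_mono) (rule cc)
    also have "\<dots> = (\<Sum>q = 1..X. real q powr (- (5/4))) + (\<Sum>s\<in>?T. \<Sum>q = 1..X. k q s)"
      unfolding sum.distrib by (intro arg_cong2[where f = "(+)"] refl sum.swap)
    also have "(\<Sum>q = 1..X. real q powr (- (5/4))) \<le> 1 + 1 / (5/4 - 1)" by (rule sum_powr_bounded) simp
    also have "(\<Sum>s\<in>?T. \<Sum>q = 1..X. k q s) \<le> (\<Sum>s\<in>?T. (if snd s \<le> fst s then \<phi> (fst s) else 0) + (if fst s \<le> snd s then \<phi> (snd s) else 0))"
      by (rule sum_mono) (rule ks)
    also have "\<dots> = (\<Sum>x\<in>{1..int X}. \<Sum>y\<in>{1..int X}. if y \<le> x then \<phi> x else 0) + (\<Sum>x\<in>{1..int X}. \<Sum>y\<in>{1..int X}. if x \<le> y then \<phi> y else 0)"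
      unfolding sum.distrib by (simp add: sum.cartesian_product case_prod_unfold)
    also have "(\<Sum>x\<in>{1..int X}. \<Sum>y\<in>{1..int X}. if x \<le> y then \<phi> y else 0) = (\<Sum>x\<in>{1..int X}. \<Sum>y\<in>{1..int X}. if y \<le> x then \<phi> x else 0)"
      by (rule sum.swap)
    finally show ?thesis using half by simp
  qed
  moreover have "5 + 2 * D * 9 > 0" using D(1) by simp
  ultimately show ?thesis by blast
qed

text \<open>A majorant of the terms of the singular series for every \<open>s \<ge> 13\<close>,
  uniform in \<open>n\<close>: the normalised sums have modulus at most 1, so the smallest exponent
  dominates.\<close>

definition unit_weight :: "nat \<Rightarrow> real" where
  "unit_weight q = (\<Sum>a | a \<in> {1..q} \<and> coprime a q. (cmod (weyl4 q (real a / real q) / of_nat q)) ^ 13)"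

lemma unit_weight_nonneg: "unit_weight q \<ge> 0"
  by (simp add: unit_weight_def sum_nonneg)

text \<open>The device of the middle arcs again: eleven factors by \<open>weyl_complete\<close>, two
  in a mean square over \<open>a\<close>. The total exponent 1/16 - 11/8 + 1/32 - 1 of
  \<open>q\<close> is just below -9/4. The extra factor \<open>q powr (1/16)\<close> later turns
  convergence of the singular series into a rate.\<close>

lemma unit_weight_le:
  "\<exists>C>0. \<forall>q>0. real q powr (1/16) * unit_weight q \<le> C * (real q powr (- (9/4)) * real (congr_count q q))"
proof -
  \<comment> \<open>Chosen so that \<open>e1 * (11/8) = 1/32\<close>.\<close>
  define e1 where "e1 = (1/44 :: real)"
  have e1: "e1 > 0" by (simp add: e1_def)
  obtain C where C: "C > 0" and W: "\<And>q a. q > 0 \<Longrightarrow> coprime a (int q) \<Longrightarrow> (cmod (weyl4 q (of_int a / real q))) ^ 8 \<le> C * real q powr (7 + e1)"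
    using weyl_complete[OF e1] by blast
  have "real q powr (1/16) * unit_weight q \<le> C powr (11/8) * (real q powr (- (9/4)) * real (congr_count q q))" if q: "q > 0" for q
  proof -
    define K where "K = C powr (11/8) * real q powr (- (11/8) + 1/32)"
    have K0: "K \<ge> 0" by (simp add: K_def)
    have each: "(cmod (weyl4 q (real a / real q) / of_nat q)) ^ 13 \<le> K * ((cmod (weyl4 q (real a / real q)))\<^sup>2 / real q ^ 2)"
      if a: "coprime a q" for a
    proof -
      define w where "w = cmod (weyl4 q (real a / real q) / of_nat q)"
      have w0: "w \<ge> 0" by (simp add: w_def)
      have "w ^ 8 = (cmod (weyl4 q (of_int (int a) / real q))) ^ 8 / real q ^ 8"
        by (simp add: w_def norm_divide power_divide)
      also have "\<dots> \<le> C * real q powr (7 + e1) / real q ^ 8"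
        by (rule divide_right_mono[OF W[OF q]]) (use a in auto)
      also have "\<dots> = C * real q powr (- 1 + e1) / 1"
      proof -
        have "real q powr (7 + e1) = real q powr ((- 1 + e1) + 8)" by simp
        also have "\<dots> = real q powr (- 1 + e1) * real q ^ 8" unfolding powr_add using q by simp
        finally show ?thesis using q by simp
      qed
      finally have w8: "w ^ 8 \<le> C * real q powr (- 1 + e1) / 1" .
      have "w ^ 11 = (w ^ 8) powr (11/8)"
      proof (cases "w = 0")
        case False
        then have "w > 0" using w0 by simp
        have "w ^ 8 = w powr 8" "w ^ 11 = w powr 11" using \<open>w > 0\<close> by simp_all
        moreover have "(w powr 8) powr (11/8) = w powr (8 * (11/8))" by (rule powr_powr)
        moreover have "8 * (11/8) = (11::real)" by simp
        ultimately show ?thesis by (simp only:)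
      qed simp
      also have "\<dots> \<le> (C * real q powr (- 1 + e1) / 1) powr (11/8)"
        using w8 w0 by (intro powr_mono2) auto
      also have "\<dots> = C powr (11/8) * (real q powr (- 1 + e1)) powr (11/8) * 1 powr (- (11/8))"
        by (rule powr_mult_mult_divide) (use C in auto)
      also have "(real q powr (- 1 + e1)) powr (11/8) = real q powr (- (11/8) + 1/32)"
      proof -
        have "(- 1 + e1) * (11/8) = - (11/8) + 1/32" by (simp add: e1_def)
        then show ?thesis by (simp only: powr_powr)
      qed
      finally have w11: "w ^ 11 \<le> K" by (simp add: K_def)
      have "w ^ 13 = w ^ 11 * w\<^sup>2" by (simp flip: power_add)
      also have "\<dots> \<le> K * w\<^sup>2" by (rule mult_right_mono[OF w11]) simp
      also have "w\<^sup>2 = (cmod (weyl4 q (real a / real q)))\<^sup>2 / real q ^ 2"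
        by (simp add: w_def norm_divide power_divide)
      finally show ?thesis by (simp add: w_def)
    qed
    have "unit_weight q \<le> (\<Sum>a | a \<in> {1..q} \<and> coprime a q. K * ((cmod (weyl4 q (real a / real q)))\<^sup>2 / real q ^ 2))"
      unfolding unit_weight_def by (rule sum_mono) (use each in auto)
    also have "\<dots> \<le> (\<Sum>a\<in>{1..q}. K * ((cmod (weyl4 q (real a / real q)))\<^sup>2 / real q ^ 2))"
      by (rule sum_mono2) (use K0 in auto)
    also have "\<dots> = K / real q ^ 2 * (\<Sum>a\<in>{1..q}. (cmod (weyl4 q (real a / real q)))\<^sup>2)"
      by (simp add: sum_distrib_left)
    also have "(\<Sum>a\<in>{1..q}. (cmod (weyl4 q (real a / real q)))\<^sup>2) = (\<Sum>a\<in>{0..<int q}. (cmod (weyl4 q (of_int a / real q + 1 / real q)))\<^sup>2)"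
      by (rule sum.reindex_bij_witness[where i = "\<lambda>a. nat (a + 1)" and j = "\<lambda>a. int a - 1"])
         (auto simp: add_divide_distrib diff_divide_distrib)
    also have "K / real q ^ 2 * \<dots> \<le> K / real q ^ 2 * (real q * real (congr_count q q))"
      by (intro mult_left_mono sum_weyl4_residues_le[OF q]) (use K0 in auto)
    also have "\<dots> = K / real q * real (congr_count q q)" using q by (simp add: power2_eq_square)
    finally have "real q powr (1/16) * unit_weight q \<le> real q powr (1/16) * (K / real q * real (congr_count q q))"
      by (rule mult_left_mono) simp
    also have "\<dots> = C powr (11/8) * ((real q powr (1/16) * real q powr (- (11/8) + 1/32) / real q) * real (congr_count q q))"
      by (simp add: K_def)
    also have "real q powr (1/16) * real q powr (- (11/8) + 1/32) / real q \<le> real q powr (- (9/4))"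
    proof -
      have "real q powr (1/16) * real q powr (- (11/8) + 1/32) / real q = real q powr (1/16 + (- (11/8) + 1/32) - 1)"
        unfolding powr_diff powr_add using q by simp
      also have "\<dots> \<le> real q powr (- (9/4))" using q by (intro powr_mono) auto
      finally show ?thesis .
    qed
    finally show ?thesis using C by (simp add: mult_left_mono mult_right_mono)
  qed
  moreover have "C powr (11/8) > 0" using C by simp
  ultimately show ?thesis by blast
qed

lemma sum_unit_weight_le:
  "\<exists>C>0. \<forall>X. (\<Sum>q = 1..X. real q powr (1/16) * unit_weight q) \<le> C"
proof -
  obtain A where A: "A > 0" "\<And>q. q > 0 \<Longrightarrow> real q powr (1/16) * unit_weight q \<le> A * (real q powr (- (9/4)) * real (congr_count q q))"
    using unit_weight_le by blast
  obtain B where B: "B > 0" "\<And>X. (\<Sum>q = 1..X. real q powr (- (9/4)) * real (congr_count q q)) \<le> B"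
    using sum_congr_count_weighted by blast
  have "(\<Sum>q = 1..X. real q powr (1/16) * unit_weight q) \<le> A * B" for X
  proof -
    have "(\<Sum>q = 1..X. real q powr (1/16) * unit_weight q) \<le> (\<Sum>q = 1..X. A * (real q powr (- (9/4)) * real (congr_count q q)))"
      by (rule sum_mono) (rule A(2), simp)
    also have "\<dots> = A * (\<Sum>q = 1..X. real q powr (- (9/4)) * real (congr_count q q))" by (simp add: sum_distrib_left)
    also have "\<dots> \<le> A * B" using B(2) A(1) by (intro mult_left_mono) auto
    finally show ?thesis .
  qed
  then show ?thesis using A(1) B(1) by (intro exI[of _ "A * B"]) auto
qed

section \<open>Representation counts as averages\<close>

text \<open>Coefficient extraction with the roots of unity of order \<open>M\<close>, exact because
  the degree stays below \<open>M\<close>. Stating it for polynomials covers the Weyl sum and its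
  model at once, with powers taken in the polynomial ring.\<close>

lemma poly_orthogonality:
  fixes B :: "complex poly" and M :: int
  assumes M: "M > 0" and B: "int (degree B) < M" and n: "int n < M"
  shows "(\<Sum>j\<in>{0..<M}. poly B (E (of_int j / of_int M)) * E (- (of_int j * real n / of_int M))) = of_int M * coeff B n"
proof -
  have "(\<Sum>j\<in>{0..<M}. poly B (E (of_int j / of_int M)) * E (- (of_int j * real n / of_int M)))
    = (\<Sum>j\<in>{0..<M}. \<Sum>i\<le>degree B. coeff B i * E (of_int (j * (int i - int n)) / of_int M))"
  proof (rule sum.cong[OF refl])
    fix j
    have e: "of_int (j * (int i - int n)) / of_int M = real i * (of_int j / of_int M) + - (of_int j * real n / of_int M)" for i
      by (simp add: right_diff_distrib diff_divide_distrib mult.commute)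
    show "poly B (E (of_int j / of_int M)) * E (- (of_int j * real n / of_int M))
      = (\<Sum>i\<le>degree B. coeff B i * E (of_int (j * (int i - int n)) / of_int M))"
      unfolding poly_altdef sum_distrib_right e E_add E_power by (simp add: mult.assoc)
  qed
  also have "\<dots> = (\<Sum>i\<le>degree B. coeff B i * (\<Sum>j\<in>{0..<M}. E (of_int (j * (int i - int n)) / of_int M)))"
    by (subst sum.swap) (simp only: sum_distrib_left)
  also have "\<dots> = (\<Sum>i\<le>degree B. if i = n then of_int M * coeff B n else 0)"
  proof (rule sum.cong[OF refl])
    fix i assume i: "i \<in> {..degree B}"
    have "M dvd int i - int n \<longleftrightarrow> i = n"
    proof
      assume d: "M dvd int i - int n"
      have "int i < M" using i B by auto
      then have "\<bar>int i - int n\<bar> < M" using n by linarith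
      then show "i = n" using dvd_imp_le_int[OF _ d] by fastforce
    qed auto
    then show "coeff B i * (\<Sum>j\<in>{0..<M}. E (of_int (j * (int i - int n)) / of_int M)) = (if i = n then of_int M * coeff B n else 0)"
      by (simp only: sum_E_complete[OF M]) auto
  qed
  also have "\<dots> = of_int M * coeff B n"
    by (cases "n \<le> degree B") (auto simp: coeff_eq_0)
  finally show ?thesis .
qed

definition weyl4_poly :: "nat \<Rightarrow> complex poly" where
  "weyl4_poly P = (\<Sum>x = 1..P. monom 1 (x ^ 4))"

lemma poly_weyl4_poly: "poly (weyl4_poly P) (E \<alpha>) = weyl4 P \<alpha>"
proof -
  have "weyl4 P \<alpha> = (\<Sum>x = 1..P. E \<alpha> ^ (x ^ 4))"
    unfolding weyl4_def E_power
    by (rule sum.reindex_bij_witness[where i = int and j = nat]) (auto simp: mult.commute)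
  then show ?thesis by (simp add: weyl4_poly_def poly_sum poly_monom)
qed

lemma degree_weyl4_poly: "degree (weyl4_poly P) \<le> P ^ 4"
  unfolding weyl4_poly_def
  by (rule degree_sum_le) (auto intro!: order.trans[OF degree_monom_le] power_mono)

lemma finite_rep: "finite {xs :: nat list. length xs = s \<and> (\<forall>x\<in>set xs. 0 < x) \<and> (\<Sum>x\<leftarrow>xs. x ^ 4) = n}"
proof (rule finite_subset)
  show "{xs :: nat list. length xs = s \<and> (\<forall>x\<in>set xs. 0 < x) \<and> (\<Sum>x\<leftarrow>xs. x ^ 4) = n}
     \<subseteq> {xs. set xs \<subseteq> {..n} \<and> length xs = s}"
  proof clarsimp
    fix xs :: "nat list" and x assume x: "x \<in> set xs"
    have "x \<le> x ^ 4" by (cases "x = 0") (auto intro: self_le_power)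
    also have "\<dots> \<le> (\<Sum>x\<leftarrow>xs. x ^ 4)" using x by (intro member_le_sum_list) auto
    finally show "x \<le> (\<Sum>x\<leftarrow>xs. x ^ 4)" .
  qed
  show "finite {xs. set xs \<subseteq> {..n} \<and> length xs = s}" by (rule finite_lists_length_eq) simp
qed

lemma rep_count_0: "rep_count 0 4 n = (if n = 0 then 1 else 0)"
proof -
  have "{xs :: nat list. length xs = 0 \<and> (\<forall>x\<in>set xs. 0 < x) \<and> (\<Sum>x\<leftarrow>xs. x ^ 4) = n} = (if n = 0 then {[]} else {})"
    by auto
  then show ?thesis by (simp add: rep_count_def)
qed

lemma rep_count_Suc:
  assumes "n \<le> P ^ 4"
  shows "rep_count (Suc s) 4 n = (\<Sum>x\<in>{x\<in>{1..P}. x ^ 4 \<le> n}. rep_count s 4 (n - x ^ 4))"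
proof -
  define L where "L = (\<lambda>s n. {xs :: nat list. length xs = s \<and> (\<forall>x\<in>set xs. 0 < x) \<and> (\<Sum>x\<leftarrow>xs. x ^ 4) = n})"
  have fin: "finite (L s n)" for s n unfolding L_def by (rule finite_rep)
  have "L (Suc s) n = (\<Union>x\<in>{x\<in>{1..P}. x ^ 4 \<le> n}. (#) x ` L s (n - x ^ 4))"
  proof (intro equalityI subsetI)
    fix xs assume "xs \<in> L (Suc s) n"
    then obtain x ys where xs: "xs = x # ys" "length ys = s" "x > 0" "\<forall>y\<in>set ys. 0 < y" "x ^ 4 + (\<Sum>x\<leftarrow>ys. x ^ 4) = n"
      by (auto simp: L_def length_Suc_conv)
    have "x ^ 4 \<le> P ^ 4" using xs(5) assms by linarith
    then have "x \<le> P" by (rule power_le_imp_le_base[where n = 3, unfolded eval_nat_numeral(3)[symmetric], simplified]) simp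
    then show "xs \<in> (\<Union>x\<in>{x\<in>{1..P}. x ^ 4 \<le> n}. (#) x ` L s (n - x ^ 4))"
      using xs by (intro UN_I[of x]) (auto simp: L_def)
  qed (auto simp: L_def)
  then have "card (L (Suc s) n) = card (\<Union>x\<in>{x\<in>{1..P}. x ^ 4 \<le> n}. (#) x ` L s (n - x ^ 4))" by simp
  also have "\<dots> = (\<Sum>x\<in>{x\<in>{1..P}. x ^ 4 \<le> n}. card ((#) x ` L s (n - x ^ 4)))"
    by (rule card_UN_disjoint) (use fin in auto)
  also have "\<dots> = (\<Sum>x\<in>{x\<in>{1..P}. x ^ 4 \<le> n}. card (L s (n - x ^ 4)))"
    by (intro sum.cong refl card_image) (auto simp: inj_on_def)
  finally show ?thesis by (simp add: rep_count_def L_def)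
qed

text \<open>Truncation at \<open>P\<close> does no harm, since a representation of
  \<open>n \<le> P ^ 4\<close> involves only integers up to \<open>P\<close>. Multiplying by one
  more factor corresponds to prefixing an entry to the list.\<close>

lemma coeff_weyl4_poly_power:
  "n \<le> P ^ 4 \<Longrightarrow> coeff (weyl4_poly P ^ s) n = of_nat (rep_count s 4 n)"
proof (induction s arbitrary: n)
  case 0
  then show ?case by (simp add: rep_count_0 coeff_1)
next
  case (Suc s)
  have "coeff (weyl4_poly P ^ Suc s) n = (\<Sum>x = 1..P. coeff (monom 1 (x ^ 4) * weyl4_poly P ^ s) n)"
    by (simp add: weyl4_poly_def sum_distrib_right coeff_sum)
  also have "\<dots> = (\<Sum>x = 1..P. if x ^ 4 \<le> n then of_nat (rep_count s 4 (n - x ^ 4)) else 0)"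
    using Suc by (intro sum.cong refl) (auto simp: coeff_monom_mult)
  also have "\<dots> = (\<Sum>x\<in>{x\<in>{1..P}. x ^ 4 \<le> n}. of_nat (rep_count s 4 (n - x ^ 4)))"
    by (rule sum.inter_filter[symmetric]) simp
  finally show ?case using rep_count_Suc[OF Suc.prems] by simp
qed

lemma rep_count_fourier:
  fixes M :: int
  assumes "int s * int P ^ 4 < M" "int P ^ 4 < M" "n \<le> P ^ 4"
  shows "(\<Sum>j\<in>{0..<M}. weyl4 P (of_int j / of_int M) ^ s * E (- (of_int j * real n / of_int M))) = of_int M * of_nat (rep_count s 4 n)"
proof -
  have M: "M > 0" using assms(2) by (smt (verit) zero_le_power of_nat_0_le_iff)
  have "degree (weyl4_poly P ^ s) \<le> degree (weyl4_poly P) * s" by (rule degree_power_le)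
  also have "\<dots> \<le> P ^ 4 * s" by (rule mult_right_mono[OF degree_weyl4_poly]) simp
  finally have "int (degree (weyl4_poly P ^ s)) \<le> int (P ^ 4 * s)" by (simp only: of_nat_le_iff)
  then have d: "int (degree (weyl4_poly P ^ s)) < M" using assms(1) by (simp add: mult.commute)
  have "int n \<le> int (P ^ 4)" using assms(3) by (simp only: of_nat_le_iff)
  then have n: "int n < M" using assms(2) unfolding of_nat_power by linarith
  from poly_orthogonality[OF M d n] show ?thesis
    by (simp add: poly_power poly_weyl4_poly coeff_weyl4_poly_power[OF assms(3)])
qed

definition weyl4_model_poly :: "nat \<Rightarrow> complex poly" where
  "weyl4_model_poly P = (\<Sum>m\<le>P ^ 4. monom (of_real (Gamma (5/4) * poch_coeff (1/4) m)) m)"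

lemma poly_weyl4_model_poly: "poly (weyl4_model_poly P) (E \<alpha>) = weyl4_model P \<alpha>"
  by (simp add: weyl4_model_poly_def weyl4_model_def poly_sum poly_monom)

lemma degree_weyl4_model_poly: "degree (weyl4_model_poly P) \<le> P ^ 4"
  unfolding weyl4_model_poly_def
  by (rule degree_sum_le) (auto intro!: order.trans[OF degree_monom_le])

lemma coeff_weyl4_model_poly: "n \<le> P ^ 4 \<Longrightarrow> coeff (weyl4_model_poly P) n = of_real (Gamma (5/4) * poch_coeff (1/4) n)"
  by (simp add: weyl4_model_poly_def coeff_sum)

lemma coeff_weyl4_model_poly_power:
  "n \<le> P ^ 4 \<Longrightarrow> coeff (weyl4_model_poly P ^ s) n = of_real (Gamma (5/4) ^ s * poch_coeff (real s / 4) n)"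
proof (induction s arbitrary: n)
  case 0
  then show ?case by (cases n) (simp_all add: coeff_1 poch_coeff_def pochhammer_rec)
next
  case (Suc s)
  have "coeff (weyl4_model_poly P ^ Suc s) n = (\<Sum>i\<le>n. coeff (weyl4_model_poly P) i * coeff (weyl4_model_poly P ^ s) (n - i))"
    by (simp add: coeff_mult)
  also have "\<dots> = (\<Sum>i\<le>n. of_real (Gamma (5/4) ^ Suc s * (poch_coeff (1/4) i * poch_coeff (real s / 4) (n - i))))"
    using Suc by (intro sum.cong refl) (simp add: coeff_weyl4_model_poly)
  also have "\<dots> = of_real (Gamma (5/4) ^ Suc s * (\<Sum>i\<le>n. poch_coeff (1/4) i * poch_coeff (real s / 4) (n - i)))"
    by (simp only: of_real_sum sum_distrib_left)
  also have "(\<Sum>i\<le>n. poch_coeff (1/4) i * poch_coeff (real s / 4) (n - i)) = poch_coeff (real (Suc s) / 4) n"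
    unfolding poch_coeff_convolution by (simp add: add_divide_distrib)
  finally show ?case .
qed

lemma weyl4_model_fourier:
  fixes M :: int
  assumes "int s * int P ^ 4 < M" "int P ^ 4 < M" "n \<le> P ^ 4"
  shows "(\<Sum>j\<in>{0..<M}. weyl4_model P (of_int j / of_int M) ^ s * E (- (of_int j * real n / of_int M)))
     = of_int M * of_real (Gamma (5/4) ^ s * poch_coeff (real s / 4) n)"
proof -
  have M: "M > 0" using assms(2) by (smt (verit) zero_le_power of_nat_0_le_iff)
  have "degree (weyl4_model_poly P ^ s) \<le> degree (weyl4_model_poly P) * s" by (rule degree_power_le)
  also have "\<dots> \<le> P ^ 4 * s" by (rule mult_right_mono[OF degree_weyl4_model_poly]) simp
  finally have "int (degree (weyl4_model_poly P ^ s)) \<le> int (P ^ 4 * s)" by (simp only: of_nat_le_iff)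
  then have d: "int (degree (weyl4_model_poly P ^ s)) < M" using assms(1) by (simp add: mult.commute)
  have "int n \<le> int (P ^ 4)" using assms(3) by (simp only: of_nat_le_iff)
  then have n: "int n < M" using assms(2) unfolding of_nat_power by linarith
  from poly_orthogonality[OF M d n] show ?thesis
    by (simp add: poly_power poly_weyl4_model_poly coeff_weyl4_model_poly_power[OF assms(3)])
qed

lemma sum_periodic_shift:
  fixes G :: "int \<Rightarrow> 'a :: comm_monoid_add" and M :: int
  assumes "M > 0" "\<And>j k. G (j + M * k) = G j"
  shows "(\<Sum>j\<in>{c..<c + M}. G j) = (\<Sum>j\<in>{0..<M}. G j)"
proof -
  have mod: "G (j mod M) = G j" for j
    using assms(2)[of "j mod M" "j div M"] by (simp add: add.commute)
  show ?thesis
  proof (rule sum.reindex_bij_witness[where i = "\<lambda>j. c + (j - c) mod M" and j = "\<lambda>j. j mod M"])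
    fix j assume j: "j \<in> {c..<c + M}"
    have "(j mod M - c) mod M = j - c"
      using j by (simp add: mod_diff_left_eq)
    then show "c + (j mod M - c) mod M = j" by simp
    show "j mod M \<in> {0..<M}" using assms(1) by simp
    show "G (j mod M) = G j" by (rule mod)
  next
    fix j assume j: "j \<in> {0..<M}"
    have "(c + (j - c) mod M) mod M = j mod M" by (simp add: mod_add_right_eq)
    then show "(c + (j - c) mod M) mod M = j" using j by simp
    show "c + (j - c) mod M \<in> {c..<c + M}" using assms(1) by simp
  qed
qed

lemma E_periodic_frac:
  fixes M :: int
  assumes "M > 0"
  shows "E (of_int (j + M * k) / of_int M) = E (of_int j / of_int M)"
proof -
  have "of_int (j + M * k) / of_int M = of_int j / of_int M + real_of_int k"
    using assms by (simp add: add_divide_distrib)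
  then show ?thesis by (simp only: E_add_of_int)
qed

lemma E_minus_nat: "E (- (x * real n)) = cnj (E x ^ n)"
  by (simp add: E_power cnj_E mult.commute)

section \<open>The singular series and the major arcs\<close>

lemma e_of_real: "e (of_real x) = E x"
  by (simp add: e_def E_def cis_conv_exp mult_ac)

lemma singular_term_eq:
  "singular_term s 4 n q = (\<Sum>a | a \<in> {1..q} \<and> coprime a q.
      (weyl4 q (real a / real q) / of_nat q) ^ s * E (- (real a * real n / real q)))"
proof -
  have "(\<Sum>r = 1..q. e (of_nat a * of_nat r ^ 4 / of_nat q)) = weyl4 q (real a / real q)" for a
  proof -
    have "e (of_nat a * of_nat r ^ 4 / of_nat q) = E (real a / real q * real r ^ 4)" for r
      using e_of_real[of "real a / real q * real r ^ 4"] by (simp add: mult.commute)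
    then have "(\<Sum>r = 1..q. e (of_nat a * of_nat r ^ 4 / of_nat q)) = (\<Sum>r = 1..q. E (real a / real q * real r ^ 4))" by simp
    also have "\<dots> = weyl4 q (real a / real q)"
      unfolding weyl4_def by (rule sum.reindex_bij_witness[where i = nat and j = int]) auto
    finally show ?thesis .
  qed
  moreover have "e (- (of_nat a * of_nat n / of_nat q)) = E (- (real a * real n / real q))" for a
    using e_of_real[of "- (real a * real n / real q)"] by simp
  ultimately show ?thesis
    unfolding singular_term_def by (simp add: divide_inverse mult.commute)
qed

lemma norm_gauss_le_1: "cmod (weyl4 q \<alpha> / of_nat q) \<le> 1"
  using norm_weyl4_le[of q \<alpha>] by (cases "q = 0") (simp_all add: norm_divide)

lemma norm_singular_term_le:
  assumes "13 \<le> s"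
  shows "(\<Sum>a | a \<in> {1..q} \<and> coprime a q. cmod ((weyl4 q (real a / real q) / of_nat q) ^ s * E (- (real a * real n / real q)))) \<le> unit_weight q"
    and "cmod (singular_term s 4 n q) \<le> unit_weight q"
proof -
  show 1: "(\<Sum>a | a \<in> {1..q} \<and> coprime a q. cmod ((weyl4 q (real a / real q) / of_nat q) ^ s * E (- (real a * real n / real q)))) \<le> unit_weight q"
    unfolding unit_weight_def
  proof (rule sum_mono)
    fix a
    show "cmod ((weyl4 q (real a / real q) / of_nat q) ^ s * E (- (real a * real n / real q))) \<le> (cmod (weyl4 q (real a / real q) / of_nat q)) ^ 13"
      unfolding norm_mult norm_E norm_power using norm_gauss_le_1 assms by (simp add: power_decreasing)
  qed
  show "cmod (singular_term s 4 n q) \<le> unit_weight q"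
    unfolding singular_term_eq by (rule order.trans[OF norm_sum 1])
qed

lemma sum_unit_weight_tail:
  assumes C: "\<And>X. (\<Sum>q = 1..X. real q powr (1/16) * unit_weight q) \<le> C" and "N > 0"
  shows "(\<Sum>q = N..X. unit_weight q) \<le> C * real N powr (- (1/16))"
proof -
  have "real N powr (1/16) * (\<Sum>q = N..X. unit_weight q) \<le> (\<Sum>q = N..X. real q powr (1/16) * unit_weight q)"
    unfolding sum_distrib_left using assms(2)
    by (intro sum_mono mult_right_mono powr_mono2) (auto simp: unit_weight_nonneg)
  also have "\<dots> \<le> (\<Sum>q = 1..X. real q powr (1/16) * unit_weight q)"
    by (rule sum_mono2) (use assms(2) in \<open>auto simp: unit_weight_nonneg\<close>)
  also have "\<dots> \<le> C" by (rule C)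
  finally show ?thesis using assms(2) by (simp add: powr_minus_divide pos_le_divide_eq mult.commute)
qed

text \<open>All estimates pass through \<open>unit_weight\<close>, so they are uniform in
  \<open>n\<close>. The weight \<open>q powr (1/16)\<close> in \<open>sum_unit_weight_le\<close>
  gives the rate of the tail.\<close>

lemma singular_series_tail:
  "\<exists>C>0. \<forall>s n N. 13 \<le> s \<longrightarrow> cmod (singular_series s 4 n - (\<Sum>q = 1..N. singular_term s 4 n q)) \<le> C * real (Suc N) powr (- (1/16))
     \<and> cmod (singular_series s 4 n) \<le> C \<and> (\<Sum>q = 1..N. unit_weight q) \<le> C"
proof -
  obtain C where C: "C > 0" "\<And>X. (\<Sum>q = 1..X. real q powr (1/16) * unit_weight q) \<le> C"
    using sum_unit_weight_le by blast
  have U: "(\<Sum>q = 1..N. unit_weight q) \<le> C" for N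
    using sum_unit_weight_tail[OF C(2), of 1 N] by simp
  have tail: "cmod (singular_series s 4 n - (\<Sum>q = 1..N. singular_term s 4 n q)) \<le> C * real (Suc N) powr (- (1/16))" if s: "13 \<le> s" for s n N
  proof -
    define f where "f = (\<lambda>q. singular_term s 4 n (Suc q))"
    have part: "(\<Sum>q<X. f q) = (\<Sum>q = 1..X. singular_term s 4 n q)" for X
      unfolding f_def by (rule sum.reindex_bij_witness[where i = "\<lambda>q. q - 1" and j = Suc]) auto
    have "summable (\<lambda>q. unit_weight (Suc q))"
    proof (rule summableI_nonneg_bounded)
      fix X
      have "(\<Sum>q<X. unit_weight (Suc q)) = (\<Sum>q = 1..X. unit_weight q)"
        by (rule sum.reindex_bij_witness[where i = "\<lambda>q. q - 1" and j = Suc]) auto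
      then show "(\<Sum>q<X. unit_weight (Suc q)) \<le> C" using U by simp
    qed (rule unit_weight_nonneg)
    then have sm: "summable f"
      by (rule summable_comparison_test'[where N = 0]) (simp add: f_def norm_singular_term_le(2)[OF s])
    then have "(\<lambda>X. \<Sum>q<X. f q) \<longlonglongrightarrow> singular_series s 4 n"
      unfolding singular_series_def f_def[symmetric] by (rule summable_LIMSEQ)
    then have lim: "(\<lambda>X. cmod ((\<Sum>q<X. f q) - (\<Sum>q = 1..N. singular_term s 4 n q)))
       \<longlonglongrightarrow> cmod (singular_series s 4 n - (\<Sum>q = 1..N. singular_term s 4 n q))"
      by (intro tendsto_intros)
    have "cmod ((\<Sum>q<X. f q) - (\<Sum>q = 1..N. singular_term s 4 n q)) \<le> C * real (Suc N) powr (- (1/16))" if X: "X \<ge> N" for X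
    proof -
      have "{1..X} = {1..N} \<union> {Suc N..X}" using X by auto
      then have "(\<Sum>q = 1..X. singular_term s 4 n q) = (\<Sum>q = 1..N. singular_term s 4 n q) + (\<Sum>q = Suc N..X. singular_term s 4 n q)"
        by (simp only:) (rule sum.union_disjoint, auto)
      then have "cmod ((\<Sum>q<X. f q) - (\<Sum>q = 1..N. singular_term s 4 n q)) = cmod (\<Sum>q = Suc N..X. singular_term s 4 n q)"
        by (simp add: part)
      also have "\<dots> \<le> (\<Sum>q = Suc N..X. unit_weight q)"
        by (rule order.trans[OF norm_sum sum_mono[OF norm_singular_term_le(2)[OF s]]])
      also have "\<dots> \<le> C * real (Suc N) powr (- (1/16))" by (rule sum_unit_weight_tail[OF C(2)]) simp
      finally show ?thesis .
    qed
    then show ?thesis by (intro tendsto_upperbound[OF lim]) (auto simp: eventually_sequentially)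
  qed
  have "cmod (singular_series s 4 n) \<le> C" if "13 \<le> s" for s n
    using tail[OF that, of n 0] by simp
  then show ?thesis using C(1) tail U by blast
qed

lemma norm_power_diff_le:
  fixes x y :: complex
  assumes "cmod x \<le> B" "cmod y \<le> B"
  shows "cmod (x ^ Suc s - y ^ Suc s) \<le> real (Suc s) * B ^ s * cmod (x - y)"
proof (induction s)
  case (Suc s)
  have B0: "B \<ge> 0" using assms(1) norm_ge_zero[of x] by linarith
  have "x ^ Suc (Suc s) - y ^ Suc (Suc s) = x * (x ^ Suc s - y ^ Suc s) + y ^ Suc s * (x - y)"
    by (simp add: algebra_simps)
  also have "cmod \<dots> \<le> cmod x * cmod (x ^ Suc s - y ^ Suc s) + cmod (y ^ Suc s) * cmod (x - y)"
    by (rule order.trans[OF norm_triangle_ineq]) (simp add: norm_mult)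
  also have "\<dots> \<le> B * (real (Suc s) * B ^ s * cmod (x - y)) + B ^ Suc s * cmod (x - y)"
    using assms B0 unfolding norm_power by (intro add_mono mult_mono Suc power_mono mult_right_mono) auto
  also have "\<dots> = real (Suc (Suc s)) * B ^ Suc s * cmod (x - y)" by (simp add: algebra_simps)
  finally show ?case .
qed simp

lemma coprime_shift:
  fixes a k q :: int
  shows "coprime (a + k * q) q \<longleftrightarrow> coprime a q"
  using gcd_add_mult[of q k a] by (simp add: coprime_iff_gcd_eq_1 gcd.commute add.commute)

text \<open>Distinct centres are at least \<open>1 / R ^ 2\<close> apart modulo 1, more than the
  \<open>2 * R / P ^ 4\<close> within which two of them could share a point; this is the condition
  \<open>2 * R ^ 3 < P ^ 4\<close>. So every major grid point arises from exactly one triple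
  \<open>(q, a, b)\<close>. Windows that stick out of \<open>{0..<M}\<close> wrap around, which the
  periodicity of \<open>G\<close> absorbs.\<close>

lemma major_arcs_reindex:
  fixes M :: int and G :: "int \<Rightarrow> complex"
  assumes P: "P > 0" and M: "M > 0" and dvd: "\<And>q. q \<in> {1..P} \<Longrightarrow> int q dvd M"
    and R: "R \<ge> 1" "R \<le> real P" "2 * R ^ 3 < real P ^ 4"
    and G: "\<And>j k. G (j + M * k) = G j"
  shows "(\<Sum>j\<in>{j\<in>{0..<M}. major_arc P R (of_int j / of_int M)}. G j)
     = (\<Sum>q = 1..nat \<lfloor>R\<rfloor>. \<Sum>a | a \<in> {1..q} \<and> coprime a q. \<Sum>b\<in>{- \<lfloor>R * of_int M / real P ^ 4\<rfloor>..\<lfloor>R * of_int M / real P ^ 4\<rfloor>}.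
         G (int a * (M div int q) + b))"
proof -
  define B where "B = \<lfloor>R * of_int M / real P ^ 4\<rfloor>"
  define A where "A = (\<lambda>q::nat. {a. a \<in> {1..q} \<and> coprime a q})"
  define T where "T = (SIGMA q:{1..nat \<lfloor>R\<rfloor>}. A q \<times> {-B..B})"
  define val where "val = (\<lambda>t::nat \<times> nat \<times> int. int (fst (snd t)) * (M div int (fst t)) + snd (snd t))"
  define J where "J = {j\<in>{0..<M}. major_arc P R (of_int j / of_int M)}"
  have Mr: "real_of_int M > 0" using M by simp
  have P4: "real P ^ 4 > 0" using P by simp
  have finA: "finite (A q)" for q unfolding A_def by (rule finite_subset[of _ "{1..q}"]) auto
  have modG: "G (j mod M) = G j" for j using G[of "j mod M" "j div M"] by (simp add: add.commute)
  have qR: "1 \<le> q \<and> real q \<le> R \<and> q \<in> {1..P} \<and> q > 0" if "q \<in> {1..nat \<lfloor>R\<rfloor>}" for q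
  proof -
    have "q \<le> nat \<lfloor>R\<rfloor>" "1 \<le> q" using that by auto
    then have "real q \<le> R" using R(1) by (simp add: le_nat_iff le_floor_iff)
    moreover then have "real q \<le> real P" using R(2) by linarith
    ultimately show ?thesis using \<open>1 \<le> q\<close> by simp
  qed
  have valM: "of_int (int a * (M div int q) + b) / of_int M = real a / real q + of_int b / of_int M" if q: "q \<in> {1..nat \<lfloor>R\<rfloor>}" for q a b
  proof -
    obtain k where k: "M = int q * k" using dvd qR[OF q] by (metis dvdE)
    have "k \<noteq> 0" "q > 0" using k M qR[OF q] by auto
    then show ?thesis by (simp add: k field_simps)
  qed
  have bB: "\<bar>of_int b\<bar> / of_int M \<le> R / real P ^ 4" if b: "b \<in> {-B..B}" for b
  proof -
    have "\<bar>b\<bar> \<le> B" using b by auto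
    then have "\<bar>real_of_int b\<bar> \<le> R * of_int M / real P ^ 4" unfolding B_def by (simp add: le_floor_iff)
    then show ?thesis using Mr P4 by (simp add: field_simps)
  qed
  have inj: "inj_on (\<lambda>t. val t mod M) T"
  proof (rule inj_onI)
    fix t t' assume t: "t \<in> T" and t': "t' \<in> T" and eq: "val t mod M = val t' mod M"
    obtain q a b where tt: "t = (q, a, b)" by (metis surj_pair)
    obtain q' a' b' where tt': "t' = (q', a', b')" by (metis surj_pair)
    have q: "q \<in> {1..nat \<lfloor>R\<rfloor>}" "a \<in> A q" "b \<in> {-B..B}" using t unfolding tt T_def by auto
    have q': "q' \<in> {1..nat \<lfloor>R\<rfloor>}" "a' \<in> A q'" "b' \<in> {-B..B}" using t' unfolding tt' T_def by auto
    have "M dvd val t - val t'" using eq by (simp add: mod_eq_dvd_iff)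
    then obtain k where k: "val t - val t' = M * k" by auto
    have "of_int (val t) / of_int M - of_int (val t') / of_int M = real_of_int k"
      using k M by (simp add: diff_divide_distrib[symmetric] flip: of_int_diff)
    then have e: "real a / real q - real a' / real q' - of_int k = of_int b' / of_int M - of_int b / of_int M"
      unfolding tt tt' val_def fst_conv snd_conv valM[OF q(1)] valM[OF q'(1)] by simp
    \<comment> \<open>The numerator of \<open>a / q - a' / q' - k\<close> over the denominator
      \<open>q * q'\<close>: an integer that turns out to have modulus below 1.\<close>
    define z where "z = int a * int q' - int a' * int q - k * int q * int q'"
    have z: "real_of_int z = (real a / real q - real a' / real q' - of_int k) * (real q * real q')"
      using qR[OF q(1)] qR[OF q'(1)] by (simp add: z_def field_simps)
    have "\<bar>real a / real q - real a' / real q' - of_int k\<bar> \<le> \<bar>of_int b' / of_int M\<bar> + \<bar>real_of_int b / of_int M\<bar>"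
      unfolding e by (rule abs_triangle_ineq4)
    also have "\<dots> \<le> R / real P ^ 4 + R / real P ^ 4"
      using bB[OF q(3)] bB[OF q'(3)] Mr by (simp add: abs_divide)
    finally have "\<bar>real a / real q - real a' / real q' - of_int k\<bar> \<le> 2 * R / real P ^ 4" by simp
    then have "\<bar>real_of_int z\<bar> \<le> 2 * R / real P ^ 4 * (R * R)"
      unfolding z abs_mult using qR[OF q(1)] qR[OF q'(1)] R(1) by (intro mult_mono) auto
    also have "\<dots> = 2 * R ^ 3 / real P ^ 4" by (simp add: power3_eq_cube)
    also have "\<dots> < 1" using R(3) P4 by simp
    finally have z0: "z = 0" by linarith
    have cop: "coprime (int a) (int q)" "coprime (int a') (int q')" using q(2) q'(2) by (auto simp: A_def)
    have z1: "int a * int q' = int q * (int a' + k * int q')" using z0 by (simp add: z_def algebra_simps)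
    have z2: "int a' * int q = int q' * (int a - k * int q)" using z0 by (simp add: z_def algebra_simps)
    have "int q dvd int a * int q'" unfolding z1 by simp
    then have d1: "int q dvd int q'" using cop(1) by (metis coprime_commute coprime_dvd_mult_right_iff)
    have "int q' dvd int a' * int q" unfolding z2 by simp
    then have d2: "int q' dvd int q" using cop(2) by (metis coprime_commute coprime_dvd_mult_right_iff)
    have qq: "q = q'" using d1 d2 by (simp add: dvd_antisym)
    have "int a = int a' + k * int q" using z1 qq qR[OF q(1)] by simp
    moreover have "1 \<le> int a" "int a \<le> int q" "1 \<le> int a'" "int a' \<le> int q" using q(2) q'(2) qq by (auto simp: A_def)
    ultimately have ad: "k * int q = int a - int a'" and ab: "\<bar>int a - int a'\<bar> < int q" by linarith+
    have k0: "k = 0"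
    proof (rule ccontr)
      assume "k \<noteq> 0"
      then have "1 * int q \<le> \<bar>k\<bar> * int q" by (intro mult_right_mono) auto
      then show False using ad ab by (simp add: abs_mult[symmetric])
    qed
    then have "a = a'" using ad by simp
    moreover have "b = b'" using k k0 qq \<open>a = a'\<close> by (simp add: tt tt' val_def)
    ultimately show "t = t'" using qq tt tt' by simp
  qed
  have im: "(\<lambda>t. val t mod M) ` T = J"
  proof (intro equalityI subsetI)
    fix j assume "j \<in> (\<lambda>t. val t mod M) ` T"
    then obtain t where t: "t \<in> T" "j = val t mod M" by blast
    obtain q a b where tt: "t = (q, a, b)" by (metis surj_pair)
    have q: "q \<in> {1..nat \<lfloor>R\<rfloor>}" "a \<in> A q" "b \<in> {-B..B}" using t unfolding tt T_def by auto
    define k where "k = val t div M"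
    have jv: "val t = j + M * k" using t(2) by (simp add: k_def)
    have "of_int (val t) / of_int M = of_int j / of_int M + real_of_int k"
      using M unfolding jv by (simp add: add_divide_distrib)
    then have e: "of_int j / of_int M - of_int (int a - k * int q) / real q = real_of_int b / of_int M"
      unfolding tt val_def fst_conv snd_conv valM[OF q(1)] using qR[OF q(1)] by (simp add: field_simps)
    have "major_arc P R (of_int j / of_int M)"
      unfolding major_arc_def
    proof (intro exI conjI)
      show "0 < q" "real q \<le> R" using qR[OF q(1)] by auto
      have "coprime (int a) (int q)" using q(2) by (simp add: A_def)
      then show "coprime (int a - k * int q) (int q)"
        using coprime_shift[of "int a" "- k" "int q"] by simp
      show "\<bar>of_int j / of_int M - of_int (int a - k * int q) / real q\<bar> \<le> R / real P ^ 4"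
        unfolding e using bB[OF q(3)] Mr by (simp add: abs_divide)
    qed
    then show "j \<in> J" using t(2) M by (simp add: J_def)
  next
    fix j assume "j \<in> J"
    then have j: "0 \<le> j" "j < M" and "major_arc P R (of_int j / of_int M)" by (auto simp: J_def)
    then obtain q a where q0: "0 < q" and qle: "real q \<le> R" and cop: "coprime a (int q)"
      and close: "\<bar>of_int j / of_int M - of_int a / real q\<bar> \<le> R / real P ^ 4" unfolding major_arc_def by blast
    have q: "q \<in> {1..nat \<lfloor>R\<rfloor>}" using q0 qle by (auto simp: le_nat_iff le_floor_iff)
    \<comment> \<open>The representative in \<open>{1..q}\<close>, matching the range of
      \<open>a\<close> in \<open>singular_term\<close>; for \<open>q = 1\<close> it is 1.\<close>
    define a0 where "a0 = (a - 1) mod int q + 1"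
    define k where "k = (a - 1) div int q"
    have ak: "a = a0 + int q * k" by (simp add: a0_def k_def)
    have "0 \<le> (a - 1) mod int q" "(a - 1) mod int q < int q" using q0 by simp_all
    then have a0: "1 \<le> a0" "a0 \<le> int q" unfolding a0_def by linarith+
    have cop0: "coprime a0 (int q)"
      using cop coprime_shift[of a0 k "int q"] unfolding ak by (simp add: mult.commute)
    obtain c where c: "M = int q * c" using dvd qR[OF q] by (metis dvdE)
    have cd: "M div int q = c" using c q0 by simp
    have c0: "c \<noteq> 0" using c M by auto
    define b where "b = j - a * c"
    have "of_int j / of_int M - of_int a / real q = real_of_int b / of_int M"
      using q0 c0 by (simp add: b_def c field_simps)
    then have "\<bar>real_of_int b\<bar> / of_int M \<le> R / real P ^ 4" using close Mr by (simp add: abs_divide)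
    then have "\<bar>real_of_int b\<bar> \<le> R * of_int M / real P ^ 4" using Mr P4 by (simp add: field_simps)
    then have "\<bar>b\<bar> \<le> B" unfolding B_def by (simp add: le_floor_iff)
    then have b: "b \<in> {-B..B}" by auto
    obtain a1 :: nat where a1: "a0 = int a1" using a0(1) zero_le_imp_eq_int[of a0] by auto
    have "a1 \<in> A q" using a0 cop0 unfolding a1 by (simp add: A_def)
    then have tT: "(q, a1, b) \<in> T" using q b by (auto simp: T_def)
    have "val (q, a1, b) = j + M * (- k)" using a1 q0 by (simp add: val_def cd b_def ak c algebra_simps)
    then have "val (q, a1, b) mod M = j mod M" by (simp only: mod_mult_self2)
    also have "\<dots> = j" using j by simp
    finally show "j \<in> (\<lambda>t. val t mod M) ` T" using tT by (metis image_eqI)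
  qed
  have "(\<Sum>j\<in>J. G j) = (\<Sum>t\<in>T. G (val t mod M))" unfolding im[symmetric] by (simp add: sum.reindex[OF inj])
  also have "\<dots> = (\<Sum>t\<in>T. G (val t))" by (simp only: modG)
  also have "\<dots> = (\<Sum>q = 1..nat \<lfloor>R\<rfloor>. \<Sum>p\<in>A q \<times> {-B..B}. G (val (q, p)))"
    unfolding T_def by (subst sum.Sigma) (auto simp: finA)
  also have "\<dots> = (\<Sum>q = 1..nat \<lfloor>R\<rfloor>. \<Sum>a\<in>A q. \<Sum>b\<in>{-B..B}. G (int a * (M div int q) + b))"
    by (simp add: sum.cartesian_product case_prod_unfold val_def)
  finally show ?thesis unfolding J_def A_def B_def .
qed

text \<open>Over a full period the sum is known exactly by \<open>weyl4_model_fourier\<close>, so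
  only the complement of the window must be bounded. As \<open>M\<close> is even the period can be
  centred at 0, where \<open>\<bar>\<beta>\<bar> \<le> 1/2\<close> and the decay of the model
  applies. Thirteen factors give the power -13/4 of \<open>\<bar>\<beta>\<bar>\<close>, and
  summation leaves -9/4.\<close>

lemma weyl4_model_window:
  "\<exists>C>0. \<forall>P s n R. \<forall>M::int. P > 0 \<longrightarrow> 13 \<le> s \<longrightarrow> s \<le> 14 \<longrightarrow> n \<le> P ^ 4 \<longrightarrow> 14 * int P ^ 4 < M \<longrightarrow> even M \<longrightarrow>
     R \<ge> 1 \<longrightarrow> 2 * R < real P ^ 4 \<longrightarrow>
     cmod ((\<Sum>b\<in>{- \<lfloor>R * of_int M / real P ^ 4\<rfloor>..\<lfloor>R * of_int M / real P ^ 4\<rfloor>}.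
          weyl4_model P (of_int b / of_int M) ^ s * E (- (of_int b * real n / of_int M)))
        - of_int M * of_real (Gamma (5/4) ^ s * poch_coeff (real s / 4) n))
      \<le> C * of_int M * real P ^ (s - 4) * R powr (- (9/4))"
proof -
  obtain K where K: "K > 0" "\<And>P \<beta>. P > 0 \<Longrightarrow> cmod (weyl4_model P \<beta>) \<le> K * real P"
     "\<And>P \<beta>. P > 0 \<Longrightarrow> 0 < \<bar>\<beta>\<bar> \<Longrightarrow> \<bar>\<beta>\<bar> \<le> 1/2 \<Longrightarrow> cmod (weyl4_model P \<beta>) \<le> K * \<bar>\<beta>\<bar> powr (- (1/4))"
    using weyl4_model_bounds by blast
  define D where "D = (K + 1) ^ 14 * 2 powr (13/4) * 2"
  have D0: "D > 0" using K(1) by (simp add: D_def)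
  have "cmod ((\<Sum>b\<in>{- \<lfloor>R * of_int M / real P ^ 4\<rfloor>..\<lfloor>R * of_int M / real P ^ 4\<rfloor>}.
          weyl4_model P (of_int b / of_int M) ^ s * E (- (of_int b * real n / of_int M)))
        - of_int M * of_real (Gamma (5/4) ^ s * poch_coeff (real s / 4) n))
      \<le> D * of_int M * real P ^ (s - 4) * R powr (- (9/4))"
    if P: "P > 0" and s: "13 \<le> s" "s \<le> 14" and n: "n \<le> P ^ 4" and M: "14 * int P ^ 4 < M" "even M"
      and R: "R \<ge> 1" "2 * R < real P ^ 4" for P s n R and M :: int
  proof -
    define d where "d = R / real P ^ 4"
    define B where "B = \<lfloor>R * of_int M / real P ^ 4\<rfloor>"
    define G where "G = (\<lambda>b::int. weyl4_model P (of_int b / of_int M) ^ s * E (- (of_int b * real n / of_int M)))"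
    obtain H where H: "M = 2 * H" using M(2) by auto
    have P4: "real P ^ 4 > 0" "int P ^ 4 > 0" using P by simp_all
    have M0: "M > 0" using M(1) P4(2) by linarith
    have Mr: "real_of_int M > 0" using M0 by simp
    have H0: "H > 0" using M0 H by simp
    have d0: "d > 0" using R P4 by (simp add: d_def)
    have Md: "of_int M * d \<ge> 1"
    proof -
      have "real_of_int (int P ^ 4) \<le> of_int M" using M(1) P4(2) by (intro of_int_le_iff[THEN iffD2]) linarith
      then have "1 * real P ^ 4 \<le> R * of_int M" using R Mr P4 by (intro mult_mono) auto
      then show ?thesis using P4 by (simp add: d_def pos_le_divide_eq mult.commute)
    qed
    have Bd: "B = \<lfloor>of_int M * d\<rfloor>" by (simp add: B_def d_def mult.commute)
    have B0: "B \<ge> 0" using Md unfolding Bd by simp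
    have BH: "B < H"
    proof -
      have "of_int M * d < of_int M * (1/2)" using R(2) P4 Mr by (intro mult_strict_left_mono) (auto simp: d_def field_simps)
      then have "of_int M * d < of_int H" using H by simp
      then show ?thesis unfolding Bd by (simp add: floor_less_iff)
    qed
    have per: "G (j + M * k) = G j" for j k
    proof -
      have "G j = poly (weyl4_model_poly P) (E (of_int j / of_int M)) ^ s * cnj (E (of_int j / of_int M) ^ n)" for j
        using E_minus_nat[of "of_int j / of_int M" n] by (simp add: G_def poly_weyl4_model_poly)
      then show ?thesis by (simp only: E_periodic_frac[OF M0])
    qed
    have "int s * int P ^ 4 \<le> 14 * int P ^ 4" using s by (intro mult_right_mono) auto
    then have sM: "int s * int P ^ 4 < M" "int P ^ 4 < M" using M(1) P4(2) by linarith+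
    have "(\<Sum>j\<in>{- H..<- H + M}. G j) = (\<Sum>j\<in>{0..<M}. G j)" by (rule sum_periodic_shift[OF M0 per])
    also have "\<dots> = of_int M * of_real (Gamma (5/4) ^ s * poch_coeff (real s / 4) n)"
      unfolding G_def by (rule weyl4_model_fourier[OF sM n])
    finally have full: "(\<Sum>j\<in>{- H..<H}. G j) = of_int M * of_real (Gamma (5/4) ^ s * poch_coeff (real s / 4) n)"
      by (simp add: H)
    have sub: "{-B..B} \<subseteq> {- H..<H}" using BH by auto
    have "(\<Sum>b\<in>{-B..B}. G b) - (\<Sum>j\<in>{- H..<H}. G j) = - (\<Sum>j\<in>{- H..<H} - {-B..B}. G j)"
      using sum.subset_diff[OF sub, of G] by simp
    then have "cmod ((\<Sum>b\<in>{-B..B}. G b) - (\<Sum>j\<in>{- H..<H}. G j)) = cmod (\<Sum>j\<in>{- H..<H} - {-B..B}. G j)"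
      by (simp only: norm_minus_cancel)
    also have "\<dots> \<le> (\<Sum>j\<in>{- H..<H} - {-B..B}. cmod (G j))" by (rule norm_sum)
    also have "\<dots> \<le> (\<Sum>j\<in>{- H..<H} - {-B..B}. (K + 1) ^ 14 * real P ^ (s - 13) * (d powr (- (13/4)) * (2 powr (13/4) * (1 + 1 / (of_int M * d) * \<bar>of_int j\<bar>) powr (- (13/4)))))"
    proof (rule sum_mono)
      fix j assume j: "j \<in> {- H..<H} - {-B..B}"
      define x where "x = \<bar>of_int j\<bar> / real_of_int M"
      have "\<bar>j\<bar> \<ge> B + 1" using j by auto
      then have "real_of_int (B + 1) \<le> \<bar>of_int j\<bar>" by linarith
      then have "of_int M * d \<le> \<bar>of_int j\<bar>" unfolding Bd using floor_correct[of "of_int M * d"] by linarith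
      then have xd: "x \<ge> d" using Mr by (simp add: x_def pos_le_divide_eq mult.commute)
      have x0: "x > 0" using xd d0 by linarith
      have "\<bar>j\<bar> \<le> H" using j by auto
      then have "2 * \<bar>real_of_int j\<bar> \<le> of_int M" using H by linarith
      then have xh: "x \<le> 1/2" using Mr by (simp add: x_def pos_divide_le_eq)
      have xa: "\<bar>of_int j / real_of_int M\<bar> = x" using Mr by (simp add: x_def abs_divide)
      define v where "v = cmod (weyl4_model P (of_int j / of_int M))"
      have v0: "v \<ge> 0" by (simp add: v_def)
      have v1: "v \<le> K * real P" unfolding v_def by (rule K(2)[OF P])
      have v2: "v \<le> K * x powr (- (1/4))" unfolding v_def by (rule K(3)[OF P, of "of_int j / of_int M", unfolded xa, OF x0 xh])
      obtain r where r: "s = 13 + r" "r \<le> 1" using s le_Suc_ex[OF s(1)] by auto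
      have "cmod (G j) = v ^ r * v ^ 13" by (simp add: G_def v_def norm_mult norm_power r power_add)
      also have "\<dots> \<le> (K * real P) ^ r * (K * x powr (- (1/4))) ^ 13"
        using v0 v1 v2 by (intro mult_mono power_mono) auto
      also have "\<dots> = K ^ s * real P ^ r * x powr (- (13/4))"
        using x0 by (simp add: power_mult_distrib r power_add powr_power)
      also have "\<dots> \<le> (K + 1) ^ 14 * real P ^ r * x powr (- (13/4))"
      proof (intro mult_right_mono)
        have "K ^ s \<le> (K + 1) ^ s" using K(1) by (intro power_mono) auto
        also have "\<dots> \<le> (K + 1) ^ 14" using K(1) s by (intro power_increasing) auto
        finally show "K ^ s \<le> (K + 1) ^ 14" .
      qed auto
      \<comment> \<open>Outside the window \<open>x / d \<ge> 1\<close>, so at the cost of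
        \<open>2 powr (13/4)\<close> it may be replaced by \<open>1 + x / d\<close>, the form which
        \<open>sum_powr_symmetric_le\<close> handles.\<close>
      also have "x powr (- (13/4)) \<le> d powr (- (13/4)) * (2 powr (13/4) * (1 + 1 / (of_int M * d) * \<bar>of_int j\<bar>) powr (- (13/4)))"
      proof -
        define y where "y = 1 / (of_int M * d) * \<bar>of_int j\<bar>"
        have xy: "x = d * y" using d0 Mr by (simp add: x_def y_def)
        have y1: "y \<ge> 1" using xd d0 unfolding xy by simp
        have "y powr (- (13/4)) \<le> ((1 + y) / 2) powr (- (13/4))" using y1 by (intro powr_mono2') auto
        also have "\<dots> = 2 powr (13/4) * (1 + y) powr (- (13/4))"
          using y1 by (simp add: powr_divide powr_minus_divide)
        finally have "d powr (- (13/4)) * y powr (- (13/4)) \<le> d powr (- (13/4)) * (2 powr (13/4) * (1 + y) powr (- (13/4)))"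
          by (rule mult_left_mono) simp
        then show ?thesis unfolding y_def[symmetric] using d0 y1 by (simp add: xy powr_mult)
      qed
      finally show "cmod (G j) \<le> (K + 1) ^ 14 * real P ^ (s - 13) * (d powr (- (13/4)) * (2 powr (13/4) * (1 + 1 / (of_int M * d) * \<bar>of_int j\<bar>) powr (- (13/4))))"
        using K(1) by (simp add: r mult_left_mono)
    qed
    also have "\<dots> = (K + 1) ^ 14 * real P ^ (s - 13) * d powr (- (13/4)) * 2 powr (13/4) *
        (\<Sum>j\<in>{- H..<H} - {-B..B}. (1 + 1 / (of_int M * d) * \<bar>of_int j\<bar>) powr (- (13/4)))"
      by (simp add: sum_distrib_left mult.assoc)
    also have "\<dots> \<le> (K + 1) ^ 14 * real P ^ (s - 13) * d powr (- (13/4)) * 2 powr (13/4) * (2 * (of_int M * d))"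
    proof (rule mult_left_mono)
      have "(\<Sum>j\<in>{- H..<H} - {-B..B}. (1 + 1 / (of_int M * d) * \<bar>of_int j\<bar>) powr (- (13/4)))
         \<le> (\<Sum>j\<in>{- int (nat H)..int (nat H)}. (1 + 1 / (of_int M * d) * \<bar>of_int j\<bar>) powr (- (13/4)))"
        by (rule sum_mono2) (use H0 in auto)
      also have "\<dots> \<le> 1 + 2 / (1 / (of_int M * d) * (13/4 - 1))"
        by (rule sum_powr_symmetric_le) (use Md in auto)
      also have "\<dots> = 1 + 8 / 9 * (of_int M * d)" by simp
      also have "\<dots> \<le> 2 * (of_int M * d)" using Md by simp
      finally show "(\<Sum>j\<in>{- H..<H} - {-B..B}. (1 + 1 / (of_int M * d) * \<bar>of_int j\<bar>) powr (- (13/4))) \<le> 2 * (of_int M * d)" .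
    qed (use K(1) in simp)
    also have "\<dots> = D * of_int M * real P ^ (s - 13) * (d powr (- (13/4)) * d)" by (simp add: D_def)
    also have "d powr (- (13/4)) * d = d powr (- (9/4))"
    proof -
      have "d powr (- (9/4)) = d powr (- (13/4) + 1)" by simp
      also have "\<dots> = d powr (- (13/4)) * d" unfolding powr_add using d0 by simp
      finally show ?thesis by simp
    qed
    also have "d powr (- (9/4)) = R powr (- (9/4)) * real P ^ 9"
    proof -
      have "(real P ^ 4) powr (9/4) = real P powr (4 * (9/4))"
        using P powr_powr[of "real P" 4 "9/4"] by simp
      also have "4 * (9/4) = (9::real)" by simp
      also have "real P powr 9 = real P ^ 9" using P by simp
      finally have p9: "(real P ^ 4) powr (9/4) = real P ^ 9" .
      show ?thesis using R P4 unfolding d_def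
        by (simp add: powr_divide powr_minus_divide p9)
    qed
    finally have "cmod ((\<Sum>b\<in>{-B..B}. G b) - (\<Sum>j\<in>{- H..<H}. G j)) \<le> D * of_int M * (real P ^ (s - 13) * real P ^ 9) * R powr (- (9/4))"
      by (simp add: mult_ac)
    also have "real P ^ (s - 13) * real P ^ 9 = real P ^ (s - 4)"
      using s(1) by (simp flip: power_add)
    finally have "cmod ((\<Sum>b\<in>{-B..B}. G b) - (\<Sum>j\<in>{- H..<H}. G j)) \<le> D * of_int M * real P ^ (s - 4) * R powr (- (9/4))" .
    then show ?thesis unfolding full unfolding G_def B_def .
  qed
  then show ?thesis using D0 by blast
qed

lemma poch_coeff_bounds:
  assumes "13 \<le> s"
  shows "\<exists>C>0. \<forall>P n. P > 0 \<longrightarrow> 1 \<le> n \<longrightarrow> n \<le> P ^ 4 \<longrightarrow>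
     \<bar>Gamma (5/4) ^ s * poch_coeff (real s / 4) n\<bar> \<le> C * real P powr (real s - 4) \<and>
     \<bar>Gamma (5/4) ^ s * poch_coeff (real s / 4) n - Gamma (5/4) ^ s / Gamma (real s / 4) * real n powr (real s / 4 - 1)\<bar> \<le> C * real P powr (real s - 8)"
proof -
  define z where "z = real s / 4"
  have z: "z > 2" using assms by (simp add: z_def)
  obtain C where C: "C > 0" "\<And>n. n \<ge> 1 \<Longrightarrow> \<bar>poch_coeff z n - real n powr (z - 1) / Gamma z\<bar> \<le> C * real n powr (z - 2)"
    using poch_coeff_asymp[of z] z by auto
  have Gz: "Gamma z > 0" using z by (intro Gamma_real_pos) simp
  define A where "A = Gamma (5/4 :: real) ^ s"
  have A0: "A > 0" using Gamma_5_4_pos by (simp add: A_def)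
  define D where "D = A * (C + 1 / Gamma z)"
  have Gi: "1 / Gamma z > 0" using Gz by simp
  have D0: "D > 0" unfolding D_def using A0 C(1) Gi by (intro mult_pos_pos add_pos_pos)
  have "\<bar>A * poch_coeff z n\<bar> \<le> D * real P powr (real s - 4) \<and>
     \<bar>A * poch_coeff z n - A / Gamma z * real n powr (z - 1)\<bar> \<le> D * real P powr (real s - 8)"
    if P: "P > 0" and n: "1 \<le> n" "n \<le> P ^ 4" for P n
  proof -
    have pw: "real n powr t \<le> real P powr (4 * t)" if t: "t \<ge> 0" for t
    proof -
      have "real n \<le> real P ^ 4" using of_nat_mono[OF n(2), where 'a = real] by simp
      then have "real n powr t \<le> (real P ^ 4) powr t" using t by (intro powr_mono2) auto
      also have "real P ^ 4 = real P powr 4" using P by simp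
      also have "(real P powr 4) powr t = real P powr (4 * t)" by (rule powr_powr)
      finally show ?thesis .
    qed
    have p1: "real n powr (z - 1) \<le> real P powr (real s - 4)" using pw[of "z - 1"] z by (simp add: z_def)
    have p2: "real n powr (z - 2) \<le> real P powr (real s - 8)" using pw[of "z - 2"] z by (simp add: z_def)
    have p3: "real P powr (real s - 8) \<le> real P powr (real s - 4)" using P by (intro powr_mono) auto
    have d: "\<bar>poch_coeff z n - real n powr (z - 1) / Gamma z\<bar> \<le> C * real P powr (real s - 8)"
      using C(2)[OF n(1)] mult_left_mono[OF p2, of C] C(1) by linarith
    have "A * poch_coeff z n - A / Gamma z * real n powr (z - 1) = A * (poch_coeff z n - real n powr (z - 1) / Gamma z)"
      by (simp add: right_diff_distrib)
    then have "\<bar>A * poch_coeff z n - A / Gamma z * real n powr (z - 1)\<bar> = A * \<bar>poch_coeff z n - real n powr (z - 1) / Gamma z\<bar>"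
      using A0 by (simp only: abs_mult abs_of_pos)
    also have "\<dots> \<le> A * (C * real P powr (real s - 8))" using d A0 by (intro mult_left_mono) auto
    also have "\<dots> \<le> D * real P powr (real s - 8)"
      unfolding D_def mult.assoc using A0 Gi C(1) by (intro mult_left_mono mult_right_mono) auto
    finally have 2: "\<bar>A * poch_coeff z n - A / Gamma z * real n powr (z - 1)\<bar> \<le> D * real P powr (real s - 8)" .
    have "poch_coeff z n \<le> C * real P powr (real s - 8) + real n powr (z - 1) / Gamma z" using d by linarith
    also have "\<dots> \<le> C * real P powr (real s - 4) + real P powr (real s - 4) / Gamma z"
      using p1 p3 C(1) Gz by (intro add_mono mult_left_mono divide_right_mono) auto
    finally have "A * poch_coeff z n \<le> A * (C * real P powr (real s - 4) + real P powr (real s - 4) / Gamma z)"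
      using A0 by (intro mult_left_mono) auto
    also have "\<dots> = D * real P powr (real s - 4)" by (simp add: D_def algebra_simps)
    finally have "A * poch_coeff z n \<le> D * real P powr (real s - 4)" .
    moreover have "A * poch_coeff z n \<ge> 0" using A0 poch_coeff_pos[of z n] z by simp
    ultimately show ?thesis using 2 by simp
  qed
  then show ?thesis using D0 unfolding A_def z_def by blast
qed

text \<open>Relative to \<open>P powr (s - 4)\<close> there are four errors: the model in place of
  the Weyl sum costs \<open>R ^ 5 / P\<close>, completing the window
  \<open>R powr (- (9/4))\<close>, completing the singular series \<open>R powr (- (1/16))\<close>,
  and the asymptotics of the coefficients \<open>P powr (- 4)\<close>. With
  \<open>R = P powr (1/20)\<close> the third one is the largest, and 1/320 is 1/16 times
  1/20.\<close>

lemma major_arcs_asymptotic: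
  assumes s: "13 \<le> s" "s \<le> 14"
  shows "\<exists>C>0. \<forall>P n. \<forall>M::int. P \<ge> 2 \<longrightarrow> 1 \<le> n \<longrightarrow> n \<le> P ^ 4 \<longrightarrow> 14 * int P ^ 4 < M \<longrightarrow> even M \<longrightarrow>
     (\<forall>q\<in>{1..P}. int q dvd M) \<longrightarrow>
     cmod ((\<Sum>j\<in>{j\<in>{0..<M}. major_arc P (real P powr (1/20)) (of_int j / of_int M)}.
            weyl4 P (of_int j / of_int M) ^ s * E (- (of_int j * real n / of_int M))) / of_int M
        - of_real (Gamma (5/4) ^ s / Gamma (real s / 4)) * singular_series s 4 n * of_real (real n powr (real s / 4 - 1)))
      \<le> C * real P powr (real s - 4 - 1/320)"
proof -
  obtain K where K: "K > 0" "\<And>P \<beta>. P > 0 \<Longrightarrow> cmod (weyl4_model P \<beta>) \<le> K * real P" using weyl4_model_bounds by blast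
  obtain L where L: "L > 0" "\<And>P q a \<beta>. q > 0 \<Longrightarrow>
     cmod (weyl4 P (of_int a / real q + \<beta>) - weyl4 q (of_int a / real q) / of_nat q * weyl4_model P \<beta>) \<le> L * real q * (1 + real P ^ 4 * \<bar>\<beta>\<bar>)"
    using weyl4_approx by blast
  obtain C2 where C2: "C2 > 0" "\<And>P n R M. P > 0 \<Longrightarrow> n \<le> P ^ 4 \<Longrightarrow> 14 * int P ^ 4 < M \<Longrightarrow> even M \<Longrightarrow> R \<ge> 1 \<Longrightarrow> 2 * R < real P ^ 4 \<Longrightarrow>
     cmod ((\<Sum>b\<in>{- \<lfloor>R * of_int M / real P ^ 4\<rfloor>..\<lfloor>R * of_int M / real P ^ 4\<rfloor>}.
          weyl4_model P (of_int b / of_int M) ^ s * E (- (of_int b * real n / of_int M)))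
        - of_int M * of_real (Gamma (5/4) ^ s * poch_coeff (real s / 4) n))
      \<le> C2 * of_int M * real P ^ (s - 4) * R powr (- (9/4))"
    using weyl4_model_window s by blast
  obtain C3 where C3: "C3 > 0" "\<And>n N. cmod (singular_series s 4 n - (\<Sum>q = 1..N. singular_term s 4 n q)) \<le> C3 * real (Suc N) powr (- (1/16))"
     "\<And>n. cmod (singular_series s 4 n) \<le> C3" "\<And>N. (\<Sum>q = 1..N. unit_weight q) \<le> C3"
    using singular_series_tail s(1) by blast
  obtain C4 where C4: "C4 > 0" "\<And>P n. P > 0 \<Longrightarrow> 1 \<le> n \<Longrightarrow> n \<le> P ^ 4 \<Longrightarrow> \<bar>Gamma (5/4) ^ s * poch_coeff (real s / 4) n\<bar> \<le> C4 * real P powr (real s - 4)"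
     "\<And>P n. P > 0 \<Longrightarrow> 1 \<le> n \<Longrightarrow> n \<le> P ^ 4 \<Longrightarrow>
       \<bar>Gamma (5/4) ^ s * poch_coeff (real s / 4) n - Gamma (5/4) ^ s / Gamma (real s / 4) * real n powr (real s / 4 - 1)\<bar> \<le> C4 * real P powr (real s - 8)"
    using poch_coeff_bounds[OF s(1)] by blast
  define C1 where "C1 = 84 * (K + 1) ^ 13 * L"
  have C1: "C1 > 0" using K(1) L(1) by (simp add: C1_def)
  define C where "C = C1 + C3 * C2 + C3 * C4 + C3 * C4"
  have C0: "C > 0" using C1 C2(1) C3(1) C4(1) by (simp add: C_def add_pos_pos)
  have "cmod ((\<Sum>j\<in>{j\<in>{0..<M}. major_arc P (real P powr (1/20)) (of_int j / of_int M)}.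
            weyl4 P (of_int j / of_int M) ^ s * E (- (of_int j * real n / of_int M))) / of_int M
        - of_real (Gamma (5/4) ^ s / Gamma (real s / 4)) * singular_series s 4 n * of_real (real n powr (real s / 4 - 1)))
      \<le> C * real P powr (real s - 4 - 1/320)"
    if P: "P \<ge> 2" and n: "1 \<le> n" "n \<le> P ^ 4" and M: "14 * int P ^ 4 < M" "even M" and dvd: "\<And>q. q \<in> {1..P} \<Longrightarrow> int q dvd M"
    for P n and M :: int
  proof -
    define R where "R = real P powr (1/20)"
    define N where "N = nat \<lfloor>R\<rfloor>"
    define B where "B = \<lfloor>R * of_int M / real P ^ 4\<rfloor>"
    define p where "p = real P"
    have P0: "P > 0" using P by simp
    have p2: "p \<ge> 2" using P by (simp add: p_def)
    have P4: "real P ^ 4 > 0" "int P ^ 4 > 0" using P0 by simp_all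
    have M0: "M > 0" using M(1) P4(2) by linarith
    have Mr: "real_of_int M > 0" using M0 by simp
    have R1: "R \<ge> 1" unfolding R_def using P0 by (intro one_le_powr) auto
    have RP: "R \<le> real P"
    proof -
      have "real P powr (1/20) \<le> real P powr 1" using P0 by (intro powr_mono) auto
      then show ?thesis using P0 by (simp add: R_def)
    qed
    have R3P: "R ^ 3 \<le> real P"
    proof -
      have "R ^ 3 = real P powr (3/20)" using P0 by (simp add: R_def powr_power)
      also have "\<dots> \<le> real P powr 1" using P0 by (intro powr_mono) auto
      finally show ?thesis using P0 by simp
    qed
    have pp: "2 * p < p ^ 4"
    proof -
      have "2 * p < 2 ^ 3 * p" using p2 by simp
      also have "\<dots> \<le> p ^ 3 * p" using p2 by (intro mult_right_mono power_mono) auto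
      finally show ?thesis by (simp add: power_numeral_reduce)
    qed
    have R3: "2 * R ^ 3 < real P ^ 4" and R2: "2 * R < real P ^ 4" using R3P RP pp by (simp_all add: p_def)
    define G where "G = (\<lambda>j::int. weyl4 P (of_int j / of_int M) ^ s * E (- (of_int j * real n / of_int M)))"
    have per: "G (j + M * k) = G j" for j k
    proof -
      have "G j = poly (weyl4_poly P) (E (of_int j / of_int M)) ^ s * cnj (E (of_int j / of_int M) ^ n)" for j
        using E_minus_nat[of "of_int j / of_int M" n] by (simp add: G_def poly_weyl4_poly)
      then show ?thesis by (simp only: E_periodic_frac[OF M0])
    qed
    define \<sigma> where "\<sigma> = (\<lambda>q a::nat. weyl4 q (real a / real q) / of_nat q)"
    define Vs where "Vs = (\<Sum>b\<in>{-B..B}. weyl4_model P (of_int b / of_int M) ^ s * E (- (of_int b * real n / of_int M)))"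
    define SR where "SR = (\<Sum>q = 1..N. singular_term s 4 n q)"
    define c where "c = Gamma (5/4) ^ s * poch_coeff (real s / 4) n"
    define c0 where "c0 = Gamma (5/4) ^ s / Gamma (real s / 4) * real n powr (real s / 4 - 1)"
    have qR: "q > 0 \<and> real q \<le> R \<and> q \<in> {1..P}" if "q \<in> {1..N}" for q
    proof -
      have "q \<le> nat \<lfloor>R\<rfloor>" "1 \<le> q" using that by (auto simp: N_def)
      then have "real q \<le> R" using R1 by (simp add: le_nat_iff le_floor_iff)
      moreover then have "real q \<le> real P" using RP by linarith
      ultimately show ?thesis using \<open>1 \<le> q\<close> by simp
    qed
    have NR: "real N \<le> R" using R1 by (simp add: N_def)
    have MB: "of_int M * R / real P ^ 4 \<ge> 1"
    proof -
      have "real_of_int (int P ^ 4) \<le> of_int M" using M(1) P4(2) by (intro of_int_le_iff[THEN iffD2]) linarith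
      then have "1 * real P ^ 4 \<le> R * of_int M" using R1 Mr P4 by (intro mult_mono) auto
      then show ?thesis using P4 by (simp add: pos_le_divide_eq mult.commute)
    qed
    have B0: "B \<ge> 0" using MB unfolding B_def by (simp add: mult.commute)
    have Bcard: "real (card {-B..B}) \<le> 3 * (R * of_int M / real P ^ 4)"
    proof -
      have "real (card {-B..B}) = 2 * of_int B + 1" using B0 by simp
      also have "of_int B \<le> R * of_int M / real P ^ 4" unfolding B_def by simp
      finally show ?thesis using MB by (simp add: mult.commute)
    qed
    have arc: "cmod ((\<Sum>b\<in>{-B..B}. G (int a * (M div int q) + b)) - \<sigma> q a ^ s * E (- (real a * real n / real q)) * Vs)
       \<le> C1 * of_int M * p powr (real s - 5) * R ^ 3" if q: "q \<in> {1..N}" for q a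
    proof -
      obtain k where k: "M = int q * k" using dvd qR[OF q] by (metis dvdE)
      have k0: "k \<noteq> 0" "q > 0" using k M0 qR[OF q] by auto
      have val: "of_int (int a * (M div int q) + b) / of_int M = real a / real q + of_int b / of_int M" for b
        using k0 by (simp add: k field_simps)
      have G: "G (int a * (M div int q) + b) = weyl4 P (real a / real q + of_int b / of_int M) ^ s *
          (E (- (real a * real n / real q)) * E (- (of_int b * real n / of_int M)))" for b
      proof -
        have "of_int (int a * (M div int q) + b) * real n / of_int M = (of_int (int a * (M div int q) + b) / of_int M) * real n" by simp
        also have "\<dots> = real a * real n / real q + of_int b * real n / of_int M" unfolding val by (simp add: distrib_right)
        finally have "- (of_int (int a * (M div int q) + b) * real n / of_int M) = - (real a * real n / real q) + - (of_int b * real n / of_int M)" by linarith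
        then show ?thesis unfolding G_def val by (simp only: E_add)
      qed
      have eq: "(\<Sum>b\<in>{-B..B}. G (int a * (M div int q) + b)) - \<sigma> q a ^ s * E (- (real a * real n / real q)) * Vs
        = (\<Sum>b\<in>{-B..B}. (weyl4 P (real a / real q + of_int b / of_int M) ^ s - (\<sigma> q a * weyl4_model P (of_int b / of_int M)) ^ s) *
            (E (- (real a * real n / real q)) * E (- (of_int b * real n / of_int M))))"
        unfolding G Vs_def sum_distrib_left sum_subtractf[symmetric]
        by (intro sum.cong refl) (simp add: power_mult_distrib algebra_simps)
      have "cmod ((\<Sum>b\<in>{-B..B}. G (int a * (M div int q) + b)) - \<sigma> q a ^ s * E (- (real a * real n / real q)) * Vs) \<le> (\<Sum>b\<in>{-B..B}. 28 * (K + 1) ^ 13 * L * p ^ (s - 1) * R ^ 2)"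
        unfolding eq
      proof (rule order.trans[OF norm_sum sum_mono])
        fix b assume b: "b \<in> {-B..B}"
        define x where "x = weyl4 P (real a / real q + of_int b / of_int M)"
        define y where "y = \<sigma> q a * weyl4_model P (of_int b / of_int M)"
        obtain r where r: "s = Suc r" "r \<le> 13" using s by (cases s) auto
        have Kp: "p \<le> (K + 1) * p" "K * p \<le> (K + 1) * p" using K(1) p2 by (auto intro: mult_right_mono)
        have x: "cmod x \<le> (K + 1) * p" unfolding x_def p_def by (rule order.trans[OF norm_weyl4_le Kp(1)[unfolded p_def]])
        have "cmod y \<le> 1 * (K * p)" unfolding y_def norm_mult p_def \<sigma>_def
          by (intro mult_mono norm_gauss_le_1 K(2) P0) auto
        then have y: "cmod y \<le> (K + 1) * p" using Kp(2) by linarith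
        have "\<bar>b\<bar> \<le> B" using b by auto
        then have "\<bar>real_of_int b\<bar> \<le> R * of_int M / real P ^ 4" unfolding B_def by (simp add: le_floor_iff)
        then have bb: "real P ^ 4 * \<bar>of_int b / of_int M\<bar> \<le> R" using Mr P4 by (simp add: abs_divide field_simps)
        have "cmod (x - y) \<le> L * real q * (1 + real P ^ 4 * \<bar>of_int b / of_int M\<bar>)"
          using L(2)[of q P "int a" "of_int b / of_int M"] k0 by (simp add: x_def y_def \<sigma>_def)
        also have "\<dots> \<le> L * R * (R + R)"
          using bb R1 qR[OF q] L(1) by (intro mult_mono add_mono) auto
        finally have xy: "cmod (x - y) \<le> 2 * L * R ^ 2" by (simp add: power2_eq_square)
        have "cmod (x ^ s - y ^ s) \<le> real (Suc r) * ((K + 1) * p) ^ r * cmod (x - y)"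
          unfolding r(1) by (rule norm_power_diff_le[OF x y])
        also have "\<dots> \<le> 14 * ((K + 1) ^ 13 * p ^ r) * (2 * L * R ^ 2)"
        proof (intro mult_mono xy)
          have "(K + 1) ^ r \<le> (K + 1) ^ 13" using K(1) r(2) by (intro power_increasing) auto
          then show "((K + 1) * p) ^ r \<le> (K + 1) ^ 13 * p ^ r"
            unfolding power_mult_distrib using p2 by (intro mult_right_mono) auto
        qed (use r K(1) p2 in auto)
        finally show "cmod ((weyl4 P (real a / real q + of_int b / of_int M) ^ s - (\<sigma> q a * weyl4_model P (of_int b / of_int M)) ^ s) *
            (E (- (real a * real n / real q)) * E (- (of_int b * real n / of_int M)))) \<le> 28 * (K + 1) ^ 13 * L * p ^ (s - 1) * R ^ 2"
          by (simp add: norm_mult x_def y_def r(1) mult_ac)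
      qed
      also have "\<dots> = real (card {-B..B}) * (28 * (K + 1) ^ 13 * L * p ^ (s - 1) * R ^ 2)"
        by (rule sum_constant)
      also have "\<dots> \<le> (3 * (R * of_int M / real P ^ 4)) * (28 * (K + 1) ^ 13 * L * p ^ (s - 1) * R ^ 2)"
        by (rule mult_right_mono[OF Bcard]) (use K(1) L(1) p2 R1 in auto)
      also have "\<dots> = C1 * of_int M * (p ^ (s - 1) / p ^ 4) * R ^ 3"
        by (simp add: C1_def p_def power2_eq_square power3_eq_cube)
      also have "p ^ (s - 1) / p ^ 4 = p powr (real s - 5)"
      proof -
        have "p ^ (s - 1) = p powr real (s - 1)" "p ^ 4 = p powr real 4" using p2 by (simp_all only: powr_realpow)
        moreover have "real (s - 1) - real 4 = real s - 5" using s(1) by simp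
        ultimately show ?thesis by (simp only: powr_diff[symmetric])
      qed
      finally show ?thesis .
    qed
    have sumG: "(\<Sum>j\<in>{j\<in>{0..<M}. major_arc P R (of_int j / of_int M)}. G j)
       = (\<Sum>q = 1..N. \<Sum>a | a \<in> {1..q} \<and> coprime a q. \<Sum>b\<in>{-B..B}. G (int a * (M div int q) + b))"
      unfolding N_def B_def by (rule major_arcs_reindex[OF P0 M0 dvd R1 RP R3 per])
    have e1: "cmod ((\<Sum>j\<in>{j\<in>{0..<M}. major_arc P R (of_int j / of_int M)}. G j) - SR * Vs) \<le> R * R * (C1 * of_int M * p powr (real s - 5) * R ^ 3)"
    proof -
      let ?X = "C1 * of_int M * p powr (real s - 5) * R ^ 3"
      have X0: "?X \<ge> 0" using C1 Mr R1 by simp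
      have "(\<Sum>j\<in>{j\<in>{0..<M}. major_arc P R (of_int j / of_int M)}. G j) - SR * Vs
        = (\<Sum>q = 1..N. \<Sum>a | a \<in> {1..q} \<and> coprime a q.
            (\<Sum>b\<in>{-B..B}. G (int a * (M div int q) + b)) - \<sigma> q a ^ s * E (- (real a * real n / real q)) * Vs)"
        unfolding sumG SR_def singular_term_eq \<sigma>_def sum_distrib_right sum_subtractf ..
      also have "cmod \<dots> \<le> (\<Sum>q = 1..N. \<Sum>a | a \<in> {1..q} \<and> coprime a q. ?X)"
        by (rule order.trans[OF norm_sum sum_mono[OF order.trans[OF norm_sum sum_mono[OF arc]]]])
      also have "\<dots> \<le> (\<Sum>q = 1..N. R * ?X)"
      proof (rule sum_mono)
        fix q assume q: "q \<in> {1..N}"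
        have "card {a. a \<in> {1..q} \<and> coprime a q} \<le> card {1..q}" by (rule card_mono) auto
        then have "real (card {a. a \<in> {1..q} \<and> coprime a q}) \<le> real q" by simp
        also have "\<dots> \<le> R" using qR[OF q] by simp
        finally have "real (card {a. a \<in> {1..q} \<and> coprime a q}) * ?X \<le> R * ?X" by (rule mult_right_mono[OF _ X0])
        then show "(\<Sum>a | a \<in> {1..q} \<and> coprime a q. ?X) \<le> R * ?X" by simp
      qed
      also have "\<dots> = real N * (R * ?X)" by simp
      also have "\<dots> \<le> R * (R * ?X)" by (rule mult_right_mono[OF NR]) (use X0 R1 in simp)
      finally show ?thesis by (simp add: mult.assoc)
    qed
    have e2: "cmod (Vs - of_int M * of_real c) \<le> C2 * of_int M * real P ^ (s - 4) * R powr (- (9/4))"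
      unfolding Vs_def B_def c_def by (rule C2(2)[OF P0 n(2) M R1 R2])
    have SRb: "cmod SR \<le> C3"
      unfolding SR_def
      by (rule order.trans[OF norm_sum order.trans[OF sum_mono[OF norm_singular_term_le(2)[OF s(1)]] C3(4)]])
    have e3: "cmod (SR - singular_series s 4 n) \<le> C3 * R powr (- (1/16))"
    proof -
      have "cmod (SR - singular_series s 4 n) \<le> C3 * real (Suc N) powr (- (1/16))"
        using C3(2)[of n N] by (simp add: SR_def norm_minus_commute)
      also have "\<dots> \<le> C3 * R powr (- (1/16))"
      proof (intro mult_left_mono powr_mono2')
        show "R \<le> real (Suc N)" using R1 by (simp add: N_def) linarith
      qed (use C3(1) R1 in auto)
      finally show ?thesis .
    qed
    have e4: "\<bar>c\<bar> \<le> C4 * p powr (real s - 4)" unfolding c_def p_def by (rule C4(2)[OF P0 n])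
    have e5: "\<bar>c - c0\<bar> \<le> C4 * p powr (real s - 8)" unfolding c_def c0_def p_def by (rule C4(3)[OF P0 n])
    define F where "F = p powr (real s - 4 - 1/320)"
    have pm: "p powr t \<le> F" if "t \<le> real s - 4 - 1/320" for t unfolding F_def using that p2 by (intro powr_mono) auto
    have Rp: "R powr t = p powr (t / 20)" for t by (simp add: R_def p_def powr_powr)
    define S where "S = (\<Sum>j\<in>{j\<in>{0..<M}. major_arc P R (of_int j / of_int M)}. G j)"
    define m where "m = complex_of_int M"
    have m0: "m \<noteq> 0" using M0 by (simp add: m_def)
    have mn: "cmod m = of_int M" using M0 by (simp add: m_def)
    have "S / m - of_real c0 * singular_series s 4 n
      = (S - SR * Vs) / m + SR * ((Vs - m * of_real c) / m) + (SR - singular_series s 4 n) * of_real c + singular_series s 4 n * of_real (c - c0)"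
      using m0 by (simp add: field_simps)
    also have "cmod \<dots> \<le> cmod ((S - SR * Vs) / m) + cmod (SR * ((Vs - m * of_real c) / m)) + cmod ((SR - singular_series s 4 n) * of_real c) + cmod (singular_series s 4 n * of_real (c - c0))"
      by (intro order.trans[OF norm_triangle_ineq] add_mono order.refl)
    also have "\<dots> \<le> C1 * F + C3 * C2 * F + C3 * C4 * F + C3 * C4 * F"
    proof (intro add_mono)
      have "cmod ((S - SR * Vs) / m) \<le> R * R * (C1 * of_int M * p powr (real s - 5) * R ^ 3) / of_int M"
        unfolding norm_divide mn S_def by (rule divide_right_mono[OF e1]) (use Mr in simp)
      also have "\<dots> = C1 * (p powr (real s - 5) * R ^ 5)" using Mr by (simp add: power_numeral_reduce)
      also have "p powr (real s - 5) * R ^ 5 = p powr (real s - 5 + 1/4)"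
      proof -
        have "R ^ 5 = p powr (1/4)" using P0 by (simp add: R_def p_def powr_power)
        then show ?thesis by (simp only: powr_add)
      qed
      also have "C1 * \<dots> \<le> C1 * F" using C1 by (intro mult_left_mono pm) auto
      finally show "cmod ((S - SR * Vs) / m) \<le> C1 * F" .
      have "cmod (SR * ((Vs - m * of_real c) / m)) \<le> C3 * (C2 * of_int M * real P ^ (s - 4) * R powr (- (9/4)) / of_int M)"
        unfolding norm_mult norm_divide mn using SRb e2 Mr C3(1) unfolding m_def by (intro mult_mono divide_right_mono) auto
      also have "\<dots> = C3 * C2 * (p ^ (s - 4) * R powr (- (9/4)))" using Mr by (simp add: p_def)
      also have "p ^ (s - 4) * R powr (- (9/4)) = p powr (real s - 4 + (- (9/80)))"
      proof -
        have "p ^ (s - 4) = p powr real (s - 4)" using p2 by (simp only: powr_realpow)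
        moreover have "real (s - 4) = real s - 4" using s(1) by simp
        ultimately show ?thesis unfolding Rp powr_add by simp
      qed
      also have "C3 * C2 * \<dots> \<le> C3 * C2 * F" using C3(1) C2(1) by (intro mult_left_mono pm) auto
      finally show "cmod (SR * ((Vs - m * of_real c) / m)) \<le> C3 * C2 * F" .
      have "cmod ((SR - singular_series s 4 n) * of_real c) \<le> (C3 * R powr (- (1/16))) * (C4 * p powr (real s - 4))"
        unfolding norm_mult norm_of_real using e3 e4 C3(1) by (intro mult_mono) auto
      also have "\<dots> = C3 * C4 * (p powr (real s - 4) * p powr (- (1/320)))" unfolding Rp by simp
      also have "p powr (real s - 4) * p powr (- (1/320)) = p powr (real s - 4 + - (1/320))" by (rule powr_add[symmetric])
      also have "C3 * C4 * \<dots> \<le> C3 * C4 * F" using C3(1) C4(1) by (intro mult_left_mono pm) auto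
      finally show "cmod ((SR - singular_series s 4 n) * of_real c) \<le> C3 * C4 * F" .
      have "cmod (singular_series s 4 n * of_real (c - c0)) \<le> C3 * (C4 * p powr (real s - 8))"
        unfolding norm_mult norm_of_real using C3(1) C3(3) e5 by (intro mult_mono) auto
      also have "\<dots> \<le> C3 * (C4 * F)" using C3(1) C4(1) by (intro mult_left_mono pm) auto
      finally show "cmod (singular_series s 4 n * of_real (c - c0)) \<le> C3 * C4 * F" by simp
    qed
    also have "\<dots> = C * F" by (simp add: C_def distrib_right)
    finally have "cmod (S / m - of_real c0 * singular_series s 4 n) \<le> C * F" .
    then show ?thesis
      by (simp add: S_def m_def c0_def F_def p_def G_def R_def mult_ac)
  qed
  then show ?thesis using C0 by blast
qed

section \<open>The minor arcs\<close>

text \<open>The coefficients \<open>\<eta>\<close> remove the phases, so that the sum over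
  \<open>Z\<close> can be carried out inside. In Cauchy--Schwarz \<open>s\<close> factors are split
  as \<open>s - 2\<close> and 2. The first sum stays on \<open>J\<close>, where pointwise bounds
  hold; the second is extended to the whole grid, where it counts solutions of an equation.\<close>

lemma sum_norm_minor_le:
  fixes M :: int and Z :: "nat set"
  assumes M: "M > 0" and J: "J \<subseteq> {0..<M}" and Z: "finite Z" and s: "s \<ge> 2"
  shows "\<exists>\<eta>::nat \<Rightarrow> complex. (\<forall>n\<in>Z. cmod (\<eta> n) \<le> 1) \<and>
    (\<Sum>n\<in>Z. cmod (\<Sum>j\<in>J. weyl4 P (of_int j / of_int M) ^ s * E (- (of_int j * real n / of_int M))))\<^sup>2
      \<le> (\<Sum>j\<in>J. (cmod (weyl4 P (of_int j / of_int M))) ^ (2 * s - 4)) *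
        (\<Sum>j\<in>{0..<M}. (cmod (weyl4 P (of_int j / of_int M))) ^ 4 *
            (cmod (\<Sum>n\<in>Z. \<eta> n * E (- (of_int j * real n / of_int M))))\<^sup>2)"
proof -
  define W where "W = (\<lambda>j::int. weyl4 P (of_int j / of_int M))"
  define z where "z = (\<lambda>n. \<Sum>j\<in>J. W j ^ s * E (- (of_int j * real n / of_int M)))"
  \<comment> \<open>Where \<open>z n = 0\<close> this is 0, hence only
    \<open>cmod (\<eta> n) \<le> 1\<close> is claimed.\<close>
  define \<eta> where "\<eta> = (\<lambda>n. cnj (sgn (z n)))"
  define K where "K = (\<lambda>j::int. \<Sum>n\<in>Z. \<eta> n * E (- (of_int j * real n / of_int M)))"
  have \<eta>1: "cmod (\<eta> n) \<le> 1" for n by (simp add: \<eta>_def norm_sgn)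
  have \<eta>z: "\<eta> n * z n = of_real (cmod (z n))" for n
  proof (cases "z n = 0")
    case False
    have "\<eta> n * z n = (z n * cnj (z n)) / of_real (cmod (z n))"
      unfolding \<eta>_def sgn_eq by simp
    also have "z n * cnj (z n) = of_real ((cmod (z n))\<^sup>2)" by (rule complex_norm_square[symmetric])
    finally show ?thesis using False by (simp add: power2_eq_square)
  qed (simp add: \<eta>_def)
  have "complex_of_real (\<Sum>n\<in>Z. cmod (z n)) = (\<Sum>n\<in>Z. \<eta> n * z n)" by (simp add: \<eta>z)
  also have "\<dots> = (\<Sum>j\<in>J. W j ^ s * K j)"
    unfolding z_def K_def sum_distrib_left by (subst sum.swap) (simp add: mult_ac)
  finally have "cmod (complex_of_real (\<Sum>n\<in>Z. cmod (z n))) \<le> (\<Sum>j\<in>J. cmod (W j ^ s * K j))"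
    by (simp only: norm_sum)
  also have "\<dots> = (\<Sum>j\<in>J. (cmod (W j)) ^ (s - 2) * ((cmod (W j))\<^sup>2 * cmod (K j)))"
  proof (rule sum.cong[OF refl])
    fix j
    have "(cmod (W j)) ^ s = (cmod (W j)) ^ (s - 2) * (cmod (W j))\<^sup>2"
      by (simp only: power_add[symmetric] le_add_diff_inverse2[OF s])
    then show "cmod (W j ^ s * K j) = (cmod (W j)) ^ (s - 2) * ((cmod (W j))\<^sup>2 * cmod (K j))"
      by (simp only: norm_mult norm_power mult.assoc)
  qed
  finally have le: "(\<Sum>n\<in>Z. cmod (z n)) \<le> (\<Sum>j\<in>J. (cmod (W j)) ^ (s - 2) * ((cmod (W j))\<^sup>2 * cmod (K j)))"
    unfolding norm_of_real by linarith
  have "(\<Sum>n\<in>Z. cmod (z n))\<^sup>2 \<le> (\<Sum>j\<in>J. (cmod (W j)) ^ (s - 2) * ((cmod (W j))\<^sup>2 * cmod (K j)))\<^sup>2"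
    by (rule power_mono[OF le]) (simp add: sum_nonneg)
  also have "\<dots> \<le> (\<Sum>j\<in>J. ((cmod (W j)) ^ (s - 2))\<^sup>2) * (\<Sum>j\<in>J. ((cmod (W j))\<^sup>2 * cmod (K j))\<^sup>2)"
    by (rule Cauchy_Schwarz_ineq_sum)
  also have "(\<Sum>j\<in>J. ((cmod (W j)) ^ (s - 2))\<^sup>2) = (\<Sum>j\<in>J. (cmod (W j)) ^ (2 * s - 4))"
  proof -
    have "2 * s - 4 = (s - 2) * 2" by simp
    then show ?thesis by (simp only: power_mult[symmetric])
  qed
  also have "(\<Sum>j\<in>J. ((cmod (W j))\<^sup>2 * cmod (K j))\<^sup>2) \<le> (\<Sum>j\<in>{0..<M}. ((cmod (W j))\<^sup>2 * cmod (K j))\<^sup>2)"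
    by (rule sum_mono2) (use J in auto)
  also have "\<dots> = (\<Sum>j\<in>{0..<M}. (cmod (W j)) ^ 4 * (cmod (K j))\<^sup>2)"
    by (intro sum.cong refl) (simp add: power_mult_distrib flip: power_mult)
  finally have fin: "(\<Sum>n\<in>Z. cmod (z n))\<^sup>2 \<le> (\<Sum>j\<in>J. (cmod (W j)) ^ (2 * s - 4)) * (\<Sum>j\<in>{0..<M}. (cmod (W j)) ^ 4 * (cmod (K j))\<^sup>2)"
    by (simp add: mult_left_mono sum_nonneg)
  show ?thesis
    by (intro exI[of _ \<eta>] conjI ballI \<eta>1) (use fin in \<open>simp only: z_def K_def W_def\<close>)
qed

text \<open>Write \<open>2 * s - 4 = (2 * s - 12) + 8\<close>. The first part is bounded pointwise
  by \<open>weyl_minor\<close>, with \<open>P powr (7/8)\<close> per factor up to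
  \<open>\<epsilon>\<close>, and the remaining eighth power by Hua's moment of order
  \<open>P ^ 5\<close>.\<close>

lemma minor_arcs_mean:
  assumes "\<epsilon> > 0" and s: "13 \<le> s" "s \<le> 14"
  shows "\<exists>C>0. \<forall>P J. \<forall>M::int. P > 0 \<longrightarrow> 8 * int P ^ 4 < M \<longrightarrow> J \<subseteq> {0..<M} \<longrightarrow>
     (\<forall>j\<in>J. \<nexists>q a. dirichlet_arc P (of_int j / of_int M) q a) \<longrightarrow>
     (\<Sum>j\<in>J. (cmod (weyl4 P (of_int j / of_int M))) ^ (2 * s - 4)) \<le> C * of_int M * real P powr (7 * (real s - 6) / 4 + 5 + \<epsilon>)"
proof -
  define e1 where "e1 = \<epsilon> / 4"
  have e1: "e1 > 0" using assms(1) by (simp add: e1_def)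
  obtain C where C: "C > 0" "\<And>P \<alpha>. P > 0 \<Longrightarrow> (\<nexists>q a. dirichlet_arc P \<alpha> q a) \<Longrightarrow> (cmod (weyl4 P \<alpha>)) ^ 8 \<le> C * real P powr (7 + e1)"
    using weyl_minor[OF e1] by blast
  obtain D where D: "D \<ge> 1" "\<And>P n. P > 0 \<Longrightarrow> n \<noteq> 0 \<Longrightarrow> \<bar>n\<bar> \<le> 8 * int P ^ 4 \<Longrightarrow> real (int_divisor_count n) \<le> D * real P powr e1"
    using int_divisor_count_le_ge1[OF e1, of 8] by auto
  define g where "g = (real s - 6) / 4"
  have g: "g \<ge> 0" "g \<le> 2" using s by (auto simp: g_def)
  have main: "(\<Sum>j\<in>J. (cmod (weyl4 P (of_int j / of_int M))) ^ (2 * s - 4)) \<le> (C powr g * 27 * D ^ 2) * of_int M * real P powr (7 * (real s - 6) / 4 + 5 + \<epsilon>)"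
    if P: "P > 0" and M: "8 * int P ^ 4 < M" and J: "J \<subseteq> {0..<M}" and mn: "\<And>j. j \<in> J \<Longrightarrow> \<nexists>q a. dirichlet_arc P (of_int j / of_int M) q a"
    for P J and M :: int
  proof -
    define p where "p = real P"
    define L where "L = D * p powr e1"
    have p1: "p \<ge> 1" using P by (simp add: p_def)
    have M0: "M > 0" using M by (smt (verit) zero_le_power of_nat_0_le_iff)
    have "1 * 1 \<le> D * p powr e1" using D(1) one_le_powr[OF P, of e1] e1 unfolding p_def by (intro mult_mono) auto
    then have L1: "L \<ge> 1" by (simp add: L_def)
    have pt: "(cmod (weyl4 P (of_int j / of_int M))) ^ (2 * s - 4) \<le> (C powr g * (p powr (7 + e1)) powr g) * (cmod (weyl4 P (of_int j / of_int M))) ^ 8"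
      if j: "j \<in> J" for j
    proof -
      define w where "w = cmod (weyl4 P (of_int j / of_int M))"
      have w0: "w \<ge> 0" by (simp add: w_def)
      have w8: "w ^ 8 \<le> C * p powr (7 + e1)" unfolding w_def p_def by (rule C(2)[OF P mn[OF j]])
      have "w ^ (2 * s - 12) = (w ^ 8) powr g"
      proof (cases "w = 0")
        case False
        then have w: "w > 0" using w0 by simp
        have "w ^ 8 = w powr 8" using w by simp
        moreover have "(w powr 8) powr g = w powr (8 * g)" by (rule powr_powr)
        moreover have "8 * g = real (2 * s - 12)" using s by (simp add: g_def of_nat_diff)
        moreover have "w powr real (2 * s - 12) = w ^ (2 * s - 12)" using w by (rule powr_realpow)
        ultimately show ?thesis by (simp only:)
      next
        case True
        then show ?thesis using s by simp
      qed
      also have "\<dots> \<le> (C * p powr (7 + e1)) powr g" using w8 w0 g by (intro powr_mono2) auto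
      also have "\<dots> = C powr g * (p powr (7 + e1)) powr g" using C(1) by (simp add: powr_mult)
      finally have le: "w ^ (2 * s - 12) \<le> C powr g * (p powr (7 + e1)) powr g" .
      have "w ^ (2 * s - 4) = w ^ (2 * s - 12) * w ^ 8" using s by (simp flip: power_add)
      also have "\<dots> \<le> (C powr g * (p powr (7 + e1)) powr g) * w ^ 8" by (rule mult_right_mono[OF le]) (use w0 in simp)
      finally show ?thesis by (simp add: w_def)
    qed
    have "(\<Sum>j\<in>J. (cmod (weyl4 P (of_int j / of_int M))) ^ (2 * s - 4))
      \<le> (\<Sum>j\<in>J. (C powr g * (p powr (7 + e1)) powr g) * (cmod (weyl4 P (of_int j / of_int M))) ^ 8)"
      by (rule sum_mono[OF pt])
    also have "\<dots> \<le> (\<Sum>j\<in>{0..<M}. (C powr g * (p powr (7 + e1)) powr g) * (cmod (weyl4 P (of_int j / of_int M))) ^ 8)"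
      by (rule sum_mono2) (use J in auto)
    also have "\<dots> = (C powr g * (p powr (7 + e1)) powr g) * (\<Sum>j\<in>{0..<M}. (cmod (weyl4 P (of_int j / of_int M))) ^ 8)"
      by (simp add: sum_distrib_left)
    also have "\<dots> \<le> (C powr g * (p powr (7 + e1)) powr g) * (of_int M * (27 * p ^ 5 * L ^ 2))"
      unfolding p_def
    proof (rule mult_left_mono[OF mean_weyl4_pow8])
      show "real (int_divisor_count n) \<le> L" if "n \<noteq> 0" "\<bar>n\<bar> \<le> 8 * int P ^ 4" for n
        unfolding L_def p_def by (rule D(2)[OF P that])
    qed (use L1 P M in auto)
    also have "\<dots> = (C powr g * 27 * D ^ 2) * of_int M * ((p powr (7 + e1)) powr g * p ^ 5 * (p powr e1) ^ 2)"
      by (simp add: L_def power_mult_distrib)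
    also have "(p powr (7 + e1)) powr g * p ^ 5 * (p powr e1) ^ 2 = p powr ((7 + e1) * g + 5 + 2 * e1)"
    proof -
      have "p ^ 5 = p powr 5" using p1 by simp
      moreover have "(p powr e1) ^ 2 = p powr (2 * e1)" using p1 by (simp add: powr_power mult.commute)
      moreover have "(p powr (7 + e1)) powr g = p powr ((7 + e1) * g)" by (rule powr_powr)
      ultimately show ?thesis by (simp only: powr_add[symmetric])
    qed
    also have "\<dots> \<le> p powr (7 * (real s - 6) / 4 + 5 + \<epsilon>)"
    proof (rule powr_mono[OF _ p1])
      have "e1 * g \<le> e1 * 2" using e1 g by (intro mult_left_mono) auto
      moreover have "7 * g = 7 * (real s - 6) / 4" by (simp add: g_def)
      moreover have "\<epsilon> = 4 * e1" by (simp add: e1_def)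
      moreover have "(7 + e1) * g = 7 * g + e1 * g" by (rule distrib_right)
      ultimately show "(7 + e1) * g + 5 + 2 * e1 \<le> 7 * (real s - 6) / 4 + 5 + \<epsilon>" by linarith
    qed
    finally show ?thesis using C(1) M0 by (simp add: p_def mult_left_mono)
  qed
  have C'0: "C powr g * 27 * D ^ 2 > 0" using C(1) D(1) by simp
  show ?thesis
  proof (intro exI[of _ "C powr g * 27 * D ^ 2"] conjI allI impI C'0)
    fix P J and M :: int
    assume h: "P > 0" "8 * int P ^ 4 < M" "J \<subseteq> {0..<M}" and mn: "\<forall>j\<in>J. \<nexists>q a. dirichlet_arc P (of_int j / of_int M) q a"
    show "(\<Sum>j\<in>J. (cmod (weyl4 P (of_int j / of_int M))) ^ (2 * s - 4)) \<le> (C powr g * 27 * D ^ 2) * of_int M * real P powr (7 * (real s - 6) / 4 + 5 + \<epsilon>)"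
      by (rule main[OF h]) (rule bspec[OF mn])
  qed
qed

text \<open>Divide by \<open>z\<close> and use \<open>V * sqrt z \<le> z / 4 + V\<^sup>2\<close> to
  move the square root to the left.\<close>

lemma quadratic_count_bound:
  fixes z U V :: real
  assumes "z \<ge> 0" "U \<ge> 0" "V \<ge> 0" and le: "z\<^sup>2 \<le> U * z + V * (z * sqrt z)"
  shows "z \<le> 2 * U + 4 * V\<^sup>2"
proof (cases "z = 0")
  case False
  then have z: "z > 0" using assms(1) by simp
  have "z * z \<le> z * (U + V * sqrt z)" using le by (simp add: power2_eq_square algebra_simps)
  then have "z \<le> U + V * sqrt z" using z by simp
  moreover have "V * sqrt z \<le> z / 4 + V\<^sup>2"
  proof -
    have "0 \<le> (sqrt z / 2 - V)\<^sup>2" by simp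
    also have "\<dots> = z / 4 - V * sqrt z + V\<^sup>2" using z by (simp add: power2_diff power_divide)
    finally show ?thesis by simp
  qed
  ultimately have "3 / 4 * z \<le> U + V\<^sup>2" by simp
  then show ?thesis using assms by (simp add: power2_eq_square) (smt (verit) zero_le_square)
qed (use assms in simp)

text \<open>The two terms correspond to the two parts of \<open>mean_weyl4_pow4_set\<close>. The one
  with \<open>P ^ 3 * z\<close> is linear in \<open>z\<close> and enters once; the one with
  \<open>z * sqrt z\<close> enters squared, which doubles its exponent of \<open>P\<close> and turns
  \<open>1 / Y\<^sup>2\<close> into its square.\<close>

lemma minor_arcs_count:
  assumes "\<epsilon> > 0" and s: "13 \<le> s" "s \<le> 14"
  shows "\<exists>C>0. \<forall>P J Z Y. \<forall>M::int. P > 0 \<longrightarrow> 8 * int P ^ 4 < M \<longrightarrow> J \<subseteq> {0..<M} \<longrightarrow>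
     (\<forall>j\<in>J. \<nexists>q a. dirichlet_arc P (of_int j / of_int M) q a) \<longrightarrow> Z \<subseteq> {1..P ^ 4} \<longrightarrow> Y > 0 \<longrightarrow>
     (\<forall>n\<in>Z. Y \<le> cmod (\<Sum>j\<in>J. weyl4 P (of_int j / of_int M) ^ s * E (- (of_int j * real n / of_int M))) / of_int M) \<longrightarrow>
     real (card Z) \<le> C * (real P powr (7 * (real s - 6) / 4 + 8 + \<epsilon>) / Y\<^sup>2 + (real P powr (7 * (real s - 6) / 4 + 7 + \<epsilon>) / Y\<^sup>2)\<^sup>2)"
proof -
  define e1 where "e1 = \<epsilon> / 4"
  have e1: "e1 > 0" using assms(1) by (simp add: e1_def)
  define A where "A = 7 * (real s - 6) / 4"
  obtain C where C: "C > 0" and mean: "\<forall>P J. \<forall>M::int. P > 0 \<longrightarrow> 8 * int P ^ 4 < M \<longrightarrow> J \<subseteq> {0..<M} \<longrightarrow>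
     (\<forall>j\<in>J. \<nexists>q a. dirichlet_arc P (of_int j / of_int M) q a) \<longrightarrow>
     (\<Sum>j\<in>J. (cmod (weyl4 P (of_int j / of_int M))) ^ (2 * s - 4)) \<le> C * of_int M * real P powr (A + 5 + e1)"
    using minor_arcs_mean[OF e1 s, folded A_def] by (elim exE conjE) (rule that)
  obtain D where D: "D \<ge> 1" "\<And>P n. P > 0 \<Longrightarrow> n \<noteq> 0 \<Longrightarrow> \<bar>n\<bar> \<le> 8 * int P ^ 4 \<Longrightarrow> real (int_divisor_count n) \<le> D * real P powr e1"
    using int_divisor_count_le_ge1[OF e1, of 8] by auto
  define C' where "C' = 132 * C + 4 * (15 * C * D ^ 2)\<^sup>2"
  have C'0: "C' > 0" unfolding C'_def using C by (intro add_pos_nonneg) auto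
  have main: "real (card Z) \<le> C' * (real P powr (A + 8 + \<epsilon>) / Y\<^sup>2 + (real P powr (A + 7 + \<epsilon>) / Y\<^sup>2)\<^sup>2)"
    if P: "P > 0" and M: "8 * int P ^ 4 < M" and J: "J \<subseteq> {0..<M}"
      and mn: "\<forall>j\<in>J. \<nexists>q a. dirichlet_arc P (of_int j / of_int M) q a" and Z: "Z \<subseteq> {1..P ^ 4}" and Y: "Y > 0"
      and big: "\<And>n. n \<in> Z \<Longrightarrow> Y \<le> cmod (\<Sum>j\<in>J. weyl4 P (of_int j / of_int M) ^ s * E (- (of_int j * real n / of_int M))) / of_int M"
    for P J Z Y and M :: int
  proof -
    define p where "p = real P"
    define z where "z = real (card Z)"
    define L where "L = D * p powr e1"
    have p1: "p \<ge> 1" using P by (simp add: p_def)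
    have M0: "M > 0" using M by (smt (verit) zero_le_power of_nat_0_le_iff)
    have Mr: "real_of_int M > 0" using M0 by simp
    have fZ: "finite Z" using Z finite_subset by blast
    have z0: "z \<ge> 0" by (simp add: z_def)
    have s2: "2 \<le> s" using s by simp
    obtain \<eta> :: "nat \<Rightarrow> complex" where \<eta>: "\<forall>n\<in>Z. cmod (\<eta> n) \<le> 1" and
      CS: "(\<Sum>n\<in>Z. cmod (\<Sum>j\<in>J. weyl4 P (of_int j / of_int M) ^ s * E (- (of_int j * real n / of_int M))))\<^sup>2
      \<le> (\<Sum>j\<in>J. (cmod (weyl4 P (of_int j / of_int M))) ^ (2 * s - 4)) *
        (\<Sum>j\<in>{0..<M}. (cmod (weyl4 P (of_int j / of_int M))) ^ 4 *
            (cmod (\<Sum>n\<in>Z. \<eta> n * E (- (of_int j * real n / of_int M))))\<^sup>2)"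
      using sum_norm_minor_le[OF M0 J fZ s2] by blast
    have "z * (Y * of_int M) = (\<Sum>n\<in>Z. Y * of_int M)" by (simp add: z_def)
    also have "\<dots> \<le> (\<Sum>n\<in>Z. cmod (\<Sum>j\<in>J. weyl4 P (of_int j / of_int M) ^ s * E (- (of_int j * real n / of_int M))))"
      using big Mr by (intro sum_mono) (simp add: pos_le_divide_eq)
    finally have "(z * (Y * of_int M))\<^sup>2 \<le> (\<Sum>n\<in>Z. cmod (\<Sum>j\<in>J. weyl4 P (of_int j / of_int M) ^ s * E (- (of_int j * real n / of_int M))))\<^sup>2"
      using z0 Y Mr by (intro power_mono) auto
    also note CS
    also have "(\<Sum>j\<in>J. (cmod (weyl4 P (of_int j / of_int M))) ^ (2 * s - 4)) *
        (\<Sum>j\<in>{0..<M}. (cmod (weyl4 P (of_int j / of_int M))) ^ 4 *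
            (cmod (\<Sum>n\<in>Z. \<eta> n * E (- (of_int j * real n / of_int M))))\<^sup>2)
      \<le> (C * of_int M * p powr (A + 5 + e1)) * (of_int M * (66 * p ^ 3 * z + 15 * p ^ 2 * L ^ 2 * (z * sqrt z)))"
      unfolding p_def z_def
    proof (intro mult_mono mean[THEN spec[of _ P], THEN spec[of _ J], THEN spec[of _ M], THEN mp, OF P, THEN mp, OF M, THEN mp, OF J, THEN mp, OF mn]
        mean_weyl4_pow4_set[OF _ P M Z])
      show "real (int_divisor_count n) \<le> L" if "n \<noteq> 0" "\<bar>n\<bar> \<le> 8 * int P ^ 4" for n
        unfolding L_def p_def by (rule D(2)[OF P that])
    qed (use \<eta> C M0 in \<open>auto intro!: sum_nonneg\<close>)
    also have "\<dots> = (of_int M)\<^sup>2 * (C * p powr (A + 5 + e1) * (66 * p ^ 3 * z + 15 * p ^ 2 * L ^ 2 * (z * sqrt z)))"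
      by (simp add: power2_eq_square)
    finally have "(of_int M)\<^sup>2 * (z * Y)\<^sup>2 \<le> (of_int M)\<^sup>2 * (C * p powr (A + 5 + e1) * (66 * p ^ 3 * z + 15 * p ^ 2 * L ^ 2 * (z * sqrt z)))"
      by (simp add: power_mult_distrib mult_ac)
    then have zY: "(z * Y)\<^sup>2 \<le> C * p powr (A + 5 + e1) * (66 * p ^ 3 * z + 15 * p ^ 2 * L ^ 2 * (z * sqrt z))"
      using Mr by simp
    define U where "U = 66 * C * (p powr (A + 5 + e1) * p ^ 3) / Y\<^sup>2"
    define V where "V = 15 * C * D ^ 2 * (p powr (A + 5 + e1) * p ^ 2 * (p powr e1) ^ 2) / Y\<^sup>2"
    have UV0: "U \<ge> 0" "V \<ge> 0" using C p1 by (auto simp: U_def V_def)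
    have "z\<^sup>2 \<le> U * z + V * (z * sqrt z)"
    proof -
      have "C * p powr (A + 5 + e1) * (66 * p ^ 3 * z + 15 * p ^ 2 * L ^ 2 * (z * sqrt z)) = (U * z + V * (z * sqrt z)) * Y\<^sup>2"
        using Y by (simp add: U_def V_def L_def power_mult_distrib algebra_simps)
      then have "z\<^sup>2 * Y\<^sup>2 \<le> (U * z + V * (z * sqrt z)) * Y\<^sup>2" using zY by (simp add: power_mult_distrib)
      then show ?thesis using Y by simp
    qed
    then have "z \<le> 2 * U + 4 * V\<^sup>2" by (rule quadratic_count_bound[OF z0 UV0])
    also have "2 * U \<le> 132 * C * (p powr (A + 8 + \<epsilon>) / Y\<^sup>2)"
    proof -
      have "p powr (A + 5 + e1) * p ^ 3 = p powr (A + 5 + e1 + 3)" using p1 by (simp add: powr_add)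
      also have "\<dots> \<le> p powr (A + 8 + \<epsilon>)" using p1 e1 by (intro powr_mono) (auto simp: e1_def)
      finally have "132 * C * ((p powr (A + 5 + e1) * p ^ 3) / Y\<^sup>2) \<le> 132 * C * (p powr (A + 8 + \<epsilon>) / Y\<^sup>2)"
        using C by (intro mult_left_mono divide_right_mono) auto
      then show ?thesis by (simp add: U_def)
    qed
    also have "4 * V\<^sup>2 \<le> 4 * (15 * C * D ^ 2)\<^sup>2 * (p powr (A + 7 + \<epsilon>) / Y\<^sup>2)\<^sup>2"
    proof -
      have "(p powr e1) ^ 2 = p powr (2 * e1)" using p1 by (simp add: powr_power mult.commute)
      moreover have "p ^ 2 = p powr 2" using p1 by simp
      ultimately have "p powr (A + 5 + e1) * p ^ 2 * (p powr e1) ^ 2 = p powr (A + 5 + e1 + 2 + 2 * e1)"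
        by (simp only: powr_add[symmetric])
      also have "\<dots> \<le> p powr (A + 7 + \<epsilon>)" using p1 e1 by (intro powr_mono) (auto simp: e1_def)
      finally have "15 * C * D ^ 2 * ((p powr (A + 5 + e1) * p ^ 2 * (p powr e1) ^ 2) / Y\<^sup>2) \<le> 15 * C * D ^ 2 * (p powr (A + 7 + \<epsilon>) / Y\<^sup>2)"
        using C by (intro mult_left_mono divide_right_mono) auto
      then have "V \<le> 15 * C * D ^ 2 * (p powr (A + 7 + \<epsilon>) / Y\<^sup>2)" by (simp add: V_def)
      then have "V\<^sup>2 \<le> (15 * C * D ^ 2 * (p powr (A + 7 + \<epsilon>) / Y\<^sup>2))\<^sup>2" using UV0 by (intro power_mono) auto
      also have "\<dots> = (15 * C * D ^ 2)\<^sup>2 * (p powr (A + 7 + \<epsilon>) / Y\<^sup>2)\<^sup>2" by (rule power_mult_distrib)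
      finally show ?thesis by simp
    qed
    finally have "z \<le> 132 * C * (p powr (A + 8 + \<epsilon>) / Y\<^sup>2) + 4 * (15 * C * D ^ 2)\<^sup>2 * (p powr (A + 7 + \<epsilon>) / Y\<^sup>2)\<^sup>2" by simp
    also have "\<dots> \<le> C' * (p powr (A + 8 + \<epsilon>) / Y\<^sup>2) + C' * (p powr (A + 7 + \<epsilon>) / Y\<^sup>2)\<^sup>2"
      using C by (intro add_mono mult_right_mono) (auto simp: C'_def)
    finally show ?thesis by (simp add: z_def p_def distrib_left)
  qed
  show ?thesis
    unfolding A_def[symmetric]
  proof (intro exI[of _ C'] conjI allI impI C'0)
    fix P J Z Y and M :: int
    assume h: "P > 0" "8 * int P ^ 4 < M" "J \<subseteq> {0..<M}" "\<forall>j\<in>J. \<nexists>q a. dirichlet_arc P (of_int j / of_int M) q a"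
      "Z \<subseteq> {1..P ^ 4}" "Y > 0"
      and big: "\<forall>n\<in>Z. Y \<le> cmod (\<Sum>j\<in>J. weyl4 P (of_int j / of_int M) ^ s * E (- (of_int j * real n / of_int M))) / of_int M"
    show "real (card Z) \<le> C' * (real P powr (A + 8 + \<epsilon>) / Y\<^sup>2 + (real P powr (A + 7 + \<epsilon>) / Y\<^sup>2)\<^sup>2)"
      by (rule main[OF h]) (rule bspec[OF big])
  qed
qed

section \<open>The exceptional set\<close>

definition main_term :: "nat \<Rightarrow> nat \<Rightarrow> complex" where
  "main_term s n = of_real (Gamma (5/4) ^ s / Gamma (real s / 4)) * singular_series s 4 n * of_real (real n powr (real s / 4 - 1))"

text \<open>Where \<open>n\<close> is comparable to \<open>P ^ 4\<close>, the error on the major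
  arcs and the total of the middle arcs are O(\<open>P powr (real s - 4 - 1/320)\<close>), at most
  half the threshold. So every exceptional \<open>n\<close> forces a large minor arc sum, and
  \<open>minor_arcs_count\<close> applies. The threshold uses a constant \<open>\<Psi>\<close> for
  the block. The factor 32 leaves room for rounding a fourth root up to the integer
  \<open>P\<close>.\<close>

lemma exceptional_dyadic:
  assumes eps: "\<epsilon> > 0" and s: "13 \<le> s" "s \<le> 14" and \<kappa>: "\<kappa> = (if s = 13 then 5/2 else 2)"
  shows "\<exists>C>0. \<exists>P0. \<forall>P \<Psi>. P0 \<le> P \<longrightarrow> 1 \<le> \<Psi> \<longrightarrow> \<Psi> \<le> real P powr (1/640) \<longrightarrow>
     real (card {n. 1 \<le> n \<and> n \<le> P ^ 4 \<and> P ^ 4 \<le> 32 * n \<and>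
        cmod (of_nat (rep_count s 4 n) - main_term s n) > real n powr (real s / 4 - 1) / \<Psi>})
       \<le> C * real P powr (\<kappa> + \<epsilon>) * \<Psi> ^ 4"
proof -
  define e1 where "e1 = \<epsilon> / 2"
  have e1: "e1 > 0" using eps by (simp add: e1_def)
  obtain C1 where C1: "C1 > 0" "\<forall>P n. \<forall>M::int. P \<ge> 2 \<longrightarrow> 1 \<le> n \<longrightarrow> n \<le> P ^ 4 \<longrightarrow> 14 * int P ^ 4 < M \<longrightarrow> even M \<longrightarrow>
     (\<forall>q\<in>{1..P}. int q dvd M) \<longrightarrow>
     cmod ((\<Sum>j\<in>{j\<in>{0..<M}. major_arc P (real P powr (1/20)) (of_int j / of_int M)}.
            weyl4 P (of_int j / of_int M) ^ s * E (- (of_int j * real n / of_int M))) / of_int M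
        - main_term s n)
      \<le> C1 * real P powr (real s - 4 - 1/320)"
    using major_arcs_asymptotic[OF s, folded main_term_def] by (elim exE conjE) (rule that)
  \<comment> \<open>This spends half of the 1/160 gained from \<open>R powr (- (1/8))\<close>, so
    the middle arcs save 1/320, as the major arcs do.\<close>
  have e320: "(1/320 :: real) > 0" by simp
  obtain C2 where C2: "C2 > 0" "\<forall>P R s. \<forall>M::int. P > 0 \<longrightarrow> R \<ge> 1 \<longrightarrow> 13 \<le> s \<longrightarrow> int P ^ 4 \<le> M \<longrightarrow> (\<forall>q\<in>{1..P}. int q dvd M) \<longrightarrow>
     (\<Sum>j\<in>{j\<in>{0..<M}. (\<exists>q a. dirichlet_arc P (of_int j / of_int M) q a) \<and> \<not> major_arc P R (of_int j / of_int M)}.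
        (cmod (weyl4 P (of_int j / of_int M))) ^ s)
      \<le> C2 * of_int M * real P powr (real s - 4 + 1/320) * R powr (- (1/8))"
    using weyl4_middle[OF e320] by (elim exE conjE) (rule that)
  obtain C3 where C3: "C3 > 0" "\<forall>P J Z Y. \<forall>M::int. P > 0 \<longrightarrow> 8 * int P ^ 4 < M \<longrightarrow> J \<subseteq> {0..<M} \<longrightarrow>
     (\<forall>j\<in>J. \<nexists>q a. dirichlet_arc P (of_int j / of_int M) q a) \<longrightarrow> Z \<subseteq> {1..P ^ 4} \<longrightarrow> Y > 0 \<longrightarrow>
     (\<forall>n\<in>Z. Y \<le> cmod (\<Sum>j\<in>J. weyl4 P (of_int j / of_int M) ^ s * E (- (of_int j * real n / of_int M))) / of_int M) \<longrightarrow>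
     real (card Z) \<le> C3 * (real P powr (7 * (real s - 6) / 4 + 8 + e1) / Y\<^sup>2 + (real P powr (7 * (real s - 6) / 4 + 7 + e1) / Y\<^sup>2)\<^sup>2)"
    using minor_arcs_count[OF e1 s] by (elim exE conjE) (rule that)
  \<comment> \<open>As \<open>n \<ge> P ^ 4 / 32\<close> and \<open>s / 4 - 1 \<le> 3\<close>, the
    size \<open>n powr (s / 4 - 1)\<close> is at least \<open>h * P powr (s - 4)\<close>.\<close>
  define h where "h = (1 / 32 ^ 3 :: real)"
  \<comment> \<open>Half of the saving, \<open>P powr (1/640)\<close>, outweighs the constants once
    \<open>P \<ge> P0\<close>; the other half is reserved for \<open>\<Psi>\<close>.\<close>
  define P0 where "P0 = max 2 (nat \<lceil>((C1 + C2) * 2 / h) powr 640\<rceil>)"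
  define C where "C = C3 * (4 / h\<^sup>2 + (4 / h\<^sup>2)\<^sup>2)"
  have h0: "h > 0" by (simp add: h_def)
  have C0: "C > 0" using C3(1) h0 by (simp add: C_def add_pos_pos)
  have main: "real (card {n. 1 \<le> n \<and> n \<le> P ^ 4 \<and> P ^ 4 \<le> 32 * n \<and>
        cmod (of_nat (rep_count s 4 n) - main_term s n) > real n powr (real s / 4 - 1) / \<Psi>})
       \<le> C * real P powr (\<kappa> + \<epsilon>) * \<Psi> ^ 4"
    if PP: "P0 \<le> P" and \<Psi>: "1 \<le> \<Psi>" "\<Psi> \<le> real P powr (1/640)" for P \<Psi>
  proof -
    define p where "p = real P"
    \<comment> \<open>divisible by every \<open>q \<le> P\<close>, so that all centres \<open>a / q\<close> lie on the grid \<open>j / M\<close>, and larger than all frequencies\<close>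
    define M where "M = int (fact (100 * P ^ 4))"
    define R where "R = p powr (1/20)"
    define Z where "Z = {n. 1 \<le> n \<and> n \<le> P ^ 4 \<and> P ^ 4 \<le> 32 * n \<and>
        cmod (of_nat (rep_count s 4 n) - main_term s n) > real n powr (real s / 4 - 1) / \<Psi>}"
    \<comment> \<open>Half of a lower bound for the threshold; the other half pays for the major and
      middle arcs.\<close>
    define Y where "Y = h / 2 * p powr (real s - 4) / \<Psi>"
    have P2: "P \<ge> 2" and Pbig: "((C1 + C2) * 2 / h) powr 640 \<le> p"
      using PP unfolding P0_def p_def by linarith+
    have P0': "P > 0" using P2 by simp
    have p1: "p \<ge> 1" using P2 by (simp add: p_def)
    have P4: "P ^ 4 \<ge> 1" using P0' by simp
    have P4i: "int P ^ 4 \<ge> 1" using P0' by simp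
    have Mge: "100 * int P ^ 4 \<le> M"
    proof -
      have "int (100 * P ^ 4) \<le> int (fact (100 * P ^ 4))" using fact_ge_self[of "100 * P ^ 4"] by (simp only: of_nat_le_iff)
      then show ?thesis by (simp add: M_def)
    qed
    have M14: "14 * int P ^ 4 < M" and M8: "8 * int P ^ 4 < M" and M1: "int P ^ 4 \<le> M" and M2: "int P ^ 4 < M" and M0: "M > 0"
      using Mge P4i by linarith+
    have Mr: "real_of_int M > 0" using M0 by simp
    have dvdM: "int q dvd M" if "1 \<le> q" "q \<le> 100 * P ^ 4" for q
      unfolding M_def using dvd_fact[OF that] by (simp only: int_dvd_int_iff)
    have PP4: "P \<le> P ^ 4" using self_le_power[of P 4] P0' by simp
    have dvd: "\<forall>q\<in>{1..P}. int q dvd M"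
    proof
      fix q assume "q \<in> {1..P}"
      then show "int q dvd M" using PP4 by (intro dvdM) auto
    qed
    have evM: "even M" using dvdM[of 2] P4 by simp
    define G where "G = (\<lambda>n j. weyl4 P (of_int j / of_int M) ^ s * E (- (of_int j * real n / of_int M)))"
    define JM where "JM = {j\<in>{0..<M}. major_arc P R (of_int j / of_int M)}"
    define JI where "JI = {j\<in>{0..<M}. (\<exists>q a. dirichlet_arc P (of_int j / of_int M) q a) \<and> \<not> major_arc P R (of_int j / of_int M)}"
    define JS where "JS = {j\<in>{0..<M}. (\<nexists>q a. dirichlet_arc P (of_int j / of_int M) q a) \<and> \<not> major_arc P R (of_int j / of_int M)}"
    have R1: "R \<ge> 1" unfolding R_def p_def using P0' by (intro one_le_powr) auto
    have Y0: "Y > 0" using h0 p1 \<Psi>(1) by (simp add: Y_def)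
    have mid: "(\<Sum>j\<in>JI. (cmod (weyl4 P (of_int j / of_int M))) ^ s) / of_int M \<le> C2 * p powr (real s - 4 - 1/320)"
    proof -
      have "(\<Sum>j\<in>JI. (cmod (weyl4 P (of_int j / of_int M))) ^ s) \<le> C2 * of_int M * real P powr (real s - 4 + 1/320) * R powr (- (1/8))"
        unfolding JI_def
        by (rule C2(2)[THEN spec[of _ P], THEN spec[of _ R], THEN spec[of _ s], THEN spec[of _ M], THEN mp, OF P0', THEN mp, OF R1, THEN mp, OF s(1), THEN mp, OF M1, THEN mp, OF dvd])
      then have "(\<Sum>j\<in>JI. (cmod (weyl4 P (of_int j / of_int M))) ^ s) / of_int M \<le> C2 * (p powr (real s - 4 + 1/320) * R powr (- (1/8)))"
        using Mr by (simp add: pos_divide_le_eq p_def mult_ac)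
      also have "p powr (real s - 4 + 1/320) * R powr (- (1/8)) = p powr (real s - 4 + 1/320 + - (1/160))"
        unfolding R_def powr_powr powr_add by simp
      also have "real s - 4 + 1/320 + - (1/160) = real s - 4 - 1/320" by simp
      finally show ?thesis .
    qed
    have small: "(C1 + C2) * p powr (real s - 4 - 1/320) \<le> Y"
    proof -
      have "(C1 + C2) * 2 / h = (((C1 + C2) * 2 / h) powr 640) powr (1/640)"
      proof -
        have "(C1 + C2) * 2 / h > 0" using C1(1) C2(1) h0 by simp
        moreover have "640 * (1/640) = (1::real)" by simp
        ultimately show ?thesis by (simp only: powr_powr powr_one)
      qed
      also have "\<dots> \<le> p powr (1/640)" using Pbig by (intro powr_mono2) auto
      finally have "(C1 + C2) \<le> h / 2 * p powr (1/640)" using h0 by (simp add: field_simps)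
      then have "(C1 + C2) * p powr (real s - 4 - 1/320) \<le> h / 2 * p powr (1/640) * p powr (real s - 4 - 1/320)"
        by (rule mult_right_mono) simp
      also have "\<dots> = h / 2 * p powr (1/640 + (real s - 4 - 1/320))" by (simp only: powr_add mult.assoc)
      also have "1/640 + (real s - 4 - 1/320) = (real s - 4) - 1/640" by simp
      also have "h / 2 * p powr ((real s - 4) - 1/640) = h / 2 * p powr (real s - 4) / p powr (1/640)"
        by (simp only: powr_diff[of p "real s - 4" "1/640"] times_divide_eq_right)
      also have "\<dots> \<le> h / 2 * p powr (real s - 4) / \<Psi>"
        using \<Psi> h0 p1 by (intro divide_left_mono) (auto simp: p_def)
      finally show ?thesis by (simp add: Y_def)
    qed
    have big: "Y \<le> cmod (\<Sum>j\<in>JS. G n j) / of_int M" if n: "n \<in> Z" for n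
    proof -
      have n1: "1 \<le> n" "n \<le> P ^ 4" "P ^ 4 \<le> 32 * n" and ex: "cmod (of_nat (rep_count s 4 n) - main_term s n) > real n powr (real s / 4 - 1) / \<Psi>"
        using n by (auto simp: Z_def)
      have "int s * int P ^ 4 \<le> 14 * int P ^ 4" using s by (intro mult_right_mono) auto
      then have sM: "int s * int P ^ 4 < M" using M14 by linarith
      have full: "(\<Sum>j\<in>{0..<M}. G n j) = of_int M * of_nat (rep_count s 4 n)"
        unfolding G_def by (rule rep_count_fourier[OF sM M2 n1(2)])
      have cover: "{0..<M} = JM \<union> (JI \<union> JS)" unfolding JM_def JI_def JS_def by blast
      have fin: "finite JM" "finite JI" "finite JS"
        by (rule finite_subset[of _ "{0..<M}"], use cover in blast, simp)+
      have disj: "JM \<inter> (JI \<union> JS) = {}" "JI \<inter> JS = {}" unfolding JM_def JI_def JS_def by blast+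
      have "(\<Sum>j\<in>{0..<M}. G n j) = (\<Sum>j\<in>JM. G n j) + (\<Sum>j\<in>JI \<union> JS. G n j)"
        unfolding cover by (rule sum.union_disjoint) (use fin disj in simp_all)
      also have "(\<Sum>j\<in>JI \<union> JS. G n j) = (\<Sum>j\<in>JI. G n j) + (\<Sum>j\<in>JS. G n j)"
        by (rule sum.union_disjoint) (use fin disj in simp_all)
      finally have "of_nat (rep_count s 4 n) = (\<Sum>j\<in>JM. G n j) / of_int M + (\<Sum>j\<in>JI. G n j) / of_int M + (\<Sum>j\<in>JS. G n j) / complex_of_int M"
        using full M0 by (simp add: field_simps)
      then have "of_nat (rep_count s 4 n) - main_term s n = ((\<Sum>j\<in>JM. G n j) / of_int M - main_term s n) + (\<Sum>j\<in>JI. G n j) / of_int M + (\<Sum>j\<in>JS. G n j) / complex_of_int M"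
        by simp
      then have "cmod (of_nat (rep_count s 4 n) - main_term s n) \<le> cmod ((\<Sum>j\<in>JM. G n j) / of_int M - main_term s n) + cmod ((\<Sum>j\<in>JI. G n j) / of_int M) + cmod ((\<Sum>j\<in>JS. G n j) / complex_of_int M)"
        by (simp only:) (intro order.trans[OF norm_triangle_ineq] add_mono order.refl)
      also have "cmod ((\<Sum>j\<in>JM. G n j) / of_int M - main_term s n) \<le> C1 * p powr (real s - 4 - 1/320)"
        unfolding JM_def G_def R_def p_def
        by (rule C1(2)[THEN spec[of _ P], THEN spec[of _ n], THEN spec[of _ M], THEN mp, OF P2, THEN mp, OF n1(1), THEN mp, OF n1(2), THEN mp, OF M14, THEN mp, OF evM, THEN mp, OF dvd])
      also have "cmod ((\<Sum>j\<in>JI. G n j) / of_int M) \<le> C2 * p powr (real s - 4 - 1/320)"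
      proof -
        have "cmod (\<Sum>j\<in>JI. G n j) \<le> (\<Sum>j\<in>JI. (cmod (weyl4 P (of_int j / of_int M))) ^ s)"
          by (rule order.trans[OF norm_sum]) (simp add: G_def norm_mult norm_power)
        then have "cmod (\<Sum>j\<in>JI. G n j) / of_int M \<le> (\<Sum>j\<in>JI. (cmod (weyl4 P (of_int j / of_int M))) ^ s) / of_int M"
          using Mr by (intro divide_right_mono) auto
        then show ?thesis using mid Mr by (simp add: norm_divide)
      qed
      also have "cmod ((\<Sum>j\<in>JS. G n j) / complex_of_int M) = cmod (\<Sum>j\<in>JS. G n j) / of_int M"
        using Mr by (simp add: norm_divide)
      finally have up: "cmod (of_nat (rep_count s 4 n) - main_term s n) \<le> Y + cmod (\<Sum>j\<in>JS. G n j) / of_int M"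
        using small by (simp add: distrib_right)
      have "h * p powr (real s - 4) \<le> real n powr (real s / 4 - 1)"
      proof -
        define t where "t = real s / 4 - 1"
        have t: "t \<ge> 0" "t \<le> 3" "4 * t = real s - 4" using s by (auto simp: t_def)
        have "p ^ 4 / 32 \<le> real n" using of_nat_mono[OF n1(3), where 'a = real] by (simp add: p_def)
        then have "(p ^ 4 / 32) powr t \<le> real n powr t" using t by (intro powr_mono2) auto
        moreover have "(p ^ 4 / 32) powr t = p powr (4 * t) / 32 powr t"
        proof -
          have "p ^ 4 = p powr 4" using p1 by simp
          then show ?thesis using p1 powr_powr[of p 4 t] by (simp add: powr_divide)
        qed
        moreover have "(32 :: real) powr t \<le> 32 ^ 3"
        proof -
          have "(32 :: real) powr t \<le> 32 powr 3" using t by (intro powr_mono) auto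
          then show ?thesis by simp
        qed
        then have "p powr (4 * t) / 32 ^ 3 \<le> p powr (4 * t) / 32 powr t" by (intro divide_left_mono) auto
        ultimately have "p powr (4 * t) / 32 ^ 3 \<le> real n powr t" by linarith
        then show ?thesis unfolding t(3) by (simp add: h_def t_def)
      qed
      then have "2 * Y \<le> real n powr (real s / 4 - 1) / \<Psi>"
        unfolding Y_def using \<Psi> by (simp add: divide_right_mono)
      then show ?thesis using up ex by linarith
    qed
    have sub: "Z \<subseteq> {1..P ^ 4}" by (auto simp: Z_def)
    have JS: "JS \<subseteq> {0..<M}" "\<forall>j\<in>JS. \<nexists>q a. dirichlet_arc P (of_int j / of_int M) q a" by (auto simp: JS_def)
    have bigA: "\<forall>n\<in>Z. Y \<le> cmod (\<Sum>j\<in>JS. weyl4 P (of_int j / of_int M) ^ s * E (- (of_int j * real n / of_int M))) / of_int M"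
      using big unfolding G_def by blast
    define A where "A = 7 * (real s - 6) / 4"
    have card: "real (card Z) \<le> C3 * (p powr (A + 8 + e1) / Y\<^sup>2 + (p powr (A + 7 + e1) / Y\<^sup>2)\<^sup>2)"
      unfolding p_def A_def
      by (rule C3(2)[THEN spec[of _ P], THEN spec[of _ JS], THEN spec[of _ Z], THEN spec[of _ Y], THEN spec[of _ M], THEN mp, OF P0', THEN mp, OF M8,
           THEN mp, OF JS(1), THEN mp, OF JS(2), THEN mp, OF sub, THEN mp, OF Y0, THEN mp, OF bigA])
    have Yi: "p powr t / Y\<^sup>2 = (4 / h\<^sup>2) * p powr (t - 2 * (real s - 4)) * \<Psi>\<^sup>2" for t
    proof -
      have "Y\<^sup>2 = h\<^sup>2 / 4 * (p powr (real s - 4))\<^sup>2 / \<Psi>\<^sup>2" by (simp add: Y_def power_mult_distrib power_divide)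
      also have "(p powr (real s - 4))\<^sup>2 = p powr (2 * (real s - 4))" using p1 by (simp add: powr_power mult.commute)
      finally have Y2: "Y\<^sup>2 = h\<^sup>2 / 4 * p powr (2 * (real s - 4)) / \<Psi>\<^sup>2" .
      show ?thesis unfolding Y2 powr_diff[of p t "2 * (real s - 4)"] using h0 \<Psi>(1) by simp
    qed
    have t1: "p powr (A + 8 + e1) / Y\<^sup>2 \<le> (4 / h\<^sup>2) * (p powr (\<kappa> + \<epsilon>) * \<Psi> ^ 4)"
    proof -
      have "p powr (A + 8 + e1 - 2 * (real s - 4)) \<le> p powr (\<kappa> + \<epsilon>)"
      proof (rule powr_mono[OF _ p1])
        have "s = 13 \<or> s = 14" using s by auto
        then show "A + 8 + e1 - 2 * (real s - 4) \<le> \<kappa> + \<epsilon>" using eps by (auto simp: A_def \<kappa> e1_def)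
      qed
      moreover have "\<Psi> ^ 2 \<le> \<Psi> ^ 4" using \<Psi>(1) by (intro power_increasing) auto
      ultimately have "p powr (A + 8 + e1 - 2 * (real s - 4)) * \<Psi>\<^sup>2 \<le> p powr (\<kappa> + \<epsilon>) * \<Psi> ^ 4"
        by (intro mult_mono) auto
      then have "(4 / h\<^sup>2) * (p powr (A + 8 + e1 - 2 * (real s - 4)) * \<Psi>\<^sup>2) \<le> (4 / h\<^sup>2) * (p powr (\<kappa> + \<epsilon>) * \<Psi> ^ 4)"
        by (rule mult_left_mono) simp
      then show ?thesis unfolding Yi by (simp only: mult.assoc)
    qed
    have t2: "(p powr (A + 7 + e1) / Y\<^sup>2)\<^sup>2 \<le> (4 / h\<^sup>2)\<^sup>2 * (p powr (\<kappa> + \<epsilon>) * \<Psi> ^ 4)"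
    proof -
      have "(p powr (A + 7 + e1) / Y\<^sup>2)\<^sup>2 = (4 / h\<^sup>2)\<^sup>2 * ((p powr (A + 7 + e1 - 2 * (real s - 4)))\<^sup>2 * (\<Psi>\<^sup>2)\<^sup>2)"
        unfolding Yi power_mult_distrib by (simp only: mult.assoc)
      also have "(p powr (A + 7 + e1 - 2 * (real s - 4)))\<^sup>2 = p powr (2 * (A + 7 + e1 - 2 * (real s - 4)))"
        using p1 by (simp add: powr_power mult.commute)
      also have "(\<Psi>\<^sup>2)\<^sup>2 = \<Psi> ^ 4" by (simp flip: power_mult)
      also have "(4 / h\<^sup>2)\<^sup>2 * (p powr (2 * (A + 7 + e1 - 2 * (real s - 4))) * \<Psi> ^ 4) \<le> (4 / h\<^sup>2)\<^sup>2 * (p powr (\<kappa> + \<epsilon>) * \<Psi> ^ 4)"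
      proof (intro mult_left_mono mult_right_mono powr_mono)
        have "s = 13 \<or> s = 14" using s by auto
        then show "2 * (A + 7 + e1 - 2 * (real s - 4)) \<le> \<kappa> + \<epsilon>" by (auto simp: A_def \<kappa> e1_def)
      qed (use p1 \<Psi>(1) in auto)
      finally show ?thesis .
    qed
    have "real (card Z) \<le> C3 * ((4 / h\<^sup>2) * (p powr (\<kappa> + \<epsilon>) * \<Psi> ^ 4) + (4 / h\<^sup>2)\<^sup>2 * (p powr (\<kappa> + \<epsilon>) * \<Psi> ^ 4))"
      using card add_mono[OF t1 t2] C3(1) by (meson order.trans mult_left_mono less_imp_le)
    also have "\<dots> = C * p powr (\<kappa> + \<epsilon>) * \<Psi> ^ 4" unfolding C_def distrib_right[symmetric] by (simp only: mult.assoc)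
    finally show ?thesis unfolding Z_def p_def .
  qed
  show ?thesis
    by (intro exI[of _ C] exI[of _ P0] conjI allI impI C0) (rule main)
qed

lemma card_le_sqrt:
  assumes "N \<ge> 0"
  shows "finite {n::nat. 1 \<le> n \<and> real n \<le> N}" "real (card {n::nat. 1 \<le> n \<and> real n \<le> N}) \<le> N"
proof -
  have eq: "{n::nat. 1 \<le> n \<and> real n \<le> N} = {1..nat \<lfloor>N\<rfloor>}"
    using assms by (auto simp: le_nat_iff le_floor_iff)
  show "finite {n::nat. 1 \<le> n \<and> real n \<le> N}" unfolding eq by simp
  show "real (card {n::nat. 1 \<le> n \<and> real n \<le> N}) \<le> N" unfolding eq using assms by simp
qed

text \<open>Take \<open>P\<close> as the ceiling of \<open>X powr (1/4)\<close>, so that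
  \<open>X \<le> P ^ 4 \<le> 16 * X < 32 * n\<close> on the block. The condition
  \<open>sqrt N \<le> X\<close> gives \<open>N \<le> P ^ 8\<close>; hence \<open>P\<close> is large
  with \<open>N\<close>, and
  \<open>\<Psi> \<le> N powr (1/10000) \<le> P powr (1/640)\<close>.\<close>

lemma exceptional_block:
  fixes N X \<Psi> :: real
  assumes s: "13 \<le> s" "s \<le> 14" and \<kappa>: "\<kappa> > 0" and eps: "\<epsilon> > 0" and C: "C > 0"
    and dyadic: "\<forall>P \<Psi>. P0 \<le> P \<longrightarrow> 1 \<le> \<Psi> \<longrightarrow> \<Psi> \<le> real P powr (1/640) \<longrightarrow>
     real (card {n. 1 \<le> n \<and> n \<le> P ^ 4 \<and> P ^ 4 \<le> 32 * n \<and>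
        cmod (of_nat (rep_count s 4 n) - main_term s n) > real n powr (real s / 4 - 1) / \<Psi>})
       \<le> C * real P powr (\<kappa> + \<epsilon>) * \<Psi> ^ 4"
    and N: "N \<ge> 1" "real P0 \<le> N powr (1/8)" and X: "sqrt N \<le> X" "X \<le> N"
    and \<Psi>: "1 \<le> \<Psi>" "\<Psi> \<le> N powr (1/10000)"
  shows "real (card {n. 1 \<le> n \<and> real n \<le> X \<and> X < 2 * real n \<and>
        cmod (of_nat (rep_count s 4 n) - main_term s n) > real n powr (real s / 4 - 1) / \<Psi>})
      \<le> C * 2 powr (\<kappa> + \<epsilon>) * N powr ((\<kappa> + \<epsilon>) / 4) * \<Psi> ^ 4"
proof -
  define x where "x = X powr (1/4)"
  define P where "P = nat \<lceil>x\<rceil>"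
  have sN: "sqrt N \<ge> 1" using N(1) by simp
  have X1: "X \<ge> 1" using sN X(1) by linarith
  have x1: "x \<ge> 1" unfolding x_def using X1 by (simp add: ge_one_powr_ge_zero)
  have x4: "x ^ 4 = X" using X1 by (simp add: x_def powr_power)
  have Px: "x \<le> real P" by (simp add: P_def real_nat_ceiling_ge)
  have "real P < x + 1" using x1 by (simp add: P_def) linarith
  then have P2x: "real P \<le> 2 * x" using x1 by linarith
  have XP: "X \<le> real P ^ 4" using power_mono[OF Px, of 4] x1 x4 by simp
  have P16: "real P ^ 4 \<le> 16 * X" using power_mono[OF P2x, of 4] x4 by (simp add: power_mult_distrib)
  have P1: "real P \<ge> 1" using Px x1 by linarith
  have P0P: "P0 \<le> P"
  proof -
    have "N powr (1/8) = (N powr (1/2)) powr (1/4)" by (simp add: powr_powr)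
    also have "\<dots> = sqrt N powr (1/4)" using N(1) by (simp add: powr_half_sqrt)
    also have "\<dots> \<le> x" unfolding x_def using X(1) sN by (intro powr_mono2) auto
    finally have "real P0 \<le> real P" using N(2) Px by linarith
    then show ?thesis by simp
  qed
  have \<Psi>P: "\<Psi> \<le> real P powr (1/640)"
  proof -
    have "N = sqrt N * sqrt N" using N(1) by simp
    also have "\<dots> \<le> X * X" using X(1) sN X1 by (intro mult_mono) auto
    also have "\<dots> \<le> real P ^ 4 * real P ^ 4" using XP X1 by (intro mult_mono) auto
    also have "\<dots> = real P powr 8" using P1 by (simp flip: power_add)
    finally have "N powr (1/10000) \<le> (real P powr 8) powr (1/10000)" using N(1) by (intro powr_mono2) auto
    also have "\<dots> = real P powr (8 * (1/10000))" by (rule powr_powr)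
    also have "\<dots> \<le> real P powr (1/640)" using P1 by (intro powr_mono) auto
    finally show ?thesis using \<Psi>(2) by linarith
  qed
  let ?D = "{n. 1 \<le> n \<and> n \<le> P ^ 4 \<and> P ^ 4 \<le> 32 * n \<and>
        cmod (of_nat (rep_count s 4 n) - main_term s n) > real n powr (real s / 4 - 1) / \<Psi>}"
  have "finite ?D" by (rule finite_subset[of _ "{1..P ^ 4}"]) auto
  moreover have "{n. 1 \<le> n \<and> real n \<le> X \<and> X < 2 * real n \<and>
        cmod (of_nat (rep_count s 4 n) - main_term s n) > real n powr (real s / 4 - 1) / \<Psi>} \<subseteq> ?D"
  proof (rule subsetI, elim CollectE conjE, intro CollectI conjI)
    fix n assume n: "1 \<le> n" "real n \<le> X" "X < 2 * real n"
    have "real n \<le> real (P ^ 4)" unfolding of_nat_power using n(2) XP by linarith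
    then show "n \<le> P ^ 4" unfolding of_nat_le_iff .
    have "real (P ^ 4) \<le> real (32 * n)" using n(3) P16 by simp
    then show "P ^ 4 \<le> 32 * n" unfolding of_nat_le_iff .
  qed
  ultimately have "card {n. 1 \<le> n \<and> real n \<le> X \<and> X < 2 * real n \<and>
        cmod (of_nat (rep_count s 4 n) - main_term s n) > real n powr (real s / 4 - 1) / \<Psi>} \<le> card ?D"
    by (rule card_mono)
  then have "real (card {n. 1 \<le> n \<and> real n \<le> X \<and> X < 2 * real n \<and>
        cmod (of_nat (rep_count s 4 n) - main_term s n) > real n powr (real s / 4 - 1) / \<Psi>}) \<le> real (card ?D)"
    by (simp only: of_nat_le_iff)
  also have "\<dots> \<le> C * real P powr (\<kappa> + \<epsilon>) * \<Psi> ^ 4"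
    by (rule dyadic[THEN spec[of _ P], THEN spec[of _ \<Psi>], THEN mp, OF P0P, THEN mp, OF \<Psi>(1), THEN mp, OF \<Psi>P])
  also have "\<dots> \<le> C * (2 powr (\<kappa> + \<epsilon>) * N powr ((\<kappa> + \<epsilon>) / 4)) * \<Psi> ^ 4"
  proof (intro mult_right_mono mult_left_mono)
    have "real P powr (\<kappa> + \<epsilon>) \<le> (2 * x) powr (\<kappa> + \<epsilon>)" using P2x \<kappa> eps by (intro powr_mono2) auto
    also have "\<dots> = 2 powr (\<kappa> + \<epsilon>) * x powr (\<kappa> + \<epsilon>)" using x1 by (simp add: powr_mult)
    also have "x powr (\<kappa> + \<epsilon>) = X powr ((\<kappa> + \<epsilon>) / 4)" unfolding x_def powr_powr by simp
    also have "\<dots> \<le> N powr ((\<kappa> + \<epsilon>) / 4)" using X X1 \<kappa> eps by (intro powr_mono2) auto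
    finally show "real P powr (\<kappa> + \<epsilon>) \<le> 2 powr (\<kappa> + \<epsilon>) * N powr ((\<kappa> + \<epsilon>) / 4)" by simp
  qed (use C \<Psi>(1) in auto)
  finally show ?thesis by (simp only: mult.assoc)
qed

lemma exceptional_count_main_term:
  "exceptional_count s 4 \<psi> N = card {n. 1 \<le> n \<and> real n \<le> N \<and>
     cmod (of_nat (rep_count s 4 n) - main_term s n) > real n powr (real s / 4 - 1) * inverse (\<psi> (real n))}"
  by (simp add: exceptional_count_def main_term_def)

text \<open>Integers up to \<open>sqrt N\<close> are counted trivially, which is affordable because
  \<open>\<alpha> \<ge> 1/2\<close>. Beyond that, monotonicity allows \<open>\<psi> n\<close> to be
  replaced by the larger \<open>\<psi> N\<close>, and the range is cut into dyadic blocks. Their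
  number, of order \<open>ln N\<close>, costs \<open>N powr (\<epsilon>/2)\<close>; together with
  the \<open>\<epsilon>/4\<close> from each block this stays below
  \<open>\<epsilon>\<close>.\<close>

lemma exceptional_count_le:
  assumes s: "13 \<le> s" "s \<le> 14" and \<alpha>: "\<alpha> = (if s = 13 then 5/8 else 1/2)" and eps: "\<epsilon> > 0"
  shows "\<exists>C. \<forall>\<psi>. sedately_increasing (1/20000) \<psi> \<longrightarrow>
     (\<forall>\<^sub>F N in at_top. real (exceptional_count s 4 \<psi> N) \<le> C * (N powr (\<alpha> + \<epsilon>) * \<psi> N ^ 4))"
proof -
  define \<kappa> :: real where "\<kappa> = (if s = 13 then 5/2 else 2)"
  have \<kappa>: "\<kappa> > 0" "\<kappa> / 4 = \<alpha>" "\<alpha> \<ge> 1/2" by (auto simp: \<kappa>_def \<alpha>)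
  obtain C P0 where C: "C > 0" and dyadic: "\<forall>P \<Psi>. P0 \<le> P \<longrightarrow> 1 \<le> \<Psi> \<longrightarrow> \<Psi> \<le> real P powr (1/640) \<longrightarrow>
     real (card {n. 1 \<le> n \<and> n \<le> P ^ 4 \<and> P ^ 4 \<le> 32 * n \<and>
        cmod (of_nat (rep_count s 4 n) - main_term s n) > real n powr (real s / 4 - 1) / \<Psi>})
       \<le> C * real P powr (\<kappa> + \<epsilon>) * \<Psi> ^ 4"
    using exceptional_dyadic[OF eps s \<kappa>_def] by (elim exE conjE) (rule that)
  define D where "D = 1 + C * 2 powr (\<kappa> + \<epsilon>)"
  have main: "\<forall>\<^sub>F N in at_top. real (exceptional_count s 4 \<psi> N) \<le> D * (N powr (\<alpha> + \<epsilon>) * \<psi> N ^ 4)"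
    if sed: "sedately_increasing (1/20000) \<psi>" for \<psi>
  proof -
    have mono: "mono_on {0<..} \<psi>" and lim: "filterlim \<psi> at_top at_top" and big: "\<psi> \<in> O[at_top](\<lambda>t. t powr (1/20000))"
      using sed by (auto simp: sedately_increasing_def)
    obtain T where T: "\<And>t. t \<ge> T \<Longrightarrow> \<psi> t \<ge> 1"
      using lim unfolding filterlim_at_top eventually_at_top_linorder by blast
    obtain c where c: "c > 0" "\<forall>\<^sub>F t in at_top. \<bar>\<psi> t\<bar> \<le> c * \<bar>t powr (1/20000)\<bar>"
      using big by (auto elim!: landau_o.bigE)
    have "\<forall>\<^sub>F t::real in at_top. c \<le> t powr (1/20000)" by real_asymp
    moreover have "\<forall>\<^sub>F t::real in at_top. 1 \<le> t" by real_asymp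
    moreover have "\<forall>\<^sub>F t::real in at_top. T \<le> t" by (rule eventually_ge_at_top)
    moreover have "\<forall>\<^sub>F t::real in at_top. 2 * T \<le> sqrt t" by real_asymp
    moreover have "\<forall>\<^sub>F t::real in at_top. real P0 \<le> t powr (1/8)" by real_asymp
    moreover have "\<forall>\<^sub>F t::real in at_top. log 2 t + 2 \<le> t powr (\<epsilon>/2)" using eps by real_asymp
    ultimately show ?thesis using c(2)
    proof eventually_elim
      case (elim N)
      define \<Psi> where "\<Psi> = \<psi> N"
      define dev where "dev = (\<lambda>n. cmod (of_nat (rep_count s 4 n) - main_term s n))"
      define u where "u = (\<lambda>n::nat. real n powr (real s / 4 - 1))"
      define S where "S = {n. 1 \<le> n \<and> real n \<le> N \<and> dev n > u n * inverse (\<psi> (real n))}"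
      define Tb where "Tb = (\<lambda>i::nat. {n. 1 \<le> n \<and> real n \<le> N / 2 ^ i \<and> N / 2 ^ i < 2 * real n \<and> dev n > u n / \<Psi>})"
      define k where "k = nat \<lfloor>log 2 N\<rfloor>"
      define I where "I = {i. i \<le> k \<and> sqrt N \<le> N / 2 ^ i}"
      define B where "B = C * 2 powr (\<kappa> + \<epsilon>) * N powr ((\<kappa> + \<epsilon>) / 4) * \<Psi> ^ 4"
      have N1: "N \<ge> 1" and N0: "N > 0" using elim by auto
      have \<Psi>1: "\<Psi> \<ge> 1" unfolding \<Psi>_def by (rule T) (use elim in simp)
      \<comment> \<open>Doubling the exponent 1/20000 absorbs the constant \<open>c\<close> of the
        growth condition for large \<open>N\<close>.\<close>
      have \<Psi>2: "\<Psi> \<le> N powr (1/10000)"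
      proof -
        have "\<Psi> \<le> c * N powr (1/20000)" using elim unfolding \<Psi>_def by simp
        also have "\<dots> \<le> N powr (1/20000) * N powr (1/20000)" using elim by (intro mult_right_mono) auto
        also have "\<dots> = N powr (1/10000)" by (simp flip: powr_add)
        finally show ?thesis .
      qed
      have B0: "B \<ge> 0" unfolding B_def using C \<Psi>1 by (intro mult_nonneg_nonneg) auto
      have finI: "finite I" unfolding I_def by (rule finite_subset[of _ "{..k}"]) auto
      have cardI: "real (card I) \<le> N powr (\<epsilon>/2)"
      proof -
        have "card I \<le> card {..k}" unfolding I_def by (rule card_mono) auto
        then have "real (card I) \<le> real k + 1" by simp
        also have "real k \<le> log 2 N" using N1 by (simp add: k_def)
        finally show ?thesis using elim by linarith
      qed
      have cover: "S \<subseteq> {n. 1 \<le> n \<and> real n \<le> sqrt N} \<union> (\<Union>i\<in>I. Tb i)"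
      proof
        fix n assume "n \<in> S"
        then have n: "1 \<le> n" "real n \<le> N" "dev n > u n * inverse (\<psi> (real n))" by (auto simp: S_def)
        show "n \<in> {n. 1 \<le> n \<and> real n \<le> sqrt N} \<union> (\<Union>i\<in>I. Tb i)"
        proof (cases "real n \<le> sqrt N")
          case False
          \<comment> \<open>The block index:
            \<open>N / 2 ^ (i + 1) < n \<le> N / 2 ^ i\<close>.\<close>
          define i where "i = nat \<lfloor>log 2 (N / real n)\<rfloor>"
          have rn: "real n \<ge> 1" using n(1) by simp
          have Nn: "N / real n \<ge> 1" using n rn by simp
          then have l0: "log 2 (N / real n) \<ge> 0" by simp
          have i1: "real i \<le> log 2 (N / real n)" using l0 by (simp add: i_def)
          have i2: "log 2 (N / real n) < real i + 1" using l0 by (simp add: i_def)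
          have p1: "2 ^ i \<le> N / real n"
          proof -
            have "2 powr real i \<le> 2 powr (log 2 (N / real n))" using i1 by simp
            then show ?thesis using Nn by (simp add: powr_realpow)
          qed
          have p2: "N / real n < 2 * 2 ^ i"
          proof -
            have "2 powr (log 2 (N / real n)) < 2 powr (real i + 1)" using i2 by simp
            then show ?thesis using Nn by (simp add: powr_add powr_realpow)
          qed
          have a1: "real n \<le> N / 2 ^ i" using p1 rn by (simp add: field_simps)
          have a2: "N / 2 ^ i < 2 * real n" using p2 rn by (simp add: field_simps)
          have "log 2 (N / real n) \<le> log 2 N"
            using N0 rn Nn by (intro log_mono) (auto simp: divide_le_eq mult_le_cancel_left1)
          then have "i \<le> k" unfolding i_def k_def by (intro nat_mono floor_mono)
          then have iI: "i \<in> I" using False a1 by (simp add: I_def)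
          \<comment> \<open>This makes \<open>\<psi> n\<close> positive, without which
            \<open>\<psi> n \<le> \<psi> N\<close> would not reverse under
            \<open>inverse\<close>.\<close>
          have "T \<le> real n" using False elim(4) by (smt (verit) real_sqrt_ge_zero N0)
          then have psin: "\<psi> (real n) \<ge> 1" by (rule T)
          have "\<psi> (real n) \<le> \<psi> N" by (rule mono_onD[OF mono]) (use rn n N0 in auto)
          then have "inverse \<Psi> \<le> inverse (\<psi> (real n))" unfolding \<Psi>_def using psin by (intro le_imp_inverse_le) auto
          then have "u n * inverse \<Psi> \<le> u n * inverse (\<psi> (real n))" by (rule mult_left_mono) (simp add: u_def)
          then have "dev n > u n / \<Psi>" using n(3) by (simp add: divide_inverse)
          then have "n \<in> Tb i" using n(1) a1 a2 by (simp add: Tb_def)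
          then show ?thesis using iI by blast
        qed (use n in simp)
      qed
      have Tcard: "finite (Tb i) \<and> real (card (Tb i)) \<le> B" if i: "i \<in> I" for i
      proof
        have "N / 2 ^ i \<le> N / 1" using N0 by (intro divide_left_mono) auto
        then have XN: "N / 2 ^ i \<le> N" by simp
        have sX: "sqrt N \<le> N / 2 ^ i" using i by (simp add: I_def)
        have "Tb i \<subseteq> {n. 1 \<le> n \<and> real n \<le> N / 2 ^ i}" by (auto simp: Tb_def)
        then show "finite (Tb i)" by (rule finite_subset) (use card_le_sqrt(1)[of "N / 2 ^ i"] N0 in simp)
        show "real (card (Tb i)) \<le> B"
          unfolding Tb_def B_def dev_def u_def
          by (rule exceptional_block[OF s \<kappa>(1) eps C dyadic N1 elim(5) sX XN \<Psi>1 \<Psi>2])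
      qed
      have sq: "finite {n::nat. 1 \<le> n \<and> real n \<le> sqrt N}" "real (card {n::nat. 1 \<le> n \<and> real n \<le> sqrt N}) \<le> sqrt N"
        using card_le_sqrt[of "sqrt N"] N0 by simp_all
      have finU: "finite (\<Union>i\<in>I. Tb i)" using finI Tcard by blast
      have "real (exceptional_count s 4 \<psi> N) = real (card S)"
        unfolding exceptional_count_main_term S_def dev_def u_def ..
      also have "\<dots> \<le> real (card ({n. 1 \<le> n \<and> real n \<le> sqrt N} \<union> (\<Union>i\<in>I. Tb i)))"
        using card_mono[OF _ cover] sq(1) finU by simp
      also have "\<dots> \<le> real (card {n::nat. 1 \<le> n \<and> real n \<le> sqrt N} + card (\<Union>i\<in>I. Tb i))"
        using card_Un_le[of "{n::nat. 1 \<le> n \<and> real n \<le> sqrt N}" "\<Union>i\<in>I. Tb i"] by (simp only: of_nat_le_iff)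
      also have "\<dots> \<le> sqrt N + real (\<Sum>i\<in>I. card (Tb i))"
        unfolding of_nat_add using sq(2) of_nat_mono[OF card_UN_le[OF finI, of Tb], where 'a=real]
        by (rule add_mono)
      also have "real (\<Sum>i\<in>I. card (Tb i)) \<le> (\<Sum>i\<in>I. B)"
        unfolding of_nat_sum using Tcard by (intro sum_mono) blast
      also have "\<dots> = real (card I) * B" by simp
      also have "\<dots> \<le> N powr (\<epsilon>/2) * B" by (rule mult_right_mono[OF cardI B0])
      also have "N powr (\<epsilon>/2) * B = C * 2 powr (\<kappa> + \<epsilon>) * (N powr (\<epsilon>/2 + (\<kappa> + \<epsilon>) / 4) * \<Psi> ^ 4)"
        by (simp add: B_def powr_add)
      also have "\<dots> \<le> C * 2 powr (\<kappa> + \<epsilon>) * (N powr (\<alpha> + \<epsilon>) * \<Psi> ^ 4)"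
      proof (intro mult_left_mono mult_right_mono powr_mono N1)
        show "\<epsilon>/2 + (\<kappa> + \<epsilon>) / 4 \<le> \<alpha> + \<epsilon>" using \<kappa>(2) eps by (simp add: add_divide_distrib)
      qed (use C \<Psi>1 in auto)
      also have "sqrt N \<le> N powr (\<alpha> + \<epsilon>) * \<Psi> ^ 4"
      proof -
        have "sqrt N = N powr (1/2)" using N0 by (simp add: powr_half_sqrt)
        also have "\<dots> \<le> N powr (\<alpha> + \<epsilon>) * 1" using N1 \<kappa>(3) eps by (simp add: powr_mono)
        also have "\<dots> \<le> N powr (\<alpha> + \<epsilon>) * \<Psi> ^ 4" using \<Psi>1 by (intro mult_left_mono one_le_power) auto
        finally show ?thesis .
      qed
      finally show ?case by (simp add: D_def \<Psi>_def algebra_simps)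
    qed
  qed
  show ?thesis by (intro exI[of _ D] allI impI main)
qed

text \<open>The order of quantifiers is the strong one: \<open>\<delta>\<close> is absolute, and
  \<open>C\<close> is fixed before the function, which can influence only how large \<open>N\<close>
  has to be. The vague smallness condition on the growth exponent thus becomes an explicit
  constant.\<close>

theorem theorem1p2:
  "\<exists>\<delta>>0. \<forall>\<epsilon>>0. \<forall>(s, \<alpha>) \<in> {(13, 5 / 8), (14, 1 / 2)}. \<exists>C. \<forall>\<psi>\<^sub>4.
     sedately_increasing \<delta> \<psi>\<^sub>4 \<longrightarrow>
       (\<forall>\<^sub>F N in at_top.
          real (exceptional_count s 4 \<psi>\<^sub>4 N) \<le> C * (N powr (\<alpha> + \<epsilon>) * \<psi>\<^sub>4 N ^ 4))"
proof (intro exI[of _ "1/20000"] conjI allI impI)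
  show "(1/20000 :: real) > 0" by simp
  fix \<epsilon> :: real assume eps: "\<epsilon> > 0"
  show "\<forall>(s, \<alpha>) \<in> {(13, 5 / 8), (14, 1 / 2)}. \<exists>C. \<forall>\<psi>\<^sub>4. sedately_increasing (1/20000) \<psi>\<^sub>4 \<longrightarrow>
       (\<forall>\<^sub>F N in at_top. real (exceptional_count s 4 \<psi>\<^sub>4 N) \<le> C * (N powr (\<alpha> + \<epsilon>) * \<psi>\<^sub>4 N ^ 4))"
    using exceptional_count_le[of 13 "5/8" \<epsilon>] exceptional_count_le[of 14 "1/2" \<epsilon>] eps by simp
qed

end
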